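(* Let $X$ be a Banach space, $A:D(A)\subset X\to X$ the infinitesimal generator of an analytic semigroup on $X$ ($D(A)$ not necessarily dense), $\alpha\in[0,1)$, $X_\alpha$ an intermediate space as described in the context such that the part of $A$ in $X_\alpha$ is sectorial in $X_\alpha$, and let $f:[0,T]\times X_\alpha\to X$ be such that for every $R>0$ there is $L=L(R,T)$ with $$\|f(t_1,v_1)-f(t_2,v_2)\|\leq L\big(|t_1-t_2|+\|v_1-v_2\|_\alpha\big)$$ for all $t_1,t_2\in[0,T]$ and $v_1,v_2\in X_\alpha$ with $\max(\|v_1\|_\alpha,\|v_2\|_\alpha)\le R$. Assume that $Au_0+f(0,u_0)\in X_\alpha$ (with $u_0\in D(A)$) and that $f:[0,T]\times X_\alpha\to X$ is Fréchet differentiable with a locally Lipschitz continuous derivative. Let $u$ be the mild solution on $[0,T]$ of $u'=Au+f(t,u)$, $u(0)=u_0$. Let $u_n$ be the numerical solution, with time step $\tau>0$ and $t_n=n\tau$, obtained by an $s$-stage explicit exponential Runge--Kutta method (see context) satisfying $$\sum_{i=1}^s b_i(z)=\varphi_1(z),\qquad \sum_{i=1}^s b_i(z)c_i=\varphi_2(z),\qquad \sum_{j=1}^{i-1}a_{ij}(z)=c_i\varphi_1(c_iz)\ \text{ for } 2\le i\le s.$$ Then, for any $\gamma\in[\alpha,1)$ and $\tau$ sufficiently small, the error is bounded for $0\le t_n\le T$ by $$\|u_n-u(t_n)\|_{D_A(\gamma,1)}\leq C\tau^{2-\gamma}(|\log\tau|+1),$$ where the constant $C$ depends on $T$, but is independent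 of $n$ and $\tau$.
   Context: Analytic semigroups. A linear operator $A:D(A)\subset X\to X$ on a Banach space $X$ (norm $\|\cdot\|$) is sectorial (equivalently, is the infinitesimal generator of an analytic semigroup in the sense used here) if there are $\omega\in\mathbb{R}$, $\theta\in(\pi/2,\pi)$, $M>0$ such that the resolvent set of $A$ contains $\{\lambda\neq\omega:|\arg(\lambda-\omega)|<\theta\}$ and $\|(\lambda I-A)^{-1}\|\le M/|\lambda-\omega|$ there. The domain is not assumed dense. $\mathrm{e}^{tA}$ ($t\ge0$) is the analytic semigroup generated by $A$ (Dunford integral for $t>0$, $\mathrm{e}^{0A}=I$); it need not be strongly continuous at $t=0$. The part of $A$ in a subspace $Y$ is the restriction of $A$ to $\{x\in D(A)\cap Y:Ax\in Y\}$. Interpolation spaces. For $0<\beta<1$, $1\le p\le\infty$, $D_A(\beta,p)=\{x\in X: v(t)=\|t^{1-\beta-1/p}A\mathrm{e}^{tA}x\|\in L^p(0,1)\}$ with norm $\|x\|+\|v\|_{L^p(0,1)}$; also $D_A(0,p)=X$. For $0<\alpha<1$, $X_\alpha$ is any Banach space with continuous embeddings $D_A(\alpha,1)\subset X_\alpha\subset D_A(\alpha,\infty)$, with norm $\|\cdot\|_\alpha$; $X_0=X$. Functions $\varphi_k$. $\varphi_0(z)=\mathrm{e}^z$ and $\varphi_k(z)=\int_0^1\mathrm{e}^{(1-\xi)z}\frac{\xi^{k-1}}{(k-1)!}\,\mathrm{d}\xi$ for $k\ge1$; $\varphi_k(tA)$ is defined by the same formula with $\mathrm{e}^{(1-\xi)tA}$.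 Local Lipschitz continuity of the derivative of $f$ is understood in the same sense as for $f$: Lipschitz on $\{(t,v):t\in[0,T],\|v\|_\alpha\le R\}$ for every $R>0$. Mild solution. $u(t)=\mathrm{e}^{tA}u_0+\int_0^t\mathrm{e}^{(t-\xi)A}f(\xi,u(\xi))\,\mathrm{d}\xi$. For $u_0\in X_\alpha$ a unique mild solution $u\in L^\infty((0,T);X_\alpha)\cap C((0,T];X_\alpha)$ exists for some $T>0$; throughout, $T>0$ is such that this solution exists on $[0,T]$. Explicit exponential Runge--Kutta (EERK) method. With $t_{ni}=t_n+c_i\tau$, $$u_{n+1}=\mathrm{e}^{\tau A}u_n+\tau\sum_{i=1}^s b_i(\tau A)F_{ni},\quad U_{ni}=\mathrm{e}^{c_i\tau A}u_n+\tau\sum_{j=1}^{i-1}a_{ij}(\tau A)F_{nj}\ (1\le i\le s),\quad F_{nj}=f(t_{nj},U_{nj}),$$ started from $u_0$, where $c_i\in[0,1]$, $c_1=0$, the $b_i(z)$ are linear combinations of the functions $\varphi_k(z)$, and the $a_{ij}(z)$ are linear combinations of the functions $\varphi_k(z)$ and $\varphi_k(c_lz)$ with $c_l>0$. *)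

theory Defs
  imports "HOL-Analysis.Analysis" "HOL-Probability.Essential_Supremum"
begin

section \<open>Complex Banach spaces\<close>

class complex_banach = banach +
  fixes scaleC :: "complex \<Rightarrow> 'a \<Rightarrow> 'a" (infixr "*\<^sub>C" 75)
  assumes scaleC_add_right: "z *\<^sub>C (x + y) = z *\<^sub>C x + z *\<^sub>C y"
    and scaleC_add_left: "(z + w) *\<^sub>C x = z *\<^sub>C x + w *\<^sub>C x"
    and scaleC_scaleC: "z *\<^sub>C w *\<^sub>C x = (z * w) *\<^sub>C x"
    and scaleC_of_real: "complex_of_real r *\<^sub>C x = r *\<^sub>R x"
    and norm_scaleC: "norm (z *\<^sub>C x) = cmod z * norm x"

instantiation complex :: complex_banach
begin
definition scaleC_complex_def: "z *\<^sub>C (x::complex) = z * x"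
instance
  by standard (auto simp: scaleC_complex_def algebra_simps norm_mult scaleR_conv_of_real)
end

definition complex_linear_on ::
    "'a::complex_banach set \<Rightarrow> ('a \<Rightarrow> 'b::complex_banach) \<Rightarrow> bool" where
  "complex_linear_on D A \<longleftrightarrow>
     0 \<in> D \<and> (\<forall>x\<in>D. \<forall>y\<in>D. x + y \<in> D) \<and> (\<forall>z. \<forall>x\<in>D. z *\<^sub>C x \<in> D) \<and>
     (\<forall>x\<in>D. \<forall>y\<in>D. A (x + y) = A x + A y) \<and> (\<forall>z. \<forall>x\<in>D. A (z *\<^sub>C x) = z *\<^sub>C A x)"

section \<open>Sectorial operators and their semigroups\<close>

text \<open>An unbounded operator is given by its domain \<open>D\<close> and a function \<open>A\<close>
  whose values outside \<open>D\<close> are irrelevant.\<close>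

definition resolvent ::
    "'a::complex_banach set \<Rightarrow> ('a \<Rightarrow> 'a) \<Rightarrow> complex \<Rightarrow> 'a \<Rightarrow> 'a" where
  "resolvent D A z = inv_into D (\<lambda>x. z *\<^sub>C x - A x)"

definition resolvent_set :: "'a::complex_banach set \<Rightarrow> ('a \<Rightarrow> 'a) \<Rightarrow> complex set" where
  "resolvent_set D A =
     {z. bij_betw (\<lambda>x. z *\<^sub>C x - A x) D UNIV \<and> bounded_linear (resolvent D A z)}"

definition sectorial_with ::
    "'a::complex_banach set \<Rightarrow> ('a \<Rightarrow> 'a) \<Rightarrow> real \<Rightarrow> real \<Rightarrow> real \<Rightarrow> bool" where
  "sectorial_with D A \<omega> \<theta> M \<longleftrightarrow>
     complex_linear_on D A \<and> pi / 2 < \<theta> \<and> \<theta> < pi \<and> 0 < M \<and>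
     (\<forall>z. z \<noteq> of_real \<omega> \<and> \<bar>Arg (z - of_real \<omega>)\<bar> < \<theta> \<longrightarrow>
        z \<in> resolvent_set D A \<and> onorm (resolvent D A z) \<le> M / cmod (z - of_real \<omega>))"

definition sectorial :: "'a::complex_banach set \<Rightarrow> ('a \<Rightarrow> 'a) \<Rightarrow> bool" where
  "sectorial D A \<longleftrightarrow> (\<exists>\<omega> \<theta> M. sectorial_with D A \<omega> \<theta> M)"

text \<open>The Dunford integral
  \<open>1/(2 pi i) \<integral> exp (t z) R(z,A) x dz\<close> over the curve \<open>\<omega> + \<gamma>\<close>, where \<open>\<gamma>\<close> consists of the
  two rays \<open>arg z = \<plusminus> \<eta>\<close>, \<open>\<bar>z\<bar> \<ge> r\<close> and the arc \<open>\<bar>z\<bar> = r\<close>, \<open>\<bar>arg z\<bar> \<le> \<eta>\<close>, oriented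
  counterclockwise (lower ray inwards, arc, upper ray outwards).\<close>

definition dunford ::
    "'a::complex_banach set \<Rightarrow> ('a \<Rightarrow> 'a) \<Rightarrow> real \<Rightarrow> real \<Rightarrow> real \<Rightarrow> real \<Rightarrow> 'a \<Rightarrow> 'a" where
  "dunford D A \<omega> r \<eta> t x =
     (let E = (\<lambda>z. exp (of_real t * z) *\<^sub>C resolvent D A z x) in
      (1 / (2 * of_real pi * \<i>)) *\<^sub>C
        (integral {r..} (\<lambda>\<rho>. cis \<eta> *\<^sub>C E (of_real \<omega> + of_real \<rho> * cis \<eta>))
         - integral {r..} (\<lambda>\<rho>. cis (- \<eta>) *\<^sub>C E (of_real \<omega> + of_real \<rho> * cis (- \<eta>)))
         + integral {- \<eta>..\<eta>}
             (\<lambda>\<phi>. (\<i> * of_real r * cis \<phi>) *\<^sub>C E (of_real \<omega> + of_real r * cis \<phi>))))"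

definition admissible_contour ::
    "'a::complex_banach set \<Rightarrow> ('a \<Rightarrow> 'a) \<Rightarrow> real \<Rightarrow> real \<Rightarrow> real \<Rightarrow> bool" where
  "admissible_contour D A \<omega> r \<eta> \<longleftrightarrow>
     0 < r \<and> pi / 2 < \<eta> \<and> (\<exists>\<theta> M. sectorial_with D A \<omega> \<theta> M \<and> \<eta> < \<theta>)"

text \<open>By Cauchy's theorem the Dunford integral does not depend on the admissible contour.\<close>

definition analytic_semigroup ::
    "'a::complex_banach set \<Rightarrow> ('a \<Rightarrow> 'a) \<Rightarrow> real \<Rightarrow> 'a \<Rightarrow> 'a" where
  "analytic_semigroup D A t x =
     (if t = 0 then x
      else case (SOME (\<omega>, r, \<eta>). admissible_contour D A \<omega> r \<eta>) of
             (\<omega>, r, \<eta>) \<Rightarrow> dunford D A \<omega> r \<eta> t x)"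

section \<open>Interpolation spaces and intermediate spaces\<close>

definition in_Lp01 :: "ereal \<Rightarrow> (real \<Rightarrow> real) \<Rightarrow> bool" where
  "in_Lp01 p v \<longleftrightarrow> v \<in> borel_measurable (lebesgue_on {0<..<1}) \<and>
     (if p = \<infinity> then esssup (lebesgue_on {0<..<1}) (\<lambda>t. ereal \<bar>v t\<bar>) < \<infinity>
      else integrable (lebesgue_on {0<..<1}) (\<lambda>t. \<bar>v t\<bar> powr real_of_ereal p))"

definition Lp01_norm :: "ereal \<Rightarrow> (real \<Rightarrow> real) \<Rightarrow> real" where
  "Lp01_norm p v =
     (if p = \<infinity> then real_of_ereal (esssup (lebesgue_on {0<..<1}) (\<lambda>t. ereal \<bar>v t\<bar>))
      else (\<integral>t. \<bar>v t\<bar> powr real_of_ereal p \<partial>lebesgue_on {0<..<1}) powr (1 / real_of_ereal p))"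

text \<open>The weight \<open>v\<close> below uses \<open>1 / \<infinity> = 0\<close>, which holds in \<open>ereal\<close>.\<close>

definition DA_weight ::
    "'a::complex_banach set \<Rightarrow> ('a \<Rightarrow> 'a) \<Rightarrow> real \<Rightarrow> ereal \<Rightarrow> 'a \<Rightarrow> real \<Rightarrow> real" where
  "DA_weight D A \<beta> p x t =
     norm (t powr (1 - \<beta> - real_of_ereal (1 / p)) *\<^sub>R A (analytic_semigroup D A t x))"

definition DA_space ::
    "'a::complex_banach set \<Rightarrow> ('a \<Rightarrow> 'a) \<Rightarrow> real \<Rightarrow> ereal \<Rightarrow> 'a set" where
  "DA_space D A \<beta> p = (if \<beta> = 0 then UNIV else {x. in_Lp01 p (DA_weight D A \<beta> p x)})"

definition DA_norm ::
    "'a::complex_banach set \<Rightarrow> ('a \<Rightarrow> 'a) \<Rightarrow> real \<Rightarrow> ereal \<Rightarrow> 'a \<Rightarrow> real" where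
  "DA_norm D A \<beta> p x =
     (if \<beta> = 0 then norm x else norm x + Lp01_norm p (DA_weight D A \<beta> p x))"

text \<open>The intermediate space \<open>X\<^sub>\<alpha> \<subseteq> X\<close> is a Banach space \<open>'b\<close> together with its inclusion map
  \<open>\<iota>\<close> into \<open>X = 'a\<close>; an element \<open>x\<close> of \<open>X\<close> lies in \<open>X\<^sub>\<alpha>\<close> iff \<open>x \<in> range \<iota>\<close>, and is then
  \<open>inv \<iota> x\<close> when seen in \<open>X\<^sub>\<alpha>\<close>. The case \<open>\<alpha> = 0\<close> says \<open>X\<^sub>0 = X\<close>.\<close>

definition intermediate_space ::
    "'a::complex_banach set \<Rightarrow> ('a \<Rightarrow> 'a) \<Rightarrow> real \<Rightarrow> ('b::complex_banach \<Rightarrow> 'a) \<Rightarrow> bool" where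
  "intermediate_space D A \<alpha> \<iota> \<longleftrightarrow> complex_linear_on UNIV \<iota> \<and> inj \<iota> \<and>
     (if \<alpha> = 0 then surj \<iota> \<and> (\<forall>y. norm (\<iota> y) = norm y)
      else DA_space D A \<alpha> 1 \<subseteq> range \<iota> \<and>
           (\<exists>C. \<forall>y. \<iota> y \<in> DA_space D A \<alpha> 1 \<longrightarrow> norm y \<le> C * DA_norm D A \<alpha> 1 (\<iota> y)) \<and>
           range \<iota> \<subseteq> DA_space D A \<alpha> \<infinity> \<and>
           (\<exists>C. \<forall>y. DA_norm D A \<alpha> \<infinity> (\<iota> y) \<le> C * norm y))"

definition part_dom :: "'a set \<Rightarrow> ('a \<Rightarrow> 'a) \<Rightarrow> ('b \<Rightarrow> 'a) \<Rightarrow> 'b set" where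
  "part_dom D A \<iota> = {y. \<iota> y \<in> D \<and> A (\<iota> y) \<in> range \<iota>}"

definition part_op :: "('a \<Rightarrow> 'a) \<Rightarrow> ('b \<Rightarrow> 'a) \<Rightarrow> 'b \<Rightarrow> 'b" where
  "part_op A \<iota> y = inv \<iota> (A (\<iota> y))"

section \<open>The nonlinearity and mild solutions\<close>

definition lipschitz_on_balls ::
    "real \<Rightarrow> (real \<Rightarrow> 'b::real_normed_vector \<Rightarrow> 'c::real_normed_vector) \<Rightarrow> bool" where
  "lipschitz_on_balls T g \<longleftrightarrow>
     (\<forall>R>0. \<exists>L. \<forall>t1\<in>{0..T}. \<forall>t2\<in>{0..T}. \<forall>v1 v2. max (norm v1) (norm v2) \<le> R \<longrightarrow>
        norm (g t1 v1 - g t2 v2) \<le> L * (\<bar>t1 - t2\<bar> + norm (v1 - v2)))"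

text \<open>The Frechet derivative is taken jointly in \<open>(t, v)\<close> over the reals, as \<open>t\<close> is real;
  it is one-sided in \<open>t\<close> at the end points.\<close>

definition frechet_lipschitz_derivative ::
    "real \<Rightarrow> (real \<Rightarrow> 'b::real_normed_vector \<Rightarrow> 'a::real_normed_vector) \<Rightarrow> bool" where
  "frechet_lipschitz_derivative T f \<longleftrightarrow>
     (\<exists>f' :: real \<Rightarrow> 'b \<Rightarrow> (real \<times> 'b) \<Rightarrow>\<^sub>L 'a.
        (\<forall>t\<in>{0..T}. \<forall>v. ((\<lambda>(s, w). f s w) has_derivative blinfun_apply (f' t v))
                           (at (t, v) within {0..T} \<times> UNIV)) \<and>
        lipschitz_on_balls T f')"

text \<open>For a function continuous on \<open>(0, T]\<close>, essential boundedness is boundedness.\<close>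

definition mild_solution ::
    "'a::complex_banach set \<Rightarrow> ('a \<Rightarrow> 'a) \<Rightarrow> ('b::complex_banach \<Rightarrow> 'a) \<Rightarrow>
     (real \<Rightarrow> 'b \<Rightarrow> 'a) \<Rightarrow> real \<Rightarrow> 'b \<Rightarrow> (real \<Rightarrow> 'b) \<Rightarrow> bool" where
  "mild_solution D A \<iota> f T u0 u \<longleftrightarrow>
     continuous_on {0<..T} u \<and> bounded (u ` {0<..T}) \<and>
     (\<forall>t\<in>{0..T}. \<exists>w.
        ((\<lambda>\<xi>. analytic_semigroup D A (t - \<xi>) (f \<xi> (u \<xi>))) has_integral w) {0..t} \<and>
        \<iota> (u t) = analytic_semigroup D A t (\<iota> u0) + w)"

section \<open>Explicit exponential Runge--Kutta methods\<close>

definition phi :: "nat \<Rightarrow> complex \<Rightarrow> complex" where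
  "phi k z = (if k = 0 then exp z
     else integral {0..1} (\<lambda>\<xi>. exp (of_real (1 - \<xi>) * z) * of_real (\<xi> ^ (k - 1) / fact (k - 1))))"

definition phi_op ::
    "'a::complex_banach set \<Rightarrow> ('a \<Rightarrow> 'a) \<Rightarrow> nat \<Rightarrow> real \<Rightarrow> 'a \<Rightarrow> 'a" where
  "phi_op D A k t x = (if k = 0 then analytic_semigroup D A t x
     else integral {0..1}
       (\<lambda>\<xi>. (\<xi> ^ (k - 1) / fact (k - 1)) *\<^sub>R analytic_semigroup D A ((1 - \<xi>) * t) x))"

text \<open>A linear combination of functions \<open>\<phi>\<^sub>k(\<sigma> z)\<close> is given by the list of its terms
  \<open>(w, k, \<sigma>)\<close>, standing for \<open>w \<phi>\<^sub>k(\<sigma> z)\<close>. The functions \<open>\<phi>\<^sub>k(\<sigma> z)\<close>, for distinct pairs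
  \<open>(k, \<sigma>)\<close> with \<open>\<sigma> > 0\<close>, are linearly independent, so the operator obtained by substituting
  \<open>t A\<close> for \<open>z\<close> depends only on the function and not on the list.\<close>

type_synonym phi_comb = "(complex \<times> nat \<times> real) list"

definition comb_fun :: "phi_comb \<Rightarrow> complex \<Rightarrow> complex" where
  "comb_fun l z = (\<Sum>(w, k, \<sigma>)\<leftarrow>l. w * phi k (of_real \<sigma> * z))"

definition comb_op ::
    "'a::complex_banach set \<Rightarrow> ('a \<Rightarrow> 'a) \<Rightarrow> phi_comb \<Rightarrow> real \<Rightarrow> 'a \<Rightarrow> 'a" where
  "comb_op D A l t x = (\<Sum>(w, k, \<sigma>)\<leftarrow>l. w *\<^sub>C phi_op D A k (\<sigma> * t) x)"

definition eerk_method ::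
    "nat \<Rightarrow> (nat \<Rightarrow> real) \<Rightarrow> (nat \<Rightarrow> phi_comb) \<Rightarrow> (nat \<Rightarrow> nat \<Rightarrow> phi_comb) \<Rightarrow> bool" where
  "eerk_method s c b a \<longleftrightarrow>
     1 \<le> s \<and> c 1 = 0 \<and> (\<forall>i\<in>{1..s}. c i \<in> {0..1}) \<and>
     (\<forall>i\<in>{1..s}. \<forall>(w, k, \<sigma>)\<in>set (b i). \<sigma> = 1) \<and>
     (\<forall>i\<in>{1..s}. \<forall>j\<in>{1..<i}. \<forall>(w, k, \<sigma>)\<in>set (a i j).
        \<sigma> = 1 \<or> (\<exists>l\<in>{1..s}. c l > 0 \<and> \<sigma> = c l))"

text \<open>\<open>eerk_stage D A c a g \<tau> t v i\<close> is the stage \<open>U\<^sub>n\<^sub>i\<close> of the step from \<open>t = t\<^sub>n\<close>, \<open>v = u\<^sub>n\<close>.\<close>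

fun eerk_stage ::
    "'a::complex_banach set \<Rightarrow> ('a \<Rightarrow> 'a) \<Rightarrow> (nat \<Rightarrow> real) \<Rightarrow> (nat \<Rightarrow> nat \<Rightarrow> phi_comb) \<Rightarrow>
     (real \<Rightarrow> 'a \<Rightarrow> 'a) \<Rightarrow> real \<Rightarrow> real \<Rightarrow> 'a \<Rightarrow> nat \<Rightarrow> 'a" where
  "eerk_stage D A c a g \<tau> t v i =
     analytic_semigroup D A (c i * \<tau>) v +
     \<tau> *\<^sub>R (\<Sum>j\<in>{1..<i}. comb_op D A (a i j) \<tau>
                          (g (t + c j * \<tau>) (eerk_stage D A c a g \<tau> t v j)))"

declare eerk_stage.simps [simp del]

primrec eerk ::
    "'a::complex_banach set \<Rightarrow> ('a \<Rightarrow> 'a) \<Rightarrow> nat \<Rightarrow> (nat \<Rightarrow> real) \<Rightarrow> (nat \<Rightarrow> phi_comb) \<Rightarrow>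
     (nat \<Rightarrow> nat \<Rightarrow> phi_comb) \<Rightarrow> (real \<Rightarrow> 'a \<Rightarrow> 'a) \<Rightarrow> 'a \<Rightarrow> real \<Rightarrow> nat \<Rightarrow> 'a" where
  "eerk D A s c b a g u0 \<tau> 0 = u0"
| "eerk D A s c b a g u0 \<tau> (Suc n) =
     analytic_semigroup D A \<tau> (eerk D A s c b a g u0 \<tau> n) +
     \<tau> *\<^sub>R (\<Sum>i\<in>{1..s}. comb_op D A (b i) \<tau>
             (g (real n * \<tau> + c i * \<tau>)
                (eerk_stage D A c a g \<tau> (real n * \<tau>) (eerk D A s c b a g u0 \<tau> n) i)))"

end

(*
  Everything is reduced to bounds for the analytic semigroup T(t): the Dunford integral gives
  |T(t)| <= C and |A T(t)| <= C / t, and interpolating the two bounds gives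
  |T(t) x| <= C t^(-g) |x| from X to D_A(g,1), hence also from X to the intermediate space, and
  the bound C h^(1-g) for a convolution integral over an interval of length h.  The order
  conditions hold for functions of z; they carry over to operators because the functions
  phi_k(sigma z) with sigma > 0 are linearly independent.

  The solution u is not differentiated.  Put g(t) = f(t, u(t)) and compare g on a step with its
  secant: the second differences of u (and hence of g) solve a weakly singular Volterra
  equation, whose initial value is controlled by the compatibility condition, and are bounded by
  C (tau^2 / (t + tau) + tau^(2 - alpha) (|log tau| + 1)).  By the order conditions the method
  integrates the secant exactly, so the local error consists of these second differences and of
  the errors of the stages.  The global error is the sum of the T((n-1-k) tau) d_k over the
  local errors d_k, and a discrete Gronwall argument with an exponential weight bounds it; the
  logarithm comes from the harmonic sum over tau^2 / (t_k + tau).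
*)
theory Submission
  imports Defs "HOL-Complex_Analysis.Complex_Analysis" "HOL-Real_Asymp.Real_Asymp"
begin

hide_const (open) Polynomial.content

text \<open>Since \<open>D\<close> need not be dense, convergence of \<open>T t x\<close> to x at
  time 0 is at hand only for x in \<open>D\<close>. So integrands \<open>T (h - s) (v s)\<close> are
  continuous on the open interval only, and a scalar majorant makes them integrable. The vector A u0
  + f(0, u0) lies only in X_\<alpha>, where its orbit under \<open>U\<close> has derivative of size
  1/t. A second difference over a step tau therefore costs tau^2/t, while for t < tau only the
  Lipschitz bound tau is available; tau^2/(t + tau) covers both. At t = 0 this is as large as tau,
  but its convolution with (t - s)^(-\<alpha>) is only of order tau^(2 - \<alpha>) (|log tau| + 1);
  hence the Volterra estimate keeps this part apart from the uniform one. Local errors are needed in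
  two norms: the last one meets no smoothing and is measured in D_A(\<gamma>, 1), the earlier ones
  are measured in X and smoothed by \<open>T\<close> at positive times. Lipschitz constants hold on
  balls only, so one induction on n must yield both the error bound and the fact that the stages
  stay in the ball of radius \<open>R\<close>; this is what forces tau to be small.\<close>

lemma bounded_bilinear_scaleC:
  "bounded_bilinear (scaleC :: complex \<Rightarrow> 'a::complex_banach \<Rightarrow> 'a)"
proof
  show "(r *\<^sub>R z) *\<^sub>C x = r *\<^sub>R (z *\<^sub>C x)" for r z and x :: 'a
    by (metis scaleC_of_real scaleC_scaleC scaleR_conv_of_real)
  show "z *\<^sub>C (r *\<^sub>R x) = r *\<^sub>R (z *\<^sub>C x)" for r z and x :: 'a
    by (metis mult.commute scaleC_of_real scaleC_scaleC)
  show "\<exists>K. \<forall>z (x::'a). norm (z *\<^sub>C x) \<le> norm z * norm x * K"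
    by (rule exI[of _ 1]) (simp add: norm_scaleC)
qed (simp_all add: scaleC_add_right scaleC_add_left)

interpretation scaleC: bounded_bilinear "scaleC :: complex \<Rightarrow> 'a::complex_banach \<Rightarrow> 'a"
  by (rule bounded_bilinear_scaleC)

lemmas [continuous_intros] = scaleC.continuous_on
lemmas [simp] = scaleC.zero_left scaleC.zero_right

lemma scaleC_one [simp]: "1 *\<^sub>C x = (x::'a::complex_banach)"
  using scaleC_of_real[of 1 x] by simp

lemma scaleC_commute: "z *\<^sub>C w *\<^sub>C x = w *\<^sub>C z *\<^sub>C (x::'a::complex_banach)"
  by (simp add: scaleC_scaleC mult.commute)

lemma scaleC_scaleR: "z *\<^sub>C (r *\<^sub>R x) = r *\<^sub>R (z *\<^sub>C (x::'a::complex_banach))"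
  by (rule scaleC.scaleR_right)

section \<open>Improper integrals of Banach space valued functions\<close>

text \<open>Riemann sums of \<open>f\<close> and \<open>h\<close> over a fine division differ by at
  most the Riemann sum of \<open>g\<close>, which is close to the small integral of
  \<open>g\<close>; so the Cauchy criterion passes from \<open>h\<close> to
  \<open>f\<close>.\<close>

lemma integrable_approx_cbox:
  fixes f :: "'n::euclidean_space \<Rightarrow> 'a::banach"
  assumes approx: "\<And>e. e > 0 \<Longrightarrow> \<exists>h g. h integrable_on cbox a b \<and> g integrable_on cbox a b \<and>
      (\<forall>x\<in>cbox a b. norm (f x - h x) \<le> g x) \<and> integral (cbox a b) g < e"
  shows "f integrable_on cbox a b"
  unfolding integrable_Cauchy
proof (intro allI impI)
  fix e :: real assume e: "e > 0"
  \<comment> \<open>An integral below e/6 and Riemann sums within e/6 of it bound the Riemann sums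
    of \<open>g\<close> by e/3; this third is spent twice, the last one goes to
    \<open>h\<close>.\<close>
  obtain h g where h: "h integrable_on cbox a b" and g: "g integrable_on cbox a b"
    and fh: "\<And>x. x \<in> cbox a b \<Longrightarrow> norm (f x - h x) \<le> g x"
    and ig: "integral (cbox a b) g < e / 6"
    using approx[of "e/6"] e by auto
  obtain \<gamma>1 where \<gamma>1: "gauge \<gamma>1"
    "\<And>\<D>1 \<D>2. \<D>1 tagged_division_of (cbox a b) \<Longrightarrow> \<gamma>1 fine \<D>1 \<Longrightarrow>
            \<D>2 tagged_division_of (cbox a b) \<Longrightarrow> \<gamma>1 fine \<D>2 \<Longrightarrow>
            norm ((\<Sum>(x,K)\<in>\<D>1. content K *\<^sub>R h x) - (\<Sum>(x,K)\<in>\<D>2. content K *\<^sub>R h x)) < e/3"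
    using h[unfolded integrable_Cauchy, rule_format, of "e/3"] e by (metis divide_pos_pos zero_less_numeral)
  obtain \<gamma>2 where \<gamma>2: "gauge \<gamma>2"
    "\<And>\<D>. \<D> tagged_division_of (cbox a b) \<Longrightarrow> \<gamma>2 fine \<D> \<Longrightarrow>
            norm ((\<Sum>(x,K)\<in>\<D>. content K *\<^sub>R g x) - integral (cbox a b) g) < e/6"
    using integrable_integral[OF g, unfolded has_integral, rule_format, of "e/6"] e by (auto)
  have small: "norm ((\<Sum>(x,K)\<in>\<D>. content K *\<^sub>R f x) - (\<Sum>(x,K)\<in>\<D>. content K *\<^sub>R h x)) < e/3"
    if \<D>: "\<D> tagged_division_of (cbox a b)" "\<gamma>2 fine \<D>" for \<D>
  proof -
    have "norm ((\<Sum>(x,K)\<in>\<D>. content K *\<^sub>R f x) - (\<Sum>(x,K)\<in>\<D>. content K *\<^sub>R h x))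
        = norm (\<Sum>(x,K)\<in>\<D>. content K *\<^sub>R (f x - h x))"
      by (simp add: sum_subtractf[symmetric] scaleR_diff_right split_def)
    also have "\<dots> \<le> (\<Sum>(x,K)\<in>\<D>. content K *\<^sub>R g x)"
    proof (rule sum_norm_le, clarify)
      fix x K assume "(x, K) \<in> \<D>"
      then have "x \<in> cbox a b" using \<D>(1) by blast
      then show "norm (content K *\<^sub>R (f x - h x)) \<le> content K *\<^sub>R g x"
        using fh by (simp add: mult_left_mono)
    qed
    also have "\<dots> < e/3" using \<gamma>2(2)[OF \<D>] ig unfolding real_norm_def by linarith
    finally show ?thesis .
  qed
  show "\<exists>\<gamma>. gauge \<gamma> \<and> (\<forall>\<D>1 \<D>2. \<D>1 tagged_division_of (cbox a b) \<and> \<gamma> fine \<D>1 \<and>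
            \<D>2 tagged_division_of (cbox a b) \<and> \<gamma> fine \<D>2 \<longrightarrow>
            norm ((\<Sum>(x,K)\<in>\<D>1. content K *\<^sub>R f x) - (\<Sum>(x,K)\<in>\<D>2. content K *\<^sub>R f x)) < e)"
  proof (intro exI[of _ "\<lambda>x. \<gamma>1 x \<inter> \<gamma>2 x"] conjI allI impI)
    show "gauge (\<lambda>x. \<gamma>1 x \<inter> \<gamma>2 x)" using \<gamma>1(1) \<gamma>2(1) by (rule gauge_Int)
    fix \<D>1 \<D>2
    assume a: "\<D>1 tagged_division_of (cbox a b) \<and> (\<lambda>x. \<gamma>1 x \<inter> \<gamma>2 x) fine \<D>1 \<and>
            \<D>2 tagged_division_of (cbox a b) \<and> (\<lambda>x. \<gamma>1 x \<inter> \<gamma>2 x) fine \<D>2"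
    let ?f = "\<lambda>\<D>. \<Sum>(x,K)\<in>\<D>. content K *\<^sub>R f x" and ?h = "\<lambda>\<D>. \<Sum>(x,K)\<in>\<D>. content K *\<^sub>R h x"
    have "norm (?f \<D>1 - ?h \<D>1) < e/3" "norm (?f \<D>2 - ?h \<D>2) < e/3" "norm (?h \<D>1 - ?h \<D>2) < e/3"
      using a small \<gamma>1(2) by (auto simp: fine_Int)
    then show "norm (?f \<D>1 - ?f \<D>2) < e"
      using dist_triangle_third[of "?f \<D>1" "?h \<D>1" e "?h \<D>2" "?f \<D>2"]
      by (simp add: dist_norm norm_minus_commute)
  qed
qed

text \<open>Cutting pieces of length \<open>d\<close> off both ends leaves a closed interval on
  which \<open>f\<close> is continuous, and by continuity of the indefinite integral of the majorant
  the pieces contribute little. This covers convolution integrands that are singular, or merely not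
  continuous, at an endpoint.\<close>

lemma integrable_dominated_interval:
  fixes f :: "real \<Rightarrow> 'a::banach"
  assumes f: "continuous_on {a<..<b} f" and g: "g integrable_on {a..b}"
    and fg: "\<And>x. a < x \<Longrightarrow> x < b \<Longrightarrow> norm (f x) \<le> g x"
  shows "f integrable_on {a..b}"
proof (cases "a < b")
  case False
  then show ?thesis by (intro integrable_on_null[of a b f, unfolded box_real]) auto
next
  case ab: True
  \<comment> \<open>The hypotheses say nothing about domination at the endpoints; setting both
    functions to 0 there makes it hold on the closed interval.\<close>
  define f0 where "f0 x = (if a < x \<and> x < b then f x else 0)" for x
  define g0 where "g0 x = (if a < x \<and> x < b then g x else 0)" for x
  have g0: "g0 integrable_on {a..b}"
    by (rule integrable_spike_finite[of "{a,b}" _ _ g]) (use g in \<open>auto simp: g0_def\<close>)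
  have g0_nonneg: "0 \<le> g0 x" for x
    using order_trans[OF norm_ge_zero fg, of x] by (auto simp: g0_def)
  define G where "G x = integral {a..x} g0" for x
  have G: "continuous_on {a..b} G"
    unfolding G_def by (rule indefinite_integral_continuous_1[OF g0])
  have "f0 integrable_on cbox a b"
  proof (rule integrable_approx_cbox)
    fix e :: real assume e: "e > 0"
    obtain d1 where d1: "d1 > 0" "\<And>x. x \<in> {a..b} \<Longrightarrow> dist x a < d1 \<Longrightarrow> dist (G x) (G a) < e/2"
      using G ab e unfolding continuous_on_iff by (metis atLeastAtMost_iff half_gt_zero less_eq_real_def order_refl)
    obtain d2 where d2: "d2 > 0" "\<And>x. x \<in> {a..b} \<Longrightarrow> dist x b < d2 \<Longrightarrow> dist (G x) (G b) < e/2"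
      using G ab e unfolding continuous_on_iff by (metis atLeastAtMost_iff half_gt_zero less_eq_real_def order_refl)
    define d where "d = min (min d1 d2) (b - a) / 3"
    have d: "d > 0" "d < d1" "d < d2" "a + d < b - d"
      using d1(1) d2(1) ab by (auto simp: d_def min_def field_simps)
    let ?I = "{a + d .. b - d}"
    have sub: "?I \<subseteq> {a..b}" using d by auto
    have fI: "f integrable_on ?I"
      using f d by (intro integrable_continuous_real continuous_on_subset[OF f]) auto
    have gI: "g0 integrable_on ?I" using g0 sub by (rule integrable_on_subinterval)
    let ?h = "\<lambda>x. if x \<in> ?I then f x else 0" and ?g = "\<lambda>x. g0 x - (if x \<in> ?I then g0 x else 0)"
    have h: "?h integrable_on {a..b}"
      using fI sub integrable_restrict_Int[of ?I f "{a..b}"] d by (simp add: max_def min_def)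
    have gr: "((\<lambda>x. if x \<in> ?I then g0 x else 0) has_integral integral ?I g0) {a..b}"
      by (rule has_integral_restrict[THEN iffD2, OF sub]) (rule integrable_integral[OF gI])
    have g': "(?g has_integral (integral {a..b} g0 - integral ?I g0)) {a..b}"
      by (intro has_integral_diff gr integrable_integral g0)
    have "integral {a..a+d} g0 + integral ?I g0 = integral {a..b-d} g0"
      using d by (intro Henstock_Kurzweil_Integration.integral_combine integrable_on_subinterval[OF g0]) auto
    then have "integral {a..b} g0 - integral ?I g0 = (G b - G (b-d)) + (G (a+d) - G a)"
      by (simp add: G_def)
    also have "\<dots> < e"
    proof -
      have "\<bar>G (a+d) - G a\<bar> < e/2" "\<bar>G (b-d) - G b\<bar> < e/2"
        using d1(2)[of "a+d"] d2(2)[of "b-d"] d by (simp_all add: dist_real_def)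
      then have "G (a+d) - G a < e/2" "G b - G (b-d) < e/2" by (auto simp only: abs_less_iff)
      then show ?thesis by simp
    qed
    finally have small: "integral {a..b} ?g < e" using integral_unique[OF g'] by simp
    have le: "norm (f0 x - ?h x) \<le> ?g x" for x
      using fg[of x] d g0_nonneg[of x] by (auto simp: f0_def g0_def)
    show "\<exists>h g. h integrable_on cbox a b \<and> g integrable_on cbox a b \<and>
      (\<forall>x\<in>cbox a b. norm (f0 x - h x) \<le> g x) \<and> integral (cbox a b) g < e"
      using h has_integral_integrable[OF g'] small le unfolding box_real by blast
  qed
  then show ?thesis
    by (intro integrable_spike_finite[of "{a,b}" _ f f0]) (auto simp: f0_def)
qed

text \<open>Cauchy criterion for growing boxes: the integrals of \<open>f\<close> over two nested
  boxes differ by the integral over the part between them, which that of \<open>g\<close>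
  dominates.\<close>

lemma integrable_dominated_halfline:
  fixes f :: "real \<Rightarrow> 'a::banach"
  assumes f: "continuous_on {r..} f" and g: "g integrable_on {r..}"
    and fg: "\<And>x. r \<le> x \<Longrightarrow> norm (f x) \<le> g x"
  shows "f integrable_on {r..}"
proof (rule iffD2[OF integrable_alt_subset], intro conjI allI impI)
  let ?f = "\<lambda>x. if x \<in> {r..} then f x else 0" and ?g = "\<lambda>x. if x \<in> {r..} then g x else 0"
  have intf: "?f integrable_on cbox a b" for a b
  proof -
    have "f integrable_on {max a r..b}"
      using f by (intro integrable_continuous_real continuous_on_subset[OF f]) auto
    moreover have "{r..} \<inter> {a..b} = {max a r..b}" by auto
    ultimately show ?thesis using integrable_restrict_Int[of "{r..}" f "{a..b}"] by (simp add: max.commute)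
  qed
  then show "?f integrable_on cbox a b" for a b .
  have intg: "?g integrable_on cbox a b" for a b
    by (rule iffD1[OF integrable_alt_subset g, THEN conjunct1, rule_format])
  fix e :: real assume "e > 0"
  with iffD1[OF integrable_alt_subset g, THEN conjunct2, rule_format, of e]
  obtain B where B: "B > 0" "\<And>a b c d. ball 0 B \<subseteq> cbox a b \<Longrightarrow> cbox a b \<subseteq> cbox c d \<Longrightarrow>
     norm (integral (cbox a b) ?g - integral (cbox c d) ?g) < e"
    by auto
  show "\<exists>B>0. \<forall>a b c d. ball 0 B \<subseteq> cbox a b \<and> cbox a b \<subseteq> cbox c d \<longrightarrow>
     norm (integral (cbox a b) ?f - integral (cbox c d) ?f) < e"
  proof (intro exI[of _ B] conjI allI impI B(1))
    fix a b c d :: real assume s: "ball 0 B \<subseteq> cbox a b \<and> cbox a b \<subseteq> cbox c d"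
    define F where "F = (\<lambda>x. ?f x - (if x \<in> cbox a b then ?f x else 0))"
    define G where "G = (\<lambda>x. ?g x - (if x \<in> cbox a b then ?g x else 0))"
    have F: "(F has_integral (integral (cbox c d) ?f - integral (cbox a b) ?f)) (cbox c d)"
      unfolding F_def using s
      by (intro has_integral_diff integrable_integral[OF intf]
          has_integral_restrict[THEN iffD2]) auto
    have G: "(G has_integral (integral (cbox c d) ?g - integral (cbox a b) ?g)) (cbox c d)"
      unfolding G_def using s
      by (intro has_integral_diff integrable_integral[OF intg]
          has_integral_restrict[THEN iffD2]) auto
    have "norm (integral (cbox c d) F) \<le> integral (cbox c d) G"
      using F G fg by (intro integral_norm_bound_integral) (auto simp: F_def G_def)
    then have "norm (integral (cbox c d) ?f - integral (cbox a b) ?f)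
        \<le> integral (cbox c d) ?g - integral (cbox a b) ?g"
      using F G by (simp add: integral_unique)
    also have "\<dots> < e" using B(2)[of a b c d] s by auto
    finally show "norm (integral (cbox a b) ?f - integral (cbox c d) ?f) < e"
      by (simp add: norm_minus_commute)
  qed
qed

section \<open>Contour integrals over the Dunford contour\<close>

definition sector :: "real \<Rightarrow> real \<Rightarrow> complex set" where
  "sector \<omega> \<theta> = {z. z \<noteq> of_real \<omega> \<and> \<bar>Arg (z - of_real \<omega>)\<bar> < \<theta>}"

abbreviation ray :: "real \<Rightarrow> real \<Rightarrow> real \<Rightarrow> complex" where
  "ray \<omega> \<phi> \<rho> \<equiv> of_real \<omega> + of_real \<rho> * cis \<phi>"

text \<open>The bracket in \<open>dunford\<close> for an arbitrary integrand, so that linearity,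
  change of radius and evaluation by primitives are treated once.\<close>

definition cint :: "real \<Rightarrow> real \<Rightarrow> real \<Rightarrow> (complex \<Rightarrow> 'a::complex_banach) \<Rightarrow> 'a" where
  "cint \<omega> r \<eta> E =
     integral {r..} (\<lambda>\<rho>. cis \<eta> *\<^sub>C E (ray \<omega> \<eta> \<rho>))
     - integral {r..} (\<lambda>\<rho>. cis (- \<eta>) *\<^sub>C E (ray \<omega> (- \<eta>) \<rho>))
     + integral {- \<eta>..\<eta>} (\<lambda>\<phi>. (\<i> * of_real r * cis \<phi>) *\<^sub>C E (ray \<omega> \<phi> r))"

text \<open>Carried as a separate predicate because \<open>integral\<close> is 0 on a function that
  is not integrable, so that additivity of \<open>cint\<close> depends on it.\<close>

definition cintegrable :: "real \<Rightarrow> real \<Rightarrow> real \<Rightarrow> (complex \<Rightarrow> 'a::complex_banach) \<Rightarrow> bool" where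
  "cintegrable \<omega> r \<eta> E \<longleftrightarrow>
     (\<lambda>\<rho>. cis \<eta> *\<^sub>C E (ray \<omega> \<eta> \<rho>)) integrable_on {r..} \<and>
     (\<lambda>\<rho>. cis (- \<eta>) *\<^sub>C E (ray \<omega> (- \<eta>) \<rho>)) integrable_on {r..} \<and>
     (\<lambda>\<phi>. (\<i> * of_real r * cis \<phi>) *\<^sub>C E (ray \<omega> \<phi> r)) integrable_on {- \<eta>..\<eta>}"

lemma dunford_cint:
  "dunford D A \<omega> r \<eta> t x =
     (1 / (2 * of_real pi * \<i>)) *\<^sub>C cint \<omega> r \<eta> (\<lambda>z. exp (of_real t * z) *\<^sub>C resolvent D A z x)"
  by (simp add: dunford_def cint_def Let_def)

lemma cint_cong:
  assumes "\<And>\<rho> \<phi>. r \<le> \<rho> \<Longrightarrow> \<bar>\<phi>\<bar> \<le> \<eta> \<Longrightarrow> E (ray \<omega> \<phi> \<rho>) = F (ray \<omega> \<phi> \<rho>)" "0 \<le> \<eta>"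
  shows "cint \<omega> r \<eta> E = cint \<omega> r \<eta> F"
  unfolding cint_def using assms
  by (intro arg_cong2[where f="(+)"] arg_cong2[where f="(-)"] integral_cong) auto

lemma cintegrable_cong:
  assumes "\<And>\<rho> \<phi>. r \<le> \<rho> \<Longrightarrow> \<bar>\<phi>\<bar> \<le> \<eta> \<Longrightarrow> E (ray \<omega> \<phi> \<rho>) = F (ray \<omega> \<phi> \<rho>)" "0 \<le> \<eta>"
  shows "cintegrable \<omega> r \<eta> E = cintegrable \<omega> r \<eta> F"
  unfolding cintegrable_def using assms
  by (intro arg_cong2[where f="(\<and>)"] integrable_cong) auto

lemma cint_add:
  "cintegrable \<omega> r \<eta> E \<Longrightarrow> cintegrable \<omega> r \<eta> F \<Longrightarrow>
   cint \<omega> r \<eta> (\<lambda>z. E z + F z) = cint \<omega> r \<eta> E + cint \<omega> r \<eta> F"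
  "cintegrable \<omega> r \<eta> E \<Longrightarrow> cintegrable \<omega> r \<eta> F \<Longrightarrow> cintegrable \<omega> r \<eta> (\<lambda>z. E z + F z)"
  by (simp_all add: cint_def cintegrable_def scaleC_add_right Henstock_Kurzweil_Integration.integral_add integrable_add)

lemma cint_diff:
  "cintegrable \<omega> r \<eta> E \<Longrightarrow> cintegrable \<omega> r \<eta> F \<Longrightarrow>
   cint \<omega> r \<eta> (\<lambda>z. E z - F z) = cint \<omega> r \<eta> E - cint \<omega> r \<eta> F"
  "cintegrable \<omega> r \<eta> E \<Longrightarrow> cintegrable \<omega> r \<eta> F \<Longrightarrow> cintegrable \<omega> r \<eta> (\<lambda>z. E z - F z)"
  by (simp_all add: cint_def cintegrable_def scaleC.diff_right Henstock_Kurzweil_Integration.integral_diff integrable_diff)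

definition clinear :: "('a::complex_banach \<Rightarrow> 'b::complex_banach) \<Rightarrow> bool" where
  "clinear f \<longleftrightarrow> bounded_linear f \<and> (\<forall>z x. f (z *\<^sub>C x) = z *\<^sub>C f x)"

lemma clinear_scaleC: "clinear f \<Longrightarrow> f (z *\<^sub>C x) = z *\<^sub>C f x"
  by (simp add: clinear_def)

lemma clinear_bounded_linear: "clinear f \<Longrightarrow> bounded_linear f"
  by (simp add: clinear_def)

text \<open>A bounded operator passes through each of the three integrals; complex linearity takes
  it past the factors \<open>cis\<close>.\<close>

lemma cint_clinear:
  assumes f: "clinear f" and E: "cintegrable \<omega> r \<eta> E"
  shows "cint \<omega> r \<eta> (\<lambda>z. f (E z)) = f (cint \<omega> r \<eta> E)" "cintegrable \<omega> r \<eta> (\<lambda>z. f (E z))"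
proof -
  interpret f: bounded_linear f using f by (rule clinear_bounded_linear)
  have *: "integral S (\<lambda>\<rho>. c \<rho> *\<^sub>C f (E (p \<rho>))) = f (integral S (\<lambda>\<rho>. c \<rho> *\<^sub>C E (p \<rho>)))"
    "(\<lambda>\<rho>. c \<rho> *\<^sub>C f (E (p \<rho>))) integrable_on S"
    if "(\<lambda>\<rho>. c \<rho> *\<^sub>C E (p \<rho>)) integrable_on S" for S :: "real set" and c p
    using integral_linear[OF that f.bounded_linear_axioms] integrable_linear[OF that f.bounded_linear_axioms]
    by (simp_all add: o_def clinear_scaleC[OF f])
  show "cint \<omega> r \<eta> (\<lambda>z. f (E z)) = f (cint \<omega> r \<eta> E)" "cintegrable \<omega> r \<eta> (\<lambda>z. f (E z))"
    using E by (simp_all add: cint_def cintegrable_def * f.add f.diff)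
qed

lemma clinear_scaleC_left: "clinear (\<lambda>x::'a::complex_banach. z *\<^sub>C x)"
  by (simp add: clinear_def scaleC.bounded_linear_right scaleC_commute)

lemma clinear_scaleC_vec: "clinear (\<lambda>z. z *\<^sub>C (x::'a::complex_banach))"
  by (simp add: clinear_def scaleC.bounded_linear_left scaleC_complex_def scaleC_scaleC)

lemma sector_ray:
  assumes "\<rho> > 0" "\<bar>\<phi>\<bar> < \<theta>" "\<theta> \<le> pi"
  shows "ray \<omega> \<phi> \<rho> \<in> sector \<omega> \<theta>"
proof -
  have "Arg (cis \<phi>) = \<phi>" using assms by (intro Arg_cis) auto
  then show ?thesis using assms by (auto simp: sector_def Arg_times_of_real)
qed

text \<open>\<open>Arg\<close> is continuous off the nonpositive reals. On the negative axis it
  equals pi, which \<theta> \<le> pi excludes, and the vertex is excluded by definition.\<close>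

lemma open_sector:
  assumes "\<theta> \<le> pi"
  shows "open (sector \<omega> \<theta>)"
proof -
  have "sector \<omega> \<theta> = (\<lambda>z. z - of_real \<omega>) -` ((- \<real>\<^sub>\<le>\<^sub>0) \<inter> Arg -` {-\<theta><..<\<theta>})"
  proof (intro set_eqI)
    fix z
    have "z - of_real \<omega> \<notin> \<real>\<^sub>\<le>\<^sub>0" if "z \<noteq> of_real \<omega>" "\<bar>Arg (z - of_real \<omega>)\<bar> < \<theta>"
    proof
      assume "z - of_real \<omega> \<in> \<real>\<^sub>\<le>\<^sub>0"
      then obtain x where x: "z - of_real \<omega> = of_real x" "x \<le> 0" by (auto elim: nonpos_Reals_cases)
      with that have "x < 0" by (metis eq_iff_diff_eq_0 of_real_0 order_le_less)
      then have "Arg (z - of_real \<omega>) = pi" using x by (simp add: Arg_of_real)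
      then show False using that assms by simp
    qed
    then show "z \<in> sector \<omega> \<theta> \<longleftrightarrow> z \<in> (\<lambda>z. z - of_real \<omega>) -` ((- \<real>\<^sub>\<le>\<^sub>0) \<inter> Arg -` {-\<theta><..<\<theta>})"
      by (auto simp: sector_def abs_less_iff)
  qed
  moreover have "open ((- \<real>\<^sub>\<le>\<^sub>0) \<inter> Arg -` {-\<theta><..<\<theta>})"
    by (intro continuous_open_preimage continuous_on_Arg) auto
  ultimately show ?thesis by (simp only:) (rule open_vimage, auto intro!: continuous_intros)
qed

lemma continuous_on_ray:
  fixes E :: "complex \<Rightarrow> 'a::complex_banach"
  assumes E: "continuous_on (sector \<omega> \<theta>) E" and "continuous_on S \<phi>" "continuous_on S \<rho>"
    and "\<And>x. x \<in> S \<Longrightarrow> \<rho> x > 0" "\<And>x. x \<in> S \<Longrightarrow> \<bar>\<phi> x\<bar> < \<theta>" "\<theta> \<le> pi"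
  shows "continuous_on S (\<lambda>x. E (ray \<omega> (\<phi> x) (\<rho> x)))"
  by (rule continuous_on_compose2[OF E]) (use assms in \<open>auto intro!: continuous_intros sector_ray\<close>)

text \<open>The exponential majorant on each ray has integral K exp (- a r) / a; the arc has length
  2 \<eta> r.\<close>

lemma cint_bound:
  fixes E :: "complex \<Rightarrow> 'a::complex_banach"
  assumes E: "continuous_on (sector \<omega> \<theta>) E" and \<eta>: "0 < \<eta>" "\<eta> < \<theta>" "\<theta> \<le> pi" and r: "0 < r" and a: "0 < a"
    and b1: "\<And>\<rho>. r \<le> \<rho> \<Longrightarrow> norm (E (ray \<omega> \<eta> \<rho>)) \<le> K * exp (- a * \<rho>)"
    and b2: "\<And>\<rho>. r \<le> \<rho> \<Longrightarrow> norm (E (ray \<omega> (- \<eta>) \<rho>)) \<le> K * exp (- a * \<rho>)"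
    and b3: "\<And>\<phi>. \<bar>\<phi>\<bar> \<le> \<eta> \<Longrightarrow> norm (E (ray \<omega> \<phi> r)) \<le> K'"
  shows "cintegrable \<omega> r \<eta> E" "norm (cint \<omega> r \<eta> E) \<le> 2 * (K * exp (- a * r) / a) + 2 * \<eta> * (r * K')"
proof -
  have g: "((\<lambda>\<rho>. K * exp (- a * \<rho>)) has_integral K * (exp (- a * r) / a)) {r..}"
    by (intro has_integral_mult_right has_integral_exp_minus_to_infinity a)
  have i: "(\<lambda>\<rho>. cis \<phi> *\<^sub>C E (ray \<omega> \<phi> \<rho>)) integrable_on {r..}"
    "norm (integral {r..} (\<lambda>\<rho>. cis \<phi> *\<^sub>C E (ray \<omega> \<phi> \<rho>))) \<le> K * (exp (- a * r) / a)"
    if "\<bar>\<phi>\<bar> = \<eta>" for \<phi>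
  proof -
    have b: "norm (cis \<phi> *\<^sub>C E (ray \<omega> \<phi> \<rho>)) \<le> K * exp (- a * \<rho>)" if "\<rho> \<in> {r..}" for \<rho>
      using b1[of \<rho>] b2[of \<rho>] \<open>\<bar>\<phi>\<bar> = \<eta>\<close> that by (auto simp: norm_scaleC abs_if split: if_splits)
    have c: "continuous_on {r..} (\<lambda>\<rho>. cis \<phi> *\<^sub>C E (ray \<omega> \<phi> \<rho>))"
      using \<eta> r that by (intro continuous_intros continuous_on_ray[OF E]) auto
    show i: "(\<lambda>\<rho>. cis \<phi> *\<^sub>C E (ray \<omega> \<phi> \<rho>)) integrable_on {r..}"
      by (rule integrable_dominated_halfline[OF c has_integral_integrable[OF g]]) (use b in auto)
    show "norm (integral {r..} (\<lambda>\<rho>. cis \<phi> *\<^sub>C E (ray \<omega> \<phi> \<rho>))) \<le> K * (exp (- a * r) / a)"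
      using integral_norm_bound_integral[OF i has_integral_integrable[OF g] b] integral_unique[OF g] by simp
  qed
  have c: "continuous_on {-\<eta>..\<eta>} (\<lambda>\<phi>. (\<i> * of_real r * cis \<phi>) *\<^sub>C E (ray \<omega> \<phi> r))"
    using \<eta> r by (intro continuous_intros continuous_on_ray[OF E]) (auto simp: cis_conv_exp intro!: continuous_intros)
  have "norm (integral {-\<eta>..\<eta>} (\<lambda>\<phi>. (\<i> * of_real r * cis \<phi>) *\<^sub>C E (ray \<omega> \<phi> r))) \<le> (r * K') * (\<eta> - (- \<eta>))"
    by (rule integral_bound[OF _ c]) (use \<eta> r b3 in \<open>auto simp: norm_scaleC norm_mult intro!: mult_left_mono\<close>)
  moreover have "norm (x - y + z) \<le> norm x + norm y + norm z" for x y z :: 'a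
    using norm_triangle_ineq[of "x - y" z] norm_triangle_ineq4[of x y] by linarith
  ultimately show "norm (cint \<omega> r \<eta> E) \<le> 2 * (K * exp (- a * r) / a) + 2 * \<eta> * (r * K')"
    unfolding cint_def using i(2)[of \<eta>] i(2)[of "-\<eta>"] \<eta>
    by (smt (verit) mult.commute times_divide_eq_right mult_2)
  show "cintegrable \<omega> r \<eta> E"
    unfolding cintegrable_def using i(1)[of \<eta>] i(1)[of "-\<eta>"] \<eta> integrable_continuous_real[OF c] by auto
qed

lemma has_vector_derivative_chainC:
  fixes E :: "complex \<Rightarrow> 'a::complex_banach"
  assumes E: "(E has_derivative (\<lambda>h. h *\<^sub>C E')) (at (p t))" and p: "(p has_vector_derivative p') (at t within S)"
  shows "((\<lambda>t. E (p t)) has_vector_derivative p' *\<^sub>C E') (at t within S)"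
  using has_derivative_compose[OF p[unfolded has_vector_derivative_def] E]
  by (simp add: has_vector_derivative_def scaleC.scaleR_left)

lemma cis_has_vector_derivative: "(cis has_vector_derivative \<i> * cis t) (at t within S)"
  using exp_scaleR_has_vector_derivative_right[of "\<i>" t S]
  unfolding cis_conv_exp[abs_def] by (simp add: scaleR_conv_of_real mult.commute)

text \<open>In polar coordinates \<open>\<partial>\<^sub>\<rho> (\<i> \<rho> e\<^sup>i\<^sup>\<phi> E) = \<partial>\<^sub>\<phi> (e\<^sup>i\<^sup>\<phi> E)\<close>, which is all of Cauchy's theorem that is needed here.\<close>

lemma cint_radius_indep:
  fixes E :: "complex \<Rightarrow> 'a::complex_banach"
  assumes E: "\<And>z. z \<in> sector \<omega> \<theta> \<Longrightarrow> (E has_derivative (\<lambda>h. h *\<^sub>C E' z)) (at z)"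
    and E': "continuous_on (sector \<omega> \<theta>) E'"
    and \<eta>: "0 < \<eta>" "\<eta> < \<theta>" "\<theta> \<le> pi" and r: "0 < r1" "r1 \<le> r2"
    and i: "cintegrable \<omega> r1 \<eta> E" "cintegrable \<omega> r2 \<eta> E"
  shows "cint \<omega> r1 \<eta> E = cint \<omega> r2 \<eta> E"
proof -
  have contE: "continuous_on (sector \<omega> \<theta>) E"
    using E has_derivative_continuous continuous_at_imp_continuous_on by blast
  define H where "H \<phi> \<rho> = cis \<phi> *\<^sub>C E (ray \<omega> \<phi> \<rho>)" for \<phi> \<rho>
  define G where "G \<rho> \<phi> = (\<i> * of_real \<rho> * cis \<phi>) *\<^sub>C E (ray \<omega> \<phi> \<rho>)" for \<rho> \<phi>
  define K where "K \<rho> \<phi> = (\<i> * cis \<phi>) *\<^sub>C E (ray \<omega> \<phi> \<rho>) + (\<i> * of_real \<rho> * cis \<phi> * cis \<phi>) *\<^sub>C E' (ray \<omega> \<phi> \<rho>)"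
    for \<rho> \<phi>
  have G: "((\<lambda>\<rho>. K \<rho> \<phi>) has_integral (G r2 \<phi> - G r1 \<phi>)) {r1..r2}" if "\<bar>\<phi>\<bar> \<le> \<eta>" for \<phi>
  proof (rule fundamental_theorem_of_calculus[OF r(2)])
    fix \<rho> assume \<rho>: "\<rho> \<in> {r1..r2}"
    have in': "ray \<omega> \<phi> \<rho> \<in> sector \<omega> \<theta>" using \<rho> r \<eta> that by (intro sector_ray) auto
    show "((\<lambda>\<rho>. G \<rho> \<phi>) has_vector_derivative K \<rho> \<phi>) (at \<rho> within {r1..r2})"
      unfolding G_def
      by (rule has_vector_derivative_eq_rhs,
          rule scaleC.has_vector_derivative[OF _ has_vector_derivative_chainC[where p="ray \<omega> \<phi>" and p'="cis \<phi>", OF E[OF in']]])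
        (auto intro!: derivative_eq_intros simp: K_def scaleC_scaleC algebra_simps)
  qed
  have H: "((\<lambda>\<phi>. K \<rho> \<phi>) has_integral (H \<eta> \<rho> - H (- \<eta>) \<rho>)) {-\<eta>..\<eta>}" if "r1 \<le> \<rho>" for \<rho>
  proof (rule fundamental_theorem_of_calculus)
    fix \<phi> assume \<phi>: "\<phi> \<in> {-\<eta>..\<eta>}"
    have in': "ray \<omega> \<phi> \<rho> \<in> sector \<omega> \<theta>" using \<phi> r \<eta> that by (intro sector_ray) auto
    show "((\<lambda>\<phi>. H \<phi> \<rho>) has_vector_derivative K \<rho> \<phi>) (at \<phi> within {-\<eta>..\<eta>})"
      unfolding H_def
      by (rule has_vector_derivative_eq_rhs,
          rule scaleC.has_vector_derivative[OF cis_has_vector_derivative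
            has_vector_derivative_chainC[where p="\<lambda>\<phi>. ray \<omega> \<phi> \<rho>" and p'="of_real \<rho> * (\<i> * cis \<phi>)", OF E[OF in']]])
        (auto intro!: derivative_eq_intros cis_has_vector_derivative simp: K_def scaleC_scaleC algebra_simps)
  qed (use \<eta> in auto)
  have contK: "continuous_on (cbox (r1,-\<eta>) (r2,\<eta>)) (\<lambda>(\<rho>,\<phi>). K \<rho> \<phi>)"
    unfolding K_def split_def using \<eta> r
    by (intro continuous_intros continuous_on_ray[OF contE] continuous_on_ray[OF E']) auto
  have contH: "continuous_on {r1..} (H \<phi>)" if "\<bar>\<phi>\<bar> = \<eta>" for \<phi>
    unfolding H_def using \<eta> r that by (intro continuous_intros continuous_on_ray[OF contE]) auto
  have intH: "H \<phi> integrable_on {r1..r2}" if "\<bar>\<phi>\<bar> = \<eta>" for \<phi>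
    using contH[OF that] by (intro integrable_continuous_real) (auto elim: continuous_on_subset)
  have split: "integral {r1..} (H \<phi>) = integral {r1..r2} (H \<phi>) + integral {r2..} (H \<phi>)" if "\<bar>\<phi>\<bar> = \<eta>" for \<phi>
  proof -
    have "H \<phi> integrable_on {r2..}" using i(2) that \<eta> unfolding cintegrable_def H_def by (auto simp: abs_if split: if_splits)
    moreover have "{r1..r2} \<inter> {r2..} = {r2}" "{r1..r2} \<union> {r2..} = {r1..}" using r by auto
    ultimately show ?thesis using Henstock_Kurzweil_Integration.integral_Un[of "H \<phi>" "{r1..r2}" "{r2..}"] intH[OF that] by simp
  qed
  \<comment> \<open>Integrating \<open>K\<close> over the rectangle [r1, r2] x [-\<eta>, \<eta>] in
    the two orders equates the ray segments between the radii with the difference of the two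
    arcs.\<close>
  have "integral {r1..r2} (\<lambda>\<rho>. integral {-\<eta>..\<eta>} (K \<rho>)) = integral {-\<eta>..\<eta>} (\<lambda>\<phi>. integral {r1..r2} (\<lambda>\<rho>. K \<rho> \<phi>))"
    using integral_swap_continuous[OF contK] by simp
  moreover have "integral {r1..r2} (\<lambda>\<rho>. integral {-\<eta>..\<eta>} (K \<rho>)) = integral {r1..r2} (\<lambda>\<rho>. H \<eta> \<rho> - H (- \<eta>) \<rho>)"
    by (intro integral_cong) (use H in \<open>auto simp: integral_unique\<close>)
  moreover have "\<dots> = integral {r1..r2} (H \<eta>) - integral {r1..r2} (H (-\<eta>))"
    using intH[of \<eta>] intH[of "-\<eta>"] \<eta> by (intro Henstock_Kurzweil_Integration.integral_diff) auto
  moreover have "integral {-\<eta>..\<eta>} (\<lambda>\<phi>. integral {r1..r2} (\<lambda>\<rho>. K \<rho> \<phi>)) = integral {-\<eta>..\<eta>} (\<lambda>\<phi>. G r2 \<phi> - G r1 \<phi>)"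
    by (intro integral_cong) (use G in \<open>auto simp: integral_unique\<close>)
  moreover have "\<dots> = integral {-\<eta>..\<eta>} (G r2) - integral {-\<eta>..\<eta>} (G r1)"
    using i unfolding cintegrable_def G_def by (intro Henstock_Kurzweil_Integration.integral_diff) auto
  ultimately have "integral {-\<eta>..\<eta>} (G r2) =
      integral {r1..r2} (H \<eta>) - integral {r1..r2} (H (-\<eta>)) + integral {-\<eta>..\<eta>} (G r1)" by simp
  moreover have "cint \<omega> \<rho> \<eta> E = integral {\<rho>..} (H \<eta>) - integral {\<rho>..} (H (- \<eta>)) + integral {-\<eta>..\<eta>} (G \<rho>)" for \<rho>
    by (simp add: cint_def H_def[abs_def] G_def[abs_def])
  ultimately show ?thesis using split[of \<eta>] split[of "-\<eta>"] \<eta> by simp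
qed

text \<open>The gauge integral over a half-line is a limit over growing boxes, and for y \<ge> |r|
  the box [-y, y] meets the half-line in [r, y].\<close>

lemma integral_halfline_tendsto:
  fixes f :: "real \<Rightarrow> 'a::banach"
  assumes "f integrable_on {r..}"
  shows "((\<lambda>y. integral {r..y} f) \<longlongrightarrow> integral {r..} f) at_top"
proof (rule tendstoI)
  fix e :: real assume e: "e > 0"
  obtain B where B: "B > 0" "\<And>a b. ball 0 B \<subseteq> cbox a b \<Longrightarrow>
      norm (integral (cbox a b) (\<lambda>x. if x \<in> {r..} then f x else 0) - integral {r..} f) < e"
    using integrable_integral[OF assms, unfolded has_integral_alt'[of f]] e by blast
  have "dist (integral {r..y} f) (integral {r..} f) < e" if y: "y \<ge> max B \<bar>r\<bar>" for y
  proof -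
    have "ball 0 B \<subseteq> cbox (-y) y" using y by (auto simp: dist_real_def)
    then have "norm (integral (cbox (-y) y) (\<lambda>x. if x \<in> {r..} then f x else 0) - integral {r..} f) < e"
      by (rule B(2))
    moreover have "{r..} \<inter> {-y..y} = {r..y}" using y by auto
    then have "integral (cbox (-y) y) (\<lambda>x. if x \<in> {r..} then f x else 0) = integral {r..y} f"
      unfolding box_real integral_restrict_Int by (simp only:)
    ultimately show ?thesis by (simp add: dist_norm)
  qed
  then show "\<forall>\<^sub>F y in at_top. dist (integral {r..y} f) (integral {r..} f) < e"
    using eventually_at_top_linorder by blast
qed

text \<open>By the fundamental theorem on both rays and on the arc, the values of \<open>P\<close>
  at the two corners cancel. Only the increment between the far ends remains, and its limit
  evaluates the contour integral.\<close>

lemma cint_primitive: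
  fixes P :: "complex \<Rightarrow> 'a::complex_banach"
  assumes P: "\<And>z. z \<in> sector \<omega> \<theta> \<Longrightarrow> (P has_derivative (\<lambda>h. h *\<^sub>C E z)) (at z)"
    and \<eta>: "0 < \<eta>" "\<eta> < \<theta>" "\<theta> \<le> pi" and r: "0 < r" and i: "cintegrable \<omega> r \<eta> E"
  shows "((\<lambda>y. P (ray \<omega> \<eta> y) - P (ray \<omega> (- \<eta>) y)) \<longlongrightarrow> cint \<omega> r \<eta> E) at_top"
proof -
  have R: "integral {r..y} (\<lambda>\<rho>. cis \<phi> *\<^sub>C E (ray \<omega> \<phi> \<rho>)) = P (ray \<omega> \<phi> y) - P (ray \<omega> \<phi> r)"
    if "\<bar>\<phi>\<bar> = \<eta>" "r \<le> y" for \<phi> y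
  proof (intro integral_unique fundamental_theorem_of_calculus)
    fix \<rho> assume \<rho>: "\<rho> \<in> {r..y}"
    show "((\<lambda>\<rho>. P (ray \<omega> \<phi> \<rho>)) has_vector_derivative cis \<phi> *\<^sub>C E (ray \<omega> \<phi> \<rho>)) (at \<rho> within {r..y})"
      by (rule has_vector_derivative_chainC[where p="ray \<omega> \<phi>"], rule P, rule sector_ray)
        (use \<rho> \<eta> r that in \<open>auto intro!: derivative_eq_intros\<close>)
  qed (use that in auto)
  have C: "integral {- \<eta>..\<eta>} (\<lambda>\<phi>. (\<i> * of_real r * cis \<phi>) *\<^sub>C E (ray \<omega> \<phi> r)) = P (ray \<omega> \<eta> r) - P (ray \<omega> (- \<eta>) r)"
  proof (intro integral_unique fundamental_theorem_of_calculus)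
    fix \<phi> assume \<phi>: "\<phi> \<in> {-\<eta>..\<eta>}"
    show "((\<lambda>\<phi>. P (ray \<omega> \<phi> r)) has_vector_derivative (\<i> * of_real r * cis \<phi>) *\<^sub>C E (ray \<omega> \<phi> r)) (at \<phi> within {-\<eta>..\<eta>})"
      by (rule has_vector_derivative_chainC[where p="\<lambda>\<phi>. ray \<omega> \<phi> r"], rule P, rule sector_ray)
        (use \<phi> \<eta> r in \<open>auto intro!: derivative_eq_intros cis_has_vector_derivative\<close>)
  qed (use \<eta> in auto)
  have "((\<lambda>y. integral {r..y} (\<lambda>\<rho>. cis \<eta> *\<^sub>C E (ray \<omega> \<eta> \<rho>)) - integral {r..y} (\<lambda>\<rho>. cis (-\<eta>) *\<^sub>C E (ray \<omega> (-\<eta>) \<rho>))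
      + integral {- \<eta>..\<eta>} (\<lambda>\<phi>. (\<i> * of_real r * cis \<phi>) *\<^sub>C E (ray \<omega> \<phi> r))) \<longlongrightarrow> cint \<omega> r \<eta> E) at_top"
    unfolding cint_def using i unfolding cintegrable_def by (intro tendsto_intros integral_halfline_tendsto) auto
  moreover have "\<forall>\<^sub>F y in at_top. integral {r..y} (\<lambda>\<rho>. cis \<eta> *\<^sub>C E (ray \<omega> \<eta> \<rho>)) - integral {r..y} (\<lambda>\<rho>. cis (-\<eta>) *\<^sub>C E (ray \<omega> (-\<eta>) \<rho>))
      + integral {- \<eta>..\<eta>} (\<lambda>\<phi>. (\<i> * of_real r * cis \<phi>) *\<^sub>C E (ray \<omega> \<phi> r)) = P (ray \<omega> \<eta> y) - P (ray \<omega> (- \<eta>) y)"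
    using eventually_ge_at_top[of r]
  proof eventually_elim
    case (elim y)
    then show ?case using R[of \<eta> y] R[of "-\<eta>" y] C \<eta> by (simp only: abs_minus_cancel abs_of_pos) simp
  qed
  ultimately show ?thesis by (rule Lim_transform_eventually)
qed

lemma has_field_derivative_imp_scaleC:
  "(f has_field_derivative f') (at z) \<Longrightarrow> (f has_derivative (\<lambda>h. h *\<^sub>C f')) (at z)"
  by (simp add: has_field_derivative_def scaleC_complex_def mult_commute_abs)

text \<open>A primitive of \<open>(e\<^sup>z - 1) / z\<close>, whose increments between conjugate points are computed along the left arc.\<close>

lemma exp_quotient_primitive:
  obtains H :: "complex \<Rightarrow> complex" where
    "\<And>z. z \<noteq> 0 \<Longrightarrow> (H has_field_derivative ((exp z - 1) / z)) (at z)"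
    "\<And>\<eta>. pi/2 < \<eta> \<Longrightarrow> \<eta> < pi \<Longrightarrow>
       ((\<lambda>y. H (of_real y * cis \<eta>) - H (of_real y * cis (- \<eta>))) \<longlongrightarrow> 2 * \<i> * of_real (pi - \<eta>)) at_top"
proof -
  \<comment> \<open>With the value 1 at 0 the quotient is continuous everywhere and differentiable
    off one point, which is enough for a primitive on the whole plane.\<close>
  define q :: "complex \<Rightarrow> complex" where "q = (\<lambda>z. if z = 0 then 1 else (exp z - 1) / z)"
  have "((\<lambda>z::complex. (exp z - exp 0) / (z - 0)) \<longlongrightarrow> exp 0) (at 0)"
    using DERIV_exp[of "0::complex"] by (simp add: has_field_derivative_iff)
  then have q0: "isCont q 0"
    unfolding isCont_def by (rule Lim_transform_eventually[THEN tendsto_eq_rhs])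
      (auto simp: q_def eventually_at_filter)
  have contq: "continuous_on UNIV q"
    unfolding continuous_on_eq_continuous_at[OF open_UNIV]
  proof
    fix z show "isCont q z"
    proof (cases "z = 0")
      case False
      have "isCont (\<lambda>z. (exp z - 1) / z) z" using False by (intro continuous_intros) auto
      moreover have "\<forall>\<^sub>F w in nhds z. q w = (exp w - 1) / w"
        using t1_space_nhds[OF False] by eventually_elim (auto simp: q_def)
      ultimately show ?thesis using isCont_cong by fast
    qed (use q0 in simp)
  qed
  have fdq: "q field_differentiable at z" if "z \<in> interior UNIV - {0}" for z
  proof (rule field_differentiable_transform_within[where f="\<lambda>z. (exp z - 1) / z" and d="norm z"])
    show "(\<lambda>z. (exp z - 1) / z) field_differentiable at z"
      using that by (intro derivative_intros field_differentiable_divide field_differentiable_within_exp field_differentiable_ident) auto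
  qed (use that in \<open>auto simp: q_def dist_norm\<close>)
  obtain H where H: "\<And>z. (H has_field_derivative q z) (at z)"
    using holomorphic_convex_primitive[OF convex_UNIV _ contq fdq] by (metis UNIV_I finite.emptyI finite_insert)
  show ?thesis
  proof
    show "(H has_field_derivative ((exp z - 1) / z)) (at z)" if "z \<noteq> 0" for z
      using H[of z] that by (simp add: q_def)
    fix \<eta> :: real assume \<eta>: "pi/2 < \<eta>" "\<eta> < pi"
    have c: "cos \<eta> < 0" using cos_monotone_0_pi[of "pi/2" \<eta>] \<eta> by simp
    have bound: "norm (H (of_real y * cis \<eta>) - H (of_real y * cis (- \<eta>)) - 2 * \<i> * of_real (pi - \<eta>))
        \<le> exp (y * cos \<eta>) * (2 * (pi - \<eta>))" if y: "y > 0" for y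
    proof -
      \<comment> \<open>On the left arc the cosine is at most cos \<eta> < 0, so the exponential is
        at most exp (y cos \<eta>); what survives of the integrand is - i, over an opening of 2 (pi
        - \<eta>).\<close>
      have "((\<lambda>\<phi>. \<i> * (exp (of_real y * cis \<phi>) - 1)) has_integral
          (H (of_real y * cis (2 * pi - \<eta>)) - H (of_real y * cis \<eta>))) {\<eta>..2 * pi - \<eta>}"
      proof (rule fundamental_theorem_of_calculus)
        fix \<phi>
        have "((\<lambda>\<phi>. of_real y * cis \<phi>) has_vector_derivative of_real y * (\<i> * cis \<phi>)) (at \<phi> within {\<eta>..2 * pi - \<eta>})"
          by (auto intro!: derivative_eq_intros cis_has_vector_derivative)
        from has_vector_derivative_chainC[OF has_field_derivative_imp_scaleC[OF H] this]
        show "((\<lambda>\<phi>. H (of_real y * cis \<phi>)) has_vector_derivative \<i> * (exp (of_real y * cis \<phi>) - 1)) (at \<phi> within {\<eta>..2 * pi - \<eta>})"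
          using y by (simp add: q_def scaleC_complex_def)
      qed (use \<eta> in auto)
      moreover have "((\<lambda>\<phi>. \<i>) has_integral \<i> * of_real (2 * (pi - \<eta>))) {\<eta>..2 * pi - \<eta>}"
        using has_integral_const_real[of \<i> \<eta> "2 * pi - \<eta>"] \<eta> by (simp add: scaleR_conv_of_real algebra_simps)
      ultimately have "((\<lambda>\<phi>. \<i> * (exp (of_real y * cis \<phi>) - 1) + \<i>) has_integral
          (H (of_real y * cis (2 * pi - \<eta>)) - H (of_real y * cis \<eta>) + \<i> * of_real (2 * (pi - \<eta>)))) {\<eta>..2 * pi - \<eta>}"
        by (rule has_integral_add)
      moreover have "norm (\<i> * (exp (of_real y * cis \<phi>) - 1) + \<i>) \<le> exp (y * cos \<eta>)" if "\<phi> \<in> {\<eta>..2 * pi - \<eta>}" for \<phi>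
      proof -
        have "cos \<phi> \<le> cos \<eta>"
        proof (cases "\<phi> \<le> pi")
          case True then show ?thesis using that \<eta> by (intro cos_monotone_0_pi_le) auto
        next
          case False
          have "cos (2 * pi - \<phi>) \<le> cos \<eta>" using that \<eta> False by (intro cos_monotone_0_pi_le) auto
          then show ?thesis by (simp add: cos_diff)
        qed
        then show ?thesis using y by (simp add: algebra_simps norm_mult mult_left_mono)
      qed
      ultimately have "norm (H (of_real y * cis (2 * pi - \<eta>)) - H (of_real y * cis \<eta>) + \<i> * of_real (2 * (pi - \<eta>)))
          \<le> exp (y * cos \<eta>) * content (cbox \<eta> (2 * pi - \<eta>))"
        by (intro has_integral_bound[where f="\<lambda>\<phi>. \<i> * (exp (of_real y * cis \<phi>) - 1) + \<i>"]) auto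
      moreover have "cis (2 * pi - \<eta>) = cis (- \<eta>)" by (simp add: complex_eq_iff cos_diff sin_diff)
      moreover have "content (cbox \<eta> (2 * pi - \<eta>)) = 2 * (pi - \<eta>)" using \<eta> by simp
      moreover have "norm (H (of_real y * cis \<eta>) - H (of_real y * cis (- \<eta>)) - 2 * \<i> * of_real (pi - \<eta>)) =
         norm (H (of_real y * cis (- \<eta>)) - H (of_real y * cis \<eta>) + \<i> * of_real (2 * (pi - \<eta>)))"
        by (subst norm_minus_cancel[symmetric]) (simp add: algebra_simps)
      ultimately show ?thesis by simp
    qed
    have "((\<lambda>y. exp (y * cos \<eta>) * (2 * (pi - \<eta>))) \<longlongrightarrow> 0 * (2 * (pi - \<eta>))) at_top"
      using c by (intro tendsto_intros) real_asymp
    then have "((\<lambda>y. H (of_real y * cis \<eta>) - H (of_real y * cis (- \<eta>)) - 2 * \<i> * of_real (pi - \<eta>)) \<longlongrightarrow> 0) at_top"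
      by (intro Lim_null_comparison[OF eventually_mono[OF eventually_gt_at_top[of 0] bound]]) simp_all
    then show "((\<lambda>y. H (of_real y * cis \<eta>) - H (of_real y * cis (- \<eta>))) \<longlongrightarrow> 2 * \<i> * of_real (pi - \<eta>)) at_top"
      using LIM_zero_iff by fast
  qed
qed

lemma has_derivative_quadratic:
  fixes f :: "'a::real_normed_vector \<Rightarrow> 'b::real_normed_vector"
  assumes "bounded_linear f'" "\<delta> > 0"
    and "\<And>y. norm (y - x) < \<delta> \<Longrightarrow> norm (f y - f x - f' (y - x)) \<le> C * (norm (y - x))\<^sup>2"
  shows "(f has_derivative f') (at x)"
proof (rule has_derivativeI_sandwich[OF assms(2,1)])
  show "norm (f y - f x - f' (y - x)) / norm (y - x) \<le> C * norm (y - x)" if "y \<noteq> x" "dist y x < \<delta>" for y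
    using assms(3)[of y] that by (simp add: dist_norm divide_le_eq power2_eq_square mult.assoc)
  have "((\<lambda>y. C * norm (y - x)) \<longlongrightarrow> C * norm (x - x)) (at x)" by (intro tendsto_intros)
  then show "((\<lambda>y. C * norm (y - x)) \<longlongrightarrow> 0) (at x)" by simp
qed

lemma has_vector_derivative_quadratic:
  fixes f :: "real \<Rightarrow> 'b::real_normed_vector"
  assumes "\<delta> > 0" "\<And>h. \<bar>h\<bar> < \<delta> \<Longrightarrow> norm (f (t + h) - f t - h *\<^sub>R f') \<le> C * h\<^sup>2"
  shows "(f has_vector_derivative f') (at t)"
  unfolding has_vector_derivative_def
  by (rule has_derivative_quadratic[OF bounded_linear_scaleR_left assms(1), where C=C])
     (use assms(2)[of "y - t" for y] in simp)

section \<open>The semigroup of a sectorial operator\<close>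

text \<open>Every contour that satisfies \<open>admissible_contour\<close> meets these assumptions,
  so the results hold for whichever one \<open>analytic_semigroup\<close> picks.\<close>

locale sectorial_contour =
  fixes D :: "'a::complex_banach set" and A :: "'a \<Rightarrow> 'a" and \<omega> \<theta> M \<eta> r0 :: real
  assumes sec: "sectorial_with D A \<omega> \<theta> M" and \<eta>: "pi / 2 < \<eta>" "\<eta> < \<theta>" and r0: "0 < r0"
begin

abbreviation R where "R \<equiv> resolvent D A"

lemma \<theta>: "\<theta> < pi" and M: "0 < M" and lin: "complex_linear_on D A"
  using sec by (auto simp: sectorial_with_def)

lemma \<eta>_pos: "0 < \<eta>" "\<eta> < pi" using \<eta> \<theta> pi_gt_zero by linarith+

lemma D_scaleC: "x \<in> D \<Longrightarrow> z *\<^sub>C x \<in> D"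
  and A_scaleC: "x \<in> D \<Longrightarrow> A (z *\<^sub>C x) = z *\<^sub>C A x"
  using lin by (auto simp: complex_linear_on_def)

lemma sector_resolvent:
  assumes "z \<in> sector \<omega> \<theta>"
  shows "bij_betw (\<lambda>x. z *\<^sub>C x - A x) D UNIV" "bounded_linear (R z)" "onorm (R z) \<le> M / cmod (z - of_real \<omega>)"
  using assms sec by (auto simp: sectorial_with_def sector_def resolvent_set_def)

lemma R_in: "z \<in> sector \<omega> \<theta> \<Longrightarrow> R z x \<in> D"
  unfolding resolvent_def by (rule inv_into_into) (use sector_resolvent(1)[of z] in \<open>auto simp: bij_betw_def\<close>)

lemma R_eq: "z \<in> sector \<omega> \<theta> \<Longrightarrow> z *\<^sub>C R z x - A (R z x) = x"
  unfolding resolvent_def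
  by (rule f_inv_into_f[of x "\<lambda>x. z *\<^sub>C x - A x"]) (use sector_resolvent(1)[of z] in \<open>auto simp: bij_betw_def\<close>)

lemma A_R: "z \<in> sector \<omega> \<theta> \<Longrightarrow> A (R z x) = z *\<^sub>C R z x - x"
  using R_eq[of z x] by (simp add: algebra_simps)

lemma R_left: "z \<in> sector \<omega> \<theta> \<Longrightarrow> x \<in> D \<Longrightarrow> R z (z *\<^sub>C x - A x) = x"
  unfolding resolvent_def
  by (rule inv_into_f_f[of "\<lambda>x. z *\<^sub>C x - A x"]) (use sector_resolvent(1)[of z] in \<open>auto simp: bij_betw_def\<close>)

text \<open>\<open>bounded_linear\<close> gives real linearity only. Complex homogeneity follows by
  applying \<open>R z\<close> to (z - A) (w R(z) x) = w x.\<close>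

lemma R_clinear: assumes z: "z \<in> sector \<omega> \<theta>" shows "clinear (R z)"
  unfolding clinear_def
proof (intro conjI allI sector_resolvent(2) z)
  fix w x
  have "R z (z *\<^sub>C (w *\<^sub>C R z x) - A (w *\<^sub>C R z x)) = w *\<^sub>C R z x"
    by (intro R_left z D_scaleC R_in)
  moreover have "z *\<^sub>C (w *\<^sub>C R z x) - A (w *\<^sub>C R z x) = w *\<^sub>C (z *\<^sub>C R z x - A (R z x))"
    by (simp add: A_scaleC R_in z scaleC.diff_right scaleC_commute)
  ultimately show "R z (w *\<^sub>C x) = w *\<^sub>C R z x" by (simp add: R_eq z)
qed

lemma R_norm: assumes z: "z \<in> sector \<omega> \<theta>" shows "norm (R z x) \<le> M / cmod (z - of_real \<omega>) * norm x"
  using onorm[OF sector_resolvent(2)[OF z], of x] sector_resolvent(3)[OF z] by (meson mult_right_mono norm_ge_zero order_trans)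

lemma R_diff: "z \<in> sector \<omega> \<theta> \<Longrightarrow> R z (x - y) = R z x - R z y"
  and R_add: "z \<in> sector \<omega> \<theta> \<Longrightarrow> R z (x + y) = R z x + R z y"
  and R_scaleC: "z \<in> sector \<omega> \<theta> \<Longrightarrow> R z (w *\<^sub>C x) = w *\<^sub>C R z x"
  using linear_diff[OF bounded_linear.linear[OF sector_resolvent(2)], of z]
    linear_add[OF bounded_linear.linear[OF sector_resolvent(2)], of z] clinear_scaleC[OF R_clinear, of z] by auto

text \<open>The first resolvent identity, from x = (z - A) R(w) x + (w - z) R(w) x.\<close>

lemma R_identity:
  assumes z: "z \<in> sector \<omega> \<theta>" and w: "w \<in> sector \<omega> \<theta>"
  shows "R z x - R w x = (w - z) *\<^sub>C R z (R w x)"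
proof -
  let ?y = "R w x"
  have "x = (z *\<^sub>C ?y - A ?y) + (w - z) *\<^sub>C ?y" using R_eq[OF w, of x] by (simp add: scaleC.diff_left)
  then have "R z x = R z ((z *\<^sub>C ?y - A ?y) + (w - z) *\<^sub>C ?y)" by simp
  also have "\<dots> = ?y + (w - z) *\<^sub>C R z ?y" by (simp only: R_add[OF z] R_left[OF z R_in[OF w]] R_scaleC[OF z])
  finally show ?thesis by simp
qed

text \<open>Adding to the resolvent identity the one with z and w exchanged gives (w - z) (R(z) R(w)
  x - R(w) R(z) x) = 0.\<close>

lemma R_commute:
  assumes z: "z \<in> sector \<omega> \<theta>" and w: "w \<in> sector \<omega> \<theta>"
  shows "R z (R w x) = R w (R z x)"
proof (cases "z = w")
  case False
  have "(w - z) *\<^sub>C (R z (R w x) - R w (R z x)) = (w - z) *\<^sub>C R z (R w x) + (z - w) *\<^sub>C R w (R z x)"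
    by (simp add: scaleC.diff_right scaleC.diff_left)
  also have "\<dots> = 0" using R_identity[OF z w, of x] R_identity[OF w z, of x] by (metis add.commute diff_add_cancel diff_self group_cancel.sub1)
  finally have "norm ((w - z) *\<^sub>C (R z (R w x) - R w (R z x))) = 0" by simp
  then show ?thesis using False by (simp add: norm_scaleC)
qed simp

lemma A_R_commute: "z \<in> sector \<omega> \<theta> \<Longrightarrow> x \<in> D \<Longrightarrow> A (R z x) = R z (A x)"
  using R_left[of z x] A_R[of z x] by (simp add: R_diff R_scaleC algebra_simps)

lemma open_sec: "open (sector \<omega> \<theta>)" using \<theta> by (intro open_sector) auto

text \<open>Two applications of the resolvent identity give the remainder exactly as (z - y)^2 R(y)
  R(z)^2 x, and |y - z| < |z - \<omega>| / 2 keeps the norm of R(y) at most 2 M / |z -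
  \<omega>|.\<close>

lemma R_deriv:
  assumes z: "z \<in> sector \<omega> \<theta>"
  shows "((\<lambda>z. R z x) has_derivative (\<lambda>h. h *\<^sub>C (- R z (R z x)))) (at z)"
proof -
  let ?m = "cmod (z - of_real \<omega>)"
  have m: "?m > 0" using z by (auto simp: sector_def)
  obtain e where e: "e > 0" "ball z e \<subseteq> sector \<omega> \<theta>" using open_sec z by (meson openE)
  show ?thesis
  proof (rule has_derivative_quadratic[where \<delta>="min e (?m/2)" and C="2 * M / ?m * norm (R z (R z x))"])
    show "bounded_linear (\<lambda>h. h *\<^sub>C (- R z (R z x)))" by (rule scaleC.bounded_linear_left)
    show "0 < min e (?m / 2)" using e m by simp
    fix y assume y: "norm (y - z) < min e (?m/2)"
    then have ys: "y \<in> sector \<omega> \<theta>" using e by (auto simp: dist_norm norm_minus_commute subset_iff)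
    have "?m \<le> cmod (y - of_real \<omega>) + cmod (y - z)"
      using norm_triangle_ineq4[of "y - of_real \<omega>" "y - z"] by simp
    then have my: "?m / 2 \<le> cmod (y - of_real \<omega>)" using y by auto
    then have "0 < cmod (y - of_real \<omega>)" using m by linarith
    have "R y x - R z x - (y - z) *\<^sub>C (- R z (R z x)) = (z - y) *\<^sub>C (R y (R z x) - R z (R z x))"
      unfolding R_identity[OF ys z, of x] by (simp add: scaleC.minus_right scaleC.diff_left scaleC.diff_right)
    also have "\<dots> = (z - y) *\<^sub>C (z - y) *\<^sub>C R y (R z (R z x))" by (simp add: R_identity[OF ys z])
    finally have "norm (R y x - R z x - (y - z) *\<^sub>C (- R z (R z x))) = (norm (y - z))\<^sup>2 * norm (R y (R z (R z x)))"
      by (simp add: norm_scaleC power2_eq_square norm_minus_commute)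
    also have "\<dots> \<le> (norm (y - z))\<^sup>2 * (M / (?m/2) * norm (R z (R z x)))"
      using my m M \<open>0 < cmod (y - of_real \<omega>)\<close>
      by (intro mult_left_mono order_trans[OF R_norm[OF ys]] mult_right_mono divide_left_mono mult_pos_pos) auto
    finally show "norm (R y x - R z x - (y - z) *\<^sub>C (- R z (R z x))) \<le> 2 * M / ?m * norm (R z (R z x)) * (norm (y - z))\<^sup>2"
      by (simp add: mult_ac)
  qed
qed

lemma R_cont: "continuous_on (sector \<omega> \<theta>) (\<lambda>z. R z x)"
  by (intro continuous_at_imp_continuous_on ballI has_derivative_continuous[OF R_deriv])

text \<open>The local bound on \<open>R z\<close> makes R(z) (R(z) x - R(w) x) small, and R(z) R(w)
  x converges by strong continuity.\<close>

lemma RR_cont: "continuous_on (sector \<omega> \<theta>) (\<lambda>z. R z (R z x))"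
  unfolding continuous_on_eq_continuous_at[OF open_sec]
proof
  fix w assume w: "w \<in> sector \<omega> \<theta>"
  have R: "((\<lambda>z. R z y) \<longlongrightarrow> R w y) (at w)" for y
    using R_cont w unfolding continuous_on_eq_continuous_at[OF open_sec] isCont_def by blast
  have m: "cmod (w - of_real \<omega>) > 0" using w by (auto simp: sector_def)
  have "((\<lambda>z. M / cmod (z - of_real \<omega>) * norm (R z x - R w x)) \<longlongrightarrow> M / cmod (w - of_real \<omega>) * norm (R w x - R w x)) (at w)"
    using m by (intro tendsto_intros R) auto
  then have lim: "((\<lambda>z. M / cmod (z - of_real \<omega>) * norm (R z x - R w x)) \<longlongrightarrow> 0) (at w)" by simp
  have ev: "\<forall>\<^sub>F z in at w. z \<in> sector \<omega> \<theta>" by (rule eventually_at_in_open'[OF open_sec w])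
  have "((\<lambda>z. R z (R z x - R w x)) \<longlongrightarrow> 0) (at w)"
    by (rule Lim_null_comparison[OF eventually_mono[OF ev R_norm] lim])
  from tendsto_add[OF this R[of "R w x"]]
  have "((\<lambda>z. R z (R z x - R w x) + R z (R w x)) \<longlongrightarrow> R w (R w x)) (at w)" by simp
  moreover have "\<forall>\<^sub>F z in at w. R z (R z x - R w x) + R z (R w x) = R z (R z x)"
    using ev by eventually_elim (simp add: R_diff)
  ultimately show "isCont (\<lambda>z. R z (R z x)) w" unfolding isCont_def by (rule Lim_transform_eventually)
qed

definition decay :: real where "decay = - cos \<eta>"

lemma decay: "decay > 0" "decay \<le> 1"
  using cos_monotone_0_pi[of "pi/2" \<eta>] \<eta> \<eta>_pos by (auto simp: decay_def)

definition contour :: "real \<Rightarrow> complex set" where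
  "contour r = {ray \<omega> \<phi> \<rho> | \<phi> \<rho>. r \<le> \<rho> \<and> (\<bar>\<phi>\<bar> = \<eta> \<or> \<rho> = r \<and> \<bar>\<phi>\<bar> \<le> \<eta>)}"

lemma contourI: "r \<le> \<rho> \<Longrightarrow> \<bar>\<phi>\<bar> = \<eta> \<or> \<rho> = r \<and> \<bar>\<phi>\<bar> \<le> \<eta> \<Longrightarrow> ray \<omega> \<phi> \<rho> \<in> contour r"
  by (auto simp: contour_def)

text \<open>The third part is one bound for rays and arc alike: on the rays Re z = \<omega> - decay
  |z - \<omega>|, and on the arc the summand 2 r leaves enough room because cos \<phi> and
  \<open>decay\<close> are at most 1.\<close>

lemma contour:
  assumes z: "z \<in> contour r" and r: "r > 0"
  shows "z \<in> sector \<omega> \<theta>" "r \<le> cmod (z - of_real \<omega>)" "Re z \<le> \<omega> + 2 * r - decay * cmod (z - of_real \<omega>)"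
proof -
  obtain \<phi> \<rho> where *: "z = ray \<omega> \<phi> \<rho>" "r \<le> \<rho>" "\<bar>\<phi>\<bar> = \<eta> \<or> \<rho> = r \<and> \<bar>\<phi>\<bar> \<le> \<eta>"
    using z by (auto simp: contour_def)
  show "z \<in> sector \<omega> \<theta>" unfolding * using * \<eta> \<theta> r by (intro sector_ray) auto
  have c: "cmod (z - of_real \<omega>) = \<rho>" using * r by (simp add: norm_mult)
  then show "r \<le> cmod (z - of_real \<omega>)" using * by simp
  show "Re z \<le> \<omega> + 2 * r - decay * cmod (z - of_real \<omega>)" unfolding c
  proof (cases "\<bar>\<phi>\<bar> = \<eta>")
    case True
    then have "cos \<phi> = cos \<eta>" by (metis cos_abs_real)
    then show "Re z \<le> \<omega> + 2 * r - decay * \<rho>" using r * by (simp add: decay_def)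
  next
    case False
    have "r * cos \<phi> \<le> r * 1" "r * decay \<le> r * 1" using r decay by (intro mult_left_mono; simp)+
    then show "Re z \<le> \<omega> + 2 * r - decay * \<rho>" using False * by (simp add: mult.commute)
  qed
qed

text \<open>The dependence on t and r is explicit on purpose: r = 1/t gives bounds uniform near t =
  0 for integrands of size t, and r = 1 gives a bound of order 1/t for integrands of size 1.\<close>

lemma exp_cint:
  fixes F :: "complex \<Rightarrow> 'b::complex_banach"
  assumes t: "t > 0" and r: "r > 0" and F: "continuous_on (sector \<omega> \<theta>) F"
    and B: "\<And>z. z \<in> contour r \<Longrightarrow> norm (F z) \<le> B"
  shows "cintegrable \<omega> r \<eta> (\<lambda>z. exp (of_real t * z) *\<^sub>C F z)"
    "norm (cint \<omega> r \<eta> (\<lambda>z. exp (of_real t * z) *\<^sub>C F z)) \<le> B * exp (t * (\<omega> + 2 * r)) * (2 / (decay * t) + 2 * \<eta> * r)"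
proof -
  let ?E = "\<lambda>z. exp (of_real t * z) *\<^sub>C F z"
  have "ray \<omega> \<eta> r \<in> contour r" using \<eta>_pos by (intro contourI) auto
  then have B0: "B \<ge> 0" using B order_trans[OF norm_ge_zero] by blast
  define K where "K = B * exp (t * (\<omega> + 2 * r))"
  have K: "K \<ge> 0" using B0 by (simp add: K_def)
  have b: "norm (?E z) \<le> K * exp (- (decay * t) * cmod (z - of_real \<omega>))" if "z \<in> contour r" for z
  proof -
    have "exp (t * Re z) \<le> exp (t * (\<omega> + 2 * r - decay * cmod (z - of_real \<omega>)))"
      using contour(3)[OF that r] t by simp
    then have "norm (?E z) \<le> exp (t * (\<omega> + 2 * r - decay * cmod (z - of_real \<omega>))) * B"
      using B[OF that] by (simp add: norm_scaleC mult_mono)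
    also have "\<dots> = K * exp (- (decay * t) * cmod (z - of_real \<omega>))"
      by (simp add: K_def mult_exp_exp algebra_simps)
    finally show ?thesis .
  qed
  have c: "continuous_on (sector \<omega> \<theta>) ?E" by (intro continuous_intros F)
  have rays: "norm (?E (ray \<omega> \<phi> \<rho>)) \<le> K * exp (- (decay * t) * \<rho>)" if "r \<le> \<rho>" "\<bar>\<phi>\<bar> = \<eta>" for \<rho> \<phi>
    using b[OF contourI[of r \<rho> \<phi>]] that r by (simp add: norm_mult)
  have "exp (- (decay * t) * r) \<le> 1" using decay t r by simp
  have arc: "norm (?E (ray \<omega> \<phi> r)) \<le> K * exp (- (decay * t) * r)" if "\<bar>\<phi>\<bar> \<le> \<eta>" for \<phi>
    using b[OF contourI[of r r \<phi>]] that r by (simp add: norm_mult)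
  have pos: "0 < decay * t" using decay t by simp
  have le: "\<eta> < \<theta>" "\<theta> \<le> pi" using \<eta> \<theta> by auto
  show "cintegrable \<omega> r \<eta> ?E"
    by (rule cint_bound(1)[OF c \<eta>_pos(1) le r pos rays rays arc]) (use \<eta>_pos in auto)
  have "norm (cint \<omega> r \<eta> ?E) \<le> 2 * (K * exp (- (decay * t) * r) / (decay * t)) + 2 * \<eta> * (r * (K * exp (- (decay * t) * r)))"
    by (rule cint_bound(2)[OF c \<eta>_pos(1) le r pos rays rays arc]) (use \<eta>_pos in auto)
  also have "\<dots> = K * exp (- (decay * t) * r) * (2 / (decay * t) + 2 * \<eta> * r)" by (simp add: field_simps)
  also have "\<dots> \<le> K * 1 * (2 / (decay * t) + 2 * \<eta> * r)"
    using pos K \<eta>_pos r \<open>exp (- (decay * t) * r) \<le> 1\<close> by (intro mult_mono) auto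
  finally show "norm (cint \<omega> r \<eta> ?E) \<le> B * exp (t * (\<omega> + 2 * r)) * (2 / (decay * t) + 2 * \<eta> * r)"
    by (simp add: K_def)
qed

lemma exp_deriv: "((\<lambda>z. exp (of_real t * z)) has_field_derivative (of_real t * exp (of_real t * z))) (at z)"
  by (auto intro!: derivative_eq_intros)

lemma exp_tendsto_0:
  assumes t: "t > 0" and "\<bar>\<phi>\<bar> = \<eta>"
  shows "((\<lambda>y. exp (of_real t * ray \<omega> \<phi> y)) \<longlongrightarrow> 0) at_top"
proof (rule tendsto_norm_zero_cancel)
  have c: "cos \<phi> = - decay" using assms by (metis cos_abs_real decay_def minus_minus)
  have "((\<lambda>y. exp (t * (\<omega> - decay * y))) \<longlongrightarrow> 0) at_top" using t decay by real_asymp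
  then show "((\<lambda>y. norm (exp (of_real t * ray \<omega> \<phi> y))) \<longlongrightarrow> 0) at_top" by (simp add: c mult.commute)
qed

text \<open>The primitive exp (t z) / t vanishes at both ends of the contour. This disposes of those
  terms of an integrand in which the resolvent no longer occurs.\<close>

lemma cint_exp:
  assumes t: "t > 0" and r: "r > 0"
  shows "cint \<omega> r \<eta> (\<lambda>z. exp (of_real t * z) *\<^sub>C (1::complex)) = 0"
proof -
  let ?P = "\<lambda>z. exp (of_real t * z) / of_real t :: complex"
  have "(?P has_field_derivative exp (of_real t * z) *\<^sub>C 1) (at z)" for z
    using t by (auto intro!: derivative_eq_intros simp: scaleC_complex_def)
  then have "((\<lambda>y. ?P (ray \<omega> \<eta> y) - ?P (ray \<omega> (- \<eta>) y)) \<longlongrightarrow> cint \<omega> r \<eta> (\<lambda>z. exp (of_real t * z) *\<^sub>C (1::complex))) at_top"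
    using \<eta> \<eta>_pos \<theta>
    by (intro cint_primitive[where \<theta>=\<theta>] has_field_derivative_imp_scaleC r exp_cint(1)[OF t r, where B=1]) auto
  moreover have "((\<lambda>y. ?P (ray \<omega> \<eta> y) - ?P (ray \<omega> (- \<eta>) y)) \<longlongrightarrow> 0 / of_real t - 0 / of_real t) at_top"
    using t \<eta>_pos by (intro tendsto_intros exp_tendsto_0) auto
  ultimately show ?thesis using tendsto_unique[OF trivial_limit_at_top_linorder] by fastforce
qed

lemma cint_exp_vec:
  assumes t: "t > 0" and r: "r > 0"
  shows "cint \<omega> r \<eta> (\<lambda>z. exp (of_real t * z) *\<^sub>C (x::'a)) = 0" "cintegrable \<omega> r \<eta> (\<lambda>z. exp (of_real t * z) *\<^sub>C (x::'a))"
proof -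
  have i: "cintegrable \<omega> r \<eta> (\<lambda>z. exp (of_real t * z) *\<^sub>C (1::complex))"
    by (rule exp_cint(1)[OF t r, where B=1]) auto
  show "cint \<omega> r \<eta> (\<lambda>z. exp (of_real t * z) *\<^sub>C x) = 0" "cintegrable \<omega> r \<eta> (\<lambda>z. exp (of_real t * z) *\<^sub>C x)"
    using cint_clinear[OF clinear_scaleC_vec[of x] i] cint_exp[OF t r] by (simp_all add: scaleC_complex_def)
qed

text \<open>Between the ends of the contour the logarithm increases by 2 i \<eta> and
  \<open>H\<close>, in the limit, by 2 i (pi - \<eta>); together they give the factor 2 pi i of the
  residue at \<omega>.\<close>

lemma cint_exp_inverse:
  assumes t: "t > 0" and r: "r > 0"
  shows "cint \<omega> r \<eta> (\<lambda>z. exp (of_real t * z) *\<^sub>C (1 / (z - of_real \<omega>))) = 2 * of_real pi * \<i> * exp (of_real (t * \<omega>))"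
    "cintegrable \<omega> r \<eta> (\<lambda>z. exp (of_real t * z) *\<^sub>C (1 / (z - of_real \<omega>)))"
proof -
  have cont: "continuous_on (sector \<omega> \<theta>) (\<lambda>z. 1 / (z - of_real \<omega>))"
    by (intro continuous_intros) (auto simp: sector_def)
  show i: "cintegrable \<omega> r \<eta> (\<lambda>z. exp (of_real t * z) *\<^sub>C (1 / (z - of_real \<omega>)))"
  proof (rule exp_cint(1)[OF t r cont, where B="1/r"])
    show "norm (1 / (z - of_real \<omega>)) \<le> 1 / r" if "z \<in> contour r" for z
      using contour(2)[OF that r] r by (simp add: norm_divide frac_le)
  qed
  obtain H where H: "\<And>z. z \<noteq> 0 \<Longrightarrow> (H has_field_derivative ((exp z - 1) / z)) (at z)"
    and Hlim: "\<And>\<eta>. pi/2 < \<eta> \<Longrightarrow> \<eta> < pi \<Longrightarrow>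
       ((\<lambda>y. H (of_real y * cis \<eta>) - H (of_real y * cis (- \<eta>))) \<longlongrightarrow> 2 * \<i> * of_real (pi - \<eta>)) at_top"
    using exp_quotient_primitive by blast
  \<comment> \<open>With w = z - \<omega>, exp (t w) / w = 1 / w + (exp (t w) - 1) / w:
    \<open>Ln\<close> at w is a primitive of the first term, \<open>H\<close> at t w one of the
    second.\<close>
  define P where "P z = exp (of_real (t * \<omega>)) * (Ln (z - of_real \<omega>) + H (of_real t * (z - of_real \<omega>)))" for z
  have dP: "(P has_derivative (\<lambda>h. h *\<^sub>C (exp (of_real t * z) *\<^sub>C (1 / (z - of_real \<omega>))))) (at z)" if z: "z \<in> sector \<omega> \<theta>" for z
  proof (rule has_field_derivative_imp_scaleC)
    let ?w = "z - of_real \<omega>"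
    have w0: "?w \<noteq> 0" using z by (auto simp: sector_def)
    have wn: "?w \<notin> \<real>\<^sub>\<le>\<^sub>0"
    proof
      assume "?w \<in> \<real>\<^sub>\<le>\<^sub>0"
      then obtain x where x: "?w = of_real x" "x \<le> 0" by (auto elim: nonpos_Reals_cases)
      with w0 have "x < 0" by (metis of_real_0 order_le_less)
      then have "Arg ?w = pi" using x by (simp add: Arg_of_real)
      then show False using z \<theta> by (simp add: sector_def)
    qed
    have tw: "of_real t * ?w \<noteq> 0" using w0 t by simp
    have 1: "((\<lambda>z. Ln (z - of_real \<omega>)) has_field_derivative 1 / ?w) (at z)"
      using wn by (auto intro!: derivative_eq_intros simp: divide_simps)
    have 2: "((\<lambda>z. H (of_real t * (z - of_real \<omega>))) has_field_derivative
        ((exp (of_real t * ?w) - 1) / (of_real t * ?w)) * of_real t) (at z)"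
      by (rule DERIV_chain2[where f=H and g="\<lambda>z. of_real t * (z - of_real \<omega>)", OF H[OF tw]]) (auto intro!: derivative_eq_intros)
    have "(P has_field_derivative exp (of_real (t * \<omega>)) * (1 / ?w + ((exp (of_real t * ?w) - 1) / (of_real t * ?w)) * of_real t)) (at z)"
      unfolding P_def by (intro DERIV_cmult DERIV_add 1 2)
    moreover have "exp (of_real (t * \<omega>)) * (1 / ?w + ((exp (of_real t * ?w) - 1) / (of_real t * ?w)) * of_real t)
        = exp (of_real (t * \<omega>)) * exp (of_real t * ?w) / ?w"
    proof -
      have "1 / w + ((E - 1) / (T * w)) * T = E / w" if "w \<noteq> 0" "T \<noteq> 0" for w E T :: complex
        using that by (simp add: field_simps)
      from this[OF w0, of "of_real t" "exp (of_real t * ?w)"] t show ?thesis by simp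
    qed
    moreover have "exp (of_real (t * \<omega>)) * exp (of_real t * ?w) = exp (of_real t * z)"
      by (simp add: mult_exp_exp algebra_simps)
    ultimately show "(P has_field_derivative exp (of_real t * z) *\<^sub>C (1 / ?w)) (at z)"
      by (simp add: scaleC_complex_def)
  qed
  have L1: "((\<lambda>y. P (ray \<omega> \<eta> y) - P (ray \<omega> (- \<eta>) y)) \<longlongrightarrow> cint \<omega> r \<eta> (\<lambda>z. exp (of_real t * z) *\<^sub>C (1 / (z - of_real \<omega>)))) at_top"
    using \<eta> \<eta>_pos \<theta> by (intro cint_primitive[OF dP _ _ _ r i]) auto
  have Lnray: "Ln (of_real y * cis \<phi>) = of_real (ln y) + \<i> * of_real \<phi>" if "y > 0" "\<bar>\<phi>\<bar> = \<eta>" for y \<phi>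
  proof -
    have "Arg (cis \<phi>) = \<phi>" using that \<eta>_pos by (intro Arg_cis) auto
    then show ?thesis using that by (simp add: Ln_Arg norm_mult Arg_times_of_real)
  qed
  have "((\<lambda>y. H (of_real (t * y) * cis \<eta>) - H (of_real (t * y) * cis (- \<eta>))) \<longlongrightarrow> 2 * \<i> * of_real (pi - \<eta>)) at_top"
    by (rule filterlim_compose[OF Hlim]) (use \<eta> \<eta>_pos t in \<open>auto intro: filterlim_tendsto_pos_mult_at_top[OF tendsto_const _ filterlim_ident]\<close>)
  then have "((\<lambda>y. exp (of_real (t * \<omega>)) * (2 * \<i> * of_real \<eta> + (H (of_real (t * y) * cis \<eta>) - H (of_real (t * y) * cis (- \<eta>)))))
      \<longlongrightarrow> exp (of_real (t * \<omega>)) * (2 * \<i> * of_real \<eta> + 2 * \<i> * of_real (pi - \<eta>))) at_top"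
    by (intro tendsto_intros)
  moreover have "\<forall>\<^sub>F y in at_top. exp (of_real (t * \<omega>)) * (2 * \<i> * of_real \<eta> + (H (of_real (t * y) * cis \<eta>) - H (of_real (t * y) * cis (- \<eta>))))
      = P (ray \<omega> \<eta> y) - P (ray \<omega> (- \<eta>) y)"
    using eventually_gt_at_top[of 0]
  proof eventually_elim
    case (elim y)
    have "Ln (ray \<omega> \<eta> y - of_real \<omega>) = of_real (ln y) + \<i> * of_real \<eta>"
      "Ln (ray \<omega> (- \<eta>) y - of_real \<omega>) = of_real (ln y) + \<i> * of_real (- \<eta>)"
      using Lnray[of y \<eta>] Lnray[of y "-\<eta>"] elim \<eta>_pos by simp_all
    then show ?case unfolding P_def by (simp only:) (simp add: algebra_simps)
  qed
  ultimately have "((\<lambda>y. P (ray \<omega> \<eta> y) - P (ray \<omega> (- \<eta>) y)) \<longlongrightarrow> exp (of_real (t * \<omega>)) * (2 * \<i> * of_real \<eta> + 2 * \<i> * of_real (pi - \<eta>))) at_top"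
    by (rule Lim_transform_eventually)
  from tendsto_unique[OF trivial_limit_at_top_linorder L1 this]
  show "cint \<omega> r \<eta> (\<lambda>z. exp (of_real t * z) *\<^sub>C (1 / (z - of_real \<omega>))) = 2 * of_real pi * \<i> * exp (of_real (t * \<omega>))"
    by (simp add: algebra_simps)
qed

end

section \<open>The Dunford integral: bounds, values in the domain, derivative, limit at time
  0\<close>

context sectorial_contour
begin

definition S :: "real \<Rightarrow> 'a \<Rightarrow> 'a" where "S t x = dunford D A \<omega> r0 \<eta> t x"

abbreviation cI :: complex where "cI \<equiv> 1 / (2 * of_real pi * \<i>)"

lemma norm_cI: "norm (cI *\<^sub>C (x::'a)) \<le> norm x"
proof -
  have "norm cI \<le> 1" using pi_ge_two by (simp add: norm_divide norm_mult)
  then show ?thesis by (simp add: norm_scaleC mult_left_le_one_le)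
qed

lemma R_bound: "z \<in> contour r \<Longrightarrow> r > 0 \<Longrightarrow> norm (R z x) \<le> M / r * norm x"
  using contour(1,2)[of z r] R_norm[of z x] M
  by (meson divide_left_mono less_le_trans mult_pos_pos mult_right_mono norm_ge_zero order_less_imp_le order_trans)

lemma ray_sector: "\<rho> > 0 \<Longrightarrow> \<bar>\<phi>\<bar> \<le> \<eta> \<Longrightarrow> ray \<omega> \<phi> \<rho> \<in> sector \<omega> \<theta>"
  using \<eta> \<theta> by (intro sector_ray) auto

lemma cint_cong_sector:
  assumes "\<And>z. z \<in> sector \<omega> \<theta> \<Longrightarrow> E z = F z" "r > 0"
  shows "cint \<omega> r \<eta> E = cint \<omega> r \<eta> F" "cintegrable \<omega> r \<eta> E = cintegrable \<omega> r \<eta> F"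
  using assms \<eta>_pos by (intro cint_cong cintegrable_cong assms ray_sector; simp)+

lemma R_integrable: "t > 0 \<Longrightarrow> r > 0 \<Longrightarrow> cintegrable \<omega> r \<eta> (\<lambda>z. exp (of_real t * z) *\<^sub>C R z x)"
  by (rule exp_cint(1)[OF _ _ R_cont R_bound])

text \<open>This lets the radius depend on t, on which the uniform bounds near t = 0 rest.\<close>

lemma S_radius:
  assumes t: "t > 0" and r: "r > 0"
  shows "dunford D A \<omega> r \<eta> t x = S t x"
proof -
  define E where "E z = exp (of_real t * z) *\<^sub>C R z x" for z
  define E' where "E' z = exp (of_real t * z) *\<^sub>C (- R z (R z x)) + (of_real t * exp (of_real t * z)) *\<^sub>C R z x" for z
  have dE: "(E has_derivative (\<lambda>h. h *\<^sub>C E' z)) (at z)" if z: "z \<in> sector \<omega> \<theta>" for z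
    unfolding E_def
    by (rule has_derivative_eq_rhs, rule scaleC.FDERIV[OF exp_deriv[unfolded has_field_derivative_def] R_deriv[OF z]])
       (simp add: E'_def fun_eq_iff scaleC_add_right scaleC_scaleC mult_ac)
  have cE': "continuous_on (sector \<omega> \<theta>) E'"
    unfolding E'_def by (intro continuous_intros R_cont RR_cont)
  have indep: "cint \<omega> r1 \<eta> E = cint \<omega> r2 \<eta> E" if "0 < r1" "r1 \<le> r2" for r1 r2
    using \<eta> \<theta> \<eta>_pos that t R_integrable[OF t, of _ x, folded E_def]
    by (intro cint_radius_indep[OF dE cE']) auto
  have "cint \<omega> r \<eta> E = cint \<omega> r0 \<eta> E"
    using indep[of r r0] indep[of r0 r] r r0 linorder_linear[of r r0] by metis
  then show ?thesis unfolding S_def dunford_cint E_def[abs_def] by (simp only:)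
qed

lemma S_cint: "t > 0 \<Longrightarrow> r > 0 \<Longrightarrow> S t x = cI *\<^sub>C cint \<omega> r \<eta> (\<lambda>z. exp (of_real t * z) *\<^sub>C R z x)"
  using S_radius[of t r x] by (simp only: dunford_cint)

text \<open>The constant that \<open>exp_cint\<close> yields at radius 1/t for an integrand bounded
  by t M, made uniform in 0 < t \<le> t0.\<close>

definition growth :: "real \<Rightarrow> real" where
  "growth t0 = M * exp (t0 * \<bar>\<omega>\<bar> + 2) * (2 / decay + 2 * \<eta>)"

text \<open>On the contour of radius 1/t the resolvent is bounded by t M, which cancels the factor
  1/t from the rays and the arc. The factor \<open>B\<close> leaves room for integrands with a
  further power of t.\<close>

lemma S_radius_bound:
  fixes F :: "complex \<Rightarrow> 'a"
  assumes t: "0 < t" "t \<le> t0" and F: "continuous_on (sector \<omega> \<theta>) F"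
    and B: "\<And>z. z \<in> contour (1 / t) \<Longrightarrow> norm (F z) \<le> t * M * B"
  shows "norm (cI *\<^sub>C cint \<omega> (1 / t) \<eta> (\<lambda>z. exp (of_real t * z) *\<^sub>C F z)) \<le> growth t0 * B"
proof -
  have "norm (F (ray \<omega> \<eta> (1/t))) \<le> t * M * B" by (intro B contourI) (use \<eta>_pos in auto)
  then have "0 \<le> t * M * B" using order_trans[OF norm_ge_zero] by blast
  then have B0: "B \<ge> 0" using mult_pos_pos[OF t(1) M] unfolding zero_le_mult_iff[of "t * M" B] by linarith
  have "norm (cI *\<^sub>C cint \<omega> (1 / t) \<eta> (\<lambda>z. exp (of_real t * z) *\<^sub>C F z))
      \<le> t * M * B * exp (t * (\<omega> + 2 * (1 / t))) * (2 / (decay * t) + 2 * \<eta> * (1 / t))"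
    by (rule order_trans[OF norm_cI exp_cint(2)[OF _ _ F B]]) (use t in auto)
  also have "\<dots> = M * B * exp (t * \<omega> + 2) * (2 / decay + 2 * \<eta>)"
  proof -
    have e: "t * (\<omega> + 2 * (1 / t)) = t * \<omega> + 2" using t by (simp add: field_simps)
    have "2 / (decay * t) + 2 * \<eta> * (1 / t) = (2 / decay + 2 * \<eta>) / t" by (simp add: add_divide_distrib)
    then show ?thesis unfolding e using t by simp
  qed
  also have "\<dots> \<le> M * B * exp (t0 * \<bar>\<omega>\<bar> + 2) * (2 / decay + 2 * \<eta>)"
  proof -
    have "t * \<omega> \<le> t * \<bar>\<omega>\<bar>" using t by (intro mult_left_mono) auto
    also have "\<dots> \<le> t0 * \<bar>\<omega>\<bar>" using t by (intro mult_right_mono) auto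
    finally have "t * \<omega> \<le> t0 * \<bar>\<omega>\<bar>" .
    then show ?thesis using M B0 decay \<eta>_pos by (intro mult_right_mono mult_left_mono) auto
  qed
  finally show ?thesis by (simp add: growth_def mult_ac)
qed

lemma S_bound: "0 < t \<Longrightarrow> t \<le> t0 \<Longrightarrow> norm (S t x) \<le> growth t0 * norm x"
  using S_radius_bound[of t t0 "\<lambda>z. R z x" "norm x"] S_cint[of t "1/t" x] R_bound[of _ "1/t" x] R_cont
  by (simp add: mult.commute)

lemma S_clinear:
  assumes t: "t > 0"
  shows "clinear (S t)"
proof -
  have a: "S t (x + y) = S t x + S t y" for x y
  proof -
    have "cint \<omega> 1 \<eta> (\<lambda>z. exp (of_real t * z) *\<^sub>C R z (x + y))
        = cint \<omega> 1 \<eta> (\<lambda>z. exp (of_real t * z) *\<^sub>C R z x + exp (of_real t * z) *\<^sub>C R z y)"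
      by (intro cint_cong_sector) (simp_all add: R_add scaleC_add_right)
    then show ?thesis using R_integrable[OF t] by (simp add: S_cint[OF t zero_less_one] cint_add scaleC_add_right)
  qed
  have s: "S t (w *\<^sub>C x) = w *\<^sub>C S t x" for w x
  proof -
    have "cint \<omega> 1 \<eta> (\<lambda>z. exp (of_real t * z) *\<^sub>C R z (w *\<^sub>C x))
        = cint \<omega> 1 \<eta> (\<lambda>z. w *\<^sub>C (exp (of_real t * z) *\<^sub>C R z x))"
      by (intro cint_cong_sector) (simp_all add: R_scaleC scaleC_commute)
    then show ?thesis using cint_clinear(1)[OF clinear_scaleC_left R_integrable[OF t], of 1]
      by (simp add: S_cint[OF t zero_less_one] scaleC_commute)
  qed
  have "bounded_linear (S t)"
    by (rule bounded_linear_intro[where K="growth t"])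
       (use a s[of "of_real _"] S_bound[OF t order_refl] in \<open>auto simp: scaleC_of_real mult.commute\<close>)
  then show ?thesis by (simp add: clinear_def s)
qed

text \<open>The candidate for \<open>A (S t x)\<close>: A R(z) x = z R(z) x - x, and the term x
  integrates to 0 by \<open>cint_exp_vec\<close>.\<close>

definition AS :: "real \<Rightarrow> 'a \<Rightarrow> 'a" where
  "AS t x = cI *\<^sub>C cint \<omega> 1 \<eta> (\<lambda>z. exp (of_real t * z) *\<^sub>C (z *\<^sub>C R z x))"

lemma zR_cont: "continuous_on (sector \<omega> \<theta>) (\<lambda>z. z *\<^sub>C R z x)"
  by (intro continuous_intros R_cont)

text \<open>Because |z - \<omega>| \<ge> 1 on this contour, |z| \<le> (|\<omega>| + 1) |z -
  \<omega>|, so the factor z just cancels the decay of the resolvent.\<close>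

lemma zR_bound: assumes "z \<in> contour 1" shows "norm (z *\<^sub>C R z x) \<le> M * (\<bar>\<omega>\<bar> + 1) * norm x"
proof -
  note c = contour[OF assms zero_less_one]
  have "cmod z \<le> \<bar>\<omega>\<bar> + cmod (z - of_real \<omega>)"
    using norm_triangle_ineq[of "of_real \<omega>" "z - of_real \<omega>"] by simp
  also have "\<dots> \<le> (\<bar>\<omega>\<bar> + 1) * cmod (z - of_real \<omega>)" using c mult_left_mono[of 1 "cmod (z - of_real \<omega>)" "\<bar>\<omega>\<bar>"] by (simp add: algebra_simps)
  finally have "cmod z * norm (R z x) \<le> (\<bar>\<omega>\<bar> + 1) * cmod (z - of_real \<omega>) * (M / cmod (z - of_real \<omega>) * norm x)"
    by (intro mult_mono R_norm c(1)) auto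
  also have "\<dots> = M * (\<bar>\<omega>\<bar> + 1) * norm x" 
  proof -
    have "0 < cmod (z - of_real \<omega>)" using c(2) by linarith
    then show ?thesis by (simp add: field_simps)
  qed
  finally show ?thesis by (simp add: norm_scaleC)
qed

lemma zR_integrable: "t > 0 \<Longrightarrow> cintegrable \<omega> 1 \<eta> (\<lambda>z. exp (of_real t * z) *\<^sub>C (z *\<^sub>C R z x))"
  by (rule exp_cint(1)[OF _ zero_less_one zR_cont zR_bound])

lemma AS_bound:
  assumes "0 < t" "t \<le> t0"
  shows "norm (AS t x) \<le> M * (\<bar>\<omega>\<bar> + 1) * exp (t0 * (\<bar>\<omega>\<bar> + 2)) * (2 / decay + 2 * \<eta> * t0) / t * norm x"
proof -
  have "norm (AS t x) \<le> M * (\<bar>\<omega>\<bar> + 1) * norm x * exp (t * (\<omega> + 2 * 1)) * (2 / (decay * t) + 2 * \<eta> * 1)"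
    unfolding AS_def by (rule order_trans[OF norm_cI exp_cint(2)[OF _ _ zR_cont zR_bound]]) (use assms in auto)
  also have "\<dots> \<le> M * (\<bar>\<omega>\<bar> + 1) * norm x * exp (t0 * (\<bar>\<omega>\<bar> + 2)) * ((2 / decay + 2 * \<eta> * t0) / t)"
  proof -
    have "t * (\<omega> + 2 * 1) \<le> t * (\<bar>\<omega>\<bar> + 2)" using assms by (intro mult_left_mono) auto
    also have "\<dots> \<le> t0 * (\<bar>\<omega>\<bar> + 2)" using assms by (intro mult_right_mono) auto
    finally have "exp (t * (\<omega> + 2 * 1)) \<le> exp (t0 * (\<bar>\<omega>\<bar> + 2))" by simp
    moreover have "2 / (decay * t) + 2 * \<eta> * 1 \<le> (2 / decay + 2 * \<eta> * t0) / t"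
      using assms \<eta>_pos by (simp add: add_divide_distrib le_divide_eq)
    ultimately show ?thesis using M assms decay \<eta>_pos by (intro mult_mono) auto
  qed
  finally show ?thesis by (simp add: field_simps)
qed

text \<open>\<open>A\<close> is not taken under the integral. With l = \<omega> + 1, the resolvent
  identity represents \<open>S t x\<close> as R(l) y, where y = l S(t) x - AS(t) x; this puts it in
  \<open>D\<close>, and A R(l) y = l R(l) y - y.\<close>

lemma AS:
  assumes t: "t > 0"
  shows "S t x \<in> D" "A (S t x) = AS t x"
proof -
  define l where "l = ray \<omega> 0 1"
  have l: "l \<in> sector \<omega> \<theta>" unfolding l_def using \<eta>_pos by (intro ray_sector) auto
  let ?e = "\<lambda>z. exp (of_real t * z)"
  have iR: "cintegrable \<omega> 1 \<eta> (\<lambda>z. ?e z *\<^sub>C R z x)" using R_integrable t by simp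
  have ilR: "cintegrable \<omega> 1 \<eta> (\<lambda>z. l *\<^sub>C (?e z *\<^sub>C R z x))" "cint \<omega> 1 \<eta> (\<lambda>z. l *\<^sub>C (?e z *\<^sub>C R z x)) = l *\<^sub>C cint \<omega> 1 \<eta> (\<lambda>z. ?e z *\<^sub>C R z x)"
    using cint_clinear[OF clinear_scaleC_left iR] by auto
  have iD: "cintegrable \<omega> 1 \<eta> (\<lambda>z. l *\<^sub>C (?e z *\<^sub>C R z x) - ?e z *\<^sub>C (z *\<^sub>C R z x))"
    by (intro cint_diff(2) ilR zR_integrable t)
  define y where "y = cI *\<^sub>C cint \<omega> 1 \<eta> (\<lambda>z. l *\<^sub>C (?e z *\<^sub>C R z x) - ?e z *\<^sub>C (z *\<^sub>C R z x))"
  have y: "y = l *\<^sub>C S t x - AS t x"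
    unfolding y_def cint_diff(1)[OF ilR(1) zR_integrable[OF t]] ilR(2)
    by (simp only: scaleC.diff_right S_cint[OF t zero_less_one] AS_def scaleC_commute[of cI l])
  have "cint \<omega> 1 \<eta> (\<lambda>z. ?e z *\<^sub>C R z x)
      = cint \<omega> 1 \<eta> (\<lambda>z. ?e z *\<^sub>C R l x + R l (l *\<^sub>C (?e z *\<^sub>C R z x) - ?e z *\<^sub>C (z *\<^sub>C R z x)))"
  proof (rule cint_cong_sector(1))
    fix z assume z: "z \<in> sector \<omega> \<theta>"
    have "R z x = R l x + (l - z) *\<^sub>C R l (R z x)"
      using R_identity[OF z l, of x] R_commute[OF z l, of x] by (simp add: algebra_simps)
    also have "\<dots> = R l x + R l (l *\<^sub>C R z x - z *\<^sub>C R z x)"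
      by (simp add: R_scaleC[OF l] R_diff[OF l] scaleC.diff_left)
    finally have "?e z *\<^sub>C R z x = ?e z *\<^sub>C R l x + R l (?e z *\<^sub>C (l *\<^sub>C R z x - z *\<^sub>C R z x))"
      by (metis R_scaleC[OF l] scaleC_add_right)
    then show "?e z *\<^sub>C R z x = ?e z *\<^sub>C R l x + R l (l *\<^sub>C (?e z *\<^sub>C R z x) - ?e z *\<^sub>C (z *\<^sub>C R z x))"
      by (simp add: scaleC.diff_right scaleC_commute)
  qed simp
  also have "\<dots> = R l (cint \<omega> 1 \<eta> (\<lambda>z. l *\<^sub>C (?e z *\<^sub>C R z x) - ?e z *\<^sub>C (z *\<^sub>C R z x)))"
    using cint_clinear[OF R_clinear[OF l] iD] cint_exp_vec[OF t zero_less_one] by (simp add: cint_add(1))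
  finally have St: "S t x = R l y" by (simp add: S_cint[OF t zero_less_one] y_def R_scaleC[OF l])
  show "S t x \<in> D" unfolding St by (rule R_in[OF l])
  have "A (S t x) = l *\<^sub>C S t x - y" unfolding St by (rule A_R[OF l])
  then show "A (S t x) = AS t x" by (simp add: y)
qed

text \<open>On \<open>D\<close>, z R(z) x = x + R(z) A x, and the term x integrates to 0.\<close>

lemma AS_D:
  assumes t: "t > 0" and x: "x \<in> D"
  shows "A (S t x) = S t (A x)"
proof -
  have "cint \<omega> 1 \<eta> (\<lambda>z. exp (of_real t * z) *\<^sub>C (z *\<^sub>C R z x))
      = cint \<omega> 1 \<eta> (\<lambda>z. exp (of_real t * z) *\<^sub>C x + exp (of_real t * z) *\<^sub>C R z (A x))"
  proof (rule cint_cong_sector(1))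
    fix z assume z: "z \<in> sector \<omega> \<theta>"
    have "z *\<^sub>C R z x = x + R z (A x)" using A_R_commute[OF z x] A_R[OF z, of x] by (simp add: algebra_simps)
    then show "exp (of_real t * z) *\<^sub>C (z *\<^sub>C R z x) = exp (of_real t * z) *\<^sub>C x + exp (of_real t * z) *\<^sub>C R z (A x)"
      by (simp add: scaleC_add_right)
  qed simp
  also have "\<dots> = cint \<omega> 1 \<eta> (\<lambda>z. exp (of_real t * z) *\<^sub>C R z (A x))"
    using cint_exp_vec[OF t zero_less_one] R_integrable[OF t] by (simp add: cint_add(1))
  finally show ?thesis 
    unfolding AS(2)[OF t, of x] AS_def S_cint[OF t zero_less_one, of "A x"] by simp
qed

lemma exp_remainder_bound: "cmod (exp w - 1 - w) \<le> exp (cmod w) * (cmod w)\<^sup>2"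
proof -
  have "cmod (exp w - (\<Sum>k\<le>1. w ^ k / fact k)) \<le> exp \<bar>Re w\<bar> * (cmod w) ^ Suc 1 / fact 1"
    by (rule Taylor_exp)
  also have "\<dots> \<le> exp (cmod w) * (cmod w)\<^sup>2"
    by (simp add: power2_eq_square mult_right_mono abs_Re_le_cmod)
  finally show ?thesis by (simp add: algebra_simps)
qed

lemma S_deriv:
  assumes t: "t > 0"
  shows "((\<lambda>t. S t x) has_vector_derivative A (S t x)) (at t)"
proof -
  \<comment> \<open>One half of the exponential, exp (t z / 2), is set aside. On the contour it
    decays like exp (- 2 d |z - \<omega>|), which just absorbs the growth exp (2 d |z|) of the
    Taylor remainder for |h| \<le> d.\<close>
  define d where "d = decay * t / 4"
  have d: "d > 0" "d \<le> t / 4" using decay t by (auto simp: d_def mult_right_le_one_le mult_left_le_one_le)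
  define F where "F h z = (exp (of_real (t/2) * z) * (exp (of_real h * z) - 1 - of_real h * z)) *\<^sub>C R z x" for h z
  define B where "B = exp (t / 2 * (\<omega> + 2)) * exp (2 * d * \<bar>\<omega>\<bar>) * (2 / d\<^sup>2) * (M * norm x)"
  have FB: "norm (F h z) \<le> B * h\<^sup>2" if h: "\<bar>h\<bar> \<le> d" and z: "z \<in> contour 1" for h z
  proof -
    note c = contour[OF z zero_less_one]
    let ?u = "cmod z" and ?y = "cmod (z - of_real \<omega>)"
    have u: "?u \<le> \<bar>\<omega>\<bar> + ?y" using norm_triangle_ineq[of "of_real \<omega>" "z - of_real \<omega>"] by simp
    have "cmod (exp (of_real h * z) - 1 - of_real h * z) \<le> exp (\<bar>h\<bar> * ?u) * (\<bar>h\<bar> * ?u)\<^sup>2"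
      using exp_remainder_bound[of "of_real h * z"] by (simp add: norm_mult)
    also have "\<dots> \<le> exp (d * ?u) * (\<bar>h\<bar> * ?u)\<^sup>2" using h by (intro mult_right_mono) (auto intro: mult_right_mono)
    also have "\<dots> = exp (d * ?u) * (h\<^sup>2 * (2 / d\<^sup>2) * ((d * ?u)\<^sup>2 / 2))" using d by (simp add: power_mult_distrib)
    also have "\<dots> \<le> exp (d * ?u) * (h\<^sup>2 * (2 / d\<^sup>2) * exp (d * ?u))"
    proof -
      have "0 \<le> d * ?u" using d by simp
      then have "(d * ?u)\<^sup>2 / 2 \<le> exp (d * ?u)"
        using exp_lower_Taylor_quadratic[of "d * ?u"] by linarith
      then show ?thesis by (intro mult_left_mono) auto
    qed
    also have "\<dots> = exp (2 * d * ?u) * (2 / d\<^sup>2) * h\<^sup>2" by (simp add: mult_exp_exp)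
    also have "\<dots> \<le> exp (2 * d * (\<bar>\<omega>\<bar> + ?y)) * (2 / d\<^sup>2) * h\<^sup>2"
      using u d by (intro mult_right_mono) auto
    finally have 1: "cmod (exp (of_real h * z) - 1 - of_real h * z) \<le> exp (2 * d * (\<bar>\<omega>\<bar> + ?y)) * (2 / d\<^sup>2) * h\<^sup>2" .
    have "t / 2 * Re z \<le> t / 2 * (\<omega> + 2 * 1 - decay * ?y)" using c(3) t by (intro mult_left_mono) auto
    then have 2: "cmod (exp (of_real (t/2) * z)) \<le> exp (t / 2 * (\<omega> + 2) - 2 * d * ?y)"
      by (simp add: d_def algebra_simps)
    have 3: "norm (R z x) \<le> M * norm x" using R_bound[OF z zero_less_one, of x] by simp
    have "norm (F h z) = cmod (exp (of_real (t/2) * z)) * cmod (exp (of_real h * z) - 1 - of_real h * z) * norm (R z x)"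
      by (simp add: F_def norm_scaleC norm_mult)
    also have "\<dots> \<le> exp (t / 2 * (\<omega> + 2) - 2 * d * ?y) * (exp (2 * d * (\<bar>\<omega>\<bar> + ?y)) * (2 / d\<^sup>2) * h\<^sup>2) * (M * norm x)"
      by (intro mult_mono 1 2 3) (auto intro!: mult_nonneg_nonneg)
    also have "\<dots> = (exp (t / 2 * (\<omega> + 2) - 2 * d * ?y) * exp (2 * d * (\<bar>\<omega>\<bar> + ?y))) * (2 / d\<^sup>2) * (M * norm x) * h\<^sup>2"
      by (simp only: mult_ac)
    also have "exp (t / 2 * (\<omega> + 2) - 2 * d * ?y) * exp (2 * d * (\<bar>\<omega>\<bar> + ?y)) = exp (t / 2 * (\<omega> + 2)) * exp (2 * d * \<bar>\<omega>\<bar>)"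
      by (simp add: mult_exp_exp algebra_simps)
    finally show ?thesis by (simp add: B_def)
  qed
  have Fc: "continuous_on (sector \<omega> \<theta>) (F h)" for h
    unfolding F_def by (intro continuous_intros R_cont)
  define C where "C = exp (t/2 * (\<omega> + 2 * 1)) * (2 / (decay * (t/2)) + 2 * \<eta> * 1)"
  show ?thesis
  proof (rule has_vector_derivative_quadratic[OF d(1), where C="B * C"])
    fix h :: real assume h: "\<bar>h\<bar> < d"
    then have th: "t + h > 0" using d t by linarith
    have "cint \<omega> 1 \<eta> (\<lambda>z. exp (of_real (t/2) * z) *\<^sub>C F h z) =
      cint \<omega> 1 \<eta> (\<lambda>z. exp (of_real (t + h) * z) *\<^sub>C R z x - exp (of_real t * z) *\<^sub>C R z x - of_real h *\<^sub>C (exp (of_real t * z) *\<^sub>C (z *\<^sub>C R z x)))"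
    proof (rule cint_cong_sector(1))
      fix z :: complex
      have "exp (of_real (t/2) * z) * (exp (of_real (t/2) * z) * (exp (of_real h * z) - 1 - of_real h * z))
        = exp (of_real (t + h) * z) - exp (of_real t * z) - of_real h * exp (of_real t * z) * z"
      proof -
        have "exp (of_real (t/2) * z) * exp (of_real (t/2) * z) = exp (of_real t * z)"
          unfolding mult_exp_exp by (rule arg_cong[where f=exp]) (simp add: field_simps)
        moreover have "exp (of_real (t + h) * z) = exp (of_real t * z) * exp (of_real h * z)"
          by (simp add: exp_add[symmetric] algebra_simps)
        moreover have "p * (p * (e - 1 - w * z)) = (p * p) * e - p * p - w * (p * p) * z" for p e w z :: complex
          by (simp add: algebra_simps)
        ultimately show ?thesis by (simp only:)
      qed
      then show "exp (of_real (t/2) * z) *\<^sub>C F h z = exp (of_real (t + h) * z) *\<^sub>C R z x - exp (of_real t * z) *\<^sub>C R z x - of_real h *\<^sub>C (exp (of_real t * z) *\<^sub>C (z *\<^sub>C R z x))"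
        by (simp add: F_def scaleC_scaleC scaleC.diff_left mult.assoc)
    qed simp
    also have "\<dots> = cint \<omega> 1 \<eta> (\<lambda>z. exp (of_real (t + h) * z) *\<^sub>C R z x) - cint \<omega> 1 \<eta> (\<lambda>z. exp (of_real t * z) *\<^sub>C R z x)
        - of_real h *\<^sub>C cint \<omega> 1 \<eta> (\<lambda>z. exp (of_real t * z) *\<^sub>C (z *\<^sub>C R z x))"
      using R_integrable[OF th, of 1 x] R_integrable[OF t, of 1 x] zR_integrable[OF t, of x]
        cint_clinear[OF clinear_scaleC_left zR_integrable[OF t, of x], of "of_real h"]
      by (simp add: cint_diff)
    finally have "S (t + h) x - S t x - h *\<^sub>R A (S t x) = cI *\<^sub>C cint \<omega> 1 \<eta> (\<lambda>z. exp (of_real (t/2) * z) *\<^sub>C F h z)"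
      unfolding AS(2)[OF t, of x] AS_def unfolding S_cint[OF t zero_less_one, of x] S_cint[OF th zero_less_one, of x]
      by (simp add: scaleC.diff_right scaleC_of_real scaleC_scaleR)
    also have "norm \<dots> \<le> B * h\<^sup>2 * exp (t/2 * (\<omega> + 2 * 1)) * (2 / (decay * (t/2)) + 2 * \<eta> * 1)"
      by (rule order_trans[OF norm_cI exp_cint(2)[OF _ _ Fc FB]]) (use t h in auto)
    finally show "norm (S (t + h) x - S t x - h *\<^sub>R A (S t x)) \<le> B * C * h\<^sup>2"
      by (simp add: C_def mult_ac)
  qed
qed

text \<open>For x in \<open>D\<close>, R(z) x = x / (z - \<omega>) + R(z) w / (z - \<omega>) with w
  = A x - \<omega> x. The first term integrates to exp (t \<omega>) x, the second contributes O(t)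
  on the contour of radius 1/t.\<close>

lemma S_tendsto:
  assumes x: "x \<in> D"
  shows "((\<lambda>t. S t x) \<longlongrightarrow> x) (at_right 0)"
proof -
  let ?w = "A x - of_real \<omega> *\<^sub>C x"
  have b: "norm (S t x - exp (t * \<omega>) *\<^sub>R x) \<le> growth 1 * norm ?w * t" if t: "0 < t" "t \<le> 1" for t
  proof -
    have t1: "1 / t > 0" using t by simp
    define F where "F z = (1 / (z - of_real \<omega>)) *\<^sub>C R z ?w" for z
    have cF: "continuous_on (sector \<omega> \<theta>) F"
      unfolding F_def by (intro continuous_intros R_cont) (auto simp: sector_def)
    have FB: "norm (F z) \<le> t * M * (t * norm ?w)" if z: "z \<in> contour (1 / t)" for z
    proof -
      have "norm (1 / (z - of_real \<omega>)) \<le> t"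
      proof -
        have "0 < cmod (z - of_real \<omega>)" using contour(2)[OF z t1] t1 by linarith
        then show ?thesis using contour(2)[OF z t1] t by (simp add: norm_divide field_simps)
      qed
      then have "norm (F z) \<le> t * (M / (1 / t) * norm ?w)"
        unfolding F_def norm_scaleC using t by (intro mult_mono R_bound z) auto
      then show ?thesis by (simp add: mult_ac)
    qed
    have iF: "cintegrable \<omega> (1/t) \<eta> (\<lambda>z. exp (of_real t * z) *\<^sub>C F z)"
      by (rule exp_cint(1)[OF t(1) t1 cF FB])
    note i1 = cint_clinear[OF clinear_scaleC_vec[of x] cint_exp_inverse(2)[OF t(1) t1]]
    have "cint \<omega> (1/t) \<eta> (\<lambda>z. exp (of_real t * z) *\<^sub>C R z x)
        = cint \<omega> (1/t) \<eta> (\<lambda>z. (exp (of_real t * z) *\<^sub>C (1 / (z - of_real \<omega>))) *\<^sub>C x + exp (of_real t * z) *\<^sub>C F z)"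
    proof (rule cint_cong_sector(1)[OF _ t1])
      fix z assume z: "z \<in> sector \<omega> \<theta>"
      have z0: "z - of_real \<omega> \<noteq> 0" using z by (auto simp: sector_def)
      have "z *\<^sub>C R z x = x + R z (A x)" using A_R_commute[OF z x] A_R[OF z, of x] by (simp add: algebra_simps)
      then have "(z - of_real \<omega>) *\<^sub>C R z x = x + R z ?w"
        by (simp add: scaleC.diff_left R_diff[OF z] R_scaleC[OF z])
      then have "(1 / (z - of_real \<omega>)) *\<^sub>C (z - of_real \<omega>) *\<^sub>C R z x = (1 / (z - of_real \<omega>)) *\<^sub>C (x + R z ?w)" by simp
      then have "R z x = (1 / (z - of_real \<omega>)) *\<^sub>C x + F z"
        using z0 by (simp add: scaleC_scaleC F_def scaleC_add_right)
      then show "exp (of_real t * z) *\<^sub>C R z x = (exp (of_real t * z) *\<^sub>C (1 / (z - of_real \<omega>))) *\<^sub>C x + exp (of_real t * z) *\<^sub>C F z"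
        by (simp add: scaleC_add_right scaleC_scaleC scaleC_complex_def)
    qed
    also have "\<dots> = (2 * of_real pi * \<i> * exp (of_real (t * \<omega>))) *\<^sub>C x + cint \<omega> (1/t) \<eta> (\<lambda>z. exp (of_real t * z) *\<^sub>C F z)"
      by (simp add: cint_add(1)[OF i1(2) iF] i1(1) cint_exp_inverse(1)[OF t(1) t1])
    finally have "S t x = cI *\<^sub>C (2 * of_real pi * \<i> * exp (of_real (t * \<omega>))) *\<^sub>C x + cI *\<^sub>C cint \<omega> (1/t) \<eta> (\<lambda>z. exp (of_real t * z) *\<^sub>C F z)"
      by (simp only: S_cint[OF t(1) t1] scaleC_add_right)
    also have "cI *\<^sub>C (2 * of_real pi * \<i> * exp (of_real (t * \<omega>))) *\<^sub>C x = exp (t * \<omega>) *\<^sub>R x"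
    proof -
      have "exp (complex_of_real (t * \<omega>)) = of_real (exp (t * \<omega>))" by (simp only: exp_of_real)
      then have "cI *\<^sub>C (2 * of_real pi * \<i> * exp (of_real (t * \<omega>))) *\<^sub>C x = of_real (exp (t * \<omega>)) *\<^sub>C x"
        by (simp add: scaleC_scaleC del: of_real_mult)
      then show ?thesis by (simp only: scaleC_of_real)
    qed
    finally have "S t x - exp (t * \<omega>) *\<^sub>R x = cI *\<^sub>C cint \<omega> (1/t) \<eta> (\<lambda>z. exp (of_real t * z) *\<^sub>C F z)" by simp
    then show ?thesis using S_radius_bound[OF t cF FB] by (simp add: mult_ac)
  qed
  have "((\<lambda>t. growth 1 * norm ?w * t) \<longlongrightarrow> growth 1 * norm ?w * 0) (at_right 0)" by (intro tendsto_intros)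
  then have l: "((\<lambda>t. growth 1 * norm ?w * t) \<longlongrightarrow> 0) (at_right 0)" by simp
  have "((\<lambda>t. S t x - exp (t * \<omega>) *\<^sub>R x) \<longlongrightarrow> 0) (at_right 0)"
  proof (rule Lim_null_comparison[OF _ l])
    show "\<forall>\<^sub>F t in at_right 0. norm (S t x - exp (t * \<omega>) *\<^sub>R x) \<le> growth 1 * norm ?w * t"
      using b unfolding eventually_at_right_field by (intro exI[of _ 1]) auto
  qed
  moreover have "((\<lambda>t. exp (t * \<omega>) *\<^sub>R x) \<longlongrightarrow> exp (0 * \<omega>) *\<^sub>R x) (at_right 0)" by (intro tendsto_intros)
  ultimately have "((\<lambda>t. (S t x - exp (t * \<omega>) *\<^sub>R x) + exp (t * \<omega>) *\<^sub>R x) \<longlongrightarrow> 0 + exp (0 * \<omega>) *\<^sub>R x) (at_right 0)"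
    by (rule tendsto_add)
  then show ?thesis by simp
qed

end

text \<open>These properties are used both for \<open>A\<close> in X and for its part in X_\<alpha>.
  The last one, surjectivity of z - A for a single z, serves to reach every vector from
  \<open>D\<close>, which need not be dense.\<close>

locale analytic_sg =
  fixes D :: "'a::complex_banach set" and A :: "'a \<Rightarrow> 'a" and T :: "real \<Rightarrow> 'a \<Rightarrow> 'a"
  assumes lin: "complex_linear_on D A"
    and T_0: "T 0 x = x"
    and T_clinear: "0 \<le> t \<Longrightarrow> clinear (T t)"
    and T_bound: "\<exists>C. \<forall>t x. 0 \<le> t \<longrightarrow> t \<le> t0 \<longrightarrow> norm (T t x) \<le> C * norm x"
    and T_D: "0 < t \<Longrightarrow> T t x \<in> D"
    and AT_bound: "\<exists>C. \<forall>t x. 0 < t \<longrightarrow> t \<le> t0 \<longrightarrow> norm (A (T t x)) \<le> C / t * norm x"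
    and T_deriv: "0 < t \<Longrightarrow> ((\<lambda>t. T t x) has_vector_derivative A (T t x)) (at t)"
    and T_A: "0 < t \<Longrightarrow> x \<in> D \<Longrightarrow> A (T t x) = T t (A x)"
    and T_lim: "x \<in> D \<Longrightarrow> ((\<lambda>t. T t x) \<longlongrightarrow> x) (at_right 0)"
    and surj: "\<exists>z. \<forall>y. \<exists>v\<in>D. z *\<^sub>C v - A v = y"

lemma (in sectorial_contour) analytic_sg:
  "analytic_sg D A (\<lambda>t x. if t = 0 then x else S t x)"
proof
  show "complex_linear_on D A" by (rule lin)
  show "clinear (\<lambda>x. if t = 0 then x else S t x)" if "0 \<le> t" for t
    using S_clinear[of t] that by (cases "t = 0") (auto simp: clinear_def bounded_linear_ident)
  show "\<exists>C. \<forall>t x. 0 \<le> t \<longrightarrow> t \<le> t0 \<longrightarrow> norm (if t = 0 then x else S t x) \<le> C * norm x" for t0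
  proof (intro exI[of _ "max 1 (growth t0)"] allI impI)
    fix t and x :: 'a assume t: "0 \<le> t" "t \<le> t0"
    have "norm (S t x) \<le> growth t0 * norm x" if "t \<noteq> 0" using S_bound t that by simp
    moreover have "1 * norm x \<le> max 1 (growth t0) * norm x" "growth t0 * norm x \<le> max 1 (growth t0) * norm x"
      by (intro mult_right_mono; simp)+
    ultimately show "norm (if t = 0 then x else S t x) \<le> max 1 (growth t0) * norm x" by (smt (verit))
  qed
  show "(if t = 0 then x else S t x) \<in> D" if "0 < t" for t x using that AS(1) by simp
  show "\<exists>C. \<forall>t x. 0 < t \<longrightarrow> t \<le> t0 \<longrightarrow> norm (A (if t = 0 then x else S t x)) \<le> C / t * norm x" for t0
    using AS(2) AS_bound by (intro exI) (auto, blast)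
  show "((\<lambda>t. if t = 0 then x else S t x) has_vector_derivative A (if t = 0 then x else S t x)) (at t)" if "0 < t" for t x
    by (rule has_vector_derivative_transform_within_open[where S="{0<..}" and f="\<lambda>t. S t x"])
       (use that S_deriv in auto)
  show "A (if t = 0 then x else S t x) = (if t = 0 then A x else S t (A x))" if "0 < t" "x \<in> D" for t x
    using that AS_D by simp
  show "((\<lambda>t. if t = 0 then x else S t x) \<longlongrightarrow> x) (at_right 0)" if "x \<in> D" for x
    by (rule Lim_transform_eventually[OF S_tendsto[OF that]]) (simp add: eventually_at_filter)
  have l: "ray \<omega> 0 1 \<in> sector \<omega> \<theta>" using \<eta>_pos by (intro ray_sector) auto
  show "\<exists>z. \<forall>y. \<exists>v\<in>D. z *\<^sub>C v - A v = y"
    using R_in[OF l] R_eq[OF l] by blast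
qed simp

text \<open>An admissible contour exists, so the choice operator returns one, and the axioms have
  been proved for each of them.\<close>

lemma sectorial_analytic_sg:
  assumes "sectorial D A"
  shows "analytic_sg D A (analytic_semigroup D A)"
proof -
  obtain \<omega> \<theta> M where s: "sectorial_with D A \<omega> \<theta> M" using assms by (auto simp: sectorial_def)
  then have "pi / 2 < \<theta>" by (simp add: sectorial_with_def)
  then obtain \<eta> where "pi / 2 < \<eta>" "\<eta> < \<theta>" using dense by blast
  then have "\<exists>p. case p of (\<omega>, r, \<eta>) \<Rightarrow> admissible_contour D A \<omega> r \<eta>"
    using s by (intro exI[of _ "(\<omega>, 1, \<eta>)"]) (auto simp: admissible_contour_def)
  from someI_ex[OF this] obtain \<omega> r \<eta> where
    *: "(SOME (\<omega>, r, \<eta>). admissible_contour D A \<omega> r \<eta>) = (\<omega>, r, \<eta>)" "admissible_contour D A \<omega> r \<eta>"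
    by (metis (mono_tags, lifting) case_prod_conv prod_cases3)
  then obtain \<theta> M where c: "sectorial_with D A \<omega> \<theta> M" "pi / 2 < \<eta>" "\<eta> < \<theta>" "0 < r"
    by (auto simp: admissible_contour_def)
  interpret sectorial_contour D A \<omega> \<theta> M \<eta> r by standard (use c in auto)
  have "analytic_semigroup D A = (\<lambda>t x. if t = 0 then x else S t x)"
    by (simp add: fun_eq_iff analytic_semigroup_def *(1) S_def)
  then show ?thesis using analytic_sg by simp
qed

section \<open>Uniqueness, semigroup law and continuity from the axioms\<close>

context analytic_sg
begin

lemma T_add: "0 \<le> t \<Longrightarrow> T t (x + y) = T t x + T t y" and T_diff: "0 \<le> t \<Longrightarrow> T t (x - y) = T t x - T t y"
  and T_scaleR: "0 \<le> t \<Longrightarrow> T t (r *\<^sub>R x) = r *\<^sub>R T t x" and T_zero: "0 \<le> t \<Longrightarrow> T t 0 = 0"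
  using bounded_linear.linear[OF clinear_bounded_linear[OF T_clinear], of t]
  by (auto simp: linear_add linear_diff linear_scale linear_0)

lemma T_bl: "0 \<le> t \<Longrightarrow> bounded_linear (T t)"
  by (rule clinear_bounded_linear[OF T_clinear])

definition Tb :: "real \<Rightarrow> real" where
  "Tb t0 = (SOME C. 0 < C \<and> (\<forall>t x. 0 \<le> t \<longrightarrow> t \<le> t0 \<longrightarrow> norm (T t x) \<le> C * norm x))"

lemma Tb: "0 < Tb t0" "0 \<le> t \<Longrightarrow> t \<le> t0 \<Longrightarrow> norm (T t x) \<le> Tb t0 * norm x"
proof -
  obtain C where C: "\<And>t x. 0 \<le> t \<Longrightarrow> t \<le> t0 \<Longrightarrow> norm (T t x) \<le> C * norm x" using T_bound by metis
  have "norm (T t x) \<le> max 1 C * norm x" if "0 \<le> t" "t \<le> t0" for t x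
    by (rule order_trans[OF C[OF that]]) (simp add: mult_right_mono)
  then have "\<exists>C. 0 < C \<and> (\<forall>t x. 0 \<le> t \<longrightarrow> t \<le> t0 \<longrightarrow> norm (T t x) \<le> C * norm x)"
    by (intro exI[of _ "max 1 C"]) auto
  from someI_ex[OF this] show "0 < Tb t0" "0 \<le> t \<Longrightarrow> t \<le> t0 \<Longrightarrow> norm (T t x) \<le> Tb t0 * norm x"
    unfolding Tb_def by blast+
qed

definition ATb :: "real \<Rightarrow> real" where
  "ATb t0 = (SOME C. 0 < C \<and> (\<forall>t x. 0 < t \<longrightarrow> t \<le> t0 \<longrightarrow> norm (A (T t x)) \<le> C / t * norm x))"

lemma ATb: "0 < ATb t0" "0 < t \<Longrightarrow> t \<le> t0 \<Longrightarrow> norm (A (T t x)) \<le> ATb t0 / t * norm x"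
proof -
  obtain C where C: "\<And>t x. 0 < t \<Longrightarrow> t \<le> t0 \<Longrightarrow> norm (A (T t x)) \<le> C / t * norm x" using AT_bound by metis
  have "norm (A (T t x)) \<le> max 1 C / t * norm x" if "0 < t" "t \<le> t0" for t x
    by (rule order_trans[OF C[OF that]]) (use that in \<open>auto intro!: mult_right_mono divide_right_mono\<close>)
  then have "\<exists>C. 0 < C \<and> (\<forall>t x. 0 < t \<longrightarrow> t \<le> t0 \<longrightarrow> norm (A (T t x)) \<le> C / t * norm x)"
    by (intro exI[of _ "max 1 C"]) auto
  from someI_ex[OF this] show "0 < ATb t0" "0 < t \<Longrightarrow> t \<le> t0 \<Longrightarrow> norm (A (T t x)) \<le> ATb t0 / t * norm x"
    unfolding ATb_def by blast+
qed

lemma AT_bl: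
  assumes t: "0 < t"
  shows "bounded_linear (\<lambda>x. A (T t x))"
proof (rule bounded_linear_intro[where K="ATb t / t"])
  show "A (T t (x + y)) = A (T t x) + A (T t y)" for x y
    using t lin T_D[OF t] by (simp add: T_add complex_linear_on_def)
  show "A (T t (r *\<^sub>R x)) = r *\<^sub>R A (T t x)" for r x
  proof -
    have "A (complex_of_real r *\<^sub>C T t x) = complex_of_real r *\<^sub>C A (T t x)"
      using lin T_D[OF t] by (simp add: complex_linear_on_def)
    then show ?thesis using t by (simp add: scaleC_of_real T_scaleR)
  qed
  show "norm (A (T t x)) \<le> norm x * (ATb t / t)" for x
    using ATb(2)[OF t order_refl, of x] by (simp add: mult.commute)
qed

lemma T_cont: "continuous_on {0<..} (\<lambda>t. T t x)"
  by (intro continuous_at_imp_continuous_on ballI has_vector_derivative_continuous[OF T_deriv]) auto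

lemma T_cont_D:
  assumes x: "x \<in> D"
  shows "continuous_on {0..} (\<lambda>t. T t x)"
  unfolding continuous_on_def
proof
  fix t :: real assume "t \<in> {0..}"
  then consider "t = 0" | "t > 0" by fastforce
  then show "((\<lambda>t. T t x) \<longlongrightarrow> T t x) (at t within {0..})"
  proof cases
    case 1
    then show ?thesis using T_lim[OF x] by (simp add: T_0 at_within_Ici_at_right)
  next
    case 2
    show ?thesis
      by (rule tendsto_within_subset[OF has_vector_derivative_continuous[OF T_deriv[OF 2, of x], unfolded continuous_at]]) simp
  qed
qed

text \<open>Split T (p r) (g r) = T (p r) (g r - g s) + T (p r) (g s); the uniform bound handles the
  first term. Continuity of the second is the hypothesis \<open>c\<close> because at time 0 it is
  available on \<open>D\<close> only.\<close>

lemma T_cont_comp0: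
  fixes p :: "'c::metric_space \<Rightarrow> real"
  assumes p: "\<And>s. s \<in> S \<Longrightarrow> 0 \<le> p s" "\<And>s. s \<in> S \<Longrightarrow> p s \<le> t0" and g: "continuous_on S g"
    and c: "\<And>s. s \<in> S \<Longrightarrow> continuous_on S (\<lambda>r. T (p r) (g s))"
  shows "continuous_on S (\<lambda>s. T (p s) (g s))"
  unfolding continuous_on_def
proof
  fix s assume s: "s \<in> S"
  have "((\<lambda>r. Tb t0 * norm (g r - g s)) \<longlongrightarrow> Tb t0 * norm (g s - g s)) (at s within S)"
    using g s by (intro tendsto_intros) (auto simp: continuous_on_def)
  then have l: "((\<lambda>r. Tb t0 * norm (g r - g s)) \<longlongrightarrow> 0) (at s within S)" by simp
  have "((\<lambda>r. T (p r) (g r - g s)) \<longlongrightarrow> 0) (at s within S)"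
    by (rule Lim_null_comparison[OF _ l]) (auto simp: eventually_at_filter intro!: always_eventually Tb(2) p)
  moreover have "((\<lambda>r. T (p r) (g s)) \<longlongrightarrow> T (p s) (g s)) (at s within S)"
    using c[OF s] s by (simp add: continuous_on_def)
  ultimately have "((\<lambda>r. T (p r) (g r - g s) + T (p r) (g s)) \<longlongrightarrow> 0 + T (p s) (g s)) (at s within S)"
    by (rule tendsto_add)
  moreover have "\<forall>\<^sub>F r in at s within S. T (p r) (g r - g s) + T (p r) (g s) = T (p r) (g r)"
    by (auto simp: eventually_at_filter T_diff p intro!: always_eventually)
  ultimately show "((\<lambda>s. T (p s) (g s)) \<longlongrightarrow> T (p s) (g s)) (at s within S)"
    by (auto intro: Lim_transform_eventually)
qed

lemma T_cont_comp:
  fixes p :: "'c::metric_space \<Rightarrow> real"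
  assumes p: "\<And>s. s \<in> S \<Longrightarrow> 0 < p s" "\<And>s. s \<in> S \<Longrightarrow> p s \<le> t0" "continuous_on S p" and g: "continuous_on S g"
  shows "continuous_on S (\<lambda>s. T (p s) (g s))"
proof (rule T_cont_comp0[OF _ p(2) g])
  show "continuous_on S (\<lambda>r. T (p r) (g s))" for s
    by (rule continuous_on_compose2[OF T_cont p(3)]) (use p in auto)
qed (use p in \<open>auto intro: less_imp_le\<close>)

text \<open>\<open>\<sigma> \<mapsto> T (t - \<sigma>) (y \<sigma>)\<close> is constant.\<close>

lemma T_unique:
  assumes t: "0 < t" and y: "continuous_on {0..t} y" "\<And>\<sigma>. \<sigma> \<in> {0..t} \<Longrightarrow> y \<sigma> \<in> D"
    and y': "\<And>\<sigma>. 0 < \<sigma> \<Longrightarrow> \<sigma> < t \<Longrightarrow> (y has_vector_derivative A (y \<sigma>)) (at \<sigma>)"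
  shows "y t = T t (y 0)"
proof -
  define k where "k \<sigma> = T (t - \<sigma>) (y \<sigma>)" for \<sigma>
  have ck: "continuous_on {0..t} k"
    unfolding k_def
  proof (rule T_cont_comp0[of "{0..t}" "\<lambda>\<sigma>. t - \<sigma>" t y, OF _ _ y(1)])
    show "continuous_on {0..t} (\<lambda>r. T (t - r) (y s))" if "s \<in> {0..t}" for s
      by (rule continuous_on_compose2[OF T_cont_D[OF y(2)[OF that]]]) (auto intro!: continuous_intros)
  qed auto
  have dk: "(k has_vector_derivative 0) (at \<sigma>)" if \<sigma>: "\<sigma> \<in> {0<..<t}" for \<sigma>
  proof -
    let ?a = "A (y \<sigma>)"
    \<comment> \<open>With this first-order remainder, T (t - \<tau>) (y \<tau>) splits into three
      summands whose derivatives at \<sigma> are 0, T (t - \<sigma>) A y and - A T (t - \<sigma>) y.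
      The last two cancel, as T commutes with A on \<open>D\<close>; strong differentiability of
      \<open>T\<close> is enough for this.\<close>
    define rem where "rem \<tau> = y \<tau> - y \<sigma> - (\<tau> - \<sigma>) *\<^sub>R ?a" for \<tau>
    have tp: "((\<lambda>\<tau>. T (t - \<tau>) x) has_vector_derivative - A (T (t - \<sigma>) x)) (at \<sigma>)" for x
    proof -
      have "((\<lambda>\<tau>. t - \<tau>) has_vector_derivative - 1) (at \<sigma>)" by (auto intro!: derivative_eq_intros)
      from vector_diff_chain_at[OF this, of "\<lambda>s. T s x" "A (T (t - \<sigma>) x)"] T_deriv[of "t - \<sigma>" x] \<sigma>
      show ?thesis by (simp add: o_def)
    qed
    have d2: "((\<lambda>\<tau>. (\<tau> - \<sigma>) *\<^sub>R T (t - \<tau>) ?a) has_vector_derivative T (t - \<sigma>) ?a) (at \<sigma>)"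
    proof -
      have "((\<lambda>\<tau>. (\<tau> - \<sigma>) *\<^sub>R T (t - \<tau>) ?a) has_vector_derivative
          (\<sigma> - \<sigma>) *\<^sub>R (- A (T (t - \<sigma>) ?a)) + 1 *\<^sub>R T (t - \<sigma>) ?a) (at \<sigma>)"
        by (intro has_vector_derivative_scaleR tp) (auto intro!: derivative_eq_intros)
      then show ?thesis by simp
    qed
    have d1: "((\<lambda>\<tau>. T (t - \<tau>) (rem \<tau>)) has_vector_derivative 0) (at \<sigma>)"
    proof -
      have r: "(rem has_vector_derivative 0) (at \<sigma>)"
        unfolding rem_def using \<sigma> by (auto intro!: derivative_eq_intros y')
      have r0: "rem \<sigma> = 0" by (simp add: rem_def)
      have l: "((\<lambda>\<tau>. norm (rem \<tau>) / norm (\<tau> - \<sigma>)) \<longlongrightarrow> 0) (at \<sigma>)"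
        using r unfolding has_vector_derivative_def has_derivative_iff_norm by (simp add: r0)
      have "((\<lambda>\<tau>. Tb t * (norm (rem \<tau>) / norm (\<tau> - \<sigma>))) \<longlongrightarrow> Tb t * 0) (at \<sigma>)" by (intro tendsto_intros l)
      then have l': "((\<lambda>\<tau>. Tb t * (norm (rem \<tau>) / norm (\<tau> - \<sigma>))) \<longlongrightarrow> 0) (at \<sigma>)" by simp
      have ev: "\<forall>\<^sub>F \<tau> in at \<sigma>. \<tau> \<in> {0<..<t}" using \<sigma> by (intro eventually_at_in_open') auto
      have "((\<lambda>\<tau>. norm (T (t - \<tau>) (rem \<tau>)) / norm (\<tau> - \<sigma>)) \<longlongrightarrow> 0) (at \<sigma>)"
      proof (rule Lim_null_comparison[OF _ l'])
        show "\<forall>\<^sub>F \<tau> in at \<sigma>. norm (norm (T (t - \<tau>) (rem \<tau>)) / norm (\<tau> - \<sigma>)) \<le> Tb t * (norm (rem \<tau>) / norm (\<tau> - \<sigma>))"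
          using ev
        proof eventually_elim
          case (elim \<tau>)
          then have "norm (T (t - \<tau>) (rem \<tau>)) \<le> Tb t * norm (rem \<tau>)" by (intro Tb(2)) auto
          then show ?case using divide_right_mono[of _ _ "norm (\<tau> - \<sigma>)"] by fastforce
        qed
      qed
      then show ?thesis
        unfolding has_vector_derivative_def has_derivative_iff_norm using \<sigma> by (simp add: r0 T_zero)
    qed
    have "((\<lambda>\<tau>. T (t - \<tau>) (rem \<tau>) + (\<tau> - \<sigma>) *\<^sub>R T (t - \<tau>) ?a + T (t - \<tau>) (y \<sigma>))
        has_vector_derivative (0 + T (t - \<sigma>) ?a + - A (T (t - \<sigma>) (y \<sigma>)))) (at \<sigma>)"
      by (intro has_vector_derivative_add d1 d2 tp)
    then have d: "((\<lambda>\<tau>. T (t - \<tau>) (rem \<tau>) + (\<tau> - \<sigma>) *\<^sub>R T (t - \<tau>) ?a + T (t - \<tau>) (y \<sigma>)) has_vector_derivative 0) (at \<sigma>)"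
      using \<sigma> y(2)[of \<sigma>] by (simp add: T_A)
    show ?thesis
    proof (rule has_vector_derivative_transform_within_open[OF d, of "{0<..<t}"])
      fix \<tau> assume "\<tau> \<in> {0<..<t}"
      then have "0 \<le> t - \<tau>" by simp
      then show "T (t - \<tau>) (rem \<tau>) + (\<tau> - \<sigma>) *\<^sub>R T (t - \<tau>) ?a + T (t - \<tau>) (y \<sigma>) = k \<tau>"
        unfolding k_def rem_def by (simp only: T_diff T_scaleR) simp
    qed (use \<sigma> in auto)
  qed
  have "((\<lambda>_. 0) has_integral (k t - k 0)) {0..t}"
    by (rule fundamental_theorem_of_calculus_interior) (use t ck dk in auto)
  then have "k t = k 0" by simp
  then show ?thesis by (simp add: k_def T_0)
qed

text \<open>For s > 0 the curve T (\<sigma> + s) x stays in \<open>D\<close> and is continuous down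
  to \<sigma> = 0, so uniqueness applies to it with initial value T s x.\<close>

lemma T_semigroup:
  assumes "0 \<le> t" "0 \<le> s"
  shows "T (t + s) x = T t (T s x)"
proof -
  consider "t = 0" | "s = 0" | "t > 0" "s > 0" using assms by linarith
  then show ?thesis
  proof cases
    case 3
    have "T (t + s) x = T t (T (0 + s) x)"
    proof (rule T_unique[OF 3(1), where y="\<lambda>\<sigma>. T (\<sigma> + s) x"])
      show "continuous_on {0..t} (\<lambda>\<sigma>. T (\<sigma> + s) x)"
        by (rule continuous_on_compose2[OF T_cont]) (use 3 in \<open>auto intro!: continuous_intros\<close>)
      show "((\<lambda>\<sigma>. T (\<sigma> + s) x) has_vector_derivative A (T (\<sigma> + s) x)) (at \<sigma>)" if "0 < \<sigma>" for \<sigma>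
      proof -
        have "((\<lambda>\<tau>. \<tau> + s) has_vector_derivative 1) (at \<sigma>)" by (auto intro!: derivative_eq_intros)
        from vector_diff_chain_at[OF this, of "\<lambda>s. T s x" "A (T (\<sigma> + s) x)"] T_deriv[of "\<sigma> + s" x] that 3
        show ?thesis by (simp add: o_def)
      qed
    qed (use 3 T_D in auto)
    then show ?thesis by simp
  qed (auto simp: T_0)
qed

text \<open>Near t, A T(s) x = A T(t/2) T(s - t/2) x, a fixed bounded operator applied to a
  continuous curve.\<close>

lemma AT_cont: "continuous_on {0<..} (\<lambda>t. A (T t x))"
  unfolding continuous_on_eq_continuous_at[OF open_greaterThan]
proof
  fix t :: real assume t: "t \<in> {0<..}"
  have "continuous_on {t/2<..} (\<lambda>s. A (T (t/2) (T (s - t/2) x)))"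
    by (rule bounded_linear.continuous_on[OF AT_bl], use t in simp, rule continuous_on_compose2[OF T_cont])
       (auto intro!: continuous_intros)
  then have "continuous_on {t/2<..} (\<lambda>s. A (T s x))"
    by (rule continuous_on_cong[OF refl, THEN iffD1, rotated]) (use T_semigroup[of "t/2" _ x, symmetric] t in auto)
  then show "isCont (\<lambda>t. A (T t x)) t"
    using t by (auto simp: continuous_on_eq_continuous_at[OF open_greaterThan])
qed

text \<open>Mean value inequality; the majorant of A T(s) is largest at the left end s = t.\<close>

lemma T_Lipschitz:
  assumes "0 < t" "0 \<le> h" "t + h \<le> t0"
  shows "norm (T (t + h) x - T t x) \<le> ATb t0 * h / t * norm x"
proof -
  have "norm (T (t + h) x - T t x) \<le> norm (t + h - t) * (ATb t0 / t * norm x)"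
  proof (rule differentiable_bound[of "{t..t+h}" "\<lambda>t. T t x" "\<lambda>s h. h *\<^sub>R A (T s x)" "ATb t0 / t * norm x", THEN order_trans])
    fix s assume s: "s \<in> {t..t+h}"
    then show "((\<lambda>t. T t x) has_derivative (\<lambda>h. h *\<^sub>R A (T s x))) (at s within {t..t+h})"
      using T_deriv[of s x] assms unfolding has_vector_derivative_def by (auto intro: has_derivative_at_withinI)
    have "norm (A (T s x)) \<le> ATb t0 / s * norm x" using s assms by (intro ATb(2)) auto
    also have "\<dots> \<le> ATb t0 / t * norm x" using s assms ATb(1)[of t0] by (intro mult_right_mono divide_left_mono) auto
    finally show "onorm (\<lambda>h. h *\<^sub>R A (T s x)) \<le> ATb t0 / t * norm x"
      by (simp add: onorm_scaleR_left onorm_id bounded_linear_ident)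
  qed (use assms in \<open>auto simp: mult_ac\<close>)
  then show ?thesis using assms by (simp add: mult_ac)
qed

lemma T_integral:
  assumes x: "x \<in> D" and t: "0 \<le> t"
  shows "((\<lambda>s. T s (A x)) has_integral (T t x - x)) {0..t}"
proof -
  have "((\<lambda>s. T s (A x)) has_integral (T t x - T 0 x)) {0..t}"
  proof (rule fundamental_theorem_of_calculus_interior[OF t])
    show "continuous_on {0..t} (\<lambda>s. T s x)" using T_cont_D[OF x] by (rule continuous_on_subset) auto
    show "((\<lambda>s. T s x) has_vector_derivative T s (A x)) (at s)" if "s \<in> {0<..<t}" for s
      using T_deriv[of s x] T_A[of s x] x that by simp
  qed
  then show ?thesis by (simp add: T_0)
qed

end

text \<open>On \<open>E\<close> uniqueness applies to the image of the orbit. The orbit of a general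
  y need not be continuous at time 0, but y = z v - B v for some v in \<open>E\<close>, and each
  semigroup commutes with its generator there.\<close>

lemma analytic_sg_intertwine:
  fixes \<iota> :: "'b::complex_banach \<Rightarrow> 'a::complex_banach"
  assumes X: "analytic_sg D A T" and Y: "analytic_sg E B U" and \<iota>: "clinear \<iota>"
    and ED: "\<And>y. y \<in> E \<Longrightarrow> \<iota> y \<in> D \<and> A (\<iota> y) = \<iota> (B y)" and t: "0 \<le> t"
  shows "\<iota> (U t y) = T t (\<iota> y)"
proof (cases "t = 0")
  case True
  then show ?thesis by (simp add: analytic_sg.T_0[OF X] analytic_sg.T_0[OF Y])
next
  case False
  with t have t: "t > 0" by simp
  interpret X: analytic_sg D A T by (rule X)
  interpret Y: analytic_sg E B U by (rule Y)
  interpret \<iota>: bounded_linear \<iota> by (rule clinear_bounded_linear[OF \<iota>])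
  have D: "\<iota> (U t v) = T t (\<iota> v)" if v: "v \<in> E" for v
  proof -
    have "\<iota> (U t v) = T t (\<iota> (U 0 v))"
    proof (rule X.T_unique[OF t, where y="\<lambda>\<sigma>. \<iota> (U \<sigma> v)"])
      show "continuous_on {0..t} (\<lambda>\<sigma>. \<iota> (U \<sigma> v))"
        by (rule \<iota>.continuous_on, rule continuous_on_subset[OF Y.T_cont_D[OF v]]) auto
      have inE: "U \<sigma> v \<in> E" if "0 \<le> \<sigma>" for \<sigma>
        using Y.T_D[of \<sigma> v] that v by (cases "\<sigma> = 0") (auto simp: Y.T_0)
      show "\<iota> (U \<sigma> v) \<in> D" if "\<sigma> \<in> {0..t}" for \<sigma> using ED inE that by auto
      show "((\<lambda>\<sigma>. \<iota> (U \<sigma> v)) has_vector_derivative A (\<iota> (U \<sigma> v))) (at \<sigma>)" if "0 < \<sigma>" for \<sigma>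
        using \<iota>.has_vector_derivative[OF Y.T_deriv[OF that, of v]] ED[OF inE[of \<sigma>]] that by simp
    qed
    then show ?thesis by (simp add: Y.T_0)
  qed
  obtain z where "\<And>y. \<exists>v\<in>E. z *\<^sub>C v - B v = y" using Y.surj by blast
  then obtain v where v: "v \<in> E" "y = z *\<^sub>C v - B v" by metis
  have "\<iota> (U t y) = z *\<^sub>C \<iota> (U t v) - \<iota> (B (U t v))"
    using t v by (simp add: Y.T_diff clinear_scaleC[OF Y.T_clinear] Y.T_A[OF t v(1)] \<iota>.diff clinear_scaleC[OF \<iota>])
  also have "\<iota> (B (U t v)) = A (\<iota> (U t v))" using ED[OF Y.T_D[OF t, of v]] by simp
  also have "z *\<^sub>C \<iota> (U t v) - A (\<iota> (U t v)) = T t (z *\<^sub>C \<iota> v - A (\<iota> v))"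
    using t ED[OF v(1)] by (simp add: D v X.T_diff clinear_scaleC[OF X.T_clinear] X.T_A)
  also have "\<dots> = T t (\<iota> y)" using ED[OF v(1)] v by (simp add: \<iota>.diff clinear_scaleC[OF \<iota>])
  finally show ?thesis .
qed

section \<open>Interpolation norms\<close>

text \<open>Links the Lebesgue integral in the definition of the norms with the gauge integral: for
  nonnegative functions gauge integrability is absolute, and the endpoints are negligible.\<close>

lemma integrable_lebesgue_on_01_iff:
  fixes w :: "real \<Rightarrow> real"
  assumes w: "\<And>t. 0 \<le> w t"
  shows "integrable (lebesgue_on {0<..<1}) w \<longleftrightarrow> w integrable_on {0..1}"
    "integrable (lebesgue_on {0<..<1}) w \<Longrightarrow> integral\<^sup>L (lebesgue_on {0<..<1}) w = integral {0..1} w"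
proof -
  have *: "w integrable_on {0..1} \<longleftrightarrow> w integrable_on {0<..<1}" "integral {0..1} w = integral {0<..<1} w"
    using integrable_on_open_interval_real[of w 0 1] integral_open_interval_real[of 0 1 w] by simp_all
  show "integrable (lebesgue_on {0<..<1}) w \<longleftrightarrow> w integrable_on {0..1}"
    unfolding * using w nonnegative_absolutely_integrable_1[of w "{0<..<1}"]
    by (auto intro: integrable_on_lebesgue_on absolutely_integrable_imp_integrable)
  show "integral\<^sup>L (lebesgue_on {0<..<1}) w = integral {0..1} w" if "integrable (lebesgue_on {0<..<1}) w"
    unfolding * using that by (intro lebesgue_integral_eq_integral) auto
qed

lemma in_Lp01_1:
  assumes w: "\<And>t. 0 \<le> w t"
  shows "in_Lp01 1 w \<longleftrightarrow> w integrable_on {0..1}" "in_Lp01 1 w \<Longrightarrow> Lp01_norm 1 w = integral {0..1} w"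
proof -
  have p: "\<bar>w t\<bar> powr real_of_ereal 1 = w t" for t using w[of t] by (simp add: one_ereal_def)
  have *: "in_Lp01 1 w \<longleftrightarrow> integrable (lebesgue_on {0<..<1}) w"
    unfolding in_Lp01_def p by (auto simp: borel_measurable_integrable)
  show "in_Lp01 1 w \<longleftrightarrow> w integrable_on {0..1}"
    unfolding * by (rule integrable_lebesgue_on_01_iff[OF w])
  assume "in_Lp01 1 w"
  then have "integral\<^sup>L (lebesgue_on {0<..<1}) w = integral {0..1} w" "w integrable_on {0..1}"
    using * integrable_lebesgue_on_01_iff[OF w] by auto
  moreover have "0 \<le> integral {0..1} w" using calculation(2) w by (intro integral_nonneg) auto
  ultimately show "Lp01_norm 1 w = integral {0..1} w"
    unfolding Lp01_norm_def p by (simp add: one_ereal_def)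
qed

locale sectorial_op =
  fixes D :: "'a::complex_banach set" and A :: "'a \<Rightarrow> 'a"
  assumes sectorial: "sectorial D A"
begin

abbreviation T where "T \<equiv> analytic_semigroup D A"

sublocale analytic_sg D A T by (rule sectorial_analytic_sg[OF sectorial])

definition W :: "real \<Rightarrow> 'a \<Rightarrow> real \<Rightarrow> real" where "W \<beta> x t = t powr (- \<beta>) * norm (A (T t x))"

abbreviation DA where "DA \<beta> \<equiv> DA_space D A \<beta> 1"
abbreviation N where "N \<beta> \<equiv> DA_norm D A \<beta> 1"

lemma DA_weight_W: "DA_weight D A \<beta> 1 x = W \<beta> x"
  by (simp add: fun_eq_iff DA_weight_def W_def one_ereal_def)

lemma W_nonneg: "0 \<le> W \<beta> x t" by (simp add: W_def)

lemma W_cont: "continuous_on {0<..} (W \<beta> x)"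
  unfolding W_def by (intro continuous_intros AT_cont) auto

lemma DA_iff: "\<beta> \<noteq> 0 \<Longrightarrow> x \<in> DA \<beta> \<longleftrightarrow> W \<beta> x integrable_on {0..1}"
  using in_Lp01_1(1)[of "W \<beta> x"] by (simp add: DA_space_def DA_weight_W W_nonneg)

lemma N_eq: "\<beta> \<noteq> 0 \<Longrightarrow> x \<in> DA \<beta> \<Longrightarrow> N \<beta> x = norm x + integral {0..1} (W \<beta> x)"
  using in_Lp01_1(2)[of "W \<beta> x"] in_Lp01_1(1)[of "W \<beta> x"] DA_iff[of \<beta> x] by (simp add: DA_norm_def DA_weight_W W_nonneg)

lemma DA_zero_exp [simp]: "DA 0 = UNIV" "N 0 x = norm x"
  by (simp_all add: DA_space_def DA_norm_def)

lemma norm_le_N: "x \<in> DA \<beta> \<Longrightarrow> norm x \<le> N \<beta> x"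
  using N_eq[of \<beta> x] DA_iff[of \<beta> x] by (cases "\<beta> = 0") (auto intro: integral_nonneg simp: W_nonneg)

lemma N_nonneg: "x \<in> DA \<beta> \<Longrightarrow> 0 \<le> N \<beta> x"
  using norm_le_N[of x \<beta>] norm_ge_zero order_trans by blast

text \<open>The weight is continuous for t > 0, so membership comes down to an integrable majorant
  on (0, 1).\<close>

lemma DA_dominated:
  assumes g: "g integrable_on {0..1}" and b: "\<And>t. 0 < t \<Longrightarrow> t < 1 \<Longrightarrow> W \<beta> x t \<le> g t" and \<beta>: "\<beta> \<noteq> 0"
  shows "x \<in> DA \<beta>" "N \<beta> x \<le> norm x + integral {0..1} g"
proof -
  have "W \<beta> x integrable_on {0..1}"
    by (rule integrable_dominated_interval[OF continuous_on_subset[OF W_cont] g]) (use b W_nonneg in auto)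
  then show x: "x \<in> DA \<beta>" by (simp add: DA_iff \<beta>)
  have "integral {0<..<1} (W \<beta> x) \<le> integral {0<..<1} g"
    by (rule integral_le) (use b g \<open>W \<beta> x integrable_on {0..1}\<close> in \<open>auto simp: integrable_on_open_interval_real\<close>)
  then show "N \<beta> x \<le> norm x + integral {0..1} g" by (simp add: N_eq[OF \<beta> x] integral_open_interval_real)
qed

lemma DA_N_add:
  assumes "x \<in> DA \<beta>" "y \<in> DA \<beta>"
  shows "x + y \<in> DA \<beta>" "N \<beta> (x + y) \<le> N \<beta> x + N \<beta> y"
proof -
  have "x + y \<in> DA \<beta> \<and> N \<beta> (x + y) \<le> N \<beta> x + N \<beta> y"
  proof (cases "\<beta> = 0")
    case True then show ?thesis by (simp add: norm_triangle_ineq)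
  next
    case False
    note i = assms[unfolded DA_iff[OF False]]
    have "W \<beta> (x + y) t \<le> W \<beta> x t + W \<beta> y t" if "0 < t" for t
      using norm_triangle_ineq[of "A (T t x)" "A (T t y)"] linear_add[OF bounded_linear.linear[OF AT_bl[OF that]], of x y]
      by (simp add: W_def distrib_left[symmetric] mult_left_mono)
    from DA_dominated[OF integrable_add[OF i] this False]
    show ?thesis using norm_triangle_ineq[of x y]
      by (simp add: N_eq[OF False assms(1)] N_eq[OF False assms(2)] Henstock_Kurzweil_Integration.integral_add[OF i])
  qed
  then show "x + y \<in> DA \<beta>" "N \<beta> (x + y) \<le> N \<beta> x + N \<beta> y" by auto
qed

lemma A_T_scaleC: "0 < t \<Longrightarrow> A (T t (z *\<^sub>C x)) = z *\<^sub>C A (T t x)"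
  using lin T_D[of t x] clinear_scaleC[OF T_clinear, of t z x] by (simp add: complex_linear_on_def)

lemma DA_N_scaleC:
  assumes "x \<in> DA \<beta>"
  shows "z *\<^sub>C x \<in> DA \<beta>" "N \<beta> (z *\<^sub>C x) \<le> cmod z * N \<beta> x"
proof -
  have "z *\<^sub>C x \<in> DA \<beta> \<and> N \<beta> (z *\<^sub>C x) \<le> cmod z * N \<beta> x"
  proof (cases "\<beta> = 0")
    case True then show ?thesis by (simp add: norm_scaleC)
  next
    case False
    note i = assms[unfolded DA_iff[OF False]]
    have w: "W \<beta> (z *\<^sub>C x) t \<le> cmod z * W \<beta> x t" if "0 < t" for t
      using that by (simp add: W_def A_T_scaleC norm_scaleC)
    have g: "(\<lambda>t. cmod z * W \<beta> x t) integrable_on {0..1}" using integrable_on_cmult_left[OF i, of "cmod z"] by simp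
    from DA_dominated[OF g w False] show ?thesis
      by (simp add: N_eq[OF False assms(1)] norm_scaleC algebra_simps)
  qed
  then show "z *\<^sub>C x \<in> DA \<beta>" "N \<beta> (z *\<^sub>C x) \<le> cmod z * N \<beta> x" by auto
qed

lemma DA_N_scaleR:
  assumes "x \<in> DA \<beta>"
  shows "r *\<^sub>R x \<in> DA \<beta>" "N \<beta> (r *\<^sub>R x) \<le> \<bar>r\<bar> * N \<beta> x"
  using DA_N_scaleC[OF assms, of "of_real r"] by (simp_all add: scaleC_of_real)

lemma DA_N_zero: "0 \<in> DA \<beta>" "N \<beta> 0 = 0"
proof -
  have "(0::'a) \<in> DA \<beta> \<and> N \<beta> 0 = 0"
  proof (cases "\<beta> = 0")
    case False
    have "W \<beta> 0 t \<le> 0" if "0 < t" for t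
      using linear_0[OF bounded_linear.linear[OF AT_bl[OF that]]] by (simp add: W_def)
    from DA_dominated[OF integrable_0 this False] show ?thesis using N_nonneg by force
  qed auto
  then show "0 \<in> DA \<beta>" "N \<beta> 0 = 0" by auto
qed

lemma DA_N_diff:
  assumes "x \<in> DA \<beta>" "y \<in> DA \<beta>"
  shows "x - y \<in> DA \<beta>" "N \<beta> (x - y) \<le> N \<beta> x + N \<beta> y"
  using DA_N_add[OF assms(1) DA_N_scaleR(1)[OF assms(2), of "-1"]] DA_N_scaleR(2)[OF assms(2), of "-1"] by auto

lemma DA_N_sum:
  assumes "finite I" "\<And>i. i \<in> I \<Longrightarrow> f i \<in> DA \<beta>"
  shows "sum f I \<in> DA \<beta>" "N \<beta> (sum f I) \<le> (\<Sum>i\<in>I. N \<beta> (f i))"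
proof -
  have "sum f I \<in> DA \<beta> \<and> N \<beta> (sum f I) \<le> (\<Sum>i\<in>I. N \<beta> (f i))"
    using assms
  proof (induction I rule: finite_induct)
    case (insert i I)
    then show ?case using DA_N_add[of "f i" \<beta> "sum f I"] by force
  qed (simp add: DA_N_zero)
  then show "sum f I \<in> DA \<beta>" "N \<beta> (sum f I) \<le> (\<Sum>i\<in>I. N \<beta> (f i))" by auto
qed

text \<open>The two bounds on \<open>A T(r) x\<close> balance at \<open>r = h\<close>.\<close>

definition Cbal :: "real \<Rightarrow> real \<Rightarrow> real" where
  "Cbal \<beta> h0 = (if \<beta> = 0 then 1 else h0 powr \<beta> + 2 / (1 - \<beta>) + 1 / \<beta>)"

lemma Cbal_pos: "0 \<le> \<beta> \<Longrightarrow> \<beta> < 1 \<Longrightarrow> 0 < Cbal \<beta> h0"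
  by (auto simp: Cbal_def intro!: add_nonneg_pos)

text \<open>\<open>b1\<close> serves r > h and \<open>b2\<close> serves r \<le> h. A singularity of
  order (1 - \<beta>) / 2 is allowed in \<open>b2\<close> to make room for the logarithm of
  convolutions; with the weight r^(-\<beta>) it remains integrable at 0 and yields 2 / (1 -
  \<beta>), while \<open>b1\<close> yields 1 / \<beta>.\<close>

lemma N_balance:
  assumes \<beta>: "0 \<le> \<beta>" "\<beta> < 1" and h: "0 < h" "h \<le> h0"
    and x: "norm x \<le> K"
    and b1: "\<And>r. 0 < r \<Longrightarrow> r < 1 \<Longrightarrow> norm (A (T r x)) \<le> K / r"
    and b2: "\<And>r. 0 < r \<Longrightarrow> r < 1 \<Longrightarrow> r \<le> h \<Longrightarrow> norm (A (T r x)) \<le> K * h powr ((1 - \<beta>) / 2 - 1) * r powr (- ((1 - \<beta>) / 2))"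
  shows "x \<in> DA \<beta>" "N \<beta> x \<le> Cbal \<beta> h0 * K * h powr (- \<beta>)"
proof -
  have K: "K \<ge> 0" using x norm_ge_zero order_trans by blast
  have "x \<in> DA \<beta> \<and> N \<beta> x \<le> Cbal \<beta> h0 * K * h powr (- \<beta>)"
  proof (cases "\<beta> = 0")
    case True then show ?thesis using x h by (simp add: Cbal_def)
  next
    case False
    then have \<beta>0: "\<beta> > 0" using \<beta> by simp
    define q where "q = (1 - \<beta>) / 2"
    have q: "0 < q" "q + \<beta> < 1" "- (q + \<beta>) + 1 = q" using \<beta> by (auto simp: q_def field_simps)
    define g1 where "g1 r = K * h powr (q - 1) * r powr (- (q + \<beta>))" for r
    define g2 where "g2 r = K * r powr (- \<beta> - 1)" for r
    define g where "g r = (if r \<le> h then g1 r else g2 r)" for r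
    have i1: "(g1 has_integral K * h powr (q - 1) * (h powr q / q)) {0..h}"
      unfolding g1_def
      by (intro has_integral_mult_right has_integral_powr_from_0[of "- (q + \<beta>)" h, unfolded q(3)]) (use q h in auto)
    have i2: "(g2 has_integral K * (h powr (- \<beta>) / \<beta>)) {h..}"
      unfolding g2_def using has_integral_powr_to_inf[of "- \<beta> - 1" h] \<beta>0 h
      by (intro has_integral_mult_right) simp
    have "(g has_integral K * h powr (q - 1) * (h powr q / q)) {0..h}"
      by (rule has_integral_eq[OF _ i1]) (simp add: g_def)
    moreover have "(g has_integral K * (h powr (- \<beta>) / \<beta>)) {h..}"
      by (rule has_integral_spike_finite[OF _ _ i2, of "{h}"]) (auto simp: g_def)
    moreover have "{0..h} \<inter> {h..} = {h}" "{0..h} \<union> {h..} = {0..}" using h by auto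
    ultimately have ig: "(g has_integral (K * h powr (q - 1) * (h powr q / q) + K * (h powr (- \<beta>) / \<beta>))) {0..}"
      using has_integral_Un[of g _ "{0..h}" _ "{h..}"] by simp
    have gi: "g integrable_on {0..1}"
      by (rule integrable_on_subinterval[OF has_integral_integrable[OF ig]]) auto
    have gn: "0 \<le> g r" for r using K by (simp add: g_def g1_def g2_def)
    have "W \<beta> x r \<le> g r" if r: "0 < r" "r < 1" for r
    proof (cases "r \<le> h")
      case True
      have "W \<beta> x r \<le> r powr (- \<beta>) * (K * h powr (q - 1) * r powr (- q))"
        unfolding W_def using b2[OF r True] by (intro mult_left_mono) (auto simp: q_def)
      also have "\<dots> = g1 r" using r by (simp add: g1_def powr_add powr_diff powr_minus field_simps)
      finally show ?thesis using True by (simp add: g_def)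
    next
      case False
      have "W \<beta> x r \<le> r powr (- \<beta>) * (K / r)"
        unfolding W_def using b1[OF r] by (intro mult_left_mono) auto
      also have "\<dots> = g2 r" using r by (simp add: g2_def powr_diff)
      finally show ?thesis using False by (simp add: g_def)
    qed
    note d = DA_dominated[OF gi this False]
    have "integral {0..1} g \<le> integral {0..} g"
      by (rule integral_subset_le) (use gi gn ig in auto)
    also have "\<dots> = K * h powr (- \<beta>) * (1 / q + 1 / \<beta>)"
    proof -
      have "h powr (q - 1) * h powr q = h powr (- \<beta>)"
        unfolding powr_add[symmetric] by (rule arg_cong[where f="\<lambda>e. h powr e"]) (simp add: q_def field_simps)
      then have "K * h powr (q - 1) * (h powr q / q) = K * h powr (- \<beta>) / q" by (metis mult.assoc times_divide_eq_right)
      then show ?thesis using integral_unique[OF ig] by (simp add: field_simps)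
    qed
    finally have I: "integral {0..1} g \<le> K * h powr (- \<beta>) * (1 / q + 1 / \<beta>)" .
    \<comment> \<open>The summand \<open>norm x\<close> carries no power of h; it is absorbed at the
      price of h0^\<beta>.\<close>
    have "h powr \<beta> \<le> h0 powr \<beta>" using h \<beta> by (intro powr_mono2) auto
    then have "1 \<le> h0 powr \<beta> * h powr (- \<beta>)" using h by (simp add: powr_minus field_simps)
    then have "K * 1 \<le> K * (h0 powr \<beta> * h powr (- \<beta>))" using K by (intro mult_left_mono) auto
    then have "norm x \<le> K * h powr (- \<beta>) * h0 powr \<beta>" using x by (simp add: mult_ac)
    then have "norm x + integral {0..1} g \<le> K * h powr (- \<beta>) * (h0 powr \<beta> + (1 / q + 1 / \<beta>))"
      using I by (simp only: distrib_left)
    also have "\<dots> = Cbal \<beta> h0 * K * h powr (- \<beta>)" using False by (simp add: Cbal_def q_def mult_ac add.assoc)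
    finally show ?thesis using d by auto
  qed
  then show "x \<in> DA \<beta>" "N \<beta> x \<le> Cbal \<beta> h0 * K * h powr (- \<beta>)" by auto
qed

lemma powr_balance: "0 < h \<Longrightarrow> 0 < r \<Longrightarrow> (h / r) powr q = h * (h powr (q - 1) * r powr (- q))" for q :: real
  by (simp add: powr_divide powr_minus_divide powr_diff)

text \<open>The norm of A T(r) T(t) x is at most K / (r + t), hence at most K / r and at most K / t.
  The latter, times (t / r)^((1 - \<beta>)/2) \<ge> 1 for r \<le> t, is the second balance bound
  with h = t.\<close>

lemma T_smooth:
  assumes \<beta>: "0 \<le> \<beta>" "\<beta> < 1" and t: "0 < t" "t \<le> t0"
  shows "T t x \<in> DA \<beta>" "N \<beta> (T t x) \<le> Cbal \<beta> t0 * (Tb t0 + ATb (t0 + 1)) * t powr (- \<beta>) * norm x"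
proof -
  define K where "K = (Tb t0 + ATb (t0 + 1)) * norm x"
  have C: "0 < Tb t0" "0 < ATb (t0 + 1)" by (rule Tb(1) ATb(1))+
  have AT: "norm (A (T r (T t x))) \<le> K / (r + t)" if r: "0 < r" "r < 1" for r
  proof -
    have "norm (A (T (r + t) x)) \<le> ATb (t0 + 1) / (r + t) * norm x" using r t by (intro ATb(2)) auto
    also have "\<dots> \<le> (Tb t0 + ATb (t0 + 1)) / (r + t) * norm x"
      using r t C by (intro mult_right_mono divide_right_mono) auto
    finally show ?thesis using r t by (simp add: T_semigroup K_def)
  qed
  have K: "K \<ge> 0" using C by (simp add: K_def)
  have 1: "norm (T t x) \<le> K"
  proof -
    have "norm (T t x) \<le> Tb t0 * norm x" using t by (intro Tb(2)) auto
    also have "\<dots> \<le> K" unfolding K_def using C by (intro mult_right_mono) auto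
    finally show ?thesis .
  qed
  have 2: "norm (A (T r (T t x))) \<le> K / r" if "0 < r" "r < 1" for r
    by (rule order_trans[OF AT[OF that]]) (use that t K in \<open>auto intro!: divide_left_mono\<close>)
  have 3: "norm (A (T r (T t x))) \<le> K * t powr ((1 - \<beta>) / 2 - 1) * r powr (- ((1 - \<beta>) / 2))" if "0 < r" "r < 1" "r \<le> t" for r
  proof -
    have "K / (r + t) \<le> K / t" using that K t by (intro divide_left_mono) auto
    also have "\<dots> = K / t * 1" by simp
    also have "\<dots> \<le> K / t * (t / r) powr ((1 - \<beta>) / 2)"
      using that K \<beta> t by (intro mult_left_mono ge_one_powr_ge_zero) auto
    also have "\<dots> = K * t powr ((1 - \<beta>) / 2 - 1) * r powr (- ((1 - \<beta>) / 2))"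
      unfolding powr_balance[OF t(1) that(1)] using t by simp
    finally show ?thesis using AT[of r] that by linarith
  qed
  show "T t x \<in> DA \<beta>" by (rule N_balance(1)[OF \<beta> t 1 2 3])
  have "N \<beta> (T t x) \<le> Cbal \<beta> t0 * K * t powr (- \<beta>)" by (rule N_balance(2)[OF \<beta> t 1 2 3])
  then show "N \<beta> (T t x) \<le> Cbal \<beta> t0 * (Tb t0 + ATb (t0 + 1)) * t powr (- \<beta>) * norm x"
    by (simp add: K_def mult_ac)
qed

lemma conv_integrable:
  assumes v: "continuous_on {0<..<h} v" and K: "\<And>s. 0 < s \<Longrightarrow> s < h \<Longrightarrow> norm (v s) \<le> K"
  shows "(\<lambda>s. T (h - s) (v s)) integrable_on {0..h}"
proof (rule integrable_dominated_interval)
  show "continuous_on {0<..<h} (\<lambda>s. T (h - s) (v s))"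
    by (rule T_cont_comp[of _ _ h]) (auto intro!: continuous_intros v)
  show "(\<lambda>_. Tb h * K) integrable_on {0..h}" by (rule integrable_const_ivl)
  show "norm (T (h - s) (v s)) \<le> Tb h * K" if "0 < s" "s < h" for s
    by (rule order_trans[OF Tb(2)[of "h - s" h] mult_left_mono[OF K]]) (use that Tb(1)[of h] in auto)
qed

lemma ln_le_powr: "0 < y \<Longrightarrow> 0 < q \<Longrightarrow> ln y \<le> y powr q / (q::real)"
  using ln_le_minus_one[of "y powr q"] by (simp add: ln_powr field_simps)

text \<open>Under A T(r) the integrand is of size K / (r + h - s), with integral K ln (1 + h/r). Up
  to constants this is at most K h / r, and for r \<le> h at most K (h/r)^((1 - \<beta>)/2): the two
  balance bounds, with K h for K.\<close>

lemma conv_smooth: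
  assumes \<beta>: "0 \<le> \<beta>" "\<beta> < 1" and h: "0 < h" "h \<le> h0"
    and v: "continuous_on {0<..<h} v" and K: "\<And>s. 0 < s \<Longrightarrow> s < h \<Longrightarrow> norm (v s) \<le> K"
  defines "y \<equiv> integral {0..h} (\<lambda>s. T (h - s) (v s))"
  shows "y \<in> DA \<beta>" "N \<beta> y \<le> Cbal \<beta> h0 * (Tb h0 + 4 / (1 - \<beta>) * ATb (h0 + 1)) * h powr (1 - \<beta>) * K"
proof -
  have K0: "K \<ge> 0" using order_trans[OF norm_ge_zero K[of "h/2"]] h by simp
  \<comment> \<open>4 / (1 - \<beta>) is 2 / q for q = (1 - \<beta>) / 2: the 1 / q comes from ln y
    \<le> y^q / q, the 2 from (r + h) / r \<le> 2 h / r and 2^q \<le> 2.\<close>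
  define C where "C = Tb h0 + 4 / (1 - \<beta>) * ATb (h0 + 1)"
  have C: "0 < Tb h0" "0 < ATb (h0 + 1)" by (rule Tb(1) ATb(1))+
  have \<beta>4: "1 \<le> 4 / (1 - \<beta>)" using \<beta> by simp
  have C1: "Tb h0 \<le> C" "ATb (h0 + 1) \<le> C" "4 / (1 - \<beta>) * ATb (h0 + 1) \<le> C"
    using C \<beta> mult_right_mono[OF \<beta>4, of "ATb (h0 + 1)"] by (auto simp: C_def)
  have iT: "(\<lambda>s. T (h - s) (v s)) integrable_on {0..h}" by (rule conv_integrable[OF v K])
  have iT': "(\<lambda>s. T (h - s) (v s)) integrable_on {0<..<h}" using iT by (simp add: integrable_on_open_interval_real)
  have y: "y = integral {0<..<h} (\<lambda>s. T (h - s) (v s))" by (simp add: y_def integral_open_interval_real)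
  have 1: "norm y \<le> C * K * h"
  proof -
    have "norm y \<le> integral {0<..<h} (\<lambda>s. C * K)"
      unfolding y
    proof (rule integral_norm_bound_integral[OF iT'])
      show "(\<lambda>s. C * K) integrable_on {0<..<h}" by (simp add: integrable_on_open_interval_real integrable_const_ivl)
      fix s assume s: "s \<in> {0<..<h}"
      have "norm (T (h - s) (v s)) \<le> Tb h0 * norm (v s)" using s h by (intro Tb(2)) auto
      also have "\<dots> \<le> C * K" using C C1 K s by (intro mult_mono) auto
      finally show "norm (T (h - s) (v s)) \<le> C * K" .
    qed
    also have "\<dots> = C * K * h" using h by (subst integral_open_interval_real[symmetric]) simp
    finally show ?thesis .
  qed
  have AT: "norm (A (T r y)) \<le> ATb (h0 + 1) * K * ln ((r + h) / r)" if r: "0 < r" "r < 1" for r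
  proof -
    have e: "A (T r (T (h - s) (v s))) = A (T (r + h - s) (v s))" if "s \<in> {0<..<h}" for s
      using T_semigroup[of r "h - s"] r that by (simp add: algebra_simps)
    have i: "((\<lambda>s. A (T (r + h - s) (v s))) has_integral A (T r y)) {0<..<h}"
      using has_integral_linear[OF integrable_integral[OF iT'] AT_bl[OF r(1)]] e unfolding y[symmetric] o_def
      by (rule has_integral_eq[rotated]) simp
    have g: "((\<lambda>s. ATb (h0 + 1) * K * (1 / (r + h - s))) has_integral ATb (h0 + 1) * K * (ln (r + h) - ln r)) {0..h}"
    proof (rule has_integral_mult_right)
      have "((\<lambda>s. 1 / (r + h - s)) has_integral (- ln (r + h - h) - (- ln (r + h - 0)))) {0..h}"
        using h r by (intro fundamental_theorem_of_calculus)
          (auto intro!: derivative_eq_intros simp flip: has_real_derivative_iff_has_vector_derivative simp: divide_simps)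
      then show "((\<lambda>s. 1 / (r + h - s)) has_integral (ln (r + h) - ln r)) {0..h}" by simp
    qed
    have "norm (A (T r y)) \<le> integral {0<..<h} (\<lambda>s. ATb (h0 + 1) * K * (1 / (r + h - s)))"
      unfolding integral_unique[OF i, symmetric]
    proof (rule integral_norm_bound_integral[OF has_integral_integrable[OF i]])
      show "(\<lambda>s. ATb (h0 + 1) * K * (1 / (r + h - s))) integrable_on {0<..<h}"
        using has_integral_integrable[OF g] by (simp only: integrable_on_open_interval_real)
      fix s assume s: "s \<in> {0<..<h}"
      have "norm (A (T (r + h - s) (v s))) \<le> ATb (h0 + 1) / (r + h - s) * norm (v s)" using r s h by (intro ATb(2)) auto
      also have "\<dots> \<le> ATb (h0 + 1) / (r + h - s) * K" using r s h C K by (intro mult_left_mono) auto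
      finally show "norm (A (T (r + h - s) (v s))) \<le> ATb (h0 + 1) * K * (1 / (r + h - s))" by simp
    qed
    also have "\<dots> = ATb (h0 + 1) * K * (ln (r + h) - ln r)"
      using integral_unique[OF g] by (simp only: integral_open_interval_real)
    finally show ?thesis using r h by (simp add: ln_div)
  qed
  have 2: "norm (A (T r y)) \<le> C * K * h / r" if r: "0 < r" "r < 1" for r
  proof -
    have "ln ((r + h) / r) \<le> h / r" using ln_le_minus_one[of "(r + h) / r"] r h by (simp add: field_simps)
    then have "ATb (h0 + 1) * K * ln ((r + h) / r) \<le> C * K * (h / r)"
      using C C1 K0 r h by (intro mult_mono) auto
    then show ?thesis using AT[OF r] by simp
  qed
  have 3: "norm (A (T r y)) \<le> C * K * h * h powr ((1 - \<beta>) / 2 - 1) * r powr (- ((1 - \<beta>) / 2))" if r: "0 < r" "r < 1" "r \<le> h" for r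
  proof -
    let ?q = "(1 - \<beta>) / 2"
    have q: "0 < ?q" "?q \<le> 1" using \<beta> by auto
    have "ln ((r + h) / r) \<le> ((r + h) / r) powr ?q / ?q" using r h q by (intro ln_le_powr) auto
    also have "((r + h) / r) powr ?q \<le> (2 * (h / r)) powr ?q" using r q by (intro powr_mono2) (auto simp: field_simps)
    also have "(2 * (h / r)) powr ?q = 2 powr ?q * (h / r) powr ?q" by (rule powr_mult; use r h in simp)
    also have "2 powr ?q \<le> 2 powr (1::real)" using q by (intro powr_mono) auto
    finally have "ln ((r + h) / r) \<le> 2 * (h / r) powr ?q / ?q" using q
      by (simp add: divide_right_mono mult_right_mono)
    also have "\<dots> = 4 / (1 - \<beta>) * (h / r) powr ?q" using \<beta> by (simp add: field_simps)
    finally have l: "ln ((r + h) / r) \<le> 4 / (1 - \<beta>) * (h / r) powr ?q" .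
    have "ATb (h0 + 1) * K * ln ((r + h) / r) \<le> ATb (h0 + 1) * K * (4 / (1 - \<beta>) * (h / r) powr ?q)"
      using C K0 by (intro mult_left_mono l) auto
    also have "\<dots> = (4 / (1 - \<beta>) * ATb (h0 + 1)) * (K * (h / r) powr ?q)" by simp
    also have "\<dots> \<le> C * (K * (h / r) powr ?q)" using C1 K0 by (intro mult_right_mono) auto
    also have "\<dots> = C * K * h * h powr (?q - 1) * r powr (- ?q)"
      unfolding powr_balance[OF h(1) r(1)] by simp
    finally show ?thesis using AT[of r] r by linarith
  qed
  show "y \<in> DA \<beta>" by (rule N_balance(1)[OF \<beta> h 1 2 3])
  have "N \<beta> y \<le> Cbal \<beta> h0 * (C * K * h) * h powr (- \<beta>)" by (rule N_balance(2)[OF \<beta> h 1 2 3])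
  also have "\<dots> = Cbal \<beta> h0 * C * h powr (1 - \<beta>) * K" using h by (simp add: powr_diff powr_minus field_simps)
  finally show "N \<beta> y \<le> Cbal \<beta> h0 * (Tb h0 + 4 / (1 - \<beta>) * ATb (h0 + 1)) * h powr (1 - \<beta>) * K"
    by (simp add: C_def)
qed

end

section \<open>The functions \<open>\<phi>\<^sub>k\<close>\<close>

lemma phi_has_integral:
  assumes "0 < k"
  shows "((\<lambda>\<xi>. exp (of_real (1 - \<xi>) * z) * of_real (\<xi> ^ (k - 1) / fact (k - 1))) has_integral phi k z) {0..1}"
proof -
  have "k \<noteq> 0" using assms by simp
  then show ?thesis
    by (simp only: phi_def if_False) (rule integrable_integral, rule integrable_continuous_real, (intro continuous_intros; simp))
qed

text \<open>Integration by parts: integrate the derivative of - exp ((1 - \<xi>) z) \<xi>^k / k!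
  over [0, 1]. For k = 0 the monomial is constant, and \<open>phi 0\<close> appears as a boundary
  term instead.\<close>

lemma phi_Suc: "z * phi (Suc k) z = phi k z - 1 / fact k"
proof -
  let ?g = "\<lambda>n \<xi>. exp (of_real (1 - \<xi>) * z) * of_real (\<xi> ^ n / fact n) :: complex"
  have d: "((\<lambda>\<xi>. - ?g k \<xi>) has_vector_derivative z * ?g k \<xi> - (if k = 0 then 0 else ?g (k - 1) \<xi>)) (at \<xi> within {0..1})" for \<xi>
  proof -
    have e: "((\<lambda>\<xi>. exp (of_real (1 - \<xi>) * z)) has_vector_derivative - z * exp (of_real (1 - \<xi>) * z)) (at \<xi> within {0..1})"
    proof -
      have "((\<lambda>w. exp ((1 - w) * z)) has_field_derivative - z * exp ((1 - of_real \<xi>) * z)) (at (of_real \<xi>))"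
        by (auto intro!: derivative_eq_intros)
      from has_vector_derivative_real_field[OF this] show ?thesis by simp
    qed
    have p: "((\<lambda>\<xi>. of_real (\<xi> ^ k / fact k)) has_vector_derivative (of_real (if k = 0 then 0 else \<xi> ^ (k - 1) / fact (k - 1)) :: complex)) (at \<xi> within {0..1})"
    proof -
      have "((\<lambda>\<xi>. \<xi> ^ k / fact k) has_field_derivative (if k = 0 then 0 else \<xi> ^ (k - 1) / fact (k - 1))) (at \<xi> within {0..1})"
      proof (cases k)
        case (Suc n)
        have "real (Suc n) * \<xi> ^ n / fact (Suc n) = \<xi> ^ n / fact n" by (simp add: fact_Suc del: of_nat_Suc)
        moreover have "((\<lambda>\<xi>. \<xi> ^ Suc n / fact (Suc n)) has_field_derivative (real (Suc n) * \<xi> ^ (Suc n - Suc 0) / fact (Suc n))) (at \<xi> within {0..1})"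
          by (intro DERIV_cdivide DERIV_pow)
        ultimately show ?thesis by (simp only: Suc) simp
      qed simp
      then show ?thesis
        by (intro has_vector_derivative_of_real) (simp add: has_real_derivative_iff_has_vector_derivative)
    qed
    show ?thesis
      by (rule has_vector_derivative_eq_rhs, rule has_vector_derivative_minus, rule has_vector_derivative_mult[OF e p])
         (auto simp: algebra_simps)
  qed
  have "((\<lambda>\<xi>. z * ?g k \<xi> - (if k = 0 then 0 else ?g (k - 1) \<xi>)) has_integral (- ?g k 1 - - ?g k 0)) {0..1}"
    by (rule fundamental_theorem_of_calculus) (use d in auto)
  moreover have "((\<lambda>\<xi>. z * ?g k \<xi> - (if k = 0 then 0 else ?g (k - 1) \<xi>)) has_integral (z * phi (Suc k) z - (if k = 0 then 0 else phi k z))) {0..1}"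
  proof -
    have A: "((\<lambda>\<xi>. z * ?g k \<xi>) has_integral z * phi (Suc k) z) {0..1}"
      using has_integral_mult_right[OF phi_has_integral[OF zero_less_Suc[of k], of z], of z] by (simp only: diff_Suc_1)
    show ?thesis
    proof (cases "k = 0")
      case True
      then show ?thesis using A by (simp only: if_True diff_zero simp_thms)
    next
      case False
      then have "0 < k" by simp
      from has_integral_diff[OF A phi_has_integral[OF this, of z]] False show ?thesis by (simp only: if_False simp_thms)
    qed
  qed
  ultimately have e: "- ?g k 1 - - ?g k 0 = z * phi (Suc k) z - (if k = 0 then 0 else phi k z)"
    by (rule has_integral_unique)
  show ?thesis
  proof (cases "k = 0")
    case True
    then show ?thesis using e by (simp add: phi_def[of 0] algebra_simps)
  next
    case False
    then show ?thesis using e by (simp add: algebra_simps power_0_left)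
  qed
qed

text \<open>For large real y, \<open>phi k\<close> grows like exp y / y^k: multiplied by y^k exp (-
  y), the inhomogeneous term of the recursion tends to 0.\<close>

lemma phi_asymp: "((\<lambda>y. of_real (y ^ k * exp (- y)) * phi k (of_real y)) \<longlongrightarrow> 1) at_top"
proof (induction k)
  case 0
  have "of_real (y ^ 0 * exp (- y)) * phi 0 (of_real y) = 1" for y
    by (simp add: phi_def exp_minus flip: exp_of_real)
  then show ?case by simp
next
  case (Suc k)
  have "((\<lambda>y. of_real (y ^ k * exp (- y)) * phi k (of_real y) - complex_of_real (y ^ k / exp y) * (1 / fact k)) \<longlongrightarrow> 1 - of_real 0 * (1 / fact k)) at_top"
    by (intro tendsto_diff tendsto_mult tendsto_const tendsto_of_real tendsto_power_div_exp_0 Suc)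
  moreover have "of_real (y ^ Suc k * exp (- y)) * phi (Suc k) (of_real y) =
     of_real (y ^ k * exp (- y)) * phi k (of_real y) - complex_of_real (y ^ k / exp y) * (1 / fact k)" for y
  proof -
    have "of_real (y ^ Suc k * exp (- y)) * phi (Suc k) (of_real y) = of_real (y ^ k * exp (- y)) * (of_real y * phi (Suc k) (of_real y))"
      by (simp add: mult_ac)
    then show ?thesis unfolding phi_Suc by (simp add: exp_minus field_simps)
  qed
  ultimately show ?case by simp
qed

lemma exp_power_decay:
  assumes "d > 0 \<or> d = 0 \<and> m < n"
  shows "((\<lambda>x::real. exp (- d * x) * x ^ m / x ^ n) \<longlongrightarrow> 0) at_top"
proof (cases "d > 0")
  case True
  have "filterlim (\<lambda>x. d * x) at_top at_top"
    using True by (intro filterlim_tendsto_pos_mult_at_top[OF tendsto_const _ filterlim_ident])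
  from filterlim_compose[OF tendsto_power_div_exp_0[of m] this]
  have "((\<lambda>x. (d * x) ^ m / exp (d * x) / d ^ m) \<longlongrightarrow> 0 / d ^ m) at_top" using True by (intro tendsto_intros) auto
  then have l: "((\<lambda>x. (d * x) ^ m / exp (d * x) / d ^ m) \<longlongrightarrow> 0) at_top" by simp
  show ?thesis
  proof (rule Lim_null_comparison[OF _ l])
    show "\<forall>\<^sub>F x in at_top. norm (exp (- d * x) * x ^ m / x ^ n) \<le> (d * x) ^ m / exp (d * x) / d ^ m"
      using eventually_ge_at_top[of 1]
    proof eventually_elim
      case (elim x)
      have "exp (- d * x) * x ^ m / x ^ n \<le> exp (- d * x) * x ^ m / 1" using elim by (intro divide_left_mono) auto
      then show ?case using elim True by (simp add: power_mult_distrib exp_minus divide_inverse mult_ac)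
    qed
  qed
next
  case False
  then have d: "d = 0" "m < n" using assms by auto
  have l: "((\<lambda>x::real. 1 / x) \<longlongrightarrow> 0) at_top" by real_asymp
  show ?thesis
  proof (rule Lim_null_comparison[OF _ l])
    show "\<forall>\<^sub>F x in at_top. norm (exp (- d * x) * x ^ m / x ^ n) \<le> 1 / x"
      using eventually_ge_at_top[of 1]
    proof eventually_elim
      case (elim x)
      have "x ^ Suc m \<le> x ^ n" using d elim by (intro power_increasing) auto
      then show ?case using elim d by (simp add: field_simps)
    qed
  qed
qed

text \<open>Growth is ordered by \<sigma> first, and for equal \<sigma> by k in reverse. After
  division by the growth rate of the pair (k0, \<sigma>0), every pair of slower growth tends to
  0.\<close>

lemma phi_scaled_asymp:
  assumes \<sigma>: "0 < \<sigma>"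
  shows "((\<lambda>x. of_real (exp (- \<sigma> * x) * x ^ k) * phi k (of_real (\<sigma> * x))) \<longlongrightarrow> 1 / of_real \<sigma> ^ k) at_top"
    and "\<sigma> < \<sigma>0 \<or> \<sigma> = \<sigma>0 \<and> k0 < k \<Longrightarrow> ((\<lambda>x. of_real (exp (- \<sigma>0 * x) * x ^ k0) * phi k (of_real (\<sigma> * x))) \<longlongrightarrow> 0) at_top"
proof -
  have "filterlim (\<lambda>x. \<sigma> * x) at_top at_top"
    using \<sigma> by (intro filterlim_tendsto_pos_mult_at_top[OF tendsto_const _ filterlim_ident])
  from filterlim_compose[OF phi_asymp this, of k]
  have "((\<lambda>x. of_real ((\<sigma> * x) ^ k * exp (- (\<sigma> * x))) * phi k (of_real (\<sigma> * x)) / of_real \<sigma> ^ k) \<longlongrightarrow> 1 / of_real \<sigma> ^ k) at_top"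
    using \<sigma> by (intro tendsto_divide tendsto_const) auto
  moreover have "of_real ((\<sigma> * x) ^ k * exp (- (\<sigma> * x))) * phi k (of_real (\<sigma> * x)) / of_real \<sigma> ^ k
      = of_real (exp (- \<sigma> * x) * x ^ k) * phi k (of_real (\<sigma> * x))" for x
    using \<sigma> by (simp add: power_mult_distrib)
  ultimately show 1: "((\<lambda>x. of_real (exp (- \<sigma> * x) * x ^ k) * phi k (of_real (\<sigma> * x))) \<longlongrightarrow> 1 / of_real \<sigma> ^ k) at_top"
    by simp
  assume a: "\<sigma> < \<sigma>0 \<or> \<sigma> = \<sigma>0 \<and> k0 < k"
  have "((\<lambda>x. exp (- (\<sigma>0 - \<sigma>) * x) * x ^ k0 / x ^ k) \<longlongrightarrow> 0) at_top" using a by (intro exp_power_decay) auto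
  then have "((\<lambda>x. complex_of_real (exp (- (\<sigma>0 - \<sigma>) * x) * x ^ k0 / x ^ k)) \<longlongrightarrow> of_real 0) at_top" by (rule tendsto_of_real)
  from tendsto_mult[OF this 1]
  have "((\<lambda>x. complex_of_real (exp (- (\<sigma>0 - \<sigma>) * x) * x ^ k0 / x ^ k) * (of_real (exp (- \<sigma> * x) * x ^ k) * phi k (of_real (\<sigma> * x)))) \<longlongrightarrow> 0) at_top"
    by simp
  then show "((\<lambda>x. of_real (exp (- \<sigma>0 * x) * x ^ k0) * phi k (of_real (\<sigma> * x))) \<longlongrightarrow> 0) at_top"
  proof (rule Lim_transform_eventually)
    show "\<forall>\<^sub>F x in at_top. complex_of_real (exp (- (\<sigma>0 - \<sigma>) * x) * x ^ k0 / x ^ k) * (of_real (exp (- \<sigma> * x) * x ^ k) * phi k (of_real (\<sigma> * x)))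
      = of_real (exp (- \<sigma>0 * x) * x ^ k0) * phi k (of_real (\<sigma> * x))"
      using eventually_gt_at_top[of 0]
    proof eventually_elim
      case (elim x)
      have "exp (- (\<sigma>0 - \<sigma>) * x) * x ^ k0 / x ^ k * (exp (- \<sigma> * x) * x ^ k) = exp (- (\<sigma>0 - \<sigma>) * x) * exp (- \<sigma> * x) * x ^ k0"
        using elim by simp
      also have "\<dots> = exp (- \<sigma>0 * x) * x ^ k0" by (simp add: mult_exp_exp algebra_simps)
      finally show ?case by (metis mult.assoc of_real_mult)
    qed
  qed
qed

text \<open>The pair with the largest \<sigma> and, among those, the smallest k grows fastest.
  Dividing the relation by its growth rate and letting x tend to infinity isolates its coefficient,
  which must vanish; the pair is removed and the argument repeated.\<close>

lemma phi_independent: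
  assumes "finite P" "\<And>k \<sigma>. (k, \<sigma>) \<in> P \<Longrightarrow> 0 < \<sigma>"
    and "\<And>x. (\<Sum>(k, \<sigma>)\<in>P. c (k, \<sigma>) * phi k (of_real (\<sigma> * x))) = 0"
  shows "\<forall>p\<in>P. c p = 0"
  using assms
proof (induction "card P" arbitrary: P)
  case (Suc n)
  then have ne: "P \<noteq> {}" by auto
  define \<sigma>0 where "\<sigma>0 = Max (snd ` P)"
  define k0 where "k0 = Min {k. (k, \<sigma>0) \<in> P}"
  have "\<sigma>0 \<in> snd ` P" unfolding \<sigma>0_def using Suc.prems(1) ne by (intro Max_in) auto
  moreover have fk: "finite {k. (k, \<sigma>0) \<in> P}"
    by (rule finite_subset[OF _ finite_imageI[OF Suc.prems(1), of fst]]) force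
  ultimately have "k0 \<in> {k. (k, \<sigma>0) \<in> P}" unfolding k0_def by (intro Min_in) force+
  then have p0: "(k0, \<sigma>0) \<in> P" by simp
  have less: "\<sigma> < \<sigma>0 \<or> \<sigma> = \<sigma>0 \<and> k0 < k" if "(k, \<sigma>) \<in> P - {(k0, \<sigma>0)}" for k \<sigma>
  proof -
    have "\<sigma> \<le> \<sigma>0" unfolding \<sigma>0_def using that Suc.prems(1) by (intro Max_ge) force+
    moreover have "k0 \<le> k" if "\<sigma> = \<sigma>0"
      unfolding k0_def using that \<open>(k, \<sigma>) \<in> P - {(k0, \<sigma>0)}\<close> fk by (intro Min_le) auto
    ultimately show ?thesis using that by force
  qed
  let ?g = "\<lambda>x. complex_of_real (exp (- \<sigma>0 * x) * x ^ k0)"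
  let ?F = "\<lambda>p x. case p of (k, \<sigma>) \<Rightarrow> c (k, \<sigma>) * (?g x * phi k (of_real (\<sigma> * x)))"
  have "((\<lambda>x. \<Sum>p\<in>P. ?F p x) \<longlongrightarrow> (\<Sum>p\<in>P. if p = (k0, \<sigma>0) then c p / of_real \<sigma>0 ^ k0 else 0)) at_top"
  proof (rule tendsto_sum)
    fix p assume p: "p \<in> P"
    obtain k \<sigma> where ks: "p = (k, \<sigma>)" by fastforce
    show "(?F p \<longlongrightarrow> (if p = (k0, \<sigma>0) then c p / of_real \<sigma>0 ^ k0 else 0)) at_top"
    proof (cases "p = (k0, \<sigma>0)")
      case True
      then show ?thesis
        using tendsto_mult[OF tendsto_const phi_scaled_asymp(1)[OF Suc.prems(2)[OF p0], of k0], of "c p"] by simp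
    next
      case False
      have "((\<lambda>x. c p * (?g x * phi k (of_real (\<sigma> * x)))) \<longlongrightarrow> c p * 0) at_top"
        by (intro tendsto_mult tendsto_const phi_scaled_asymp(2)[OF Suc.prems(2)[of k \<sigma>] less[of k \<sigma>]]) (use p ks False in auto)
      then show ?thesis unfolding if_not_P[OF False] by (simp only: ks prod.case mult_zero_right)
    qed
  qed
  moreover have "(\<Sum>p\<in>P. ?F p x) = 0" for x
  proof -
    have "(\<Sum>p\<in>P. ?F p x) = ?g x * (\<Sum>(k, \<sigma>)\<in>P. c (k, \<sigma>) * phi k (of_real (\<sigma> * x)))"
      by (simp add: sum_distrib_left split_def mult_ac)
    then show ?thesis by (simp only: Suc.prems(3) mult_zero_right)
  qed
  ultimately have "((\<lambda>x::real. 0) \<longlongrightarrow> c (k0, \<sigma>0) / of_real \<sigma>0 ^ k0) at_top"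
    using p0 Suc.prems(1) by simp
  then have "c (k0, \<sigma>0) / of_real \<sigma>0 ^ k0 = 0"
    using tendsto_unique[OF trivial_limit_at_top_linorder tendsto_const] by metis
  then have c0: "c (k0, \<sigma>0) = 0" using Suc.prems(2)[OF p0] by simp
  have "\<forall>p\<in>P - {(k0, \<sigma>0)}. c p = 0"
  proof (rule Suc.hyps(1))
    show "n = card (P - {(k0, \<sigma>0)})" using Suc.hyps(2) p0 Suc.prems(1) by simp
    show "(\<Sum>(k, \<sigma>)\<in>P - {(k0, \<sigma>0)}. c (k, \<sigma>) * phi k (of_real (\<sigma> * x))) = 0" for x
      using Suc.prems(3)[of x] c0 by (simp add: sum.remove[OF Suc.prems(1) p0])
  qed (use Suc.prems in auto)
  then show ?case using c0 by blast
qed auto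

text \<open>A list may contain the same pair several times, so coefficients are collected before
  independence can apply. \<open>G\<close> is arbitrary so that the same coefficients serve for
  functions and for operators.\<close>

lemma sum_list_group:
  fixes G :: "nat \<Rightarrow> real \<Rightarrow> 'a::complex_banach"
  assumes "finite P" "\<And>w k \<sigma>. (w, k, \<sigma>) \<in> set l \<Longrightarrow> (k, \<sigma>) \<in> P"
  shows "(\<Sum>(w, k, \<sigma>)\<leftarrow>l. w *\<^sub>C G k \<sigma>) =
    (\<Sum>(k, \<sigma>)\<in>P. (\<Sum>(w, k', \<sigma>')\<leftarrow>l. if (k', \<sigma>') = (k, \<sigma>) then w else 0) *\<^sub>C G k \<sigma>)"
  using assms(2)
proof (induction l)
  case Nil
  then show ?case by (simp add: split_def)
next
  case (Cons x l)
  obtain w k \<sigma> where x: "x = (w, k, \<sigma>)" by (cases x)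
  have "w *\<^sub>C G k \<sigma> = (\<Sum>p\<in>P. if p = (k, \<sigma>) then w *\<^sub>C G (fst p) (snd p) else 0)"
    using assms(1) Cons.prems[of w k \<sigma>] x by simp
  also have "\<dots> = (\<Sum>(k', \<sigma>')\<in>P. (if (k, \<sigma>) = (k', \<sigma>') then w else 0) *\<^sub>C G k' \<sigma>')"
    by (intro sum.cong) (auto split: if_splits)
  finally have "w *\<^sub>C G k \<sigma> = \<dots>" .
  moreover note Cons.IH[OF Cons.prems[OF list.set_intros(2)]]
  ultimately show ?case by (simp add: x split_def scaleC_add_left sum.distrib cong: if_cong)
qed

text \<open>By independence all collected coefficients vanish, and then so does the combination of
  any family \<open>G\<close>.\<close>

lemma comb_zero:
  fixes G :: "nat \<Rightarrow> real \<Rightarrow> 'a::complex_banach"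
  assumes pos: "\<And>w k \<sigma>. (w, k, \<sigma>) \<in> set l \<Longrightarrow> 0 < \<sigma>" and z: "\<And>z. comb_fun l z = 0"
  shows "(\<Sum>(w, k, \<sigma>)\<leftarrow>l. w *\<^sub>C G k \<sigma>) = 0"
proof -
  define P where "P = snd ` set l"
  have P: "finite P" "\<And>w k \<sigma>. (w, k, \<sigma>) \<in> set l \<Longrightarrow> (k, \<sigma>) \<in> P" by (force simp: P_def)+
  define c where "c p = (\<Sum>(w, k', \<sigma>')\<leftarrow>l. if (k', \<sigma>') = p then w else 0)" for p
  have "\<forall>p\<in>P. c p = 0"
  proof (rule phi_independent[OF P(1)])
    show "0 < \<sigma>" if "(k, \<sigma>) \<in> P" for k \<sigma> using that pos by (auto simp: P_def)
    show "(\<Sum>(k, \<sigma>)\<in>P. c (k, \<sigma>) * phi k (of_real (\<sigma> * x))) = 0" for x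
      using z[of "of_real x"] sum_list_group[OF P, where G="\<lambda>k \<sigma>. phi k (of_real (\<sigma> * x))"]
      by (simp add: comb_fun_def scaleC_complex_def c_def)
  qed
  then have "(\<Sum>(k, \<sigma>)\<in>P. c (k, \<sigma>) *\<^sub>C G k \<sigma>) = 0" by (intro sum.neutral) auto
  then show ?thesis using sum_list_group[OF P, where G=G] by (simp add: c_def)
qed

text \<open>This carries the order conditions from functions of z to operators, with
  \<open>G\<close> the family of values of \<open>phi_op\<close> at a vector.\<close>

lemma comb_identity:
  fixes G :: "nat \<Rightarrow> real \<Rightarrow> 'a::complex_banach" and I :: "nat set"
  assumes I: "finite I" and pos: "\<And>i w k \<sigma>. i \<in> I \<Longrightarrow> (w, k, \<sigma>) \<in> set (b i) \<Longrightarrow> 0 < \<sigma>"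
    and e: "e = 0 \<or> 0 < \<sigma>'"
    and eq: "\<And>z. (\<Sum>i\<in>I. comb_fun (b i) z * d i) = e * phi m (of_real \<sigma>' * z)"
  shows "(\<Sum>i\<in>I. d i *\<^sub>C (\<Sum>(w, k, \<sigma>)\<leftarrow>b i. w *\<^sub>C G k \<sigma>)) = e *\<^sub>C G m \<sigma>'"
proof -
  \<comment> \<open>The right-hand side joins the list as one more term. It is left out for e = 0,
    where \<sigma>' may be 0: in the stage conditions both are c_i.\<close>
  define l where "l = concat (map (\<lambda>i. map (\<lambda>p. (d i * fst p, snd p)) (b i)) (sorted_list_of_set I)) @
      (if e = 0 then [] else [(- e, m, \<sigma>')])"
  have sc: "(\<Sum>(w, k, \<sigma>)\<leftarrow>map (\<lambda>p. (d i * fst p, snd p)) xs. w *\<^sub>C F k \<sigma>) = d i *\<^sub>C (\<Sum>(w, k, \<sigma>)\<leftarrow>xs. w *\<^sub>C F k \<sigma>)"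
    for i xs and F :: "nat \<Rightarrow> real \<Rightarrow> 'c::complex_banach"
    by (induction xs) (auto simp: scaleC_add_right scaleC_scaleC split_def)
  have cc: "(\<Sum>(w, k, \<sigma>)\<leftarrow>concat (map (\<lambda>i. map (\<lambda>p. (d i * fst p, snd p)) (b i)) is). w *\<^sub>C F k \<sigma>)
      = (\<Sum>i\<leftarrow>is. d i *\<^sub>C (\<Sum>(w, k, \<sigma>)\<leftarrow>b i. w *\<^sub>C F k \<sigma>))"
    for "is" and F :: "nat \<Rightarrow> real \<Rightarrow> 'c::complex_banach"
    by (induction "is") (simp_all add: sc del: map_map)
  have l: "(\<Sum>(w, k, \<sigma>)\<leftarrow>l. w *\<^sub>C F k \<sigma>) = (\<Sum>i\<in>I. d i *\<^sub>C (\<Sum>(w, k, \<sigma>)\<leftarrow>b i. w *\<^sub>C F k \<sigma>)) - e *\<^sub>C F m \<sigma>'"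
    for F :: "nat \<Rightarrow> real \<Rightarrow> 'c::complex_banach"
    unfolding l_def map_append sum_list_append cc
    using I by (simp add: sum_list_distinct_conv_sum_set scaleC.minus_left)
  have "(\<Sum>(w, k, \<sigma>)\<leftarrow>l. w *\<^sub>C G k \<sigma>) = 0"
  proof (rule comb_zero)
    show "0 < \<sigma>" if "(w, k, \<sigma>) \<in> set l" for w k \<sigma>
      using that e pos I by (auto simp: l_def split: if_splits)
    show "comb_fun l z = 0" for z
      using l[of "\<lambda>k \<sigma>. phi k (of_real \<sigma> * z)"] eq[of z] by (simp add: comb_fun_def scaleC_complex_def mult.commute)
  qed
  then show ?thesis using l[of G] by simp
qed

section \<open>The functions phi_k of the operator: smoothing bounds and linearity\<close>

context sectorial_op
begin

lemma norm_weight_le: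
  assumes "0 \<le> \<xi>" "\<xi> \<le> 1"
  shows "norm ((\<xi> ^ n / fact n) *\<^sub>R (x::'b::real_normed_vector)) \<le> norm x"
proof -
  have "\<xi> ^ n \<le> 1" using assms by (intro power_le_one)
  also have "1 \<le> (fact n :: real)" by (rule fact_ge_1)
  finally have "\<xi> ^ n / fact n \<le> 1" by (simp add: divide_le_eq)
  moreover have "0 \<le> \<xi> ^ n / fact n" using assms by simp
  ultimately show ?thesis
    unfolding norm_scaleR abs_of_nonneg[OF \<open>0 \<le> \<xi> ^ n / fact n\<close>] by (intro mult_left_le_one_le) auto
qed

lemma phi_op_has_integral:
  assumes t: "0 < t" and k: "0 < k"
  shows "((\<lambda>\<xi>. (\<xi> ^ (k - 1) / fact (k - 1)) *\<^sub>R T ((1 - \<xi>) * t) x) has_integral phi_op D A k t x) {0..1}"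
proof -
  have "(\<lambda>\<xi>. (\<xi> ^ (k - 1) / fact (k - 1)) *\<^sub>R T ((1 - \<xi>) * t) x) integrable_on {0..1}"
  proof (rule integrable_dominated_interval[where g="\<lambda>_. Tb t * norm x"])
    show "continuous_on {0<..<1} (\<lambda>\<xi>. (\<xi> ^ (k - 1) / fact (k - 1)) *\<^sub>R T ((1 - \<xi>) * t) x)"
      using t by (intro continuous_intros T_cont_comp[of _ _ t]) auto
    fix \<xi> :: real assume \<xi>: "0 < \<xi>" "\<xi> < 1"
    have "norm (T ((1 - \<xi>) * t) x) \<le> Tb t * norm x" using \<xi> t by (intro Tb(2)) auto
    then show "norm ((\<xi> ^ (k - 1) / fact (k - 1)) *\<^sub>R T ((1 - \<xi>) * t) x) \<le> Tb t * norm x"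
      using \<xi> by (intro order_trans[OF norm_weight_le]) auto
  qed (rule integrable_const_ivl)
  then show ?thesis using k by (simp add: phi_op_def integrable_integral)
qed

lemma phi_op_add: "0 < t \<Longrightarrow> phi_op D A k t (x + y) = phi_op D A k t x + phi_op D A k t y"
proof (cases "k = 0")
  case False
  assume t: "0 < t"
  have "((\<lambda>\<xi>. (\<xi> ^ (k - 1) / fact (k - 1)) *\<^sub>R T ((1 - \<xi>) * t) (x + y)) has_integral phi_op D A k t x + phi_op D A k t y) {0..1}"
    by (rule has_integral_eq[OF _ has_integral_add[OF phi_op_has_integral[OF t, of k x] phi_op_has_integral[OF t, of k y]]])
       (use False t in \<open>auto simp: T_add scaleR_add_right\<close>)
  then show ?thesis using has_integral_unique phi_op_has_integral[OF t, of k "x + y"] False by blast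
qed (simp add: phi_op_def T_add)

lemma phi_op_scaleR: "0 < t \<Longrightarrow> phi_op D A k t (r *\<^sub>R x) = r *\<^sub>R phi_op D A k t x"
proof (cases "k = 0")
  case False
  assume t: "0 < t"
  have "((\<lambda>\<xi>. (\<xi> ^ (k - 1) / fact (k - 1)) *\<^sub>R T ((1 - \<xi>) * t) (r *\<^sub>R x)) has_integral r *\<^sub>R phi_op D A k t x) {0..1}"
    by (rule has_integral_eq[OF _ has_integral_cmul[OF phi_op_has_integral[OF t, of k x], of r]])
       (use False t in \<open>auto simp: T_scaleR\<close>)
  then show ?thesis using has_integral_unique phi_op_has_integral[OF t, of k "r *\<^sub>R x"] False by blast
qed (simp add: phi_op_def T_scaleR)

text \<open>The substitution s = t \<xi> turns the defining integral into a convolution, so that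
  \<open>conv_smooth\<close> applies.\<close>

lemma phi_op_conv:
  assumes t: "0 < t" and k: "0 < k"
  shows "t *\<^sub>R phi_op D A k t x = integral {0..t} (\<lambda>s. T (t - s) (((s / t) ^ (k - 1) / fact (k - 1)) *\<^sub>R x))"
proof -
  let ?v = "\<lambda>s. ((s / t) ^ (k - 1) / fact (k - 1)) *\<^sub>R x"
  have "(\<lambda>s. T (t - s) (?v s)) integrable_on {0..t}"
  proof (rule conv_integrable[where K="norm x"])
    show "continuous_on {0<..<t} ?v" using t by (intro continuous_intros) auto
    show "norm (?v s) \<le> norm x" if "0 < s" "s < t" for s
      using that by (intro norm_weight_le) auto
  qed
  then have "((\<lambda>s. T (t - s) (?v s)) has_integral integral {0..t} (\<lambda>s. T (t - s) (?v s))) (cbox 0 t)"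
    by (simp add: integrable_integral)
  from has_integral_affinity'[OF this, of t 0] t
  have "((\<lambda>\<xi>. T (t - t * \<xi>) (?v (t * \<xi>))) has_integral (integral {0..t} (\<lambda>s. T (t - s) (?v s)) /\<^sub>R t)) {0..1}" by simp
  then have "((\<lambda>\<xi>. (\<xi> ^ (k - 1) / fact (k - 1)) *\<^sub>R T ((1 - \<xi>) * t) x) has_integral (integral {0..t} (\<lambda>s. T (t - s) (?v s)) /\<^sub>R t)) {0..1}"
  proof (rule has_integral_eq[rotated])
    fix \<xi> :: real assume "\<xi> \<in> {0..1}"
    then have "0 \<le> (1 - \<xi>) * t" using t by auto
    moreover have "t - t * \<xi> = (1 - \<xi>) * t" by (simp add: algebra_simps)
    ultimately show "T (t - t * \<xi>) (?v (t * \<xi>)) = (\<xi> ^ (k - 1) / fact (k - 1)) *\<^sub>R T ((1 - \<xi>) * t) x"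
      using t by (simp only: T_scaleR) simp
  qed
  from has_integral_unique[OF this phi_op_has_integral[OF t k]] show ?thesis using t by (simp add: field_simps flip: divideR_right)
qed

text \<open>Large enough for \<open>conv_smooth\<close> and \<open>T_smooth\<close> at once, since 4
  / (1 - \<beta>) \<ge> 1.\<close>

definition Cconv :: "real \<Rightarrow> real \<Rightarrow> real" where
  "Cconv \<beta> t0 = Cbal \<beta> t0 * (Tb t0 + 4 / (1 - \<beta>) * ATb (t0 + 1))"

lemma Cconv_pos: "0 \<le> \<beta> \<Longrightarrow> \<beta> < 1 \<Longrightarrow> 0 < Cconv \<beta> t0"
  using Cbal_pos[of \<beta> t0] Tb(1)[of t0] ATb(1)[of "t0 + 1"] by (auto simp: Cconv_def intro!: mult_pos_pos add_pos_pos)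

lemma T_smooth':
  assumes \<beta>: "0 \<le> \<beta>" "\<beta> < 1" and t: "0 < t" "t \<le> t0"
  shows "N \<beta> (T t x) \<le> Cconv \<beta> t0 * t powr (- \<beta>) * norm x"
proof -
  have "1 \<le> 4 / (1 - \<beta>)" using \<beta> by simp
  then have "1 * ATb (t0 + 1) \<le> 4 / (1 - \<beta>) * ATb (t0 + 1)" using ATb(1)[of "t0 + 1"] by (intro mult_right_mono) auto
  then have "Cbal \<beta> t0 * (Tb t0 + ATb (t0 + 1)) \<le> Cconv \<beta> t0"
    unfolding Cconv_def using Cbal_pos[OF \<beta>, of t0] by (intro mult_left_mono) auto
  then have "Cbal \<beta> t0 * (Tb t0 + ATb (t0 + 1)) * (t powr (- \<beta>) * norm x) \<le> Cconv \<beta> t0 * (t powr (- \<beta>) * norm x)"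
    by (intro mult_right_mono) auto
  then show ?thesis using T_smooth(2)[OF \<beta> t, of x] by (simp add: mult.assoc)
qed

text \<open>For k = 0 this is the semigroup. For k > 0, dividing a convolution of length t by t
  turns t^(1 - \<beta>) into t^(-\<beta>).\<close>

lemma phi_op_N:
  assumes \<beta>: "0 \<le> \<beta>" "\<beta> < 1" and t: "0 < t" "t \<le> t0"
  shows "phi_op D A k t x \<in> DA \<beta>" "N \<beta> (phi_op D A k t x) \<le> Cconv \<beta> t0 * t powr (- \<beta>) * norm x"
proof -
  have "phi_op D A k t x \<in> DA \<beta> \<and> N \<beta> (phi_op D A k t x) \<le> Cconv \<beta> t0 * t powr (- \<beta>) * norm x"
  proof (cases "k = 0")
    case True
    then show ?thesis using T_smooth(1)[OF \<beta> t] T_smooth'[OF \<beta> t] by (simp add: phi_op_def)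
  next
    case False
    let ?v = "\<lambda>s. ((s / t) ^ (k - 1) / fact (k - 1)) *\<^sub>R x"
    define y where "y = integral {0..t} (\<lambda>s. T (t - s) (?v s))"
    have v: "continuous_on {0<..<t} ?v" using t by (intro continuous_intros) auto
    have K: "norm (?v s) \<le> norm x" if "0 < s" "s < t" for s
      using that by (intro norm_weight_le) auto
    have y: "y \<in> DA \<beta>" "N \<beta> y \<le> Cconv \<beta> t0 * t powr (1 - \<beta>) * norm x"
      unfolding y_def Cconv_def by (rule conv_smooth[OF \<beta> t v K]; assumption)+
    have p: "phi_op D A k t x = (1 / t) *\<^sub>R y"
      unfolding y_def using phi_op_conv[OF t(1), of k x, symmetric] False t by simp
    have "N \<beta> ((1 / t) *\<^sub>R y) \<le> \<bar>1 / t\<bar> * (Cconv \<beta> t0 * t powr (1 - \<beta>) * norm x)"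
      by (rule order_trans[OF DA_N_scaleR(2)[OF y(1)] mult_left_mono[OF y(2)]]) simp
    also have "\<dots> = Cconv \<beta> t0 * t powr (- \<beta>) * norm x" using t by (simp add: powr_diff powr_minus field_simps)
    finally show ?thesis using DA_N_scaleR(1)[OF y(1)] by (simp add: p)
  qed
  then show "phi_op D A k t x \<in> DA \<beta>" "N \<beta> (phi_op D A k t x) \<le> Cconv \<beta> t0 * t powr (- \<beta>) * norm x" by auto
qed

lemma comb_op_N:
  assumes \<beta>: "0 \<le> \<beta>" "\<beta> < 1" and pos: "\<And>w k \<sigma>. (w, k, \<sigma>) \<in> set l \<Longrightarrow> 0 < \<sigma>"
  shows "\<exists>C\<ge>0. \<forall>t x. 0 < t \<longrightarrow> t \<le> t0 \<longrightarrow> comb_op D A l t x \<in> DA \<beta> \<and> N \<beta> (comb_op D A l t x) \<le> C * t powr (- \<beta>) * norm x"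
  using pos
proof (induction l)
  case Nil
  show ?case by (intro exI[of _ 0]) (simp add: comb_op_def DA_N_zero)
next
  case (Cons p l)
  obtain w k \<sigma> where p: "p = (w, k, \<sigma>)" by (cases p)
  then have \<sigma>: "0 < \<sigma>" using Cons.prems by auto
  obtain C where C: "C \<ge> 0" "\<And>t x. 0 < t \<Longrightarrow> t \<le> t0 \<Longrightarrow> comb_op D A l t x \<in> DA \<beta> \<and> N \<beta> (comb_op D A l t x) \<le> C * t powr (- \<beta>) * norm x"
    using Cons by (metis list.set_intros(2))
  \<comment> \<open>The new term acts at time \<sigma> t \<le> \<sigma> t0, and (\<sigma>
    t)^(-\<beta>) is split so that only the power of t remains outside the constant.\<close>
  let ?C = "C + cmod w * (Cconv \<beta> (\<sigma> * t0) * \<sigma> powr (- \<beta>))"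
  show ?case
  proof (intro exI[of _ ?C] conjI allI impI)
    show "0 \<le> ?C" using C(1) Cconv_pos[OF \<beta>, of "\<sigma> * t0"] by simp
    fix t x assume t: "0 < t" "t \<le> t0"
    have \<sigma>t: "0 < \<sigma> * t" "\<sigma> * t \<le> \<sigma> * t0" using \<sigma> t by auto
    note P = phi_op_N[OF \<beta> \<sigma>t, of k x]
    have e: "comb_op D A (p # l) t x = w *\<^sub>C phi_op D A k (\<sigma> * t) x + comb_op D A l t x" by (simp add: comb_op_def p)
    show "comb_op D A (p # l) t x \<in> DA \<beta>"
      unfolding e by (intro DA_N_add(1) DA_N_scaleC(1) P(1) C(2)[OF t, THEN conjunct1])
    have "N \<beta> (comb_op D A (p # l) t x) \<le> N \<beta> (w *\<^sub>C phi_op D A k (\<sigma> * t) x) + N \<beta> (comb_op D A l t x)"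
      unfolding e by (intro DA_N_add(2) DA_N_scaleC(1) P(1) C(2)[OF t, THEN conjunct1])
    also have "\<dots> \<le> cmod w * (Cconv \<beta> (\<sigma> * t0) * (\<sigma> * t) powr (- \<beta>) * norm x) + C * t powr (- \<beta>) * norm x"
      by (intro add_mono C(2)[OF t, THEN conjunct2] order_trans[OF DA_N_scaleC(2)[OF P(1)]] mult_left_mono P(2)) simp
    also have "\<dots> = ?C * t powr (- \<beta>) * norm x" using \<sigma> t by (simp add: powr_mult algebra_simps)
    finally show "N \<beta> (comb_op D A (p # l) t x) \<le> ?C * t powr (- \<beta>) * norm x" .
  qed
qed

lemma comb_op_linear:
  assumes pos: "\<And>w k \<sigma>. (w, k, \<sigma>) \<in> set l \<Longrightarrow> 0 < \<sigma>" and t: "0 < t"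
  shows "comb_op D A l t (x + y) = comb_op D A l t x + comb_op D A l t y"
    "comb_op D A l t (r *\<^sub>R x) = r *\<^sub>R comb_op D A l t x"
    "comb_op D A l t (x - y) = comb_op D A l t x - comb_op D A l t y"
proof -
  have *: "comb_op D A l t (x + y) = comb_op D A l t x + comb_op D A l t y"
    "comb_op D A l t (r *\<^sub>R x) = r *\<^sub>R comb_op D A l t x" for x y r
  proof -
    have "\<forall>p\<in>set l. 0 < snd (snd p)" using pos by auto
    then show "comb_op D A l t (x + y) = comb_op D A l t x + comb_op D A l t y"
      "comb_op D A l t (r *\<^sub>R x) = r *\<^sub>R comb_op D A l t x"
      by (induction l) (auto simp: comb_op_def split_def phi_op_add phi_op_scaleR t scaleC_add_right scaleC_scaleR scaleR_add_right)
  qed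
  then show "comb_op D A l t (x + y) = comb_op D A l t x + comb_op D A l t y"
    "comb_op D A l t (r *\<^sub>R x) = r *\<^sub>R comb_op D A l t x" by auto
  show "comb_op D A l t (x - y) = comb_op D A l t x - comb_op D A l t y"
    using *(1)[of x "(-1) *\<^sub>R y"] *(2)[of "-1" y] by simp
qed

end

section \<open>Kernels and Gronwall arguments\<close>

lemma kernel_integral:
  assumes "q < (1::real)" "0 \<le> h"
  shows "((\<lambda>s. (h - s) powr (- q)) has_integral h powr (1 - q) / (1 - q)) {0..h}"
proof -
  have "((\<lambda>s. (h - s) powr (- q)) has_integral (- ((h - h) powr (1 - q) / (1 - q)) - (- ((h - 0) powr (1 - q) / (1 - q))))) {0..h}"
  proof (rule fundamental_theorem_of_calculus_interior[OF assms(2)])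
    show "continuous_on {0..h} (\<lambda>s. - ((h - s) powr (1 - q) / (1 - q)))"
      using assms by (intro continuous_intros continuous_on_powr') auto
    show "((\<lambda>s. - ((h - s) powr (1 - q) / (1 - q))) has_vector_derivative (h - s) powr (- q)) (at s)" if "s \<in> {0<..<h}" for s
    proof -
      have "((\<lambda>s. (h - s) powr (1 - q)) has_real_derivative (1 - q) * (h - s) powr (1 - q - 1) * (- 1)) (at s)"
        using that by (auto intro!: derivative_eq_intros)
      from DERIV_minus[OF DERIV_cdivide[OF this, of "1 - q"]] assms show ?thesis
        by (simp flip: has_real_derivative_iff_has_vector_derivative)
    qed
  qed
  then show ?thesis using assms by simp
qed

lemma exp_minus_le_powr:
  fixes x b :: real
  assumes "0 < x" "0 < b" "b \<le> 1"
  shows "exp (- x) \<le> x powr (- b)"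
proof -
  have "x powr b \<le> exp x"
  proof (cases "x \<le> 1")
    case True
    have "x powr b \<le> 1" using assms True by (intro powr_le1) auto
    also have "1 \<le> exp x" using assms by simp
    finally show ?thesis .
  next
    case False
    have "x powr b \<le> x powr 1" using assms False by (intro powr_mono) auto
    also have "\<dots> = x" using assms by simp
    also have "x \<le> exp x" using exp_ge_add_one_self[of x] by linarith
    finally show ?thesis .
  qed
  then show ?thesis using assms by (simp add: exp_minus powr_minus le_imp_inverse_le)
qed

text \<open>The exponential is traded for (\<mu> x)^(-b) with b = (1 - \<alpha>) / 2. The exponent
  (1 + \<alpha>) / 2 that results is midway between \<alpha> and 1, so the kernel stays integrable
  while a negative power of \<mu> is gained.\<close>

lemma kernel_exp_le:
  fixes \<alpha> :: real
  assumes \<alpha>: "0 \<le> \<alpha>" "\<alpha> < 1" and "0 < \<mu>" "0 < x"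
  shows "x powr (- \<alpha>) * exp (- \<mu> * x) \<le> \<mu> powr (- ((1 - \<alpha>) / 2)) * x powr (- ((1 + \<alpha>) / 2))"
proof -
  let ?b = "(1 - \<alpha>) / 2"
  have "exp (- (\<mu> * x)) \<le> (\<mu> * x) powr (- ?b)" using assms by (intro exp_minus_le_powr) auto
  also have "\<dots> = \<mu> powr (- ?b) * x powr (- ?b)" by (rule powr_mult; use assms in simp)
  finally have "x powr (- \<alpha>) * exp (- (\<mu> * x)) \<le> x powr (- \<alpha>) * (\<mu> powr (- ?b) * x powr (- ?b))"
    by (intro mult_left_mono) auto
  also have "\<dots> = \<mu> powr (- ?b) * (x powr (- \<alpha>) * x powr (- ?b))" by simp
  also have "x powr (- \<alpha>) * x powr (- ?b) = x powr (- ((1 + \<alpha>) / 2))"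
    unfolding powr_add[symmetric] by (rule arg_cong[where f="\<lambda>e. x powr e"]) (simp add: field_simps)
  finally show ?thesis by simp
qed

text \<open>A large exponential weight makes the weakly singular kernel a contraction.\<close>

lemma large_weight:
  assumes "0 < b" "0 \<le> (C::real)"
  obtains \<mu> where "0 < \<mu>" "C * \<mu> powr (- b) \<le> 1 / 2"
proof
  let ?\<mu> = "(2 * C + 1) powr (1 / b)"
  show "0 < ?\<mu>" using assms by simp
  have e: "?\<mu> powr (- b) = 1 / (2 * C + 1)" using assms by (simp add: powr_powr powr_minus_divide)
  show "C * ?\<mu> powr (- b) \<le> 1 / 2" unfolding e using assms by (simp add: field_simps)
qed

text \<open>Factor out exp (\<mu> t) and apply \<open>kernel_exp_le\<close> to the rest; the
  integral is then at most a constant times \<mu>^(-(1 - \<alpha>)/2), made small by the choice of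
  \<mu>.\<close>

lemma kernel_weight:
  fixes \<alpha> C T0 :: real
  assumes \<alpha>: "0 \<le> \<alpha>" "\<alpha> < 1" and C: "0 \<le> C" and T0: "0 \<le> T0"
  obtains \<mu> where "0 < \<mu>"
    "\<And>t. 0 \<le> t \<Longrightarrow> t \<le> T0 \<Longrightarrow> (\<lambda>s. (t - s) powr (- \<alpha>) * exp (\<mu> * s)) integrable_on {0..t}"
    "\<And>t. 0 \<le> t \<Longrightarrow> t \<le> T0 \<Longrightarrow> C * integral {0..t} (\<lambda>s. (t - s) powr (- \<alpha>) * exp (\<mu> * s)) \<le> exp (\<mu> * t) / 2"
proof -
  let ?b = "(1 - \<alpha>) / 2"
  have b: "0 < ?b" using \<alpha> by simp
  obtain \<mu> where \<mu>: "0 < \<mu>" "(C * (T0 powr ?b / ?b)) * \<mu> powr (- ?b) \<le> 1 / 2"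
    using large_weight[OF b, of "C * (T0 powr ?b / ?b)"] C b by (metis divide_nonneg_pos mult_nonneg_nonneg powr_ge_zero)
  have i: "(\<lambda>s. (t - s) powr (- \<alpha>) * exp (\<mu> * s)) integrable_on {0..t} \<and>
      C * integral {0..t} (\<lambda>s. (t - s) powr (- \<alpha>) * exp (\<mu> * s)) \<le> exp (\<mu> * t) / 2" if t: "0 \<le> t" "t \<le> T0" for t
  proof -
    let ?f = "\<lambda>s. (t - s) powr (- \<alpha>) * exp (\<mu> * s)"
    let ?g = "\<lambda>s. exp (\<mu> * t) * \<mu> powr (- ?b) * (t - s) powr (- ((1 + \<alpha>) / 2))"
    have e: "1 - (1 + \<alpha>) / 2 = ?b" by (simp add: field_simps)
    have g: "(?g has_integral exp (\<mu> * t) * \<mu> powr (- ?b) * (t powr ?b / ?b)) {0..t}"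
      using kernel_integral[of "(1 + \<alpha>) / 2" t] \<alpha> t unfolding e by (intro has_integral_mult_right) auto
    have le: "?f s \<le> ?g s" if "s < t" for s
    proof -
      have "?f s = exp (\<mu> * t) * ((t - s) powr (- \<alpha>) * exp (- \<mu> * (t - s)))"
        by (simp add: mult_exp_exp algebra_simps)
      also have "\<dots> \<le> exp (\<mu> * t) * (\<mu> powr (- ?b) * (t - s) powr (- ((1 + \<alpha>) / 2)))"
        using that \<mu> by (intro mult_left_mono kernel_exp_le \<alpha>) auto
      finally show ?thesis by (simp add: mult.assoc)
    qed
    have f: "?f integrable_on {0..t}"
    proof (rule integrable_dominated_interval[OF _ has_integral_integrable[OF g]])
      show "continuous_on {0<..<t} ?f" by (intro continuous_intros) auto
    qed (use le in auto)
    have "integral {0..t} ?f \<le> integral {0..t} ?g"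
    proof (rule integral_le[OF f has_integral_integrable[OF g]])
      show "?f s \<le> ?g s" if "s \<in> {0..t}" for s using le[of s] that by (cases "s = t") auto
    qed
    then have "C * integral {0..t} ?f \<le> C * (exp (\<mu> * t) * \<mu> powr (- ?b) * (t powr ?b / ?b))"
      unfolding integral_unique[OF g] using C by (rule mult_left_mono)
    also have "\<dots> \<le> C * (exp (\<mu> * t) * \<mu> powr (- ?b) * (T0 powr ?b / ?b))"
      using C t b by (intro mult_left_mono divide_right_mono powr_mono2) auto
    also have "\<dots> = exp (\<mu> * t) * ((C * (T0 powr ?b / ?b)) * \<mu> powr (- ?b))" by simp
    also have "\<dots> \<le> exp (\<mu> * t) * (1 / 2)" using \<mu>(2) by (intro mult_left_mono) auto
    finally show ?thesis using f by simp
  qed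
  show ?thesis by (rule that[OF \<mu>(1)]) (use i in auto)
qed

text \<open>\<open>step\<close> halves the coefficient of the exponential up to the additive
  \<open>K\<close>. Boundedness starts the iteration, and the coefficients tend to 2 K, the fixed
  point of Z -> K + Z / 2; \<open>B\<close> is reproduced each time with factor 1.\<close>

lemma gronwall_iterate:
  fixes \<phi> B :: "real \<Rightarrow> real"
  assumes S: "\<And>t. t \<in> S \<Longrightarrow> 0 \<le> t" and bd: "\<And>t. t \<in> S \<Longrightarrow> \<phi> t \<le> M0" and B: "\<And>t. t \<in> S \<Longrightarrow> 0 \<le> B t"
    and \<mu>: "0 \<le> \<mu>" and K: "0 \<le> K"
    and step: "\<And>Z. 0 \<le> Z \<Longrightarrow> (\<And>t. t \<in> S \<Longrightarrow> \<phi> t \<le> B t + Z * exp (\<mu> * t)) \<Longrightarrow>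
      (\<And>t. t \<in> S \<Longrightarrow> \<phi> t \<le> B t + K + Z / 2 * exp (\<mu> * t))"
    and t: "t \<in> S"
  shows "\<phi> t \<le> B t + 2 * K * exp (\<mu> * t)"
proof -
  let ?Z = "\<lambda>n. \<bar>M0\<bar> / 2 ^ n + 2 * K"
  have e1: "1 \<le> exp (\<mu> * t)" if "t \<in> S" for t using S[OF that] \<mu> by simp
  have *: "\<phi> t \<le> B t + ?Z n * exp (\<mu> * t)" if "t \<in> S" for t n
    using that
  proof (induction n arbitrary: t)
    case 0
    have "\<phi> t \<le> \<bar>M0\<bar> * 1" using bd[OF 0] by simp
    also have "\<dots> \<le> (\<bar>M0\<bar> + 2 * K) * exp (\<mu> * t)" using e1[OF 0] K by (intro mult_mono) auto
    finally show ?case using B[OF 0] by simp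
  next
    case (Suc n)
    have "\<phi> t \<le> B t + K * 1 + ?Z n / 2 * exp (\<mu> * t)"
      using step[of "?Z n" t] Suc K by simp
    also have "\<dots> \<le> B t + K * exp (\<mu> * t) + ?Z n / 2 * exp (\<mu> * t)"
      using mult_left_mono[OF e1[OF Suc.prems] K] by simp
    also have "\<dots> = B t + ?Z (Suc n) * exp (\<mu> * t)" by (simp add: field_simps)
    finally show ?case .
  qed
  have "(\<lambda>n. \<bar>M0\<bar> * (1 / 2) ^ n) \<longlonglongrightarrow> \<bar>M0\<bar> * 0" by (intro tendsto_intros LIMSEQ_power_zero) simp
  then have "(\<lambda>n. B t + (\<bar>M0\<bar> * (1 / 2) ^ n + 2 * K) * exp (\<mu> * t)) \<longlonglongrightarrow> B t + (\<bar>M0\<bar> * 0 + 2 * K) * exp (\<mu> * t)"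
    by (intro tendsto_add tendsto_mult tendsto_const LIMSEQ_power_zero) simp
  moreover have "\<phi> t \<le> B t + (\<bar>M0\<bar> * (1 / 2) ^ n + 2 * K) * exp (\<mu> * t)" for n
    using *[OF t, of n] by (simp add: power_one_over)
  ultimately have "\<phi> t \<le> B t + (\<bar>M0\<bar> * 0 + 2 * K) * exp (\<mu> * t)" by (intro LIMSEQ_le_const) auto
  then show ?thesis by simp
qed

section \<open>The intermediate space\<close>

text \<open>|v| is nonnegative and (0, 1) is not a null set, so the essential supremum cannot be
  negative.\<close>

lemma Lp01_norm_infty_nonneg: "0 \<le> Lp01_norm \<infinity> v"
proof -
  let ?M = "lebesgue_on {0<..<1::real}" and ?f = "\<lambda>t. ereal \<bar>v t\<bar>"
  have "0 \<le> esssup ?M ?f"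
  proof (rule ccontr)
    assume neg: "\<not> 0 \<le> esssup ?M ?f"
    have "AE t in ?M. False"
      using esssup_AE[of ?f ?M] by eventually_elim (use neg in \<open>meson abs_ge_zero ereal_less_eq(5) order_trans\<close>)
    then have "ae_filter ?M = bot" by (simp add: eventually_False)
    then have "emeasure ?M (space ?M) = 0" by (simp only: ae_filter_eq_bot_iff)
    then show False by (simp add: emeasure_restrict_space)
  qed
  then show ?thesis by (simp add: Lp01_norm_def real_of_ereal_pos)
qed

locale intermediate = sectorial_op D A for D :: "'a::complex_banach set" and A :: "'a \<Rightarrow> 'a" +
  fixes \<alpha> :: real and \<iota> :: "'b::complex_banach \<Rightarrow> 'a"
  assumes \<alpha>: "0 \<le> \<alpha>" "\<alpha> < 1" and inter: "intermediate_space D A \<alpha> \<iota>"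
    and part: "sectorial (part_dom D A \<iota>) (part_op A \<iota>)"
begin

sublocale Y: sectorial_op "part_dom D A \<iota>" "part_op A \<iota>" by standard (rule part)

abbreviation U where "U \<equiv> analytic_semigroup (part_dom D A \<iota>) (part_op A \<iota>)"

lemma inj: "inj \<iota>" and cl\<iota>: "complex_linear_on UNIV \<iota>"
  using inter by (auto simp: intermediate_space_def)

lemma norm_DA_infty: "norm x \<le> DA_norm D A \<alpha> \<infinity> x"
  using Lp01_norm_infty_nonneg by (simp add: DA_norm_def)

text \<open>Boundedness comes from the embedding into D_A(\<alpha>, \<infinity>), whose norm
  dominates that of X; for \<alpha> = 0 the map is isometric.\<close>

lemma \<iota>_clinear: "clinear \<iota>"
proof -
  obtain C where C: "\<And>y. norm (\<iota> y) \<le> C * norm y"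
  proof (cases "\<alpha> = 0")
    case True
    then show ?thesis using inter that[of 1] by (auto simp: intermediate_space_def)
  next
    case False
    then show ?thesis using inter that norm_DA_infty order_trans unfolding intermediate_space_def by (smt (verit))
  qed
  have "\<iota> (r *\<^sub>R x) = r *\<^sub>R \<iota> x" for r x
    using cl\<iota> by (simp add: complex_linear_on_def flip: scaleC_of_real)
  then have "bounded_linear \<iota>"
    using cl\<iota> C by (intro bounded_linear_intro[where K=C]) (auto simp: complex_linear_on_def mult.commute)
  then show ?thesis using cl\<iota> by (simp add: clinear_def complex_linear_on_def)
qed

sublocale \<iota>: bounded_linear \<iota> by (rule clinear_bounded_linear[OF \<iota>_clinear])

lemma \<iota>_eq_iff: "\<iota> x = \<iota> y \<longleftrightarrow> x = y"
  using inj by (auto dest: injD)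

lemma inv_\<iota> [simp]: "inv \<iota> (\<iota> y) = y"
  by (rule inv_f_f[OF inj])

lemma \<iota>_inv: "x \<in> range \<iota> \<Longrightarrow> \<iota> (inv \<iota> x) = x"
  by (rule f_inv_into_f)

lemma intertwine: "0 \<le> t \<Longrightarrow> \<iota> (U t y) = T t (\<iota> y)"
  by (rule analytic_sg_intertwine[OF analytic_sg_axioms Y.analytic_sg_axioms \<iota>_clinear])
     (auto simp: part_dom_def part_op_def \<iota>_inv)

lemma DA_mono:
  assumes "\<beta> \<le> \<gamma>" "0 < \<beta>" and x: "x \<in> DA \<gamma>"
  shows "x \<in> DA \<beta>" "N \<beta> x \<le> N \<gamma> x"
proof -
  have \<gamma>: "\<gamma> \<noteq> 0" "\<beta> \<noteq> 0" using assms by auto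
  have g: "W \<gamma> x integrable_on {0..1}" using x by (simp add: DA_iff \<gamma>)
  have "t powr (- \<beta>) \<le> t powr (- \<gamma>)" if "0 < t" "t < 1" for t
    using that assms by (intro powr_mono') auto
  then have b: "W \<beta> x t \<le> W \<gamma> x t" if "0 < t" "t < 1" for t
    using that by (auto simp: W_def intro!: mult_right_mono)
  show "x \<in> DA \<beta>" "N \<beta> x \<le> N \<gamma> x"
    using DA_dominated[OF g b \<gamma>(2)] by (auto simp: N_eq[OF \<gamma>(1) x])
qed

text \<open>One constant serves all \<gamma> \<ge> \<alpha> because on (0, 1) the weights
  t^(-\<gamma>) increase with \<gamma>. The case \<alpha> = 0 is separate, as the norm then has no
  integral part.\<close>

lemma embed_ex:
  "\<exists>C>0. \<forall>\<gamma>\<ge>\<alpha>. \<forall>x\<in>DA \<gamma>. x \<in> range \<iota> \<and> norm (inv \<iota> x) \<le> C * N \<gamma> x"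
proof (cases "\<alpha> = 0")
  case True
  then have s: "x \<in> range \<iota>" and n: "norm (\<iota> y) = norm y" for x y
    using inter by (auto simp: intermediate_space_def)
  have "norm (inv \<iota> x) = norm x" for x using n[of "inv \<iota> x"] \<iota>_inv[OF s, of x] by simp
  then show ?thesis using s norm_le_N by (intro exI[of _ 1]) auto
next
  case False
  obtain C where C: "\<And>y. \<iota> y \<in> DA \<alpha> \<Longrightarrow> norm y \<le> C * N \<alpha> (\<iota> y)" and sub: "DA \<alpha> \<subseteq> range \<iota>"
    using inter False unfolding intermediate_space_def by auto
  have "x \<in> range \<iota> \<and> norm (inv \<iota> x) \<le> (\<bar>C\<bar> + 1) * N \<gamma> x" if "\<alpha> \<le> \<gamma>" "x \<in> DA \<gamma>" for \<gamma> x
  proof -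
    have x: "x \<in> DA \<alpha>" "N \<alpha> x \<le> N \<gamma> x" using DA_mono[OF that(1) _ that(2)] False \<alpha> by auto
    have "norm (inv \<iota> x) \<le> C * N \<alpha> x" using C[of "inv \<iota> x"] \<iota>_inv[of x] x sub by auto
    also have "\<dots> \<le> (\<bar>C\<bar> + 1) * N \<gamma> x" using x N_nonneg[OF x(1)] by (intro mult_mono) auto
    finally show ?thesis using x sub by auto
  qed
  then show ?thesis by (intro exI[of _ "\<bar>C\<bar> + 1"]) auto
qed

definition Ce where "Ce = (SOME C. 0 < C \<and> (\<forall>\<gamma>\<ge>\<alpha>. \<forall>x\<in>DA \<gamma>. x \<in> range \<iota> \<and> norm (inv \<iota> x) \<le> C * N \<gamma> x))"

lemma Ce: "0 < Ce" "\<alpha> \<le> \<gamma> \<Longrightarrow> x \<in> DA \<gamma> \<Longrightarrow> x \<in> range \<iota>"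
  "\<alpha> \<le> \<gamma> \<Longrightarrow> x \<in> DA \<gamma> \<Longrightarrow> norm (inv \<iota> x) \<le> Ce * N \<gamma> x"
  using someI_ex[OF embed_ex] unfolding Ce_def by blast+

text \<open>\<open>T t\<close> as a map from X into X_\<alpha>; meaningful for t > 0, when
  \<open>T t\<close> takes values in D_A(\<alpha>, 1).\<close>

definition V :: "real \<Rightarrow> 'a \<Rightarrow> 'b" where "V t x = inv \<iota> (T t x)"

definition Cv :: "real \<Rightarrow> real" where "Cv t0 = Ce * Cconv \<alpha> t0"

lemma Cv_pos: "0 < Cv t0"
  using Ce(1) Cconv_pos[OF \<alpha>] by (simp add: Cv_def)

lemma \<iota>_V: "0 < t \<Longrightarrow> \<iota> (V t x) = T t x"
  unfolding V_def by (intro \<iota>_inv Ce(2)[OF order_refl] T_smooth(1)[OF \<alpha> _ order_refl])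

lemma V_bound:
  assumes "0 < t" "t \<le> t0"
  shows "norm (V t x) \<le> Cv t0 * t powr (- \<alpha>) * norm x"
proof -
  have "norm (V t x) \<le> Ce * N \<alpha> (T t x)"
    unfolding V_def by (rule Ce(3)[OF order_refl T_smooth(1)[OF \<alpha> assms]])
  also have "\<dots> \<le> Ce * (Cconv \<alpha> t0 * t powr (- \<alpha>) * norm x)"
    using Ce(1) by (intro mult_left_mono T_smooth' \<alpha> assms) auto
  finally show ?thesis by (simp add: Cv_def mult_ac)
qed

lemma V_bl: assumes t: "0 < t" shows "bounded_linear (V t)"
proof (rule bounded_linear_intro[where K="Cv t * t powr (- \<alpha>)"])
  show "V t (x + y) = V t x + V t y" for x y
    using t \<iota>_V[OF t] by (simp add: T_add \<iota>.add flip: \<iota>_eq_iff)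
  show "V t (r *\<^sub>R x) = r *\<^sub>R V t x" for r x
    using t \<iota>_V[OF t] by (simp add: T_scaleR \<iota>.scaleR flip: \<iota>_eq_iff)
  show "norm (V t x) \<le> norm x * (Cv t * t powr (- \<alpha>))" for x
    using V_bound[OF t order_refl, of x] by (simp add: mult_ac)
qed

lemma V_T: "0 < t \<Longrightarrow> 0 \<le> s \<Longrightarrow> V t (T s x) = V (t + s) x"
  by (simp add: \<iota>_V T_semigroup flip: \<iota>_eq_iff)

lemma V_\<iota>: "0 < t \<Longrightarrow> V t (\<iota> y) = U t y"
  by (simp add: \<iota>_V intertwine flip: \<iota>_eq_iff)

text \<open>Near s0 write V (h - s) = V d T (h - s - d) with d = (h - s0) / 2: \<open>V d\<close> is
  one bounded operator, and continuity of \<open>T\<close> at positive times suffices.\<close>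

lemma V_cont:
  assumes v: "continuous_on {0<..<h} v"
  shows "continuous_on {0<..<h} (\<lambda>s. V (h - s) (v s))"
  unfolding continuous_on_eq_continuous_at[OF open_greaterThanLessThan]
proof
  fix s0 assume s0: "s0 \<in> {0<..<h}"
  define d where "d = (h - s0) / 2"
  have d: "0 < d" "s0 < h - d" using s0 by (auto simp: d_def field_simps)
  have "continuous_on {0<..<h - d} (\<lambda>s. V d (T (h - s - d) (v s)))"
    by (rule bounded_linear.continuous_on[OF V_bl[OF d(1)]], rule T_cont_comp[of _ _ h])
       (use d in \<open>auto intro!: continuous_intros continuous_on_subset[OF v]\<close>)
  then have "continuous_on {0<..<h - d} (\<lambda>s. V (h - s) (v s))"
    by (rule continuous_on_cong[OF refl, THEN iffD1, rotated]) (use d in \<open>auto simp: V_T\<close>)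
  then show "isCont (\<lambda>s. V (h - s) (v s)) s0"
    using s0 d by (auto simp: continuous_on_eq_continuous_at[OF open_greaterThanLessThan])
qed

text \<open>The majorant may depend on s, because the Volterra estimate inserts an exponential
  weight and a nonuniform forcing term.\<close>

lemma V_conv:
  assumes h: "0 \<le> h" "h \<le> t0" and v: "continuous_on {0<..<h} v"
    and b: "\<And>s. 0 < s \<Longrightarrow> s < h \<Longrightarrow> norm (v s) \<le> b s"
    and i: "(\<lambda>s. (h - s) powr (- \<alpha>) * b s) integrable_on {0..h}"
  shows "(\<lambda>s. V (h - s) (v s)) integrable_on {0..h}"
    "norm (integral {0..h} (\<lambda>s. V (h - s) (v s))) \<le> Cv t0 * integral {0..h} (\<lambda>s. (h - s) powr (- \<alpha>) * b s)"
proof -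
  have ib: "(\<lambda>s. Cv t0 * ((h - s) powr (- \<alpha>) * b s)) integrable_on {0..h}"
    using integrable_on_cmult_left[OF i, of "Cv t0"] by simp
  have le: "norm (V (h - s) (v s)) \<le> Cv t0 * ((h - s) powr (- \<alpha>) * b s)" if "0 < s" "s < h" for s
  proof -
    have "norm (V (h - s) (v s)) \<le> Cv t0 * (h - s) powr (- \<alpha>) * norm (v s)" using that h by (intro V_bound) auto
    also have "\<dots> \<le> Cv t0 * (h - s) powr (- \<alpha>) * b s" using that Cv_pos[of t0] by (intro mult_left_mono b) auto
    finally show ?thesis by simp
  qed
  show I: "(\<lambda>s. V (h - s) (v s)) integrable_on {0..h}"
    by (rule integrable_dominated_interval[OF V_cont[OF v] ib le])
  have "norm (integral {0<..<h} (\<lambda>s. V (h - s) (v s))) \<le> integral {0<..<h} (\<lambda>s. Cv t0 * ((h - s) powr (- \<alpha>) * b s))"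
    by (rule integral_norm_bound_integral) (use I ib le in \<open>auto simp: integrable_on_open_interval_real\<close>)
  then show "norm (integral {0..h} (\<lambda>s. V (h - s) (v s))) \<le> Cv t0 * integral {0..h} (\<lambda>s. (h - s) powr (- \<alpha>) * b s)"
    by (simp add: integral_open_interval_real)
qed

lemma \<iota>_V_conv:
  assumes "(\<lambda>s. V (h - s) (v s)) integrable_on {0..h}"
  shows "\<iota> (integral {0..h} (\<lambda>s. V (h - s) (v s))) = integral {0..h} (\<lambda>s. T (h - s) (v s))"
proof -
  have "((\<lambda>s. \<iota> (V (h - s) (v s))) has_integral \<iota> (integral {0..h} (\<lambda>s. V (h - s) (v s)))) {0..h}"
    using has_integral_linear[OF integrable_integral[OF assms] \<iota>.bounded_linear_axioms] by (simp add: o_def)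
  \<comment> \<open>At s = h the value of \<open>V 0\<close> is not tied to \<open>T 0\<close>; a
    single point is negligible.\<close>
  then have "((\<lambda>s. T (h - s) (v s)) has_integral \<iota> (integral {0..h} (\<lambda>s. V (h - s) (v s)))) {0..h}"
    by (rule has_integral_spike_finite[of "{h}", rotated 2]) (auto simp: \<iota>_V)
  then show ?thesis by (simp add: integral_unique)
qed

lemma V_conv_const:
  assumes h: "0 \<le> h" "h \<le> t0" and v: "continuous_on {0<..<h} v"
    and b: "\<And>s. 0 < s \<Longrightarrow> s < h \<Longrightarrow> norm (v s) \<le> K"
  shows "(\<lambda>s. V (h - s) (v s)) integrable_on {0..h}"
    "norm (integral {0..h} (\<lambda>s. V (h - s) (v s))) \<le> Cv t0 * K * h powr (1 - \<alpha>) / (1 - \<alpha>)"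
proof -
  have i: "((\<lambda>s. (h - s) powr (- \<alpha>) * K) has_integral h powr (1 - \<alpha>) / (1 - \<alpha>) * K) {0..h}"
    by (intro has_integral_mult_left kernel_integral \<alpha> h)
  show "(\<lambda>s. V (h - s) (v s)) integrable_on {0..h}"
    by (rule V_conv(1)[OF h v b has_integral_integrable[OF i]])
  show "norm (integral {0..h} (\<lambda>s. V (h - s) (v s))) \<le> Cv t0 * K * h powr (1 - \<alpha>) / (1 - \<alpha>)"
    using V_conv(2)[OF h v b has_integral_integrable[OF i], unfolded integral_unique[OF i]] by (simp add: mult_ac)
qed

end

lemma integral_reflect_Icc:
  fixes F :: "real \<Rightarrow> 'a::banach"
  assumes "(F has_integral i) {0..t}"
  shows "((\<lambda>s. F (t - s)) has_integral i) {0..t}"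
proof -
  have "((\<lambda>s. F (- s)) has_integral i) {- t..- 0}" using assms by (simp only: has_integral_reflect_real)
  from has_integral_shift_real_ivl[OF this, of "- t"] show ?thesis by simp
qed

section \<open>Regularity of the mild solution\<close>

locale mild = intermediate D A \<alpha> \<iota>
  for D :: "'a::complex_banach set" and A :: "'a \<Rightarrow> 'a" and \<alpha> :: real and \<iota> :: "'b::complex_banach \<Rightarrow> 'a" +
  fixes f :: "real \<Rightarrow> 'b \<Rightarrow> 'a" and u0 :: 'b and u :: "real \<Rightarrow> 'b" and Tm :: real
  assumes Tm: "0 < Tm" and Lip: "lipschitz_on_balls Tm f" and frech: "frechet_lipschitz_derivative Tm f"
    and u0_D: "\<iota> u0 \<in> D" and compat: "A (\<iota> u0) + f 0 u0 \<in> range \<iota>"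
    and mild: "mild_solution D A \<iota> f Tm u0 u"
begin

definition g where "g t = f t (u t)"

lemma u_0: "u 0 = u0"
proof -
  obtain w where w: "((\<lambda>\<xi>. T (0 - \<xi>) (f \<xi> (u \<xi>))) has_integral w) {0..0}" "\<iota> (u 0) = T 0 (\<iota> u0) + w"
    using mild Tm unfolding mild_solution_def by (metis atLeastAtMost_iff less_eq_real_def order_refl)
  have "w = 0" using integral_unique[OF w(1)] by simp
  then show ?thesis using w(2) by (simp add: T_0 \<iota>_eq_iff)
qed

lemma u_cont: "continuous_on {0<..Tm} u"
  using mild by (simp add: mild_solution_def)

text \<open>One more than a bound of the solution, so that a stage within distance 1 of the solution
  still lies in the ball where the Lipschitz constants hold.\<close>

definition R where "R = (SOME R. 1 < R \<and> (\<forall>t\<in>{0..Tm}. norm (u t) \<le> R - 1))"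

lemma R: "1 < R" "0 \<le> t \<Longrightarrow> t \<le> Tm \<Longrightarrow> norm (u t) \<le> R - 1"
proof -
  have "\<exists>B. \<forall>t\<in>{0<..Tm}. norm (u t) \<le> B"
    using mild unfolding mild_solution_def bounded_iff by auto
  then obtain B where "\<forall>t\<in>{0<..Tm}. norm (u t) \<le> B" ..
  then have B: "\<And>t. 0 < t \<Longrightarrow> t \<le> Tm \<Longrightarrow> norm (u t) \<le> B" by simp
  have "norm (u t) \<le> \<bar>B\<bar> + norm u0 + 2 - 1" if "0 \<le> t" "t \<le> Tm" for t
  proof (cases "t = 0")
    case True
    then show ?thesis by (simp add: u_0)
  next
    case False
    then have "norm (u t) \<le> B" using that by (intro B) auto
    then show ?thesis using abs_ge_self[of B] norm_ge_zero[of u0] by linarith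
  qed
  moreover have "1 < \<bar>B\<bar> + norm u0 + 2" using abs_ge_zero[of B] norm_ge_zero[of u0] by linarith
  ultimately have "\<exists>R. 1 < R \<and> (\<forall>t\<in>{0..Tm}. norm (u t) \<le> R - 1)"
    by (intro exI[of _ "\<bar>B\<bar> + norm u0 + 2"]) simp
  from someI_ex[OF this] show "1 < R" "0 \<le> t \<Longrightarrow> t \<le> Tm \<Longrightarrow> norm (u t) \<le> R - 1"
    unfolding R_def by auto
qed

lemma u_le_R: "0 \<le> t \<Longrightarrow> t \<le> Tm \<Longrightarrow> norm (u t) \<le> R"
  using R(2)[of t] by simp

lemma u_diff_le_R: "s \<in> {0..Tm} \<Longrightarrow> t \<in> {0..Tm} \<Longrightarrow> norm (u s - u t) \<le> 2 * R"
  using norm_triangle_ineq4[of "u s" "u t"] u_le_R[of s] u_le_R[of t] by auto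

definition L where "L = (SOME L. 0 < L \<and> (\<forall>t1\<in>{0..Tm}. \<forall>t2\<in>{0..Tm}. \<forall>v1 v2. norm v1 \<le> R \<longrightarrow> norm v2 \<le> R \<longrightarrow>
    norm (f t1 v1 - f t2 v2) \<le> L * (\<bar>t1 - t2\<bar> + norm (v1 - v2))))"

lemma L: "0 < L" "t1 \<in> {0..Tm} \<Longrightarrow> t2 \<in> {0..Tm} \<Longrightarrow> norm v1 \<le> R \<Longrightarrow> norm v2 \<le> R \<Longrightarrow>
    norm (f t1 v1 - f t2 v2) \<le> L * (\<bar>t1 - t2\<bar> + norm (v1 - v2))"
proof -
  have "0 < R" using R(1) by simp
  then obtain C where C: "\<And>t1 t2 v1 v2. t1 \<in> {0..Tm} \<Longrightarrow> t2 \<in> {0..Tm} \<Longrightarrow> norm v1 \<le> R \<Longrightarrow> norm v2 \<le> R \<Longrightarrow>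
      norm (f t1 v1 - f t2 v2) \<le> C * (\<bar>t1 - t2\<bar> + norm (v1 - v2))"
    using Lip unfolding lipschitz_on_balls_def by (metis max.bounded_iff)
  have "norm (f t1 v1 - f t2 v2) \<le> max 1 C * (\<bar>t1 - t2\<bar> + norm (v1 - v2))"
    if "t1 \<in> {0..Tm}" "t2 \<in> {0..Tm}" "norm v1 \<le> R" "norm v2 \<le> R" for t1 t2 v1 v2
    by (rule order_trans[OF C[OF that]]) (intro mult_right_mono, auto)
  then have "\<exists>L. 0 < L \<and> (\<forall>t1\<in>{0..Tm}. \<forall>t2\<in>{0..Tm}. \<forall>v1 v2. norm v1 \<le> R \<longrightarrow> norm v2 \<le> R \<longrightarrow>
    norm (f t1 v1 - f t2 v2) \<le> L * (\<bar>t1 - t2\<bar> + norm (v1 - v2)))"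
    by (intro exI[of _ "max 1 C"]) auto
  from someI_ex[OF this] show "0 < L" "t1 \<in> {0..Tm} \<Longrightarrow> t2 \<in> {0..Tm} \<Longrightarrow> norm v1 \<le> R \<Longrightarrow> norm v2 \<le> R \<Longrightarrow>
    norm (f t1 v1 - f t2 v2) \<le> L * (\<bar>t1 - t2\<bar> + norm (v1 - v2))"
    unfolding L_def by auto
qed

lemma g_diff: "s \<in> {0..Tm} \<Longrightarrow> t \<in> {0..Tm} \<Longrightarrow> norm (g s - g t) \<le> L * (\<bar>s - t\<bar> + norm (u s - u t))"
  unfolding g_def by (intro L(2) u_le_R) auto

lemma g_cont: "continuous_on {0<..Tm} g"
  unfolding continuous_on_def
proof
  fix t assume t: "t \<in> {0<..Tm}"
  have "((\<lambda>s. L * (\<bar>s - t\<bar> + norm (u s - u t))) \<longlongrightarrow> L * (\<bar>t - t\<bar> + norm (u t - u t))) (at t within {0<..Tm})"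
    using u_cont t by (intro tendsto_intros) (auto simp: continuous_on_def)
  then have l: "((\<lambda>s. L * (\<bar>s - t\<bar> + norm (u s - u t))) \<longlongrightarrow> 0) (at t within {0<..Tm})" by simp
  have "((\<lambda>s. g s - g t) \<longlongrightarrow> 0) (at t within {0<..Tm})"
    by (rule Lim_null_comparison[OF _ l]) (use t in \<open>auto simp: eventually_at_filter intro!: always_eventually g_diff\<close>)
  then show "(g \<longlongrightarrow> g t) (at t within {0<..Tm})" by (simp add: LIM_zero_iff)
qed

definition Kg where "Kg = norm (g 0) + L * (Tm + 2 * R)"

lemma g_bound: assumes "t \<in> {0..Tm}" shows "norm (g t) \<le> Kg"
proof -
  have "norm (g t - g 0) \<le> L * (\<bar>t - 0\<bar> + norm (u t - u 0))" using assms Tm by (intro g_diff) auto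
  also have "norm (u t - u 0) \<le> R + R"
    using assms Tm by (intro order_trans[OF norm_triangle_ineq4] add_mono u_le_R) auto
  finally have "norm (g t - g 0) \<le> L * (Tm + 2 * R)" using assms L(1) by (auto intro: order_trans mult_left_mono)
  then show ?thesis using norm_triangle_sub[of "g t" "g 0"] by (simp add: Kg_def)
qed

lemma g_shift_cont: "0 \<le> s \<Longrightarrow> s + t \<le> Tm \<Longrightarrow> continuous_on {0<..<t} (\<lambda>\<xi>. g (s + \<xi>))"
  by (rule continuous_on_compose2[OF g_cont]) (auto intro!: continuous_intros)

lemma mild_X:
  assumes t: "0 \<le> t" "t \<le> Tm"
  shows "\<iota> (u t) = T t (\<iota> u0) + integral {0..t} (\<lambda>\<xi>. T (t - \<xi>) (g \<xi>))"
proof -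
  obtain w where "((\<lambda>\<xi>. T (t - \<xi>) (f \<xi> (u \<xi>))) has_integral w) {0..t}" "\<iota> (u t) = T t (\<iota> u0) + w"
    using mild t unfolding mild_solution_def by (metis atLeastAtMost_iff)
  then show ?thesis by (simp add: g_def integral_unique)
qed

lemma conv_g_integrable:
  assumes "0 \<le> s" "0 \<le> t" "s + t \<le> Tm"
  shows "(\<lambda>\<xi>. T (t - \<xi>) (g (s + \<xi>))) integrable_on {0..t}"
  by (rule conv_integrable[OF g_shift_cont, where K=Kg]) (use assms in \<open>auto intro!: g_bound\<close>)

lemma V_conv_g_integrable:
  assumes "0 \<le> s" "0 \<le> t" "s + t \<le> Tm"
  shows "(\<lambda>\<xi>. V (t - \<xi>) (g (s + \<xi>))) integrable_on {0..t}"
  by (rule V_conv_const(1)[OF assms(2) order_refl g_shift_cont, where K=Kg]) (use assms in \<open>auto intro!: g_bound\<close>)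

text \<open>Split the integral at s and take \<open>T t\<close> out of its first part by the
  semigroup law; the first part and the initial term then combine to the solution at time s.\<close>

lemma u_shift_X:
  assumes "0 \<le> s" "0 \<le> t" "s + t \<le> Tm"
  shows "\<iota> (u (s + t)) = T t (\<iota> (u s)) + integral {0..t} (\<lambda>\<xi>. T (t - \<xi>) (g (s + \<xi>)))"
proof -
  let ?F = "\<lambda>\<xi>. T (s + t - \<xi>) (g \<xi>)"
  have i: "?F integrable_on {0..s + t}" using conv_g_integrable[of 0 "s + t"] assms by simp
  have "integral {0..s + t} ?F = integral {0..s} ?F + integral {s..s + t} ?F"
    using Henstock_Kurzweil_Integration.integral_combine[OF _ _ i, of s] assms by simp
  also have "integral {s..s + t} ?F = integral {0..t} (\<lambda>\<xi>. T (t - \<xi>) (g (s + \<xi>)))"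
    using integral_shift_real_ivl[of s s "s + t" ?F] by (simp add: add.commute)
  also have "integral {0..s} ?F = T t (integral {0..s} (\<lambda>\<xi>. T (s - \<xi>) (g \<xi>)))"
  proof -
    have "((\<lambda>\<xi>. T t (T (s - \<xi>) (g \<xi>))) has_integral T t (integral {0..s} (\<lambda>\<xi>. T (s - \<xi>) (g \<xi>)))) {0..s}"
      using has_integral_linear[OF integrable_integral[OF conv_g_integrable[of 0 s]] T_bl[of t]] assms by (simp add: o_def)
    then have "(?F has_integral T t (integral {0..s} (\<lambda>\<xi>. T (s - \<xi>) (g \<xi>)))) {0..s}"
      by (rule has_integral_eq[rotated]) (use assms in \<open>simp add: T_semigroup[symmetric] algebra_simps\<close>)
    then show ?thesis by (rule integral_unique)
  qed
  finally have e: "integral {0..s + t} ?F = T t (integral {0..s} (\<lambda>\<xi>. T (s - \<xi>) (g \<xi>))) + integral {0..t} (\<lambda>\<xi>. T (t - \<xi>) (g (s + \<xi>)))" .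
  have "\<iota> (u (s + t)) = T (t + s) (\<iota> u0) + integral {0..s + t} ?F"
    using mild_X[of "s + t"] assms by (simp add: add.commute)
  also have "T (t + s) (\<iota> u0) = T t (T s (\<iota> u0))" using assms by (intro T_semigroup) auto
  also have "T t (T s (\<iota> u0)) + integral {0..s + t} ?F = T t (\<iota> (u s)) + integral {0..t} (\<lambda>\<xi>. T (t - \<xi>) (g (s + \<xi>)))"
    unfolding e using mild_X[of s] assms by (simp add: T_add)
  finally show ?thesis .
qed

lemma u_shift:
  assumes "0 \<le> s" "0 \<le> t" "s + t \<le> Tm"
  shows "u (s + t) = U t (u s) + integral {0..t} (\<lambda>\<xi>. V (t - \<xi>) (g (s + \<xi>)))"
  using u_shift_X[OF assms] \<iota>_V_conv[OF V_conv_g_integrable[OF assms]] intertwine[OF assms(2), of "u s"]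
  by (simp add: \<iota>.add flip: \<iota>_eq_iff)

text \<open>The part \<open>B\<close> of the forcing need not be uniformly small: it reappears in the bound for \<open>w\<close> with factor \<open>1\<close>, and the constant multiplies only its convolution with the kernel.\<close>

definition volterra :: "real \<Rightarrow> real \<Rightarrow> (real \<Rightarrow> 'b) \<Rightarrow> (real \<Rightarrow> 'b) \<Rightarrow> (real \<Rightarrow> 'a) \<Rightarrow> (real \<Rightarrow> real) \<Rightarrow> real \<Rightarrow> real \<Rightarrow> real \<Rightarrow> bool" where
  "volterra c S0 w r G B K KB k \<longleftrightarrow> S0 \<le> Tm \<and> (\<exists>M0. \<forall>t\<in>{0..S0}. norm (w t) \<le> M0) \<and> continuous_on {0<..<S0} G \<and>
    (\<forall>t\<in>{0..S0}. w t = r t + integral {0..t} (\<lambda>\<xi>. V (t - \<xi>) (G \<xi>))) \<and>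
    (\<forall>t\<in>{0..S0}. norm (r t) \<le> B t + K) \<and> (\<forall>t\<in>{0..S0}. norm (G t) \<le> c * (norm (w t) + k)) \<and>
    (\<forall>t\<in>{0..S0}. 0 \<le> B t) \<and> 0 \<le> K \<and> 0 \<le> KB \<and> 0 \<le> k \<and>
    (\<forall>t\<in>{0..S0}. (\<lambda>\<xi>. (t - \<xi>) powr (- \<alpha>) * B \<xi>) integrable_on {0..t} \<and> integral {0..t} (\<lambda>\<xi>. (t - \<xi>) powr (- \<alpha>) * B \<xi>) \<le> KB)"

text \<open>\<open>C\<close> depends on \<open>c\<close> and on the fixed data of the locale only,
  so the estimate may be used for horizons and forcings that vary with h. The weight \<mu> is chosen
  so that the kernel, with its constants, maps exp (\<mu> t) below half of itself.\<close>

lemma volterra_ex: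
  assumes c: "0 \<le> c"
  shows "\<exists>C\<ge>0. \<forall>S0 w r G B K KB k. volterra c S0 w r G B K KB k \<longrightarrow> (\<forall>t\<in>{0..S0}. norm (w t) \<le> B t + C * (K + KB + k))"
proof -
  define E where "E = Cv Tm * c"
  have E: "0 \<le> E" using Cv_pos[of Tm] c by (simp add: E_def)
  obtain \<mu> where \<mu>: "0 < \<mu>"
    "\<And>t. 0 \<le> t \<Longrightarrow> t \<le> Tm \<Longrightarrow> (\<lambda>s. (t - s) powr (- \<alpha>) * exp (\<mu> * s)) integrable_on {0..t}"
    "\<And>t. 0 \<le> t \<Longrightarrow> t \<le> Tm \<Longrightarrow> E * integral {0..t} (\<lambda>s. (t - s) powr (- \<alpha>) * exp (\<mu> * s)) \<le> exp (\<mu> * t) / 2"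
    using kernel_weight[OF \<alpha> E less_imp_le[OF Tm]] by blast
  define P where "P = Tm powr (1 - \<alpha>) / (1 - \<alpha>)"
  have P: "0 \<le> P" using \<alpha> by (simp add: P_def)
  define C where "C = 2 * exp (\<mu> * Tm) * (1 + E * (1 + P))"
  have main: "norm (w t) \<le> B t + C * (K + KB + k)"
    if S0: "S0 \<le> Tm" and M0: "\<And>t. t \<in> {0..S0} \<Longrightarrow> norm (w t) \<le> M0" and G: "continuous_on {0<..<S0} G"
      and w: "\<And>t. t \<in> {0..S0} \<Longrightarrow> w t = r t + integral {0..t} (\<lambda>\<xi>. V (t - \<xi>) (G \<xi>))"
      and r: "\<And>t. t \<in> {0..S0} \<Longrightarrow> norm (r t) \<le> B t + K" and Gb: "\<And>t. t \<in> {0..S0} \<Longrightarrow> norm (G t) \<le> c * (norm (w t) + k)"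
      and B: "\<And>t. t \<in> {0..S0} \<Longrightarrow> 0 \<le> B t" and K: "0 \<le> K" "0 \<le> KB" "0 \<le> k"
      and KB: "\<And>t. t \<in> {0..S0} \<Longrightarrow> (\<lambda>\<xi>. (t - \<xi>) powr (- \<alpha>) * B \<xi>) integrable_on {0..t}"
        "\<And>t. t \<in> {0..S0} \<Longrightarrow> integral {0..t} (\<lambda>\<xi>. (t - \<xi>) powr (- \<alpha>) * B \<xi>) \<le> KB"
      and t: "t \<in> {0..S0}" for S0 w r G B K KB k M0 t
  proof -
    \<comment> \<open>The convolution of \<open>B\<close> enters through its bound
      \<open>KB\<close>, that of the constant k through \<open>P\<close>, which bounds the integral
      of the kernel.\<close>
    define K' where "K' = K + E * (KB + k * P)"
    have K': "0 \<le> K'" using K E P by (simp add: K'_def)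
    have "norm (w t) \<le> B t + 2 * K' * exp (\<mu> * t)"
    proof (rule gronwall_iterate[where S="{0..S0}", OF _ M0 B less_imp_le[OF \<mu>(1)] K' _ t])
      fix Z t assume Z: "0 \<le> Z" "\<And>t. t \<in> {0..S0} \<Longrightarrow> norm (w t) \<le> B t + Z * exp (\<mu> * t)" and t: "t \<in> {0..S0}"
      have tT: "0 \<le> t" "t \<le> Tm" using t S0 by auto
      let ?b = "\<lambda>\<xi>. c * (B \<xi> + Z * exp (\<mu> * \<xi>) + k)"
      let ?k = "\<lambda>\<xi>. (t - \<xi>) powr (- \<alpha>)"
      have ik: "(?k has_integral t powr (1 - \<alpha>) / (1 - \<alpha>)) {0..t}" using \<alpha> tT by (intro kernel_integral) auto
      have i: "((\<lambda>\<xi>. c * (?k \<xi> * B \<xi>) + c * Z * (?k \<xi> * exp (\<mu> * \<xi>)) + c * k * ?k \<xi>) has_integral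
          c * integral {0..t} (\<lambda>\<xi>. ?k \<xi> * B \<xi>) + c * Z * integral {0..t} (\<lambda>\<xi>. ?k \<xi> * exp (\<mu> * \<xi>)) + c * k * (t powr (1 - \<alpha>) / (1 - \<alpha>))) {0..t}"
        by (intro has_integral_add has_integral_mult_right ik integrable_integral KB(1)[OF t] \<mu>(2)[OF tT])
      then have i': "((\<lambda>\<xi>. ?k \<xi> * ?b \<xi>) has_integral
          c * integral {0..t} (\<lambda>\<xi>. ?k \<xi> * B \<xi>) + c * Z * integral {0..t} (\<lambda>\<xi>. ?k \<xi> * exp (\<mu> * \<xi>)) + c * k * (t powr (1 - \<alpha>) / (1 - \<alpha>))) {0..t}"
        by (rule has_integral_eq[rotated]) (simp add: algebra_simps)
      have cG: "continuous_on {0<..<t} G" using t by (intro continuous_on_subset[OF G]) auto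
      have Gb': "norm (G \<xi>) \<le> ?b \<xi>" if "0 < \<xi>" "\<xi> < t" for \<xi>
        using t that by (intro order_trans[OF Gb] mult_left_mono c add_right_mono Z(2)) auto
      have "t powr (1 - \<alpha>) / (1 - \<alpha>) \<le> P" unfolding P_def using tT \<alpha> by (intro divide_right_mono powr_mono2) auto
      then have P1: "c * k * (t powr (1 - \<alpha>) / (1 - \<alpha>)) \<le> c * k * P" using c K by (intro mult_left_mono) auto
      have "norm (integral {0..t} (\<lambda>\<xi>. V (t - \<xi>) (G \<xi>))) \<le>
          Cv Tm * (c * integral {0..t} (\<lambda>\<xi>. ?k \<xi> * B \<xi>) + c * Z * integral {0..t} (\<lambda>\<xi>. ?k \<xi> * exp (\<mu> * \<xi>)) + c * k * (t powr (1 - \<alpha>) / (1 - \<alpha>)))"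
        using V_conv(2)[OF tT cG Gb' has_integral_integrable[OF i']] unfolding integral_unique[OF i'] .
      also have "\<dots> \<le> Cv Tm * (c * KB + c * Z * integral {0..t} (\<lambda>\<xi>. ?k \<xi> * exp (\<mu> * \<xi>)) + c * k * P)"
        using Cv_pos[of Tm] c by (intro mult_left_mono add_mono KB(2)[OF t] P1 order_refl) auto
      also have "\<dots> = E * (KB + k * P) + Z * (E * integral {0..t} (\<lambda>\<xi>. ?k \<xi> * exp (\<mu> * \<xi>)))"
        by (simp add: E_def algebra_simps)
      also have "\<dots> \<le> E * (KB + k * P) + Z * (exp (\<mu> * t) / 2)"
        using Z(1) \<mu>(3)[OF tT] by (intro add_left_mono mult_left_mono) auto
      finally show "norm (w t) \<le> B t + K' + Z / 2 * exp (\<mu> * t)"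
        using norm_triangle_ineq[of "r t" "integral {0..t} (\<lambda>\<xi>. V (t - \<xi>) (G \<xi>))"] r[OF t] w[OF t]
        by (simp add: K'_def)
    qed auto
    also have "2 * K' * exp (\<mu> * t) \<le> 2 * K' * exp (\<mu> * Tm)" using K' \<mu>(1) t S0 by (intro mult_left_mono) auto
    also have "K' \<le> (1 + E * (1 + P)) * (K + KB + k)"
    proof -
      have "K' = K + E * KB + E * P * k" by (simp add: K'_def algebra_simps)
      also have "\<dots> \<le> (1 + E * (1 + P)) * K + (1 + E * (1 + P)) * KB + (1 + E * (1 + P)) * k"
        using K E P by (intro add_mono) (auto simp: algebra_simps intro!: add_nonneg_nonneg mult_nonneg_nonneg)
      finally show ?thesis by (simp add: distrib_left)
    qed
    then have "2 * K' * exp (\<mu> * Tm) \<le> C * (K + KB + k)"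
      by (simp add: C_def mult_ac)
    finally show ?thesis by simp
  qed
  have "0 \<le> C" using E P by (simp add: C_def)
  show ?thesis
  proof (intro exI[of _ C] conjI allI impI ballI)
    fix S0 w r G B K KB k t
    assume v: "volterra c S0 w r G B K KB k" and t: "t \<in> {0..S0}"
    then obtain M0 where "\<forall>t\<in>{0..S0}. norm (w t) \<le> M0" by (auto simp: volterra_def)
    with v t show "norm (w t) \<le> B t + C * (K + KB + k)"
      unfolding volterra_def by (intro main[of S0 w M0 G r B K k KB t]) auto
  qed (rule \<open>0 \<le> C\<close>)
qed

text \<open>The formal derivative of u at time 0; the compatibility condition places it in
  X_\<alpha>.\<close>

definition x0 where "x0 = inv \<iota> (A (\<iota> u0) + f 0 u0)"

lemma \<iota>_x0: "\<iota> x0 = A (\<iota> u0) + g 0"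
  unfolding x0_def by (simp add: \<iota>_inv[OF compat] g_def u_0)

lemma U_integrable: "0 \<le> t \<Longrightarrow> (\<lambda>s. U s y) integrable_on {0..t}"
proof (rule integrable_dominated_interval[where g="\<lambda>_. Y.Tb t * norm y"])
  show "continuous_on {0<..<t} (\<lambda>s. U s y)" by (rule continuous_on_subset[OF Y.T_cont]) auto
qed (auto intro!: Y.Tb(2))

text \<open>As u0 lies in \<open>D\<close>, T(t) u0 - u0 is the integral of T(s) A u0. Adding the
  integral of T(s) g(0) turns the integrand into T(s) x0 = U(s) x0, and the forcing that remains
  vanishes at time 0.\<close>

lemma u_expansion:
  assumes t: "0 \<le> t" "t \<le> Tm"
  shows "(\<lambda>\<xi>. V (t - \<xi>) (g \<xi> - g 0)) integrable_on {0..t}"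
    "u t - u0 = integral {0..t} (\<lambda>s. U s x0) + integral {0..t} (\<lambda>\<xi>. V (t - \<xi>) (g \<xi> - g 0))"
proof -
  have c: "continuous_on {0<..<t} (\<lambda>\<xi>. g \<xi> - g 0)"
    using g_shift_cont[of 0 t] t by (intro continuous_intros) auto
  have b: "norm (g \<xi> - g 0) \<le> Kg + Kg" if "0 < \<xi>" "\<xi> < t" for \<xi>
    using that t by (intro order_trans[OF norm_triangle_ineq4] add_mono g_bound) auto
  show i: "(\<lambda>\<xi>. V (t - \<xi>) (g \<xi> - g 0)) integrable_on {0..t}"
    by (rule V_conv_const(1)[OF t(1) order_refl c b])
  have iT: "(\<lambda>\<xi>. T (t - \<xi>) (g \<xi> - g 0)) integrable_on {0..t}" by (rule conv_integrable[OF c b])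
  have 1: "((\<lambda>s. \<iota> (U s x0)) has_integral \<iota> (integral {0..t} (\<lambda>s. U s x0))) {0..t}"
    using has_integral_linear[OF integrable_integral[OF U_integrable[OF t(1), of x0]] \<iota>.bounded_linear_axioms] by (simp add: o_def)
  have 2: "((\<lambda>s. T s (A (\<iota> u0))) has_integral (T t (\<iota> u0) - \<iota> u0)) {0..t}" by (rule T_integral[OF u0_D t(1)])
  have "((\<lambda>s. \<iota> (U s x0) - T s (A (\<iota> u0))) has_integral (\<iota> (integral {0..t} (\<lambda>s. U s x0)) - (T t (\<iota> u0) - \<iota> u0))) {0..t}"
    by (rule has_integral_diff[OF 1 2])
  then have "((\<lambda>s. T s (g 0)) has_integral (\<iota> (integral {0..t} (\<lambda>s. U s x0)) - (T t (\<iota> u0) - \<iota> u0))) {0..t}"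
    by (rule has_integral_eq[rotated]) (simp add: intertwine \<iota>_x0 T_add)
  from integral_reflect_Icc[OF this]
  have "((\<lambda>\<xi>. T (t - \<xi>) (g \<xi> - g 0) + T (t - \<xi>) (g 0)) has_integral
      (integral {0..t} (\<lambda>\<xi>. T (t - \<xi>) (g \<xi> - g 0)) + (\<iota> (integral {0..t} (\<lambda>s. U s x0)) - (T t (\<iota> u0) - \<iota> u0)))) {0..t}"
    by (intro has_integral_add integrable_integral[OF iT])
  then have "((\<lambda>\<xi>. T (t - \<xi>) (g \<xi>)) has_integral
      (integral {0..t} (\<lambda>\<xi>. T (t - \<xi>) (g \<xi> - g 0)) + (\<iota> (integral {0..t} (\<lambda>s. U s x0)) - (T t (\<iota> u0) - \<iota> u0)))) {0..t}"
    by (rule has_integral_eq[rotated]) (simp add: T_diff)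
  then have "\<iota> (u t) - \<iota> u0 = \<iota> (integral {0..t} (\<lambda>s. U s x0)) + \<iota> (integral {0..t} (\<lambda>\<xi>. V (t - \<xi>) (g \<xi> - g 0)))"
    using mild_X[OF t] by (simp add: integral_unique \<iota>_V_conv[OF i])
  then show "u t - u0 = integral {0..t} (\<lambda>s. U s x0) + integral {0..t} (\<lambda>\<xi>. V (t - \<xi>) (g \<xi> - g 0))"
    by (simp add: \<iota>.add \<iota>.diff flip: \<iota>_eq_iff)
qed

lemma U_integral_bound:
  assumes "0 \<le> t" "t \<le> Tm"
  shows "norm (integral {0..t} (\<lambda>s. U s y)) \<le> Y.Tb Tm * norm y * t"
proof -
  have "norm (integral {0..t} (\<lambda>s. U s y)) \<le> integral {0..t} (\<lambda>s. Y.Tb Tm * norm y)"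
    using assms by (intro integral_norm_bound_integral U_integrable) (auto intro!: Y.Tb(2))
  then show ?thesis using assms by (simp add: mult_ac)
qed

text \<open>The Volterra estimate is applied on [0, h] itself, where the integral of U(s) x0 and the
  increments of the time argument are both O(h).\<close>

lemma u_Lipschitz_0: "\<exists>C\<ge>0. \<forall>h. 0 \<le> h \<longrightarrow> h \<le> Tm \<longrightarrow> norm (u h - u0) \<le> C * h"
proof -
  obtain C where C: "C \<ge> 0" and V: "\<And>S0 w r G B K KB k. volterra L S0 w r G B K KB k \<Longrightarrow> (\<forall>t\<in>{0..S0}. norm (w t) \<le> B t + C * (K + KB + k))"
    using volterra_ex[OF less_imp_le[OF L(1)]] by metis
  let ?K = "Y.Tb Tm * norm x0"
  have "norm (u h - u0) \<le> C * (?K + 1) * h" if h: "0 \<le> h" "h \<le> Tm" for h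
  proof -
    have "volterra L h (\<lambda>t. u t - u0) (\<lambda>t. integral {0..t} (\<lambda>s. U s x0)) (\<lambda>\<xi>. g \<xi> - g 0) (\<lambda>_. 0) (?K * h) 0 h"
      unfolding volterra_def
    proof (intro conjI exI[of _ "2 * R"])
      show "\<forall>t\<in>{0..h}. norm (u t - u0) \<le> 2 * R"
        unfolding u_0[symmetric] using h by (auto intro!: u_diff_le_R)
      show "continuous_on {0<..<h} (\<lambda>\<xi>. g \<xi> - g 0)" using g_shift_cont[of 0 h] h by (intro continuous_intros) auto
      show "\<forall>t\<in>{0..h}. u t - u0 = integral {0..t} (\<lambda>s. U s x0) + integral {0..t} (\<lambda>\<xi>. V (t - \<xi>) (g \<xi> - g 0))"
        using u_expansion(2) h by auto
      show "\<forall>t\<in>{0..h}. norm (integral {0..t} (\<lambda>s. U s x0)) \<le> 0 + ?K * h"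
        using h Y.Tb(1)[of Tm] by (auto intro!: order_trans[OF U_integral_bound] mult_left_mono)
      show "\<forall>t\<in>{0..h}. norm (g t - g 0) \<le> L * (norm (u t - u0) + h)"
        using h L(1) g_diff[of _ 0] u_0 by (auto intro!: order_trans[OF g_diff] mult_left_mono)
    qed (use h Y.Tb(1)[of Tm] in auto)
    from V[OF this] have "norm (u h - u0) \<le> C * (?K * h + h)" using h by auto
    then show ?thesis by (simp add: algebra_simps)
  qed
  then show ?thesis using C Y.Tb(1)[of Tm] by (intro exI[of _ "C * (?K + 1)"]) auto
qed

text \<open>u(h + t) - u(t) solves a Volterra equation with initial value u(h) - u(0), which is O(h)
  by \<open>u_Lipschitz_0\<close>; the shift in the time argument of f contributes k = h.\<close>

lemma u_Lipschitz: "\<exists>C\<ge>0. \<forall>s\<in>{0..Tm}. \<forall>t\<in>{0..Tm}. norm (u s - u t) \<le> C * \<bar>s - t\<bar>"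
proof -
  obtain C0 where C0: "C0 \<ge> 0" "\<And>h. 0 \<le> h \<Longrightarrow> h \<le> Tm \<Longrightarrow> norm (u h - u0) \<le> C0 * h" using u_Lipschitz_0 by blast
  obtain C where C: "C \<ge> 0" and V: "\<And>S0 w r G B K KB k. volterra L S0 w r G B K KB k \<Longrightarrow> (\<forall>t\<in>{0..S0}. norm (w t) \<le> B t + C * (K + KB + k))"
    using volterra_ex[OF less_imp_le[OF L(1)]] by metis
  let ?K = "Y.Tb Tm * C0"
  have *: "norm (u (t + h) - u t) \<le> C * (?K + 1) * h" if h: "0 \<le> h" "0 \<le> t" "t + h \<le> Tm" for h t
  proof -
    let ?S = "Tm - h"
    have "volterra L ?S (\<lambda>t. u (h + t) - u (0 + t)) (\<lambda>t. U t (u h - u 0)) (\<lambda>\<xi>. g (h + \<xi>) - g (0 + \<xi>)) (\<lambda>_. 0) (?K * h) 0 h"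
      unfolding volterra_def
    proof (intro conjI exI[of _ "2 * R"])
      show "\<forall>t\<in>{0..?S}. norm (u (h + t) - u (0 + t)) \<le> 2 * R"
        using h by (auto intro!: u_diff_le_R)
      show "continuous_on {0<..<?S} (\<lambda>\<xi>. g (h + \<xi>) - g (0 + \<xi>))"
        using h by (intro continuous_intros g_shift_cont) auto
      show "\<forall>t\<in>{0..?S}. u (h + t) - u (0 + t) = U t (u h - u 0) + integral {0..t} (\<lambda>\<xi>. V (t - \<xi>) (g (h + \<xi>) - g (0 + \<xi>)))"
      proof
        fix t assume t: "t \<in> {0..?S}"
        have i: "(\<lambda>\<xi>. V (t - \<xi>) (g (h + \<xi>))) integrable_on {0..t}" "(\<lambda>\<xi>. V (t - \<xi>) (g (0 + \<xi>))) integrable_on {0..t}"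
          using t h by (intro V_conv_g_integrable; auto)+
        have "((\<lambda>\<xi>. V (t - \<xi>) (g (h + \<xi>) - g (0 + \<xi>))) has_integral
            (integral {0..t} (\<lambda>\<xi>. V (t - \<xi>) (g (h + \<xi>))) - integral {0..t} (\<lambda>\<xi>. V (t - \<xi>) (g (0 + \<xi>))))) {0..t}"
          by (rule has_integral_spike_finite[OF _ _ has_integral_diff[OF integrable_integral[OF i(1)] integrable_integral[OF i(2)]], of "{t}"])
             (auto simp: linear_diff[OF bounded_linear.linear[OF V_bl]])
        then show "u (h + t) - u (0 + t) = U t (u h - u 0) + integral {0..t} (\<lambda>\<xi>. V (t - \<xi>) (g (h + \<xi>) - g (0 + \<xi>)))"
          using u_shift[of h t] u_shift[of 0 t] t h by (simp add: integral_unique Y.T_diff)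
      qed
      show "\<forall>t\<in>{0..?S}. norm (U t (u h - u 0)) \<le> 0 + ?K * h"
      proof
        fix t assume t: "t \<in> {0..?S}"
        have "norm (U t (u h - u 0)) \<le> Y.Tb Tm * norm (u h - u 0)" using t h by (intro Y.Tb(2)) auto
        also have "\<dots> \<le> Y.Tb Tm * (C0 * h)" using Y.Tb(1)[of Tm] C0(2)[of h] h u_0 by (intro mult_left_mono) auto
        finally show "norm (U t (u h - u 0)) \<le> 0 + ?K * h" by simp
      qed
      show "\<forall>t\<in>{0..?S}. norm (g (h + t) - g (0 + t)) \<le> L * (norm (u (h + t) - u (0 + t)) + h)"
        using h g_diff[of "h + _" "0 + _"] by (auto simp: add.commute intro!: order_trans[OF g_diff])
    qed (use h C0(1) Y.Tb(1)[of Tm] in auto)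
    from V[OF this] have "\<forall>t\<in>{0..?S}. norm (u (h + t) - u (0 + t)) \<le> 0 + C * (?K * h + 0 + h)" .
    moreover have "t \<in> {0..?S}" using h by auto
    ultimately have "norm (u (h + t) - u (0 + t)) \<le> C * (?K * h + h)" by auto
    then show ?thesis by (simp add: algebra_simps)
  qed
  have "norm (u s - u t) \<le> C * (?K + 1) * \<bar>s - t\<bar>" if "s \<in> {0..Tm}" "t \<in> {0..Tm}" for s t
    using *[of "s - t" t] *[of "t - s" s] that by (cases "t \<le> s") (auto simp: norm_minus_commute)
  then show ?thesis using C C0(1) Y.Tb(1)[of Tm] by (intro exI[of _ "C * (?K + 1)"]) auto
qed

end

lemma norm_triangle_diff3:
  fixes a b c d :: "'c::real_normed_vector"
  shows "norm (a - b + c) \<le> norm a + norm b + norm c" "norm (a - b - c) \<le> norm a + norm b + norm c"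
    "norm (a - b + (c - d)) \<le> norm a + norm b + (norm c + norm d)"
  using norm_triangle_ineq[of "a - b" c] norm_triangle_ineq4[of "a - b" c] norm_triangle_ineq4[of a b]
    norm_triangle_ineq[of "a - b" "c - d"] norm_triangle_ineq4[of c d] by linarith+

section \<open>Second differences of the solution\<close>

context mild
begin

text \<open>Where t - \<xi> \<ge> h, the kernel is at most h^(-\<alpha>) and 1 / (h + \<xi>)
  integrates to a logarithm. On the last stretch of length h, h^2 / (h + \<xi>) \<le> h and the
  kernel integrates to a multiple of h^(1 - \<alpha>); for t \<le> h only this part occurs.\<close>

lemma kernel_log:
  "\<exists>C\<ge>0. \<forall>h t. 0 < h \<longrightarrow> h \<le> 1 \<longrightarrow> 0 \<le> t \<longrightarrow> t \<le> Tm \<longrightarrow>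
     (\<lambda>\<xi>. (t - \<xi>) powr (- \<alpha>) * (h\<^sup>2 / (h + \<xi>))) integrable_on {0..t} \<and>
     integral {0..t} (\<lambda>\<xi>. (t - \<xi>) powr (- \<alpha>) * (h\<^sup>2 / (h + \<xi>))) \<le> C * (h powr (2 - \<alpha>) * (\<bar>ln h\<bar> + 1))"
proof -
  define C where "C = 1 / (1 - \<alpha>) + \<bar>ln Tm\<bar> + 1"
  have C: "0 \<le> C" using \<alpha> by (simp add: C_def)
  have main: "(\<lambda>\<xi>. (t - \<xi>) powr (- \<alpha>) * (h\<^sup>2 / (h + \<xi>))) integrable_on {0..t} \<and>
     integral {0..t} (\<lambda>\<xi>. (t - \<xi>) powr (- \<alpha>) * (h\<^sup>2 / (h + \<xi>))) \<le> C * (h powr (2 - \<alpha>) * (\<bar>ln h\<bar> + 1))"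
    if h: "0 < h" "h \<le> 1" and t: "0 \<le> t" "t \<le> Tm" for h t
  proof -
    let ?f = "\<lambda>\<xi>. (t - \<xi>) powr (- \<alpha>) * (h\<^sup>2 / (h + \<xi>))"
    have hB: "h\<^sup>2 / (h + \<xi>) \<le> h" if "0 \<le> \<xi>" for \<xi>
      using h that by (simp add: divide_le_eq power2_eq_square)
    have le: "?f \<xi> \<le> (t - \<xi>) powr (- \<alpha>) * h" if "0 \<le> \<xi>" for \<xi> by (intro mult_left_mono hB that) auto
    have i1: "((\<lambda>\<xi>. (t - \<xi>) powr (- \<alpha>) * h) has_integral t powr (1 - \<alpha>) / (1 - \<alpha>) * h) {0..t}"
      using \<alpha> t by (intro has_integral_mult_left kernel_integral) auto
    have f: "?f integrable_on {0..t}"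
    proof (rule integrable_dominated_interval[OF _ has_integral_integrable[OF i1]])
      show "continuous_on {0<..<t} ?f" using h by (intro continuous_intros) auto
      show "norm (?f \<xi>) \<le> (t - \<xi>) powr (- \<alpha>) * h" if "0 < \<xi>" for \<xi>
        using le[of \<xi>] that h by simp
    qed
    have hp: "h powr (1 - \<alpha>) * h = h powr (2 - \<alpha>)"
    proof -
      have "h powr (1 - \<alpha>) * h powr 1 = h powr (2 - \<alpha>)" unfolding powr_add[symmetric] by simp
      then show ?thesis using h by simp
    qed
    have hp2: "h powr (- \<alpha>) * h\<^sup>2 = h powr (2 - \<alpha>)"
    proof -
      have "h powr (- \<alpha>) * h powr 2 = h powr (2 - \<alpha>)" unfolding powr_add[symmetric] by simp
      then show ?thesis using h by simp
    qed
    have l1: "1 \<le> \<bar>ln h\<bar> + 1" by simp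
    have "integral {0..t} ?f \<le> h powr (2 - \<alpha>) * (1 / (1 - \<alpha>) + \<bar>ln Tm\<bar> + \<bar>ln h\<bar>)"
    proof (cases "t \<le> h")
      case True
      have "integral {0..t} ?f \<le> t powr (1 - \<alpha>) / (1 - \<alpha>) * h"
        using integral_le[OF f has_integral_integrable[OF i1]] le unfolding integral_unique[OF i1] by auto
      also have "\<dots> \<le> h powr (1 - \<alpha>) / (1 - \<alpha>) * h"
        using True t h \<alpha> by (intro mult_right_mono divide_right_mono powr_mono2) auto
      also have "\<dots> = h powr (2 - \<alpha>) * (1 / (1 - \<alpha>))" using hp by simp
      also have "\<dots> \<le> h powr (2 - \<alpha>) * (1 / (1 - \<alpha>) + \<bar>ln Tm\<bar> + \<bar>ln h\<bar>)" by (intro mult_left_mono) auto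
      finally show ?thesis .
    next
      case False
      then have th: "h < t" by simp
      have fa: "?f integrable_on {0..t - h}" and fb: "?f integrable_on {t - h..t}"
        using th h by (intro integrable_on_subinterval[OF f]; auto)+
      have ia: "((\<lambda>\<xi>. h powr (2 - \<alpha>) * (1 / (h + \<xi>))) has_integral h powr (2 - \<alpha>) * (ln (h + (t - h)) - ln (h + 0))) {0..t - h}"
        using th h by (intro has_integral_mult_right fundamental_theorem_of_calculus)
          (auto intro!: derivative_eq_intros simp flip: has_real_derivative_iff_has_vector_derivative)
      have "integral {0..t - h} ?f \<le> h powr (2 - \<alpha>) * (ln (h + (t - h)) - ln (h + 0))"
        unfolding integral_unique[OF ia, symmetric]
      proof (rule integral_le[OF fa has_integral_integrable[OF ia]])
        fix \<xi> assume \<xi>: "\<xi> \<in> {0..t - h}"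
        have "(t - \<xi>) powr (- \<alpha>) \<le> h powr (- \<alpha>)" using \<xi> h \<alpha> by (intro powr_mono2') auto
        then have "?f \<xi> \<le> h powr (- \<alpha>) * (h\<^sup>2 / (h + \<xi>))" using \<xi> h by (intro mult_right_mono) auto
        also have "\<dots> = h powr (2 - \<alpha>) * (1 / (h + \<xi>))" unfolding hp2[symmetric] by simp
        finally show "?f \<xi> \<le> h powr (2 - \<alpha>) * (1 / (h + \<xi>))" .
      qed
      also have "\<dots> \<le> h powr (2 - \<alpha>) * (\<bar>ln Tm\<bar> + \<bar>ln h\<bar>)"
      proof -
        have "ln t \<le> ln Tm" using th h t by simp
        then have "ln (h + (t - h)) - ln (h + 0) \<le> \<bar>ln Tm\<bar> + \<bar>ln h\<bar>" by simp
        then show ?thesis by (intro mult_left_mono) auto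
      qed
      finally have A: "integral {0..t - h} ?f \<le> h powr (2 - \<alpha>) * (\<bar>ln Tm\<bar> + \<bar>ln h\<bar>)" .
      have "((\<lambda>\<xi>. (h - \<xi>) powr (- \<alpha>) * h) has_integral h powr (1 - \<alpha>) / (1 - \<alpha>) * h) {0..h}"
        using \<alpha> h by (intro has_integral_mult_left kernel_integral) auto
      from has_integral_shift_real_ivl[OF this, of "h - t"]
      have ib: "((\<lambda>\<xi>. (t - \<xi>) powr (- \<alpha>) * h) has_integral h powr (1 - \<alpha>) / (1 - \<alpha>) * h) {t - h..t}" by simp
      have "integral {t - h..t} ?f \<le> h powr (1 - \<alpha>) / (1 - \<alpha>) * h"
        unfolding integral_unique[OF ib, symmetric]
        by (rule integral_le[OF fb has_integral_integrable[OF ib]]) (use le th in auto)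
      also have "\<dots> = h powr (2 - \<alpha>) * (1 / (1 - \<alpha>))" using hp by simp
      finally have B: "integral {t - h..t} ?f \<le> h powr (2 - \<alpha>) * (1 / (1 - \<alpha>))" .
      have "integral {0..t} ?f = integral {0..t - h} ?f + integral {t - h..t} ?f"
        using Henstock_Kurzweil_Integration.integral_combine[OF _ _ f, of "t - h"] th h by simp
      then show ?thesis using A B by (simp add: distrib_left)
    qed
    also have "\<dots> \<le> h powr (2 - \<alpha>) * (C * (\<bar>ln h\<bar> + 1))"
    proof (rule mult_left_mono)
      have "\<bar>ln h\<bar> \<le> C * \<bar>ln h\<bar>" using \<alpha> mult_right_mono[of 1 C "\<bar>ln h\<bar>"] by (simp add: C_def)
      moreover have "1 / (1 - \<alpha>) + \<bar>ln Tm\<bar> \<le> C" by (simp add: C_def)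
      ultimately show "1 / (1 - \<alpha>) + \<bar>ln Tm\<bar> + \<bar>ln h\<bar> \<le> C * (\<bar>ln h\<bar> + 1)"
        unfolding distrib_left mult_1_right by linarith
    qed simp
    finally show ?thesis using f by (simp add: mult_ac)
  qed
  show ?thesis
    by (intro exI[of _ C] conjI[OF C] allI impI main)
qed

text \<open>The segment between the two points stays in the ball by convexity, and along it the
  derivative changes by at most L2 times the distance; the mean value inequality for the
  linearisation error gives the quadratic remainder.\<close>

lemma taylor:
  obtains F :: "real \<Rightarrow> 'b \<Rightarrow> (real \<times> 'b) \<Rightarrow>\<^sub>L 'a" and M L2 where "0 \<le> M" "0 \<le> L2"
    "\<And>t v. t \<in> {0..Tm} \<Longrightarrow> norm v \<le> R \<Longrightarrow> norm (F t v) \<le> M"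
    "\<And>t1 t2 v1 v2. t1 \<in> {0..Tm} \<Longrightarrow> t2 \<in> {0..Tm} \<Longrightarrow> norm v1 \<le> R \<Longrightarrow> norm v2 \<le> R \<Longrightarrow>
       norm (f t2 v2 - f t1 v1 - blinfun_apply (F t1 v1) (t2 - t1, v2 - v1)) \<le> L2 * (\<bar>t2 - t1\<bar> + norm (v2 - v1))\<^sup>2"
proof -
  obtain F where F: "\<And>t v. t \<in> {0..Tm} \<Longrightarrow> ((\<lambda>(s, w). f s w) has_derivative blinfun_apply (F t v)) (at (t, v) within {0..Tm} \<times> UNIV)"
    and lF: "lipschitz_on_balls Tm F"
    using frech unfolding frechet_lipschitz_derivative_def by metis
  have "0 < R" using R(1) by simp
  then obtain C where C: "\<And>t1 t2 v1 v2. t1 \<in> {0..Tm} \<Longrightarrow> t2 \<in> {0..Tm} \<Longrightarrow> norm v1 \<le> R \<Longrightarrow> norm v2 \<le> R \<Longrightarrow>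
      norm (F t1 v1 - F t2 v2) \<le> C * (\<bar>t1 - t2\<bar> + norm (v1 - v2))"
    using lF unfolding lipschitz_on_balls_def by (metis max.bounded_iff)
  define L2 where "L2 = \<bar>C\<bar>"
  have L2: "norm (F t1 v1 - F t2 v2) \<le> L2 * (\<bar>t1 - t2\<bar> + norm (v1 - v2))"
    if "t1 \<in> {0..Tm}" "t2 \<in> {0..Tm}" "norm v1 \<le> R" "norm v2 \<le> R" for t1 t2 v1 v2
    by (rule order_trans[OF C[OF that]]) (simp add: L2_def mult_right_mono)
  define M where "M = norm (F 0 0) + L2 * (Tm + R)"
  show ?thesis
  proof (rule that[of M L2 F])
    show "0 \<le> M" "0 \<le> L2" using Tm R(1) by (auto simp: M_def L2_def)
    show "norm (F t v) \<le> M" if "t \<in> {0..Tm}" "norm v \<le> R" for t v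
    proof -
      have "norm (F t v - F 0 0) \<le> L2 * (\<bar>t - 0\<bar> + norm (v - 0))" using that Tm R(1) by (intro L2) auto
      also have "\<dots> \<le> L2 * (Tm + R)" using that by (intro mult_left_mono add_mono) (auto simp: L2_def)
      finally show ?thesis using norm_triangle_sub[of "F t v" "F 0 0"] by (simp add: M_def)
    qed
    fix t1 t2 :: real and v1 v2 :: 'b
    assume a: "t1 \<in> {0..Tm}" "t2 \<in> {0..Tm}" "norm v1 \<le> R" "norm v2 \<le> R"
    let ?f = "\<lambda>(s, w). f s w" and ?F = "\<lambda>p. blinfun_apply (F (fst p) (snd p))"
    let ?a = "(t1, v1)" and ?b = "(t2, v2)"
    let ?S = "closed_segment ?a ?b" and ?d = "\<bar>t2 - t1\<bar> + norm (v2 - v1)"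
    have seg: "\<exists>r. 0 \<le> r \<and> r \<le> 1 \<and> p = (t1 + r * (t2 - t1), v1 + r *\<^sub>R (v2 - v1))" if "p \<in> ?S" for p
      using that by (auto simp: in_segment algebra_simps)
    have sub: "?S \<subseteq> {0..Tm} \<times> cball 0 R"
      by (rule closed_segment_subset) (use a in \<open>auto intro: convex_Times\<close>)
    have segR: "fst p \<in> {0..Tm} \<and> norm (snd p) \<le> R" if "p \<in> ?S" for p
    proof -
      from sub have "p \<in> {0..Tm} \<times> cball 0 R" using that by (rule subsetD)
      then show ?thesis by auto
    qed
    have "norm (?f ?b - ?f ?a - ?F ?a (?b - ?a)) \<le> norm (?b - ?a) * (L2 * ?d)"
    proof (rule differentiable_bound_linearization[where S="?S" and f'="?F" and ?x0.0="?a"])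
      show "?a + t *\<^sub>R (?b - ?a) \<in> ?S" if "t \<in> {0..1}" for t
        using that by (auto simp: in_segment algebra_simps intro!: exI[of _ t])
      show "(?f has_derivative ?F p) (at p within ?S)" if "p \<in> ?S" for p
      proof -
        have "?S \<subseteq> {0..Tm} \<times> UNIV" by (rule subset_trans[OF sub]) auto
        then have "(?f has_derivative ?F p) (at (fst p, snd p) within ?S)"
          using F[of "fst p" "snd p"] segR[OF that] by (blast intro: has_derivative_subset)
        then show ?thesis by simp
      qed
      show "onorm (?F p - ?F ?a) \<le> L2 * ?d" if p: "p \<in> ?S" for p
      proof -
        obtain r where r: "0 \<le> r" "r \<le> 1" "p = (t1 + r * (t2 - t1), v1 + r *\<^sub>R (v2 - v1))" using seg[OF p] by blast
        have "onorm (?F p - ?F ?a) = norm (F (fst p) (snd p) - F t1 v1)"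
          by (simp add: norm_blinfun.rep_eq minus_blinfun.rep_eq fun_diff_def)
        also have "\<dots> \<le> L2 * (\<bar>fst p - t1\<bar> + norm (snd p - v1))" using segR[OF p] a by (intro L2) auto
        also have "\<bar>fst p - t1\<bar> + norm (snd p - v1) = r * ?d"
        proof -
          have "fst p - t1 = r * (t2 - t1)" "snd p - v1 = r *\<^sub>R (v2 - v1)" using r(3) by simp_all
          then show ?thesis using r(1) by (simp only: abs_mult norm_scaleR abs_of_nonneg distrib_left)
        qed
        also have "L2 * (r * ?d) \<le> L2 * (1 * ?d)" using r by (intro mult_left_mono mult_right_mono) (auto simp: L2_def)
        finally show ?thesis by (simp add: fun_diff_def)
      qed
    qed simp
    also have "norm (?b - ?a) \<le> ?d" using norm_Pair_le[of "t2 - t1" "v2 - v1"] by simp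
    then have "norm (?b - ?a) * (L2 * ?d) \<le> ?d * (L2 * ?d)" by (intro mult_right_mono) (auto simp: L2_def)
    finally show "norm (f t2 v2 - f t1 v1 - blinfun_apply (F t1 v1) (t2 - t1, v2 - v1)) \<le> L2 * ?d\<^sup>2"
      by (simp add: power2_eq_square mult_ac)
  qed
qed

text \<open>The part s U(t) y is linear in s and cancels in second differences. What remains is the
  integral over \<sigma> \<le> s of U(t + \<sigma>) y - U(t) y, which is of size s / t.\<close>

lemma U_integral_linear_part:
  assumes "0 < t" "0 \<le> s" "t + s \<le> Tm"
  shows "norm (U t (integral {0..s} (\<lambda>\<sigma>. U \<sigma> y)) - s *\<^sub>R U t y) \<le> Y.ATb Tm * norm y * s\<^sup>2 / t"
proof -
  have i: "((\<lambda>\<sigma>. U t (U \<sigma> y)) has_integral U t (integral {0..s} (\<lambda>\<sigma>. U \<sigma> y))) {0..s}"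
    using has_integral_linear[OF integrable_integral[OF U_integrable[OF assms(2)]] Y.T_bl[of t]] assms by (simp add: o_def)
  have "((\<lambda>_. U t y) has_integral s *\<^sub>R U t y) {0..s}" using has_integral_const_real[of "U t y" 0 s] assms by simp
  from has_integral_diff[OF i this]
  have i2: "((\<lambda>\<sigma>. U t (U \<sigma> y) - U t y) has_integral U t (integral {0..s} (\<lambda>\<sigma>. U \<sigma> y)) - s *\<^sub>R U t y) {0..s}" .
  have "norm (integral {0..s} (\<lambda>\<sigma>. U t (U \<sigma> y) - U t y)) \<le> integral {0..s} (\<lambda>_. Y.ATb Tm * s / t * norm y)"
  proof (rule integral_norm_bound_integral[OF has_integral_integrable[OF i2] integrable_const_ivl])
    fix \<sigma> assume \<sigma>: "\<sigma> \<in> {0..s}"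
    have "norm (U (t + \<sigma>) y - U t y) \<le> Y.ATb Tm * \<sigma> / t * norm y" using assms \<sigma> by (intro Y.T_Lipschitz) auto
    also have "\<dots> \<le> Y.ATb Tm * s / t * norm y"
      using assms \<sigma> Y.ATb(1)[of Tm] by (intro mult_right_mono divide_right_mono mult_left_mono) auto
    finally show "norm (U t (U \<sigma> y) - U t y) \<le> Y.ATb Tm * s / t * norm y" using assms \<sigma> by (simp add: Y.T_semigroup)
  qed
  then show ?thesis using assms by (simp add: integral_unique[OF i2] power2_eq_square mult_ac)
qed

text \<open>By \<open>u_shift\<close> the second difference w of u satisfies a Volterra equation
  with forcing G, the second difference of g, and linearising f at (t, u(t)) bounds G by w and h^2.
  So the matter rests on U(t) w(0): for t < h the bound w(0) = O(h) is used, for t \<ge> h the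
  expansion of u at time 0.\<close>

lemma u_second_difference:
  "\<exists>C\<ge>0. \<forall>h l t. 0 < h \<longrightarrow> h \<le> 1 \<longrightarrow> 0 \<le> l \<longrightarrow> l \<le> 1 \<longrightarrow> 0 \<le> t \<longrightarrow> t + h \<le> Tm \<longrightarrow>
     norm (u (t + l * h) - (1 - l) *\<^sub>R u t - l *\<^sub>R u (t + h)) \<le> C * (h\<^sup>2 / (h + t) + h powr (2 - \<alpha>) * (\<bar>ln h\<bar> + 1)) \<and>
     norm (g (t + l * h) - (1 - l) *\<^sub>R g t - l *\<^sub>R g (t + h)) \<le> C * (h\<^sup>2 / (h + t) + h powr (2 - \<alpha>) * (\<bar>ln h\<bar> + 1))"
proof -
  obtain Cu where Cu: "Cu \<ge> 0" "\<And>s t. s \<in> {0..Tm} \<Longrightarrow> t \<in> {0..Tm} \<Longrightarrow> norm (u s - u t) \<le> Cu * \<bar>s - t\<bar>"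
    using u_Lipschitz by blast
  obtain M L2 F where T: "0 \<le> M" "0 \<le> L2" "\<And>t v. t \<in> {0..Tm} \<Longrightarrow> norm v \<le> R \<Longrightarrow> norm (F t v) \<le> M"
    "\<And>t1 t2 v1 v2. t1 \<in> {0..Tm} \<Longrightarrow> t2 \<in> {0..Tm} \<Longrightarrow> norm v1 \<le> R \<Longrightarrow> norm v2 \<le> R \<Longrightarrow>
       norm (f t2 v2 - f t1 v1 - blinfun_apply (F t1 v1) (t2 - t1, v2 - v1)) \<le> L2 * (\<bar>t2 - t1\<bar> + norm (v2 - v1))\<^sup>2"
    by (rule taylor, rule that, assumption+)
  obtain Cl where Cl: "Cl \<ge> 0" "\<And>h t. 0 < h \<Longrightarrow> h \<le> 1 \<Longrightarrow> 0 \<le> t \<Longrightarrow> t \<le> Tm \<Longrightarrow>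
     (\<lambda>\<xi>. (t - \<xi>) powr (- \<alpha>) * (h\<^sup>2 / (h + \<xi>))) integrable_on {0..t} \<and>
     integral {0..t} (\<lambda>\<xi>. (t - \<xi>) powr (- \<alpha>) * (h\<^sup>2 / (h + \<xi>))) \<le> Cl * (h powr (2 - \<alpha>) * (\<bar>ln h\<bar> + 1))"
    using kernel_log by blast
  \<comment> \<open>\<open>M\<close> is for the derivative applied to w, and there is one Taylor
    remainder each at l h and at h.\<close>
  define c where "c = M + 2 * (L2 * (1 + Cu)\<^sup>2)"
  have c: "0 \<le> c" using T by (simp add: c_def)
  obtain C where C: "C \<ge> 0" and V: "\<And>S0 w r G B K KB k. volterra c S0 w r G B K KB k \<Longrightarrow> (\<forall>t\<in>{0..S0}. norm (w t) \<le> B t + C * (K + KB + k))"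
    using volterra_ex[OF c] by metis
  define Lg where "Lg = L * (1 + Cu)"
  have Lg: "0 \<le> Lg" using L(1) Cu(1) by (simp add: Lg_def)
  have gL: "norm (g s - g t) \<le> Lg * \<bar>s - t\<bar>" if "s \<in> {0..Tm}" "t \<in> {0..Tm}" for s t
  proof -
    have "norm (g s - g t) \<le> L * (\<bar>s - t\<bar> + norm (u s - u t))" by (rule g_diff[OF that])
    also have "\<dots> \<le> L * (\<bar>s - t\<bar> + Cu * \<bar>s - t\<bar>)" using L(1) by (intro mult_left_mono add_left_mono Cu(2) that) auto
    finally show ?thesis by (simp add: Lg_def algebra_simps)
  qed
  define CB where "CB = 4 * Cu * Y.Tb Tm + 4 * (Y.ATb Tm * norm x0)"
  define CK where "CK = 2 * (Cv Tm * Tb Tm * Lg)"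
  have CB: "0 \<le> CB" using Cu(1) Y.Tb(1)[of Tm] Y.ATb(1)[of Tm] by (simp add: CB_def)
  have CK: "0 \<le> CK" using Cv_pos[of Tm] Tb(1)[of Tm] Lg by (simp add: CK_def)
  define Q where "Q s = integral {0..s} (\<lambda>\<xi>. V (s - \<xi>) (g \<xi> - g 0))" for s
  define I where "I s = integral {0..s} (\<lambda>\<sigma>. U \<sigma> x0)" for s
  \<comment> \<open>\<open>Q s\<close> is O(s^2) in X because g - g(0) is O(\<xi>) at time \<xi>;
    \<open>U t\<close> then acts as smoothing from X to X_\<alpha>, at the cost of
    t^(-\<alpha>).\<close>
  have UQ: "norm (U t (Q s)) \<le> Cv Tm * Tb Tm * Lg * t powr (- \<alpha>) * s\<^sup>2" if "0 < t" "0 \<le> s" "t + s \<le> Tm" for t s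
  proof -
    have i: "(\<lambda>\<xi>. V (s - \<xi>) (g \<xi> - g 0)) integrable_on {0..s}" using that by (intro u_expansion(1)) auto
    have iT: "(\<lambda>\<xi>. T (s - \<xi>) (g \<xi> - g 0)) integrable_on {0..s}"
    proof (rule conv_integrable)
      show "continuous_on {0<..<s} (\<lambda>\<xi>. g \<xi> - g 0)" using g_shift_cont[of 0 s] that by (intro continuous_intros) auto
      show "norm (g \<xi> - g 0) \<le> Lg * Tm" if "0 < \<xi>" "\<xi> < s" for \<xi>
        using that \<open>t + s \<le> Tm\<close> \<open>0 < t\<close> Lg by (intro order_trans[OF gL] mult_left_mono) auto
    qed
    have "norm (\<iota> (Q s)) \<le> integral {0..s} (\<lambda>_. Tb Tm * (Lg * s))"
      unfolding Q_def \<iota>_V_conv[OF i]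
    proof (rule integral_norm_bound_integral[OF iT integrable_const_ivl])
      fix \<xi> assume \<xi>: "\<xi> \<in> {0..s}"
      have "norm (T (s - \<xi>) (g \<xi> - g 0)) \<le> Tb Tm * norm (g \<xi> - g 0)" using that \<xi> by (intro Tb(2)) auto
      also have "\<dots> \<le> Tb Tm * (Lg * \<bar>\<xi> - 0\<bar>)" using that \<xi> Tb(1)[of Tm] by (intro mult_left_mono gL) auto
      also have "\<dots> \<le> Tb Tm * (Lg * s)" using \<xi> Tb(1)[of Tm] Lg by (intro mult_left_mono) auto
      finally show "norm (T (s - \<xi>) (g \<xi> - g 0)) \<le> Tb Tm * (Lg * s)" .
    qed
    then have 1: "norm (\<iota> (Q s)) \<le> Tb Tm * Lg * s\<^sup>2" using that by (simp add: power2_eq_square mult_ac)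
    have "norm (U t (Q s)) = norm (local.V t (\<iota> (Q s)))" using that by (simp add: V_\<iota>)
    also have "\<dots> \<le> Cv Tm * t powr (- \<alpha>) * norm (\<iota> (Q s))" using that by (intro V_bound) auto
    also have "\<dots> \<le> Cv Tm * t powr (- \<alpha>) * (Tb Tm * Lg * s\<^sup>2)" using 1 Cv_pos[of Tm] by (intro mult_left_mono) auto
    finally show ?thesis by (simp add: mult_ac)
  qed
  define C' where "C' = CB + C * (CK + CB * Cl + 1)"
  have C': "0 \<le> C'" using C CB CK Cl by (simp add: C'_def)
  have main: "norm (u (t + l * h) - (1 - l) *\<^sub>R u t - l *\<^sub>R u (t + h)) \<le> C' * (h\<^sup>2 / (h + t) + h powr (2 - \<alpha>) * (\<bar>ln h\<bar> + 1)) \<and>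
     norm (g (t + l * h) - (1 - l) *\<^sub>R g t - l *\<^sub>R g (t + h)) \<le> (c * (C' + 1)) * (h\<^sup>2 / (h + t) + h powr (2 - \<alpha>) * (\<bar>ln h\<bar> + 1))"
    if h: "0 < h" "h \<le> 1" and l: "0 \<le> l" "l \<le> 1" and t: "0 \<le> t" "t + h \<le> Tm" for h l t
  proof -
    let ?S = "Tm - h" and ?lh = "l * h"
    have lh: "0 \<le> ?lh" "?lh \<le> h" using h l by (auto simp: mult_left_le_one_le)
    define w where "w t = u (?lh + t) - (1 - l) *\<^sub>R u (0 + t) - l *\<^sub>R u (h + t)" for t
    define G where "G t = g (?lh + t) - (1 - l) *\<^sub>R g (0 + t) - l *\<^sub>R g (h + t)" for t
    have h2: "h\<^sup>2 \<le> h powr (2 - \<alpha>)"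
    proof -
      have "h powr 2 \<le> h powr (2 - \<alpha>)" using h \<alpha> by (intro powr_mono') auto
      then show ?thesis using h by simp
    qed
    have Gb: "norm (G t) \<le> c * (norm (w t) + h\<^sup>2)" if t: "t \<in> {0..?S}" for t
    proof -
      let ?p = "\<lambda>s. (s, u (s + t) - u t)"
      let ?F = "blinfun_apply (F t (u t))"
      let ?r = "\<lambda>s. g (s + t) - g (0 + t) - ?F (?p s)"
      have rb: "norm (?r s) \<le> L2 * (1 + Cu)\<^sup>2 * h\<^sup>2" if s: "0 \<le> s" "s \<le> h" for s
      proof -
        have "norm (?r s) \<le> L2 * (\<bar>s + t - t\<bar> + norm (u (s + t) - u t))\<^sup>2"
          using T(4)[of t "s + t" "u t" "u (s + t)"] s t h u_le_R by (simp add: g_def)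
        also have "\<dots> \<le> L2 * (h + Cu * h)\<^sup>2"
        proof (intro mult_left_mono power_mono add_mono T)
          have "norm (u (s + t) - u t) \<le> Cu * \<bar>s + t - t\<bar>" using s t h by (intro Cu(2)) auto
          also have "\<dots> \<le> Cu * h" using s Cu(1) by (intro mult_left_mono) auto
          finally show "norm (u (s + t) - u t) \<le> Cu * h" .
        qed (use s in auto)
        also have "\<dots> = L2 * (1 + Cu)\<^sup>2 * h\<^sup>2" by (simp add: power2_eq_square algebra_simps)
        finally show ?thesis .
      qed
      \<comment> \<open>The time components cancel, so the linear part of G sees only w.\<close>
      have "?p ?lh - l *\<^sub>R ?p h = (0, w t)" by (simp add: w_def algebra_simps)
      then have "?F (?p ?lh) - l *\<^sub>R ?F (?p h) = ?F (0, w t)"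
        by (simp only: blinfun.diff_right[symmetric] blinfun.scaleR_right[symmetric])
      then have "G t = ?r ?lh - l *\<^sub>R ?r h + ?F (0, w t)" by (simp add: G_def algebra_simps)
      then have "norm (G t) \<le> norm (?r ?lh) + norm (l *\<^sub>R ?r h) + norm (?F (0, w t))"
        by (simp only: norm_triangle_diff3)
      also have "norm (l *\<^sub>R ?r h) \<le> 1 * norm (?r h)" using l by (simp add: mult_left_le_one_le)
      also have "norm (?F (0, w t)) \<le> M * norm (w t)"
      proof -
        have "norm (?F (0, w t)) \<le> norm (F t (u t)) * norm ((0::real), w t)" by (rule norm_blinfun)
        also have "\<dots> \<le> M * norm ((0::real), w t)" using t h u_le_R by (intro mult_right_mono T(3)) auto
        finally show ?thesis by (simp add: norm_Pair)
      qed
      finally have "norm (G t) \<le> norm (?r ?lh) + 1 * norm (?r h) + M * norm (w t)" by simp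
      then have "norm (G t) \<le> 2 * (L2 * (1 + Cu)\<^sup>2 * h\<^sup>2) + M * norm (w t)"
        using rb[OF lh] rb[of h] h by simp
      also have "\<dots> \<le> c * (norm (w t) + h\<^sup>2)"
        using T by (simp add: c_def algebra_simps add_increasing)
      finally show ?thesis .
    qed
    have rB: "norm (U t (w 0)) \<le> CB * (h\<^sup>2 / (h + t)) + CK * h powr (2 - \<alpha>)" if t: "t \<in> {0..?S}" for t
    proof (cases "t < h")
      \<comment> \<open>Here h + t < 2 h, so that h itself is at most 2 h^2 / (h + t).\<close>
      case True
      have w0: "w 0 = (u ?lh - u 0) - l *\<^sub>R (u h - u 0)" by (simp add: w_def algebra_simps)
      have "norm (w 0) \<le> norm (u ?lh - u 0) + norm (l *\<^sub>R (u h - u 0))" unfolding w0 by (rule norm_triangle_ineq4)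
      also have "\<dots> \<le> Cu * h + 1 * (Cu * h)"
      proof (rule add_mono)
        have "?lh \<le> Tm" using lh(2) t unfolding atLeastAtMost_iff by linarith
        then have "norm (u ?lh - u 0) \<le> Cu * \<bar>?lh - 0\<bar>" using lh(1) Tm by (intro Cu(2)) auto
        also have "\<dots> \<le> Cu * h" using lh Cu(1) by (intro mult_left_mono) auto
        finally show "norm (u ?lh - u 0) \<le> Cu * h" .
        have "norm (u h - u 0) \<le> Cu * \<bar>h - 0\<bar>" using t h Tm by (intro Cu(2)) auto
        then show "norm (l *\<^sub>R (u h - u 0)) \<le> 1 * (Cu * h)" unfolding norm_scaleR using h l by (intro mult_mono) auto
      qed
      finally have "norm (w 0) \<le> 2 * Cu * h" by simp
      moreover have "norm (U t (w 0)) \<le> Y.Tb Tm * norm (w 0)" using t h by (intro Y.Tb(2)) auto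
      ultimately have "norm (U t (w 0)) \<le> Y.Tb Tm * (2 * Cu * h)"
        using Y.Tb(1)[of Tm] by (meson less_imp_le mult_left_mono order_trans)
      also have "\<dots> \<le> Y.Tb Tm * (2 * Cu * (2 * (h\<^sup>2 / (h + t))))"
      proof -
        have "h \<le> 2 * (h\<^sup>2 / (h + t))" using True h t by (simp add: field_simps power2_eq_square)
        then show ?thesis using Y.Tb(1)[of Tm] Cu(1) by (intro mult_left_mono) auto
      qed
      also have "\<dots> \<le> CB * (h\<^sup>2 / (h + t))"
      proof -
        have "4 * Cu * Y.Tb Tm * (h\<^sup>2 / (h + t)) \<le> CB * (h\<^sup>2 / (h + t))"
          using t h Y.ATb(1)[of Tm] by (intro mult_right_mono) (auto simp: CB_def)
        then show ?thesis by (simp add: mult_ac)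
      qed
      finally show ?thesis using CK by (simp add: add_increasing2)
    next
      case False
      then have t0: "0 < t" using h by simp
      have ue: "u s - u 0 = I s + Q s" if "0 \<le> s" "s \<le> Tm" for s
        using u_expansion(2)[OF that] by (simp add: I_def Q_def u_0)
      have "w 0 = (u ?lh - u 0) - l *\<^sub>R (u h - u 0)" by (simp add: w_def algebra_simps)
      also have "\<dots> = (I ?lh + Q ?lh) - l *\<^sub>R (I h + Q h)"
      proof -
        have "?lh \<le> Tm" using lh(2) t unfolding atLeastAtMost_iff by linarith
        then show ?thesis using ue[OF lh(1)] ue[of h] h t by simp
      qed
      finally have "U t (w 0) = (U t (I ?lh) + U t (Q ?lh)) - l *\<^sub>R (U t (I h) + U t (Q h))"
        using t0 by (simp add: Y.T_add Y.T_diff Y.T_scaleR)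
      \<comment> \<open>Subtracting s U(t) x0 from both \<open>I\<close> terms changes nothing,
        because the two corrections l h U(t) x0 cancel.\<close>
      also have "\<dots> = (U t (I ?lh) - ?lh *\<^sub>R U t x0) - l *\<^sub>R (U t (I h) - h *\<^sub>R U t x0) + (U t (Q ?lh) - l *\<^sub>R U t (Q h))"
        by (simp add: algebra_simps)
      finally have e: "norm (U t (w 0)) \<le> norm (U t (I ?lh) - ?lh *\<^sub>R U t x0) + norm (l *\<^sub>R (U t (I h) - h *\<^sub>R U t x0))
          + (norm (U t (Q ?lh)) + norm (l *\<^sub>R U t (Q h)))"
        by (simp only: norm_triangle_diff3)
      have Ib: "norm (U t (I s) - s *\<^sub>R U t x0) \<le> Y.ATb Tm * norm x0 * (2 * (h\<^sup>2 / (h + t)))" if s: "0 \<le> s" "s \<le> h" for s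
      proof -
        have "norm (U t (I s) - s *\<^sub>R U t x0) \<le> Y.ATb Tm * norm x0 * s\<^sup>2 / t"
          unfolding I_def using t0 s t by (intro U_integral_linear_part) auto
        also have "\<dots> \<le> Y.ATb Tm * norm x0 * h\<^sup>2 / t"
          using s t0 Y.ATb(1)[of Tm] by (intro divide_right_mono mult_left_mono power_mono) auto
        also have "\<dots> = Y.ATb Tm * norm x0 * (h\<^sup>2 / t)" by simp
        also have "h\<^sup>2 / t \<le> 2 * (h\<^sup>2 / (h + t))" using False t0 h by (simp add: field_simps)
        finally show ?thesis using Y.ATb(1)[of Tm] by (simp add: mult_left_mono)
      qed
      have Qb: "norm (U t (Q s)) \<le> Cv Tm * Tb Tm * Lg * h powr (2 - \<alpha>)" if s: "0 \<le> s" "s \<le> h" for s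
      proof -
        have "norm (U t (Q s)) \<le> Cv Tm * Tb Tm * Lg * t powr (- \<alpha>) * s\<^sup>2" using t0 s t by (intro UQ) auto
        also have "\<dots> \<le> Cv Tm * Tb Tm * Lg * h powr (- \<alpha>) * h\<^sup>2"
          using s h False \<alpha> Cv_pos[of Tm] Tb(1)[of Tm] Lg by (intro mult_mono power_mono powr_mono2' mult_nonneg_nonneg) auto
        also have "\<dots> = Cv Tm * Tb Tm * Lg * (h powr (- \<alpha>) * h powr 2)" using h by simp
        also have "h powr (- \<alpha>) * h powr 2 = h powr (2 - \<alpha>)" unfolding powr_add[symmetric] by simp
        finally show ?thesis .
      qed
      have l1: "norm (l *\<^sub>R x) \<le> norm x" for x :: 'b using l by (simp add: mult_left_le_one_le)
      have "norm (U t (w 0)) \<le> Y.ATb Tm * norm x0 * (2 * (h\<^sup>2 / (h + t))) + Y.ATb Tm * norm x0 * (2 * (h\<^sup>2 / (h + t)))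
          + (Cv Tm * Tb Tm * Lg * h powr (2 - \<alpha>) + Cv Tm * Tb Tm * Lg * h powr (2 - \<alpha>))"
        using h lh by (intro order_trans[OF e] add_mono order_trans[OF l1] Ib Qb) auto
      also have "\<dots> = 4 * (Y.ATb Tm * norm x0) * (h\<^sup>2 / (h + t)) + CK * h powr (2 - \<alpha>)" by (simp add: CK_def)
      also have "\<dots> \<le> CB * (h\<^sup>2 / (h + t)) + CK * h powr (2 - \<alpha>)"
        using h t Cu(1) Y.Tb(1)[of Tm] by (intro add_right_mono mult_right_mono) (auto simp: CB_def)
      finally show ?thesis .
    qed
    have nn: "0 \<le> CB * (Cl * (h powr (2 - \<alpha>) * (\<bar>ln h\<bar> + 1)))"
      using CB Cl(1) by (intro mult_nonneg_nonneg) auto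
    \<comment> \<open>The multiple of h^2 / (h + t) is the nonuniform part \<open>B\<close>; k = h^2
      comes from the Taylor remainders.\<close>
    have "volterra c ?S w (\<lambda>t. U t (w 0)) G (\<lambda>t. CB * (h\<^sup>2 / (h + t))) (CK * h powr (2 - \<alpha>))
        (CB * (Cl * (h powr (2 - \<alpha>) * (\<bar>ln h\<bar> + 1)))) (h\<^sup>2)"
      unfolding volterra_def
    proof (intro conjI exI[of _ "3 * R"])
      show "\<forall>t\<in>{0..?S}. norm (w t) \<le> 3 * R"
      proof
        fix t assume t: "t \<in> {0..?S}"
        have b: "norm (u (s + t)) \<le> R" if "0 \<le> s" "s \<le> h" for s using that t by (intro u_le_R) auto
        have "norm (w t) \<le> norm (u (?lh + t)) + norm ((1 - l) *\<^sub>R u (0 + t)) + norm (l *\<^sub>R u (h + t))"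
          unfolding w_def by (rule norm_triangle_diff3)
        also have "\<dots> \<le> R + 1 * R + 1 * R"
          unfolding norm_scaleR using l h R(1) b[of 0] b[of h] b[OF lh] by (intro add_mono mult_mono) auto
        finally show "norm (w t) \<le> 3 * R" by simp
      qed
      show "continuous_on {0<..<?S} G"
        unfolding G_def using h lh by (intro continuous_intros g_shift_cont) auto
      show "\<forall>t\<in>{0..?S}. w t = U t (w 0) + integral {0..t} (\<lambda>\<xi>. local.V (t - \<xi>) (G \<xi>))"
      proof
        fix t assume t: "t \<in> {0..?S}"
        have i: "((\<lambda>\<xi>. local.V (t - \<xi>) (g (s + \<xi>))) has_integral integral {0..t} (\<lambda>\<xi>. local.V (t - \<xi>) (g (s + \<xi>)))) {0..t}"
          if "0 \<le> s" "s \<le> h" for s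
          using t that by (intro integrable_integral V_conv_g_integrable) auto
        have "((\<lambda>\<xi>. local.V (t - \<xi>) (G \<xi>)) has_integral
            (integral {0..t} (\<lambda>\<xi>. local.V (t - \<xi>) (g (?lh + \<xi>))) - (1 - l) *\<^sub>R integral {0..t} (\<lambda>\<xi>. local.V (t - \<xi>) (g (0 + \<xi>)))
              - l *\<^sub>R integral {0..t} (\<lambda>\<xi>. local.V (t - \<xi>) (g (h + \<xi>))))) {0..t}"
          by (rule has_integral_spike_finite[OF _ _ has_integral_diff[OF has_integral_diff[OF i[OF lh] has_integral_cmul[OF i[of 0], of "1 - l"]]
                has_integral_cmul[OF i[of h], of l]], of "{t}"])
             (use h in \<open>auto simp: G_def linear_diff[OF bounded_linear.linear[OF V_bl]] linear_scale[OF bounded_linear.linear[OF V_bl]]\<close>)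
        note GI = integral_unique[OF this]
        have t': "0 \<le> t" "?lh + t \<le> Tm" "0 + t \<le> Tm" "h + t \<le> Tm"
          using t h lh(2) unfolding atLeastAtMost_iff by linarith+
        have U0: "U t (w 0) = U t (u ?lh) - (1 - l) *\<^sub>R U t (u 0) - l *\<^sub>R U t (u h)"
          using t'(1) by (simp add: w_def Y.T_diff Y.T_scaleR)
        show "w t = U t (w 0) + integral {0..t} (\<lambda>\<xi>. local.V (t - \<xi>) (G \<xi>))"
          unfolding GI U0 unfolding w_def u_shift[OF lh(1) t'(1,2)] u_shift[OF order_refl t'(1,3)] u_shift[OF less_imp_le[OF h(1)] t'(1,4)]
          by (simp add: scaleR_add_right)
      qed
      show "\<forall>t\<in>{0..?S}. norm (U t (w 0)) \<le> CB * (h\<^sup>2 / (h + t)) + CK * h powr (2 - \<alpha>)" using rB by blast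
      show "\<forall>t\<in>{0..?S}. norm (G t) \<le> c * (norm (w t) + h\<^sup>2)" using Gb by blast
      show "\<forall>t\<in>{0..?S}. (\<lambda>\<xi>. (t - \<xi>) powr (- \<alpha>) * (CB * (h\<^sup>2 / (h + \<xi>)))) integrable_on {0..t} \<and>
          integral {0..t} (\<lambda>\<xi>. (t - \<xi>) powr (- \<alpha>) * (CB * (h\<^sup>2 / (h + \<xi>)))) \<le> CB * (Cl * (h powr (2 - \<alpha>) * (\<bar>ln h\<bar> + 1)))"
      proof
        fix t assume t: "t \<in> {0..?S}"
        let ?f = "\<lambda>\<xi>. (t - \<xi>) powr (- \<alpha>) * (h\<^sup>2 / (h + \<xi>))"
        have f: "?f integrable_on {0..t}" "integral {0..t} ?f \<le> Cl * (h powr (2 - \<alpha>) * (\<bar>ln h\<bar> + 1))"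
          using Cl(2)[of h t] h t by auto
        have e: "(\<lambda>\<xi>. (t - \<xi>) powr (- \<alpha>) * (CB * (h\<^sup>2 / (h + \<xi>)))) = (\<lambda>\<xi>. CB * ?f \<xi>)" by (simp add: mult_ac)
        have i: "((\<lambda>\<xi>. CB * ?f \<xi>) has_integral CB * integral {0..t} ?f) {0..t}"
          by (intro has_integral_mult_right integrable_integral f)
        show "(\<lambda>\<xi>. (t - \<xi>) powr (- \<alpha>) * (CB * (h\<^sup>2 / (h + \<xi>)))) integrable_on {0..t} \<and>
          integral {0..t} (\<lambda>\<xi>. (t - \<xi>) powr (- \<alpha>) * (CB * (h\<^sup>2 / (h + \<xi>)))) \<le> CB * (Cl * (h powr (2 - \<alpha>) * (\<bar>ln h\<bar> + 1)))"
          unfolding e integral_unique[OF i] using f CB has_integral_integrable[OF i] by (intro conjI mult_left_mono) auto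
      qed
    qed (use h CB CK nn in auto)
    from V[OF this] t have wb: "norm (w t) \<le> CB * (h\<^sup>2 / (h + t)) + C * (CK * h powr (2 - \<alpha>) + CB * (Cl * (h powr (2 - \<alpha>) * (\<bar>ln h\<bar> + 1))) + h\<^sup>2)"
      by auto
    let ?a = "h\<^sup>2 / (h + t)" and ?b = "h powr (2 - \<alpha>) * (\<bar>ln h\<bar> + 1)"
    have ab: "0 \<le> ?a" "0 \<le> ?b" "h powr (2 - \<alpha>) \<le> ?b" "h\<^sup>2 \<le> ?b"
    proof -
      show "0 \<le> ?a" using h t by auto
      show "0 \<le> ?b" by (intro mult_nonneg_nonneg add_nonneg_nonneg) auto
      show 1: "h powr (2 - \<alpha>) \<le> ?b" using mult_left_mono[of 1 "\<bar>ln h\<bar> + 1" "h powr (2 - \<alpha>)"] by simp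
      show "h\<^sup>2 \<le> ?b" using h2 1 by linarith
    qed
    have "norm (w t) \<le> CB * ?a + C * (CK * ?b + CB * (Cl * ?b) + ?b)"
      using C CK ab(3,4) by (intro order_trans[OF wb] add_left_mono mult_left_mono add_mono order_refl) auto
    also have "\<dots> = CB * ?a + C * (CK + CB * Cl + 1) * ?b" by (simp add: algebra_simps)
    also have "\<dots> \<le> C' * ?a + C' * ?b"
      using C CB CK Cl(1) ab(1,2) by (intro add_mono mult_right_mono) (auto simp: C'_def)
    finally have W: "norm (w t) \<le> C' * (?a + ?b)" by (simp add: distrib_left)
    have "norm (G t) \<le> c * (norm (w t) + h\<^sup>2)" using Gb t by auto
    also have "\<dots> \<le> c * (C' * (?a + ?b) + 1 * (?a + ?b))"
      using W ab c by (intro mult_left_mono add_mono) auto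
    also have "\<dots> = (c * (C' + 1)) * (?a + ?b)" by (simp only: distrib_right mult.assoc)
    finally have "norm (G t) \<le> (c * (C' + 1)) * (?a + ?b)" .
    with W show ?thesis by (simp add: w_def G_def add.commute)
  qed
  let ?K = "C' + c * (C' + 1)"
  have le: "C' * x \<le> ?K * x" "c * (C' + 1) * x \<le> ?K * x" if "0 \<le> x" for x
    using that C' c by (intro mult_right_mono; simp)+
  show ?thesis
  proof (intro exI[of _ ?K] conjI allI impI)
    show "0 \<le> ?K" using C' c by simp
    fix h l t :: real assume p: "0 < h" "h \<le> 1" "0 \<le> l" "l \<le> 1" "0 \<le> t" "t + h \<le> Tm"
    have nn: "0 \<le> h\<^sup>2 / (h + t) + h powr (2 - \<alpha>) * (\<bar>ln h\<bar> + 1)"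
      using p(1,5) by (intro add_nonneg_nonneg mult_nonneg_nonneg divide_nonneg_nonneg) auto
    show "norm (u (t + l * h) - (1 - l) *\<^sub>R u t - l *\<^sub>R u (t + h)) \<le> ?K * (h\<^sup>2 / (h + t) + h powr (2 - \<alpha>) * (\<bar>ln h\<bar> + 1))"
      by (rule order_trans[OF conjunct1[OF main[OF p]] le(1)[OF nn]])
    show "norm (g (t + l * h) - (1 - l) *\<^sub>R g t - l *\<^sub>R g (t + h)) \<le> ?K * (h\<^sup>2 / (h + t) + h powr (2 - \<alpha>) * (\<bar>ln h\<bar> + 1))"
      by (rule order_trans[OF conjunct2[OF main[OF p]] le(2)[OF nn]])
  qed
qed

end

section \<open>Discrete sums\<close>

text \<open>A right-endpoint Riemann sum of the nonincreasing function x^(-q) lies below its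
  integral; the mean value theorem for x^(1 - q) / (1 - q) shows this term by term.\<close>

lemma power_sum_le:
  fixes q \<tau> :: real
  assumes q: "0 \<le> q" "q < 1" and \<tau>: "0 < \<tau>"
  shows "(\<Sum>k<n. \<tau> * (real (n - k) * \<tau>) powr (- q)) \<le> (real n * \<tau>) powr (1 - q) / (1 - q)"
proof -
  have "(\<Sum>k<n. \<tau> * (real (n - k) * \<tau>) powr (- q)) = (\<Sum>j<n. \<tau> * (real (Suc j) * \<tau>) powr (- q))"
    by (rule sum.reindex_bij_witness[of _ "\<lambda>j. n - Suc j" "\<lambda>k. n - Suc k"]) (auto simp: Suc_diff_Suc)
  also have "\<dots> \<le> (real n * \<tau>) powr (1 - q) / (1 - q)"
  proof (induction n)
    case 0
    then show ?case using q by simp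
  next
    case (Suc n)
    let ?f = "\<lambda>x. x powr (1 - q) / (1 - q)" and ?a = "real n * \<tau>" and ?b = "real (Suc n) * \<tau>"
    have ab: "?a < ?b" using \<tau> by simp
    obtain l z where z: "?a < z" "z < ?b" "DERIV ?f z :> l" "?f ?b - ?f ?a = (?b - ?a) * l"
    proof -
      have "0 \<le> x" if "?a \<le> x" for x
        using that \<tau> by (meson mult_nonneg_nonneg of_nat_0_le_iff less_imp_le order_trans)
      then have "continuous_on {?a..?b} ?f" using q \<tau>
        by (intro continuous_on_divide continuous_on_powr' continuous_on_id continuous_on_const) auto
      moreover have "?f differentiable (at x)" if "?a < x" for x
      proof -
        have "0 \<le> ?a" using \<tau> by simp
        then have "0 < x" using that by linarith
        then have "(?f has_real_derivative ((1 - q) * x powr (1 - q - 1) / (1 - q))) (at x)"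
          by (intro DERIV_cdivide) (auto intro!: derivative_eq_intros)
        then show ?thesis using real_differentiable_def by blast
      qed
      ultimately show ?thesis using MVT[OF ab, of ?f] that by blast
    qed
    have z0: "0 < z" using z(1) \<tau> by (meson le_less_trans mult_nonneg_nonneg of_nat_0_le_iff less_imp_le)
    have "(?f has_real_derivative ((1 - q) * z powr (1 - q - 1) / (1 - q))) (at z)"
      using z0 by (intro DERIV_cdivide) (auto intro!: derivative_eq_intros)
    from DERIV_unique[OF z(3) this] have l: "l = z powr (- q)" using q by simp
    have "?b powr (- q) \<le> z powr (- q)" using z z0 q by (intro powr_mono2') auto
    then have "\<tau> * ?b powr (- q) \<le> (?b - ?a) * l" using \<tau> by (simp add: l algebra_simps)
    then have "\<tau> * ?b powr (- q) \<le> ?f ?b - ?f ?a" using z(4) by simp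
    then show ?case using Suc by simp
  qed
  finally show ?thesis .
qed

text \<open>Discrete counterpart of \<open>kernel_weight\<close>: the kernel exponent rises to (1 +
  \<gamma>) / 2, and a factor \<mu>^(-(1 - \<gamma>)/2) is gained.\<close>

lemma weighted_power_sum_le:
  fixes \<gamma> \<tau> \<mu> Tm :: real
  assumes \<gamma>: "0 \<le> \<gamma>" "\<gamma> < 1" and \<tau>: "0 < \<tau>" and \<mu>: "0 < \<mu>" and n: "real n * \<tau> \<le> Tm"
  shows "(\<Sum>k<n. \<tau> * (real (n - k) * \<tau>) powr (- \<gamma>) * exp (\<mu> * (real k * \<tau>)))
    \<le> exp (\<mu> * (real n * \<tau>)) * ((Tm powr ((1 - \<gamma>) / 2) / ((1 - \<gamma>) / 2)) * \<mu> powr (- ((1 - \<gamma>) / 2)))"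
proof -
  let ?b = "(1 - \<gamma>) / 2"
  let ?q = "(1 + \<gamma>) / 2"
  have bq: "1 - ?q = ?b" by (simp add: field_simps)
  have "(\<Sum>k<n. \<tau> * (real (n - k) * \<tau>) powr (- \<gamma>) * exp (\<mu> * (real k * \<tau>)))
      \<le> (\<Sum>k<n. exp (\<mu> * (real n * \<tau>)) * \<mu> powr (- ?b) * (\<tau> * (real (n - k) * \<tau>) powr (- ?q)))"
  proof (rule sum_mono)
    fix k assume k: "k \<in> {..<n}"
    have "exp (\<mu> * (real k * \<tau>)) = exp (\<mu> * (real n * \<tau>)) * exp (- \<mu> * (real (n - k) * \<tau>))"
      using k by (simp add: mult_exp_exp of_nat_diff algebra_simps)
    then have "\<tau> * (real (n - k) * \<tau>) powr (- \<gamma>) * exp (\<mu> * (real k * \<tau>)) =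
        exp (\<mu> * (real n * \<tau>)) * \<tau> * ((real (n - k) * \<tau>) powr (- \<gamma>) * exp (- \<mu> * (real (n - k) * \<tau>)))" by simp
    also have "\<dots> \<le> exp (\<mu> * (real n * \<tau>)) * \<tau> * (\<mu> powr (- ?b) * (real (n - k) * \<tau>) powr (- ?q))"
      using k \<tau> by (intro mult_left_mono kernel_exp_le \<gamma> \<mu>) auto
    finally show "\<tau> * (real (n - k) * \<tau>) powr (- \<gamma>) * exp (\<mu> * (real k * \<tau>))
        \<le> exp (\<mu> * (real n * \<tau>)) * \<mu> powr (- ?b) * (\<tau> * (real (n - k) * \<tau>) powr (- ?q))" by (simp add: mult_ac)
  qed
  also have "\<dots> = exp (\<mu> * (real n * \<tau>)) * \<mu> powr (- ?b) * (\<Sum>k<n. \<tau> * (real (n - k) * \<tau>) powr (- ?q))"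
    by (simp add: sum_distrib_left)
  also have "\<dots> \<le> exp (\<mu> * (real n * \<tau>)) * \<mu> powr (- ?b) * ((real n * \<tau>) powr ?b / ?b)"
    using power_sum_le[of ?q \<tau> n] \<gamma> \<tau> unfolding bq by (intro mult_left_mono) auto
  also have "\<dots> \<le> exp (\<mu> * (real n * \<tau>)) * \<mu> powr (- ?b) * (Tm powr ?b / ?b)"
    using n \<gamma> \<tau> by (intro mult_left_mono divide_right_mono powr_mono2) auto
  finally show ?thesis by (simp add: mult_ac)
qed

text \<open>In the first part (n - k) \<tau> \<ge> \<tau> bounds the kernel by \<tau>^(-\<gamma>),
  and \<tau>^2 / (\<tau> + k \<tau>) = \<tau> / (k + 1) leaves a harmonic sum with n \<le> Tm /
  \<tau> terms. In the second the kernel sum is bounded and \<tau>^(2 - \<alpha>) \<le> \<tau>^(2 -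
  \<gamma>).\<close>

lemma defect_sum_le:
  fixes \<alpha> \<gamma> \<tau> Tm :: real
  assumes \<gamma>: "0 \<le> \<gamma>" "\<gamma> < 1" "\<alpha> \<le> \<gamma>" and \<tau>: "0 < \<tau>" "\<tau> \<le> 1" and n: "real n * \<tau> \<le> Tm"
  shows "(\<Sum>k<n. \<tau> * (real (n - k) * \<tau>) powr (- \<gamma>) * (\<tau>\<^sup>2 / (\<tau> + real k * \<tau>) + \<tau> powr (2 - \<alpha>) * (\<bar>ln \<tau>\<bar> + 1)))
    \<le> (\<bar>ln Tm\<bar> + 1 + Tm powr (1 - \<gamma>) / (1 - \<gamma>)) * (\<tau> powr (2 - \<gamma>) * (\<bar>ln \<tau>\<bar> + 1))"
proof -
  let ?w = "\<lambda>k. \<tau> * (real (n - k) * \<tau>) powr (- \<gamma>)" and ?l = "\<bar>ln \<tau>\<bar> + 1"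
  have Tm0: "0 \<le> Tm" using n \<tau> by (meson mult_nonneg_nonneg of_nat_0_le_iff less_imp_le order_trans)
  have A: "(\<Sum>k<n. ?w k * (\<tau>\<^sup>2 / (\<tau> + real k * \<tau>))) \<le> (\<bar>ln Tm\<bar> + 1) * (\<tau> powr (2 - \<gamma>) * ?l)"
  proof (cases "n = 0")
    case True then show ?thesis by simp
  next
    case False
    have "(\<Sum>k<n. ?w k * (\<tau>\<^sup>2 / (\<tau> + real k * \<tau>))) \<le> (\<Sum>k<n. \<tau> powr (2 - \<gamma>) * inverse (real (Suc k)))"
    proof (rule sum_mono)
      fix k assume k: "k \<in> {..<n}"
      have "\<tau> \<le> real (n - k) * \<tau>" using k \<tau> by simp
      then have "(real (n - k) * \<tau>) powr (- \<gamma>) \<le> \<tau> powr (- \<gamma>)" using \<tau> \<gamma> by (intro powr_mono2') auto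
      then have "?w k * (\<tau>\<^sup>2 / (\<tau> + real k * \<tau>)) \<le> \<tau> * \<tau> powr (- \<gamma>) * (\<tau>\<^sup>2 / (\<tau> + real k * \<tau>))"
        using \<tau> by (intro mult_right_mono mult_left_mono) auto
      also have "\<dots> = \<tau> * \<tau> powr (- \<gamma>) * (\<tau> * inverse (real (Suc k)))"
      proof -
        have "\<tau> + real k * \<tau> = \<tau> * real (Suc k)" by (simp add: algebra_simps)
        then show ?thesis using \<tau> by (simp add: power2_eq_square divide_inverse)
      qed
      also have "\<tau> * \<tau> powr (- \<gamma>) * (\<tau> * inverse (real (Suc k))) = \<tau> powr 2 * \<tau> powr (- \<gamma>) * inverse (real (Suc k))"
        using \<tau> by (simp add: power2_eq_square)
      also have "\<tau> powr 2 * \<tau> powr (- \<gamma>) = \<tau> powr (2 - \<gamma>)" unfolding powr_add[symmetric] by simp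
      finally show "?w k * (\<tau>\<^sup>2 / (\<tau> + real k * \<tau>)) \<le> \<tau> powr (2 - \<gamma>) * inverse (real (Suc k))" .
    qed
    also have "\<dots> = \<tau> powr (2 - \<gamma>) * harm n"
      unfolding sum_distrib_left[symmetric] harm_def
      by (intro arg_cong[where f="\<lambda>x. \<tau> powr (2 - \<gamma>) * x"] sum.reindex_bij_witness[of _ "\<lambda>k. k - 1" Suc]) auto
    also have "\<dots> \<le> \<tau> powr (2 - \<gamma>) * ((\<bar>ln Tm\<bar> + 1) * ?l)"
    proof (rule mult_left_mono)
      \<comment> \<open>The sequence harm n - ln n is decreasing from its value 1 at n = 1.\<close>
      have "harm n \<le> ln (real n) + (1::real)"
        using euler_mascheroni_sequence_decreasing[of 1 n] False by (simp add: harm_expand)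
      also have "real n \<le> Tm / \<tau>" using n \<tau> by (simp add: field_simps)
      then have "ln (real n) \<le> ln (Tm / \<tau>)" using False by simp
      also have "ln (Tm / \<tau>) = ln Tm - ln \<tau>"
      proof -
        have "0 < real n * \<tau>" using False \<tau> by simp
        then have "0 < Tm" using n by linarith
        then show ?thesis using \<tau> by (simp add: ln_div)
      qed
      finally have "harm n \<le> \<bar>ln Tm\<bar> + ?l" by linarith
      also have "\<dots> \<le> (\<bar>ln Tm\<bar> + 1) * ?l" using mult_left_mono[of 1 ?l "\<bar>ln Tm\<bar>"] by (simp add: algebra_simps)
      finally show "harm n \<le> (\<bar>ln Tm\<bar> + 1) * ?l" .
    qed simp
    finally show ?thesis by (simp add: mult_ac)
  qed
  have B: "(\<Sum>k<n. ?w k * (\<tau> powr (2 - \<alpha>) * ?l)) \<le> Tm powr (1 - \<gamma>) / (1 - \<gamma>) * (\<tau> powr (2 - \<gamma>) * ?l)"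
  proof -
    have "(\<Sum>k<n. ?w k * (\<tau> powr (2 - \<alpha>) * ?l)) = (\<Sum>k<n. ?w k) * (\<tau> powr (2 - \<alpha>) * ?l)"
      by (simp add: sum_distrib_right)
    also have "\<dots> \<le> ((real n * \<tau>) powr (1 - \<gamma>) / (1 - \<gamma>)) * (\<tau> powr (2 - \<alpha>) * ?l)"
      by (intro mult_right_mono power_sum_le \<gamma> \<tau>) auto
    also have "\<dots> \<le> (Tm powr (1 - \<gamma>) / (1 - \<gamma>)) * (\<tau> powr (2 - \<gamma>) * ?l)"
    proof (rule mult_mono)
      have l0: "0 \<le> ?l" by simp
      show "(real n * \<tau>) powr (1 - \<gamma>) / (1 - \<gamma>) \<le> Tm powr (1 - \<gamma>) / (1 - \<gamma>)"
        using n \<gamma> \<tau> by (intro divide_right_mono powr_mono2) auto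
      show "\<tau> powr (2 - \<alpha>) * ?l \<le> \<tau> powr (2 - \<gamma>) * ?l"
        using \<gamma>(3) \<tau> by (intro mult_right_mono powr_mono' l0) auto
      show "0 \<le> Tm powr (1 - \<gamma>) / (1 - \<gamma>)" using \<gamma> by simp
    qed (intro mult_nonneg_nonneg add_nonneg_nonneg; simp)
    finally show ?thesis .
  qed
  have "(\<Sum>k<n. ?w k * (\<tau>\<^sup>2 / (\<tau> + real k * \<tau>) + \<tau> powr (2 - \<alpha>) * ?l)) =
      (\<Sum>k<n. ?w k * (\<tau>\<^sup>2 / (\<tau> + real k * \<tau>))) + (\<Sum>k<n. ?w k * (\<tau> powr (2 - \<alpha>) * ?l))"
    by (simp add: distrib_left sum.distrib)
  also have "\<dots> \<le> (\<bar>ln Tm\<bar> + 1) * (\<tau> powr (2 - \<gamma>) * ?l) + Tm powr (1 - \<gamma>) / (1 - \<gamma>) * (\<tau> powr (2 - \<gamma>) * ?l)"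
    by (rule add_mono[OF A B])
  also have "\<dots> = (\<bar>ln Tm\<bar> + 1 + Tm powr (1 - \<gamma>) / (1 - \<gamma>)) * (\<tau> powr (2 - \<gamma>) * ?l)"
    by (simp add: distrib_right)
  finally show ?thesis .
qed

section \<open>The Runge--Kutta method\<close>

lemma (in sectorial_op) comb_op_N_uniform:
  fixes l :: "'i \<Rightarrow> phi_comb"
  assumes \<beta>: "0 \<le> \<beta>" "\<beta> < 1" and I: "finite I" and pos: "\<And>i w k \<sigma>. i \<in> I \<Longrightarrow> (w, k, \<sigma>) \<in> set (l i) \<Longrightarrow> 0 < \<sigma>"
  shows "\<exists>C\<ge>0. \<forall>i\<in>I. \<forall>t x. 0 < t \<longrightarrow> t \<le> t0 \<longrightarrow>
     comb_op D A (l i) t x \<in> DA \<beta> \<and> N \<beta> (comb_op D A (l i) t x) \<le> C * t powr (- \<beta>) * norm x"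
proof -
  have "\<forall>i\<in>I. \<exists>C\<ge>0. \<forall>t x. 0 < t \<longrightarrow> t \<le> t0 \<longrightarrow>
     comb_op D A (l i) t x \<in> DA \<beta> \<and> N \<beta> (comb_op D A (l i) t x) \<le> C * t powr (- \<beta>) * norm x"
    by (intro ballI comb_op_N \<beta>) (rule pos)
  then obtain C where C: "\<And>i. i \<in> I \<Longrightarrow> 0 \<le> C i" "\<And>i t x. i \<in> I \<Longrightarrow> 0 < t \<Longrightarrow> t \<le> t0 \<Longrightarrow>
     comb_op D A (l i) t x \<in> DA \<beta> \<and> N \<beta> (comb_op D A (l i) t x) \<le> C i * t powr (- \<beta>) * norm x"
    by metis
  show ?thesis
  proof (intro exI[of _ "sum C I"] conjI ballI allI impI)
    show "0 \<le> sum C I" by (rule sum_nonneg[OF C(1)])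
    fix i t x assume i: "i \<in> I" "0 < t" "t \<le> t0"
    show "comb_op D A (l i) t x \<in> DA \<beta>" using C(2)[OF i] by simp
    have "C i \<le> sum C I" by (rule member_le_sum[OF i(1) _ I]) (use C(1) in auto)
    then have "C i * (t powr (- \<beta>) * norm x) \<le> sum C I * (t powr (- \<beta>) * norm x)" by (intro mult_right_mono) auto
    then show "N \<beta> (comb_op D A (l i) t x) \<le> sum C I * t powr (- \<beta>) * norm x"
      using C(2)[OF i, of x] by (simp add: mult.assoc)
  qed
qed

locale runge_kutta = mild D A \<alpha> \<iota> f u0 u Tm
  for D :: "'a::complex_banach set" and A :: "'a \<Rightarrow> 'a" and \<alpha> :: real and \<iota> :: "'b::complex_banach \<Rightarrow> 'a"
    and f u0 u Tm +
  fixes s :: nat and c :: "nat \<Rightarrow> real" and b :: "nat \<Rightarrow> phi_comb" and a :: "nat \<Rightarrow> nat \<Rightarrow> phi_comb" and \<gamma> :: real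
  assumes rk_method: "eerk_method s c b a"
    and ord1: "\<And>z. (\<Sum>i\<in>{1..s}. comb_fun (b i) z) = phi 1 z"
    and ord2: "\<And>z. (\<Sum>i\<in>{1..s}. comb_fun (b i) z * of_real (c i)) = phi 2 z"
    and ord3: "\<And>i z. i \<in> {2..s} \<Longrightarrow> (\<Sum>j\<in>{1..<i}. comb_fun (a i j) z) = of_real (c i) * phi 1 (of_real (c i) * z)"
    and \<gamma>: "\<alpha> \<le> \<gamma>" "\<gamma> < 1"
begin

lemma \<gamma>_nonneg: "0 \<le> \<gamma>" using \<alpha>(1) \<gamma>(1) by linarith

lemma c: "c (Suc 0) = 0" "i \<in> {1..s} \<Longrightarrow> 0 \<le> c i" "i \<in> {1..s} \<Longrightarrow> c i \<le> 1"
  using rk_method by (auto simp: eerk_method_def)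

lemma b_pos: "i \<in> {1..s} \<Longrightarrow> (w, k, \<sigma>) \<in> set (b i) \<Longrightarrow> 0 < \<sigma>"
  using rk_method unfolding eerk_method_def by fastforce

lemma a_pos: "i \<in> {1..s} \<Longrightarrow> j \<in> {1..<i} \<Longrightarrow> (w, k, \<sigma>) \<in> set (a i j) \<Longrightarrow> 0 < \<sigma>"
  using rk_method unfolding eerk_method_def by fastforce

lemma b_sum: "(\<Sum>i\<in>{1..s}. comb_op D A (b i) t x) = phi_op D A 1 t x"
proof -
  have "(\<Sum>i\<in>{1..s}. 1 *\<^sub>C (\<Sum>(w, k, \<sigma>)\<leftarrow>b i. w *\<^sub>C phi_op D A k (\<sigma> * t) x)) = 1 *\<^sub>C phi_op D A 1 (1 * t) x"
    by (rule comb_identity[where G="\<lambda>k \<sigma>. phi_op D A k (\<sigma> * t) x"]) (use b_pos ord1 in auto)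
  then show ?thesis by (simp add: comb_op_def)
qed

lemma b_c_sum: "(\<Sum>i\<in>{1..s}. c i *\<^sub>R comb_op D A (b i) t x) = phi_op D A 2 t x"
proof -
  have "(\<Sum>i\<in>{1..s}. of_real (c i) *\<^sub>C (\<Sum>(w, k, \<sigma>)\<leftarrow>b i. w *\<^sub>C phi_op D A k (\<sigma> * t) x)) = 1 *\<^sub>C phi_op D A 2 (1 * t) x"
    by (rule comb_identity[where G="\<lambda>k \<sigma>. phi_op D A k (\<sigma> * t) x"]) (use b_pos ord2 in auto)
  then show ?thesis by (simp add: comb_op_def scaleC_of_real)
qed

text \<open>The order condition covers i \<ge> 2; for i = 1 the sum is empty and c_1 = 0.\<close>

lemma a_sum: assumes i: "i \<in> {1..s}" shows "(\<Sum>j\<in>{1..<i}. comb_op D A (a i j) t x) = c i *\<^sub>R phi_op D A 1 (c i * t) x"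
proof (cases "i = 1")
  case True then show ?thesis using c(1) by simp
next
  case False
  have "(\<Sum>j\<in>{1..<i}. 1 *\<^sub>C (\<Sum>(w, k, \<sigma>)\<leftarrow>a i j. w *\<^sub>C phi_op D A k (\<sigma> * t) x)) = of_real (c i) *\<^sub>C phi_op D A 1 (c i * t) x"
    by (rule comb_identity[where G="\<lambda>k \<sigma>. phi_op D A k (\<sigma> * t) x"])
       (use a_pos[OF i] ord3[of i] i False c(2)[OF i] in \<open>auto simp: less_le\<close>)
  then show ?thesis by (simp add: comb_op_def scaleC_of_real)
qed

section \<open>Errors of the internal stages\<close>

abbreviation fX where "fX \<equiv> \<lambda>t x. f t (inv \<iota> x)"
abbreviation stage where "stage \<tau> t v i \<equiv> eerk_stage D A c a fX \<tau> t v i"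
abbreviation step where
  "step \<tau> t v \<equiv> T \<tau> v + \<tau> *\<^sub>R (\<Sum>i\<in>{1..s}. comb_op D A (b i) \<tau> (fX (t + c i * \<tau>) (stage \<tau> t v i)))"

definition Lg where "Lg = (SOME C. 0 \<le> C \<and> (\<forall>s\<in>{0..Tm}. \<forall>t\<in>{0..Tm}. norm (g s - g t) \<le> C * \<bar>s - t\<bar>))"

lemma Lg: "0 \<le> Lg" "r \<in> {0..Tm} \<Longrightarrow> t \<in> {0..Tm} \<Longrightarrow> norm (g r - g t) \<le> Lg * \<bar>r - t\<bar>"
proof -
  obtain Cu where Cu: "Cu \<ge> 0" "\<And>r t. r \<in> {0..Tm} \<Longrightarrow> t \<in> {0..Tm} \<Longrightarrow> norm (u r - u t) \<le> Cu * \<bar>r - t\<bar>"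
    using u_Lipschitz by blast
  have "norm (g r - g t) \<le> L * (1 + Cu) * \<bar>r - t\<bar>" if "r \<in> {0..Tm}" "t \<in> {0..Tm}" for r t
  proof -
    have "norm (g r - g t) \<le> L * (\<bar>r - t\<bar> + norm (u r - u t))" by (rule g_diff[OF that])
    also have "\<dots> \<le> L * (\<bar>r - t\<bar> + Cu * \<bar>r - t\<bar>)" using L(1) by (intro mult_left_mono add_left_mono Cu(2) that) auto
    finally show ?thesis by (simp add: algebra_simps)
  qed
  then have "\<exists>C. 0 \<le> C \<and> (\<forall>r\<in>{0..Tm}. \<forall>t\<in>{0..Tm}. norm (g r - g t) \<le> C * \<bar>r - t\<bar>)"
    using L(1) Cu(1) by (intro exI[of _ "L * (1 + Cu)"]) auto
  from someI_ex[OF this] show "0 \<le> Lg" "r \<in> {0..Tm} \<Longrightarrow> t \<in> {0..Tm} \<Longrightarrow> norm (g r - g t) \<le> Lg * \<bar>r - t\<bar>"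
    unfolding Lg_def by auto
qed

text \<open>By the condition on the \<open>a i j\<close> the stage integrates the constant g(t)
  exactly, so g(t) can be subtracted both in the stage sum and under the integral for the exact
  solution.\<close>

lemma stage_defect:
  assumes \<tau>: "0 < \<tau>" and t: "0 \<le> t" "t + \<tau> \<le> Tm" and i: "i \<in> {1..s}"
  shows "stage \<tau> t v i - \<iota> (u (t + c i * \<tau>)) = T (c i * \<tau>) (v - \<iota> (u t))
     + \<tau> *\<^sub>R (\<Sum>j\<in>{1..<i}. comb_op D A (a i j) \<tau> (fX (t + c j * \<tau>) (stage \<tau> t v j) - g (t + c j * \<tau>)))
     + \<tau> *\<^sub>R (\<Sum>j\<in>{1..<i}. comb_op D A (a i j) \<tau> (g (t + c j * \<tau>) - g t))
     - integral {0..c i * \<tau>} (\<lambda>\<xi>. T (c i * \<tau> - \<xi>) (g (t + \<xi>) - g t))"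
proof -
  let ?h = "c i * \<tau>"
  have h: "0 \<le> ?h" "?h \<le> \<tau>" using c(2,3)[OF i] \<tau> by (auto simp: mult_left_le_one_le)
  let ?F = "\<lambda>j. fX (t + c j * \<tau>) (stage \<tau> t v j)" and ?g = "\<lambda>j. g (t + c j * \<tau>)"
  have lin: "comb_op D A (a i j) \<tau> (x - y) = comb_op D A (a i j) \<tau> x - comb_op D A (a i j) \<tau> y" if "j \<in> {1..<i}" for j x y
    by (rule comb_op_linear(3)[OF a_pos[OF i that] \<tau>])
  have 1: "(\<Sum>j\<in>{1..<i}. comb_op D A (a i j) \<tau> (?F j)) = (\<Sum>j\<in>{1..<i}. comb_op D A (a i j) \<tau> (?F j - ?g j))
      + (\<Sum>j\<in>{1..<i}. comb_op D A (a i j) \<tau> (?g j - g t)) + (\<Sum>j\<in>{1..<i}. comb_op D A (a i j) \<tau> (g t))"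
    by (simp add: lin sum_subtractf)
  have i1: "(\<lambda>\<xi>. T (?h - \<xi>) (g (t + \<xi>))) integrable_on {0..?h}" by (rule conv_g_integrable) (use h t in auto)
  have i2: "(\<lambda>\<xi>. T (?h - \<xi>) (g t)) integrable_on {0..?h}" by (rule conv_integrable) auto
  have "integral {0..?h} (\<lambda>\<xi>. T (?h - \<xi>) (g (t + \<xi>) - g t)) = integral {0..?h} (\<lambda>\<xi>. T (?h - \<xi>) (g (t + \<xi>)) - T (?h - \<xi>) (g t))"
    by (intro integral_cong) (simp add: T_diff)
  also have "\<dots> = integral {0..?h} (\<lambda>\<xi>. T (?h - \<xi>) (g (t + \<xi>))) - integral {0..?h} (\<lambda>\<xi>. T (?h - \<xi>) (g t))"
    by (rule Henstock_Kurzweil_Integration.integral_diff[OF i1 i2])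
  also have "integral {0..?h} (\<lambda>\<xi>. T (?h - \<xi>) (g t)) = \<tau> *\<^sub>R (\<Sum>j\<in>{1..<i}. comb_op D A (a i j) \<tau> (g t))"
  proof (cases "c i = 0")
    case True
    then show ?thesis using a_sum[OF i, of \<tau> "g t"] by simp
  next
    case False
    then have "0 < ?h" using c(2)[OF i] \<tau> by simp
    from phi_op_conv[OF this, of 1 "g t"] show ?thesis using a_sum[OF i, of \<tau> "g t"] by (simp add: mult.commute)
  qed
  finally have 2: "integral {0..?h} (\<lambda>\<xi>. T (?h - \<xi>) (g (t + \<xi>))) = integral {0..?h} (\<lambda>\<xi>. T (?h - \<xi>) (g (t + \<xi>) - g t))
      + \<tau> *\<^sub>R (\<Sum>j\<in>{1..<i}. comb_op D A (a i j) \<tau> (g t))" by (simp add: algebra_simps)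
  have 3: "\<iota> (u (t + ?h)) = T ?h (\<iota> (u t)) + integral {0..?h} (\<lambda>\<xi>. T (?h - \<xi>) (g (t + \<xi>)))"
    by (rule u_shift_X) (use h t in auto)
  have 4: "stage \<tau> t v i = T ?h v + \<tau> *\<^sub>R (\<Sum>j\<in>{1..<i}. comb_op D A (a i j) \<tau> (?F j))"
    by (simp add: eerk_stage.simps[of D A c a fX \<tau> t v i])
  show ?thesis unfolding 3 4 2 1 using h by (simp add: T_diff scaleR_add_right algebra_simps)
qed

text \<open>The size of the stage errors in X_\<alpha>, up to a constant. In \<tau>^(2 - \<alpha>)
  one factor \<tau> is from the increments of g, and \<tau>^(1 - \<alpha>) from a smoothed integral
  over one step.\<close>

definition quant where "quant \<tau> t v = N \<gamma> (v - \<iota> (u t)) + \<tau> powr (2 - \<alpha>)"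

definition admissible where
  "admissible \<tau> t v \<longleftrightarrow> 0 < \<tau> \<and> \<tau> \<le> 1 \<and> 0 \<le> t \<and> t + \<tau> \<le> Tm \<and> v - \<iota> (u t) \<in> DA \<gamma>"

text \<open>Induction on the number of stages. The Lipschitz constant applies only to stages in the
  ball of radius \<open>R\<close>, whence the smallness condition; K grows with each stage, and the
  condition tightens accordingly.\<close>

lemma stage_error:
  assumes "n \<le> s"
  shows "\<exists>K\<ge>0. \<forall>\<tau> t v i. admissible \<tau> t v \<longrightarrow> K * quant \<tau> t v \<le> 1 \<longrightarrow> i \<in> {1..n} \<longrightarrow>
    stage \<tau> t v i - \<iota> (u (t + c i * \<tau>)) \<in> range \<iota> \<and> norm (inv \<iota> (stage \<tau> t v i - \<iota> (u (t + c i * \<tau>)))) \<le> K * quant \<tau> t v \<and>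
    norm (fX (t + c i * \<tau>) (stage \<tau> t v i) - g (t + c i * \<tau>)) \<le> L * (K * quant \<tau> t v)"
  using assms
proof (induction n)
  case 0
  show ?case by (intro exI[of _ 0]) auto
next
  case (Suc n)
  let ?i = "Suc n"
  have i: "?i \<in> {1..s}" using Suc.prems by auto
  obtain K where K: "0 \<le> K" "\<And>\<tau> t v i. admissible \<tau> t v \<Longrightarrow> K * quant \<tau> t v \<le> 1 \<Longrightarrow> i \<in> {1..n} \<Longrightarrow>
    norm (fX (t + c i * \<tau>) (stage \<tau> t v i) - g (t + c i * \<tau>)) \<le> L * (K * quant \<tau> t v)"
    and K': "\<And>\<tau> t v i. admissible \<tau> t v \<Longrightarrow> K * quant \<tau> t v \<le> 1 \<Longrightarrow> i \<in> {1..n} \<Longrightarrow>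
    stage \<tau> t v i - \<iota> (u (t + c i * \<tau>)) \<in> range \<iota> \<and> norm (inv \<iota> (stage \<tau> t v i - \<iota> (u (t + c i * \<tau>)))) \<le> K * quant \<tau> t v"
    using Suc by (metis Suc_leD)
  obtain Ca where Ca: "0 \<le> Ca" "\<And>j t x. j \<in> {1..<?i} \<Longrightarrow> 0 < t \<Longrightarrow> t \<le> Tm \<Longrightarrow>
     comb_op D A (a ?i j) t x \<in> DA \<alpha> \<and> N \<alpha> (comb_op D A (a ?i j) t x) \<le> Ca * t powr (- \<alpha>) * norm x"
    using comb_op_N_uniform[OF \<alpha>, of "{1..<?i}" "a ?i" Tm] a_pos[OF i] by blast
  \<comment> \<open>In this order: the propagated error, the errors of the earlier stages, the
    increments of g in the stage sum, and those under the integral.\<close>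
  define B where "B = Y.Tb Tm * Ce + Ce * (real n * (Ca * (L * K)) + real n * (Ca * Lg) + Cconv \<alpha> Tm * Lg)"
  have B: "0 \<le> B"
    using Y.Tb(1)[of Tm] Ce(1) Ca(1) L(1) K(1) Lg(1) Cconv_pos[OF \<alpha>, of Tm] by (simp add: B_def)
  have main: "stage \<tau> t v ?i - \<iota> (u (t + c ?i * \<tau>)) \<in> range \<iota> \<and>
      norm (inv \<iota> (stage \<tau> t v ?i - \<iota> (u (t + c ?i * \<tau>)))) \<le> B * quant \<tau> t v"
    if ad: "admissible \<tau> t v" and q: "K * quant \<tau> t v \<le> 1" for \<tau> t v
  proof -
    have \<tau>: "0 < \<tau>" "\<tau> \<le> 1" and t: "0 \<le> t" "t + \<tau> \<le> Tm" and E: "v - \<iota> (u t) \<in> DA \<gamma>"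
      using ad by (auto simp: admissible_def)
    let ?h = "c ?i * \<tau>" and ?p = "\<tau> powr (2 - \<alpha>)" and ?q = "quant \<tau> t v"
    have h: "0 \<le> ?h" "?h \<le> \<tau>" using c(2,3)[OF i] \<tau> by (auto simp: mult_left_le_one_le)
    have cj: "0 \<le> c j * \<tau>" "c j * \<tau> \<le> \<tau>" if "j \<in> {1..<?i}" for j
      using c(2,3)[of j] that i \<tau> by (auto simp: mult_left_le_one_le)
    have E0: "0 \<le> N \<gamma> (v - \<iota> (u t))" by (rule N_nonneg[OF E])
    have pq: "0 \<le> ?q" "?p \<le> ?q" "N \<gamma> (v - \<iota> (u t)) \<le> ?q" using E0 by (auto simp: quant_def)
    have p1: "\<tau> * \<tau> powr (- \<alpha>) \<le> 1"
    proof -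
      have "\<tau> * \<tau> powr (- \<alpha>) = \<tau> powr (1 - \<alpha>)" using \<tau> by (simp add: powr_diff powr_minus divide_inverse)
      also have "\<dots> \<le> 1" using \<tau> \<alpha> by (intro powr_le1) auto
      finally show ?thesis .
    qed
    have p2: "\<tau> * \<tau> powr (- \<alpha>) * \<tau> = ?p"
    proof -
      have "\<tau> * \<tau> powr (- \<alpha>) * \<tau> = \<tau> powr 2 * \<tau> powr (- \<alpha>)" using \<tau> by (simp add: power2_eq_square)
      also have "\<dots> = ?p" unfolding powr_add[symmetric] by simp
      finally show ?thesis .
    qed
    define t2 where "t2 = \<tau> *\<^sub>R (\<Sum>j\<in>{1..<?i}. comb_op D A (a ?i j) \<tau> (fX (t + c j * \<tau>) (stage \<tau> t v j) - g (t + c j * \<tau>)))"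
    define t3 where "t3 = \<tau> *\<^sub>R (\<Sum>j\<in>{1..<?i}. comb_op D A (a ?i j) \<tau> (g (t + c j * \<tau>) - g t))"
    define t4 where "t4 = integral {0..?h} (\<lambda>\<xi>. T (?h - \<xi>) (g (t + \<xi>) - g t))"
    have sumN: "\<tau> *\<^sub>R (\<Sum>j\<in>{1..<?i}. comb_op D A (a ?i j) \<tau> (x j)) \<in> DA \<alpha> \<and>
        N \<alpha> (\<tau> *\<^sub>R (\<Sum>j\<in>{1..<?i}. comb_op D A (a ?i j) \<tau> (x j))) \<le> real n * (Ca * (\<tau> * \<tau> powr (- \<alpha>) * X))"
      if x: "\<And>j. j \<in> {1..<?i} \<Longrightarrow> norm (x j) \<le> X" for x X
    proof -
      have m: "comb_op D A (a ?i j) \<tau> (x j) \<in> DA \<alpha>" "N \<alpha> (comb_op D A (a ?i j) \<tau> (x j)) \<le> Ca * \<tau> powr (- \<alpha>) * X"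
        if "j \<in> {1..<?i}" for j
      proof -
        show "comb_op D A (a ?i j) \<tau> (x j) \<in> DA \<alpha>" using Ca(2)[OF that \<tau>(1)] t by simp
        have "N \<alpha> (comb_op D A (a ?i j) \<tau> (x j)) \<le> Ca * \<tau> powr (- \<alpha>) * norm (x j)" using Ca(2)[OF that \<tau>(1)] t by simp
        also have "\<dots> \<le> Ca * \<tau> powr (- \<alpha>) * X" using Ca(1) x[OF that] by (intro mult_left_mono) auto
        finally show "N \<alpha> (comb_op D A (a ?i j) \<tau> (x j)) \<le> Ca * \<tau> powr (- \<alpha>) * X" .
      qed
      have s: "(\<Sum>j\<in>{1..<?i}. comb_op D A (a ?i j) \<tau> (x j)) \<in> DA \<alpha>" by (rule DA_N_sum(1)) (use m in auto)
      have "N \<alpha> (\<tau> *\<^sub>R (\<Sum>j\<in>{1..<?i}. comb_op D A (a ?i j) \<tau> (x j))) \<le> \<bar>\<tau>\<bar> * (\<Sum>j\<in>{1..<?i}. Ca * \<tau> powr (- \<alpha>) * X)"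
        by (intro order_trans[OF DA_N_scaleR(2)[OF s]] mult_left_mono order_trans[OF DA_N_sum(2)] sum_mono m) auto
      also have "\<dots> = real n * (Ca * (\<tau> * \<tau> powr (- \<alpha>) * X))" using \<tau> by simp
      finally show ?thesis using DA_N_scaleR(1)[OF s] by simp
    qed
    have T2: "t2 \<in> DA \<alpha>" "N \<alpha> t2 \<le> real n * (Ca * (L * K)) * ?q"
    proof -
      have x: "norm (fX (t + c j * \<tau>) (stage \<tau> t v j) - g (t + c j * \<tau>)) \<le> L * (K * ?q)" if "j \<in> {1..<?i}" for j
        by (rule K(2)[OF ad q]) (use that in auto)
      show "t2 \<in> DA \<alpha>" unfolding t2_def by (rule conjunct1[OF sumN[of "\<lambda>j. fX (t + c j * \<tau>) (stage \<tau> t v j) - g (t + c j * \<tau>)" "L * (K * ?q)", OF x]])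
      have "N \<alpha> t2 \<le> real n * (Ca * (\<tau> * \<tau> powr (- \<alpha>) * (L * (K * ?q))))" 
        unfolding t2_def by (rule conjunct2[OF sumN[of "\<lambda>j. fX (t + c j * \<tau>) (stage \<tau> t v j) - g (t + c j * \<tau>)" "L * (K * ?q)", OF x]])
      also have "\<dots> \<le> real n * (Ca * (1 * (L * (K * ?q))))"
        using p1 Ca(1) L(1) K(1) pq by (intro mult_left_mono mult_right_mono) auto
      finally show "N \<alpha> t2 \<le> real n * (Ca * (L * K)) * ?q" by (simp add: mult_ac)
    qed
    have gd: "norm (g (t + \<xi>) - g t) \<le> Lg * \<tau>" if "0 \<le> \<xi>" "\<xi> \<le> \<tau>" for \<xi>
    proof -
      have "norm (g (t + \<xi>) - g t) \<le> Lg * \<bar>t + \<xi> - t\<bar>" using that t \<tau> by (intro Lg(2)) auto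
      also have "\<dots> \<le> Lg * \<tau>" using that Lg(1) by (intro mult_left_mono) auto
      finally show ?thesis .
    qed
    have T3: "t3 \<in> DA \<alpha>" "N \<alpha> t3 \<le> real n * (Ca * Lg) * ?q"
    proof -
      have x: "norm (g (t + c j * \<tau>) - g t) \<le> Lg * \<tau>" if "j \<in> {1..<?i}" for j
        using gd cj[OF that] by simp
      show "t3 \<in> DA \<alpha>" unfolding t3_def by (rule conjunct1[OF sumN[of "\<lambda>j. g (t + c j * \<tau>) - g t" "Lg * \<tau>", OF x]])
      have "N \<alpha> t3 \<le> real n * (Ca * (\<tau> * \<tau> powr (- \<alpha>) * (Lg * \<tau>)))" 
        unfolding t3_def by (rule conjunct2[OF sumN[of "\<lambda>j. g (t + c j * \<tau>) - g t" "Lg * \<tau>", OF x]])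
      also have "\<dots> = real n * (Ca * Lg) * (\<tau> * \<tau> powr (- \<alpha>) * \<tau>)" by simp
      also have "\<dots> \<le> real n * (Ca * Lg) * ?q" unfolding p2 using pq Ca(1) Lg(1) by (intro mult_left_mono) auto
      finally show "N \<alpha> t3 \<le> real n * (Ca * Lg) * ?q" .
    qed
    have T4: "t4 \<in> DA \<alpha>" "N \<alpha> t4 \<le> Cconv \<alpha> Tm * Lg * ?q"
    proof -
      have "t4 \<in> DA \<alpha> \<and> N \<alpha> t4 \<le> Cconv \<alpha> Tm * Lg * ?q"
      proof (cases "?h = 0")
        case True
        then show ?thesis using DA_N_zero[of \<alpha>] Cconv_pos[OF \<alpha>, of Tm] Lg(1) pq unfolding t4_def True by simp
      next
        case False
        then have h0: "0 < ?h" "?h \<le> Tm" using h t by linarith+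
        have cg: "continuous_on {0<..<?h} (\<lambda>\<xi>. g (t + \<xi>) - g t)" using h t by (intro continuous_intros g_shift_cont) auto
        have bg: "norm (g (t + \<xi>) - g t) \<le> Lg * \<tau>" if "0 < \<xi>" "\<xi> < ?h" for \<xi> using gd[of \<xi>] that h by auto
        have m: "t4 \<in> DA \<alpha>" "N \<alpha> t4 \<le> Cconv \<alpha> Tm * ?h powr (1 - \<alpha>) * (Lg * \<tau>)"
          unfolding t4_def Cconv_def by (rule conv_smooth[OF \<alpha> h0 cg bg]; assumption)+
        have "?h powr (1 - \<alpha>) \<le> \<tau> powr (1 - \<alpha>)" using h \<alpha> by (intro powr_mono2) auto
        then have "Cconv \<alpha> Tm * ?h powr (1 - \<alpha>) * (Lg * \<tau>) \<le> Cconv \<alpha> Tm * \<tau> powr (1 - \<alpha>) * (Lg * \<tau>)"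
          using Cconv_pos[OF \<alpha>, of Tm] Lg(1) \<tau> by (intro mult_right_mono mult_left_mono) auto
        also have "\<dots> = Cconv \<alpha> Tm * Lg * (\<tau> * \<tau> powr (- \<alpha>) * \<tau>)"
          using \<tau> by (simp add: powr_diff powr_minus divide_inverse)
        also have "\<dots> \<le> Cconv \<alpha> Tm * Lg * ?q"
          unfolding p2 using pq Cconv_pos[OF \<alpha>, of Tm] Lg(1) by (intro mult_left_mono) auto
        finally show ?thesis using m by simp
      qed
      then show "t4 \<in> DA \<alpha>" "N \<alpha> t4 \<le> Cconv \<alpha> Tm * Lg * ?q" by auto
    qed
    have rE: "v - \<iota> (u t) \<in> range \<iota>" by (rule Ce(2)[OF \<gamma>(1) E])
    \<comment> \<open>c_i may be 0, so the incoming error has to be propagated without a smoothing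
      factor; it lies in X_\<alpha>, where \<open>U\<close> is bounded.\<close>
    have t1: "T ?h (v - \<iota> (u t)) = \<iota> (U ?h (inv \<iota> (v - \<iota> (u t))))"
      using intertwine[OF h(1)] \<iota>_inv[OF rE] by simp
    have "norm (U ?h (inv \<iota> (v - \<iota> (u t)))) \<le> Y.Tb Tm * norm (inv \<iota> (v - \<iota> (u t)))" using h t by (intro Y.Tb(2)) auto
    also have "\<dots> \<le> Y.Tb Tm * (Ce * ?q)"
      using Y.Tb(1)[of Tm] Ce(1) pq by (intro mult_left_mono order_trans[OF Ce(3)[OF \<gamma>(1) E]]) auto
    finally have n1: "norm (U ?h (inv \<iota> (v - \<iota> (u t)))) \<le> Y.Tb Tm * Ce * ?q" by simp
    define r where "r = t2 + t3 - t4"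
    have r: "r \<in> DA \<alpha>" "N \<alpha> r \<le> N \<alpha> t2 + N \<alpha> t3 + N \<alpha> t4"
      unfolding r_def using DA_N_diff[OF DA_N_add(1)[OF T2(1) T3(1)] T4(1)] DA_N_add(2)[OF T2(1) T3(1)] by auto
    have rr: "r \<in> range \<iota>" by (rule Ce(2)[OF order_refl r(1)])
    have "stage \<tau> t v ?i - \<iota> (u (t + ?h)) = T ?h (v - \<iota> (u t)) + r"
      using stage_defect[OF \<tau>(1) t i, of v] by (simp add: r_def t2_def t3_def t4_def)
    also have "\<dots> = \<iota> (U ?h (inv \<iota> (v - \<iota> (u t))) + inv \<iota> r)" by (simp add: t1 \<iota>.add \<iota>_inv[OF rr])
    finally have e: "stage \<tau> t v ?i - \<iota> (u (t + ?h)) = \<iota> (U ?h (inv \<iota> (v - \<iota> (u t))) + inv \<iota> r)" .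
    have "norm (inv \<iota> r) \<le> Ce * N \<alpha> r" by (rule Ce(3)[OF order_refl r(1)])
    also have "\<dots> \<le> Ce * (real n * (Ca * (L * K)) * ?q + real n * (Ca * Lg) * ?q + Cconv \<alpha> Tm * Lg * ?q)"
      using r(2) T2(2) T3(2) T4(2) Ce(1) by (intro mult_left_mono) auto
    finally have "norm (U ?h (inv \<iota> (v - \<iota> (u t))) + inv \<iota> r) \<le> B * ?q"
      using norm_triangle_ineq[of "U ?h (inv \<iota> (v - \<iota> (u t)))" "inv \<iota> r"] n1 by (simp add: B_def algebra_simps)
    then show ?thesis unfolding e by simp
  qed
  show ?case
  proof (intro exI[of _ "K + B"] conjI allI impI)
    show "0 \<le> K + B" using K(1) B by simp
    fix \<tau> t v j assume ad: "admissible \<tau> t v" and q: "(K + B) * quant \<tau> t v \<le> 1" and j: "j \<in> {1..?i}"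
    let ?q = "quant \<tau> t v"
    have \<tau>: "0 < \<tau>" "\<tau> \<le> 1" and t: "0 \<le> t" "t + \<tau> \<le> Tm" and E: "v - \<iota> (u t) \<in> DA \<gamma>"
      using ad by (auto simp: admissible_def)
    have q0: "0 \<le> ?q" using N_nonneg[OF E] by (simp add: quant_def)
    have Kq: "K * ?q \<le> (K + B) * ?q" "B * ?q \<le> (K + B) * ?q" using K(1) B q0 by (simp_all add: mult_right_mono)
    have K1: "K * ?q \<le> 1" using Kq q by linarith
    have st: "stage \<tau> t v j - \<iota> (u (t + c j * \<tau>)) \<in> range \<iota> \<and>
       norm (inv \<iota> (stage \<tau> t v j - \<iota> (u (t + c j * \<tau>)))) \<le> (K + B) * ?q"
    proof (cases "j = ?i")
      case True
      then show ?thesis using main[OF ad K1] Kq by auto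
    next
      case False
      then have "j \<in> {1..n}" using j by auto
      from K'[OF ad K1 this] show ?thesis using Kq by auto
    qed
    then show "stage \<tau> t v j - \<iota> (u (t + c j * \<tau>)) \<in> range \<iota>"
      "norm (inv \<iota> (stage \<tau> t v j - \<iota> (u (t + c j * \<tau>)))) \<le> (K + B) * ?q" by auto
    let ?e = "inv \<iota> (stage \<tau> t v j - \<iota> (u (t + c j * \<tau>)))"
    have "j \<in> {1..s}" using j i by auto
    then have cj: "0 \<le> c j * \<tau>" "c j * \<tau> \<le> \<tau>" using c(2,3)[of j] \<tau> by (auto simp: mult_left_le_one_le)
    then have tj: "t + c j * \<tau> \<in> {0..Tm}" using t by auto
    have "stage \<tau> t v j = \<iota> (?e + u (t + c j * \<tau>))" using st by (simp add: \<iota>.add \<iota>_inv)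
    from arg_cong[OF this, of "inv \<iota>"] have inv: "inv \<iota> (stage \<tau> t v j) = ?e + u (t + c j * \<tau>)" by (simp only: inv_\<iota>)
    \<comment> \<open>The margin 1 in the definition of \<open>R\<close> keeps the stage in the
      ball.\<close>
    have "norm ?e \<le> 1" using st q by linarith
    then have "norm (?e + u (t + c j * \<tau>)) \<le> R"
      using norm_triangle_ineq[of ?e "u (t + c j * \<tau>)"] R(2)[of "t + c j * \<tau>"] tj by auto
    then have "norm (f (t + c j * \<tau>) (?e + u (t + c j * \<tau>)) - g (t + c j * \<tau>)) \<le> L * (\<bar>t + c j * \<tau> - (t + c j * \<tau>)\<bar> + norm (?e + u (t + c j * \<tau>) - u (t + c j * \<tau>)))"
      unfolding g_def using tj u_le_R by (intro L(2)) auto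
    also have "\<dots> = L * norm ?e" by simp
    also have "\<dots> \<le> L * ((K + B) * ?q)" using st L(1) by (intro mult_left_mono) auto
    finally show "norm (fX (t + c j * \<tau>) (stage \<tau> t v j) - g (t + c j * \<tau>)) \<le> L * ((K + B) * ?q)" unfolding inv .
  qed
qed

end

section \<open>Error of one step\<close>

context runge_kutta
begin

text \<open>Write F_i = (F_i - g(t + c_i \<tau>) + \<rho>(c_i)) + g(t) + c_i (g(t + \<tau>) - g(t)).
  The first condition on the \<open>b i\<close> turns g(t) into a \<phi>_1 term, the second turns
  the increment into a \<phi>_2 term, and the same two terms occur in the integral for the exact
  solution.\<close>

lemma step_defect:
  assumes \<tau>: "0 < \<tau>" and t: "0 \<le> t" "t + \<tau> \<le> Tm"
  defines "\<rho> \<equiv> \<lambda>l. g (t + l * \<tau>) - (1 - l) *\<^sub>R g t - l *\<^sub>R g (t + \<tau>)"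
  shows "step \<tau> t v - \<iota> (u (t + \<tau>)) - T \<tau> (v - \<iota> (u t)) =
    \<tau> *\<^sub>R (\<Sum>i\<in>{1..s}. comb_op D A (b i) \<tau> (fX (t + c i * \<tau>) (stage \<tau> t v i) - g (t + c i * \<tau>) + \<rho> (c i)))
    - integral {0..\<tau>} (\<lambda>\<xi>. T (\<tau> - \<xi>) (\<rho> (\<xi> / \<tau>)))"
proof -
  let ?F = "\<lambda>i. fX (t + c i * \<tau>) (stage \<tau> t v i)" and ?d = "g (t + \<tau>) - g t"
  let ?y = "\<lambda>i. ?F i - g (t + c i * \<tau>) + \<rho> (c i)"
  have F: "?F i = ?y i + g t + c i *\<^sub>R ?d" for i
    by (simp add: \<rho>_def scaleR_diff_left scaleR_diff_right)
  have lin: "comb_op D A (b i) \<tau> (x + y + r *\<^sub>R z) = comb_op D A (b i) \<tau> x + comb_op D A (b i) \<tau> y + r *\<^sub>R comb_op D A (b i) \<tau> z"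
    if "i \<in> {1..s}" for i x y r z
    by (simp only: comb_op_linear(1,2)[OF b_pos[OF that] \<tau>])
  have "(\<Sum>i\<in>{1..s}. comb_op D A (b i) \<tau> (?F i)) =
      (\<Sum>i\<in>{1..s}. comb_op D A (b i) \<tau> (?y i) + comb_op D A (b i) \<tau> (g t) + c i *\<^sub>R comb_op D A (b i) \<tau> ?d)"
  proof (rule sum.cong[OF refl])
    fix i assume i: "i \<in> {1..s}"
    show "comb_op D A (b i) \<tau> (?F i) =
        comb_op D A (b i) \<tau> (?y i) + comb_op D A (b i) \<tau> (g t) + c i *\<^sub>R comb_op D A (b i) \<tau> ?d"
      unfolding lin[OF i, symmetric] by (rule arg_cong[OF F])
  qed
  then have sF: "(\<Sum>i\<in>{1..s}. comb_op D A (b i) \<tau> (?F i)) =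
      (\<Sum>i\<in>{1..s}. comb_op D A (b i) \<tau> (?y i)) + phi_op D A 1 \<tau> (g t) + phi_op D A 2 \<tau> ?d"
    by (simp only: sum.distrib b_sum b_c_sum)
  have i1: "((\<lambda>\<xi>. T (\<tau> - \<xi>) (g t)) has_integral \<tau> *\<^sub>R phi_op D A 1 \<tau> (g t)) {0..\<tau>}"
  proof -
    have "(\<lambda>\<xi>. T (\<tau> - \<xi>) (g t)) integrable_on {0..\<tau>}" by (rule conv_integrable[where K="norm (g t)"]) auto
    from integrable_integral[OF this] show ?thesis using phi_op_conv[OF \<tau>, of 1 "g t"] by simp
  qed
  have i2: "((\<lambda>\<xi>. T (\<tau> - \<xi>) ((\<xi> / \<tau>) *\<^sub>R ?d)) has_integral \<tau> *\<^sub>R phi_op D A 2 \<tau> ?d) {0..\<tau>}"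
  proof -
    have "(\<lambda>\<xi>. T (\<tau> - \<xi>) ((\<xi> / \<tau>) *\<^sub>R ?d)) integrable_on {0..\<tau>}"
    proof (rule conv_integrable[where K="norm ?d"])
      show "continuous_on {0<..<\<tau>} (\<lambda>\<xi>. (\<xi> / \<tau>) *\<^sub>R ?d)" using \<tau> by (intro continuous_intros) auto
      show "norm ((\<xi> / \<tau>) *\<^sub>R ?d) \<le> norm ?d" if "0 < \<xi>" "\<xi> < \<tau>" for \<xi>
        using that unfolding norm_scaleR by (intro mult_left_le_one_le) auto
    qed
    from integrable_integral[OF this] show ?thesis using phi_op_conv[OF \<tau>, of 2 ?d] by simp
  qed
  have i3: "((\<lambda>\<xi>. T (\<tau> - \<xi>) (g (t + \<xi>))) has_integral integral {0..\<tau>} (\<lambda>\<xi>. T (\<tau> - \<xi>) (g (t + \<xi>)))) {0..\<tau>}"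
    by (rule integrable_integral[OF conv_g_integrable[OF t(1) less_imp_le[OF \<tau>] t(2)]])
  have "((\<lambda>\<xi>. T (\<tau> - \<xi>) (\<rho> (\<xi> / \<tau>))) has_integral
      integral {0..\<tau>} (\<lambda>\<xi>. T (\<tau> - \<xi>) (g (t + \<xi>))) - \<tau> *\<^sub>R phi_op D A 1 \<tau> (g t) - \<tau> *\<^sub>R phi_op D A 2 \<tau> ?d) {0..\<tau>}"
  proof (rule has_integral_eq[OF _ has_integral_diff[OF has_integral_diff[OF i3 i1] i2]])
    fix \<xi> assume \<xi>: "\<xi> \<in> {0..\<tau>}"
    have "\<rho> (\<xi> / \<tau>) = g (t + \<xi>) - g t - (\<xi> / \<tau>) *\<^sub>R ?d"
      using \<tau> by (simp add: \<rho>_def scaleR_diff_left scaleR_diff_right)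
    then show "T (\<tau> - \<xi>) (g (t + \<xi>)) - T (\<tau> - \<xi>) (g t) - T (\<tau> - \<xi>) ((\<xi> / \<tau>) *\<^sub>R ?d) = T (\<tau> - \<xi>) (\<rho> (\<xi> / \<tau>))"
      using \<xi> by (simp only: T_diff diff_ge_0_iff_ge atLeastAtMost_iff)
  qed
  then have I: "integral {0..\<tau>} (\<lambda>\<xi>. T (\<tau> - \<xi>) (\<rho> (\<xi> / \<tau>))) =
      integral {0..\<tau>} (\<lambda>\<xi>. T (\<tau> - \<xi>) (g (t + \<xi>))) - \<tau> *\<^sub>R phi_op D A 1 \<tau> (g t) - \<tau> *\<^sub>R phi_op D A 2 \<tau> ?d"
    by (rule integral_unique)
  show ?thesis
    unfolding sF I u_shift_X[OF t(1) less_imp_le[OF \<tau>] t(2)] T_diff[OF less_imp_le[OF \<tau>]] scaleR_add_right by simp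
qed

text \<open>The bracket is the bound of \<open>u_second_difference\<close> at h = \<tau>, which
  dominates the power of \<tau> in \<open>quant\<close>.\<close>

definition local_error where
  "local_error \<tau> t v = N \<gamma> (v - \<iota> (u t)) + (\<tau>\<^sup>2 / (\<tau> + t) + \<tau> powr (2 - \<alpha>) * (\<bar>ln \<tau>\<bar> + 1))"

text \<open>\<beta> is free because the global estimate needs the defect both in D_A(\<gamma>, 1)
  and in X, that is for \<beta> = \<gamma> and \<beta> = 0. In \<tau>^(1 - \<beta>) the factor
  \<tau> is the length of the step and \<tau>^(-\<beta>) the cost of smoothing.\<close>

lemma step_error:
  assumes \<beta>: "0 \<le> \<beta>" "\<beta> < 1"
  shows "\<exists>C\<ge>0. \<exists>q0>0. \<forall>\<tau> t v. admissible \<tau> t v \<longrightarrow> quant \<tau> t v \<le> q0 \<longrightarrow>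
    step \<tau> t v - \<iota> (u (t + \<tau>)) - T \<tau> (v - \<iota> (u t)) \<in> DA \<beta> \<and>
    N \<beta> (step \<tau> t v - \<iota> (u (t + \<tau>)) - T \<tau> (v - \<iota> (u t))) \<le> C * \<tau> powr (1 - \<beta>) * local_error \<tau> t v"
proof -
  obtain K where K: "0 \<le> K" "\<And>\<tau> t v i. admissible \<tau> t v \<Longrightarrow> K * quant \<tau> t v \<le> 1 \<Longrightarrow> i \<in> {1..s} \<Longrightarrow>
    norm (fX (t + c i * \<tau>) (stage \<tau> t v i) - g (t + c i * \<tau>)) \<le> L * (K * quant \<tau> t v)"
    using stage_error[OF order_refl] by blast
  obtain Cb where Cb: "0 \<le> Cb" "\<And>i t x. i \<in> {1..s} \<Longrightarrow> 0 < t \<Longrightarrow> t \<le> Tm \<Longrightarrow>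
     comb_op D A (b i) t x \<in> DA \<beta> \<and> N \<beta> (comb_op D A (b i) t x) \<le> Cb * t powr (- \<beta>) * norm x"
    using comb_op_N_uniform[OF \<beta>, of "{1..s}" b Tm] b_pos by blast
  obtain Cg where Cg: "0 \<le> Cg" "\<And>h l t. 0 < h \<Longrightarrow> h \<le> 1 \<Longrightarrow> 0 \<le> l \<Longrightarrow> l \<le> 1 \<Longrightarrow> 0 \<le> t \<Longrightarrow> t + h \<le> Tm \<Longrightarrow>
     norm (g (t + l * h) - (1 - l) *\<^sub>R g t - l *\<^sub>R g (t + h)) \<le> Cg * (h\<^sup>2 / (h + t) + h powr (2 - \<alpha>) * (\<bar>ln h\<bar> + 1))"
    using u_second_difference by blast
  define C where "C = real s * (Cb * (L * K + Cg)) + Cconv \<beta> Tm * Cg"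
  have C: "0 \<le> C" using Cb(1) L(1) K(1) Cg(1) Cconv_pos[OF \<beta>, of Tm] by (simp add: C_def)
  have main: "step \<tau> t v - \<iota> (u (t + \<tau>)) - T \<tau> (v - \<iota> (u t)) \<in> DA \<beta> \<and>
    N \<beta> (step \<tau> t v - \<iota> (u (t + \<tau>)) - T \<tau> (v - \<iota> (u t))) \<le> C * \<tau> powr (1 - \<beta>) * local_error \<tau> t v"
    if ad: "admissible \<tau> t v" and q: "quant \<tau> t v \<le> 1 / (K + 1)" for \<tau> t v
  proof -
    have \<tau>: "0 < \<tau>" "\<tau> \<le> 1" and t: "0 \<le> t" "t + \<tau> \<le> Tm" and E: "v - \<iota> (u t) \<in> DA \<gamma>"
      using ad by (auto simp: admissible_def)
    let ?m = "\<tau>\<^sup>2 / (\<tau> + t) + \<tau> powr (2 - \<alpha>) * (\<bar>ln \<tau>\<bar> + 1)" and ?e = "local_error \<tau> t v"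
    have E0: "0 \<le> N \<gamma> (v - \<iota> (u t))" by (rule N_nonneg[OF E])
    have m2: "\<tau> powr (2 - \<alpha>) \<le> ?m"
    proof -
      have "\<tau> powr (2 - \<alpha>) * 1 \<le> \<tau> powr (2 - \<alpha>) * (\<bar>ln \<tau>\<bar> + 1)" by (intro mult_left_mono) auto
      moreover have "0 \<le> \<tau>\<^sup>2 / (\<tau> + t)" using \<tau> t by simp
      ultimately show ?thesis by linarith
    qed
    have m0: "0 \<le> ?m" by (rule order_trans[OF powr_ge_zero m2])
    have qe: "quant \<tau> t v \<le> ?e" using m2 unfolding quant_def local_error_def by linarith
    have me: "?m \<le> ?e" using E0 unfolding local_error_def by linarith
    have e0: "0 \<le> ?e" using m0 me by linarith
    \<comment> \<open>The threshold 1 / (K + 1) is positive even for K = 0.\<close>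
    have Kq: "K * quant \<tau> t v \<le> 1"
    proof -
      have "K * quant \<tau> t v \<le> K * (1 / (K + 1))" by (rule mult_left_mono[OF q K(1)])
      also have "\<dots> \<le> 1" using K(1) by simp
      finally show ?thesis .
    qed
    define \<rho> where "\<rho> l = g (t + l * \<tau>) - (1 - l) *\<^sub>R g t - l *\<^sub>R g (t + \<tau>)" for l
    have \<rho>: "norm (\<rho> l) \<le> Cg * ?e" if "0 \<le> l" "l \<le> 1" for l
      unfolding \<rho>_def by (rule order_trans[OF Cg(2)[OF \<tau> that t] mult_left_mono[OF me Cg(1)]])
    let ?y = "\<lambda>i. fX (t + c i * \<tau>) (stage \<tau> t v i) - g (t + c i * \<tau>) + \<rho> (c i)"
    define Y where "Y = (L * K + Cg) * ?e"
    have y: "norm (?y i) \<le> Y" if i: "i \<in> {1..s}" for i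
    proof -
      have "norm (?y i) \<le> L * (K * quant \<tau> t v) + Cg * ?e"
        by (rule order_trans[OF norm_triangle_ineq add_mono[OF K(2)[OF ad Kq i] \<rho>[OF c(2,3)[OF i]]]])
      also have "\<dots> \<le> L * (K * ?e) + Cg * ?e"
        using L(1) K(1) qe by (intro add_right_mono mult_left_mono) auto
      also have "\<dots> = Y" by (simp add: Y_def algebra_simps)
      finally show ?thesis .
    qed
    define S where "S = (\<Sum>i\<in>{1..s}. comb_op D A (b i) \<tau> (?y i))"
    have \<tau>T: "\<tau> \<le> Tm" using t by linarith
    have m: "comb_op D A (b i) \<tau> (?y i) \<in> DA \<beta>" "N \<beta> (comb_op D A (b i) \<tau> (?y i)) \<le> Cb * \<tau> powr (- \<beta>) * Y"
      if i: "i \<in> {1..s}" for i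
    proof -
      note cb = Cb(2)[OF i \<tau>(1) \<tau>T, of "?y i"]
      show "comb_op D A (b i) \<tau> (?y i) \<in> DA \<beta>" using cb by (rule conjunct1)
      show "N \<beta> (comb_op D A (b i) \<tau> (?y i)) \<le> Cb * \<tau> powr (- \<beta>) * Y"
        by (rule order_trans[OF conjunct2[OF cb] mult_left_mono[OF y[OF i]]]) (use Cb(1) in simp)
    qed
    have S: "S \<in> DA \<beta>" unfolding S_def by (rule DA_N_sum(1)[OF finite_atLeastAtMost m(1)])
    have pb: "\<tau> * \<tau> powr (- \<beta>) = \<tau> powr (1 - \<beta>)" using \<tau> by (simp add: powr_diff powr_minus divide_inverse)
    have "N \<beta> S \<le> (\<Sum>i\<in>{1..s}. N \<beta> (comb_op D A (b i) \<tau> (?y i)))"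
      unfolding S_def by (rule DA_N_sum(2)[OF finite_atLeastAtMost m(1)])
    also have "\<dots> \<le> (\<Sum>i\<in>{1..s}. Cb * \<tau> powr (- \<beta>) * Y)" by (rule sum_mono[OF m(2)])
    also have "\<dots> = real s * (Cb * \<tau> powr (- \<beta>) * Y)" by simp
    finally have "\<tau> * N \<beta> S \<le> \<tau> * (real s * (Cb * \<tau> powr (- \<beta>) * Y))" using \<tau> by (intro mult_left_mono) auto
    also have "\<dots> = real s * (Cb * (L * K + Cg)) * ((\<tau> * \<tau> powr (- \<beta>)) * ?e)" by (simp add: Y_def mult_ac)
    finally have S1: "N \<beta> (\<tau> *\<^sub>R S) \<le> real s * (Cb * (L * K + Cg)) * (\<tau> powr (1 - \<beta>) * ?e)"
      unfolding pb using DA_N_scaleR(2)[OF S, of \<tau>] \<tau> by linarith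
    define I where "I = integral {0..\<tau>} (\<lambda>\<xi>. T (\<tau> - \<xi>) (\<rho> (\<xi> / \<tau>)))"
    have c\<rho>: "continuous_on {0<..<\<tau>} (\<lambda>\<xi>. \<rho> (\<xi> / \<tau>))"
    proof -
      have "continuous_on {0<..<\<tau>} (\<lambda>\<xi>. g (t + \<xi>) - (1 - \<xi> / \<tau>) *\<^sub>R g t - (\<xi> / \<tau>) *\<^sub>R g (t + \<tau>))"
        using \<tau> t by (intro continuous_intros g_shift_cont) auto
      then show ?thesis using \<tau> by (simp add: \<rho>_def)
    qed
    have b\<rho>: "norm (\<rho> (\<xi> / \<tau>)) \<le> Cg * ?e" if "0 < \<xi>" "\<xi> < \<tau>" for \<xi> using that by (intro \<rho>) auto
    have I: "I \<in> DA \<beta>" "N \<beta> I \<le> Cconv \<beta> Tm * \<tau> powr (1 - \<beta>) * (Cg * ?e)"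
      unfolding I_def Cconv_def by (rule conv_smooth[OF \<beta> \<tau>(1) \<tau>T c\<rho> b\<rho>]; assumption)+
    have d: "step \<tau> t v - \<iota> (u (t + \<tau>)) - T \<tau> (v - \<iota> (u t)) = \<tau> *\<^sub>R S - I"
      unfolding S_def I_def \<rho>_def by (rule step_defect[OF \<tau>(1) t])
    have "N \<beta> (\<tau> *\<^sub>R S - I) \<le> real s * (Cb * (L * K + Cg)) * (\<tau> powr (1 - \<beta>) * ?e) + Cconv \<beta> Tm * \<tau> powr (1 - \<beta>) * (Cg * ?e)"
      by (rule order_trans[OF DA_N_diff(2)[OF DA_N_scaleR(1)[OF S] I(1)] add_mono[OF S1 I(2)]])
    also have "\<dots> = C * \<tau> powr (1 - \<beta>) * ?e" by (simp add: C_def algebra_simps)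
    finally show ?thesis unfolding d using DA_N_diff(1)[OF DA_N_scaleR(1)[OF S] I(1)] by blast
  qed
  show ?thesis
    using C K(1) main by (intro exI[of _ C] conjI exI[of _ "1 / (K + 1)"]) auto
qed

end

section \<open>Error propagation\<close>

context sectorial_op
begin

text \<open>The defect \<open>d k\<close> arises in the step to k + 1 and is propagated over the
  remaining n - k - 1 steps, so the last one carries T 0.\<close>

lemma discrete_variation_of_constants:
  assumes \<tau>: "0 \<le> \<tau>" and E: "E 0 = 0" "\<And>k. k < n \<Longrightarrow> E (Suc k) = T \<tau> (E k) + d k"
  shows "E n = (\<Sum>k<n. T (real (n - Suc k) * \<tau>) (d k))"
  using E(2)
proof (induction n)
  case 0
  show ?case by (simp add: E(1))
next
  case (Suc n)
  have IH: "E n = (\<Sum>k<n. T (real (n - Suc k) * \<tau>) (d k))" by (rule Suc.IH) (use Suc.prems in auto)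
  have "E (Suc n) = T \<tau> (E n) + d n" by (rule Suc.prems) simp
  also have "T \<tau> (E n) = (\<Sum>k<n. T \<tau> (T (real (n - Suc k) * \<tau>) (d k)))"
    unfolding IH by (rule linear_sum[OF bounded_linear.linear[OF T_bl[OF \<tau>]]])
  also have "\<dots> = (\<Sum>k<n. T (real (Suc n - Suc k) * \<tau>) (d k))"
  proof (rule sum.cong[OF refl])
    fix k assume "k \<in> {..<n}"
    then have "Suc n - Suc k = Suc (n - Suc k)" by auto
    then have "real (Suc n - Suc k) * \<tau> = \<tau> + real (n - Suc k) * \<tau>" by (simp only: of_nat_Suc distrib_right mult_1)
    then show "T \<tau> (T (real (n - Suc k) * \<tau>) (d k)) = T (real (Suc n - Suc k) * \<tau>) (d k)"
      using \<tau> by (simp only: T_semigroup mult_nonneg_nonneg of_nat_0_le_iff)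
  qed
  finally show ?case by (simp add: T_0)
qed

text \<open>For j = 0 there is no smoothing and the bound in D_A(\<gamma>, 1) is used; for j \<ge> 1
  the bound in X is smoothed over the time j \<tau>. Since j \<tau> \<ge> (j + 1) \<tau> / 2, both
  cases fit the kernel ((j + 1) \<tau>)^(-\<gamma>), at the cost of 2^\<gamma> \<le> 2.\<close>

lemma T_step_smooth:
  assumes \<gamma>: "0 \<le> \<gamma>" "\<gamma> < 1" and \<tau>: "0 < \<tau>" and j: "real j * \<tau> \<le> t0" and P: "0 \<le> P"
    and d: "d \<in> DA \<gamma>" "N \<gamma> d \<le> P * \<tau> powr (1 - \<gamma>)" "norm d \<le> P * \<tau>"
  shows "T (real j * \<tau>) d \<in> DA \<gamma>"
    "N \<gamma> (T (real j * \<tau>) d) \<le> (2 * Cconv \<gamma> t0 + 1) * (\<tau> * (real (Suc j) * \<tau>) powr (- \<gamma>) * P)"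
proof -
  have C: "0 < Cconv \<gamma> t0" by (rule Cconv_pos[OF \<gamma>])
  have "T (real j * \<tau>) d \<in> DA \<gamma> \<and>
    N \<gamma> (T (real j * \<tau>) d) \<le> (2 * Cconv \<gamma> t0 + 1) * (\<tau> * (real (Suc j) * \<tau>) powr (- \<gamma>) * P)"
  proof (cases "j = 0")
    case True
    have "\<tau> * \<tau> powr (- \<gamma>) = \<tau> powr (1 - \<gamma>)" using \<tau> by (simp add: powr_diff powr_minus divide_inverse)
    then have "N \<gamma> d \<le> 1 * (\<tau> * \<tau> powr (- \<gamma>) * P)" using d(2) by (simp add: mult.commute)
    also have "\<dots> \<le> (2 * Cconv \<gamma> t0 + 1) * (\<tau> * \<tau> powr (- \<gamma>) * P)"
      using C \<tau> P by (intro mult_right_mono) auto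
    finally show ?thesis using True d(1) by (simp add: T_0)
  next
    case False
    let ?h = "real j * \<tau>" and ?k = "real (Suc j) * \<tau>"
    have h: "0 < ?h" using False \<tau> by simp
    have "?k / 2 \<le> ?h" using False \<tau> by (simp add: field_simps)
    then have "?h powr (- \<gamma>) \<le> (?k / 2) powr (- \<gamma>)" using \<gamma> \<tau> by (intro powr_mono2') auto
    also have "\<dots> = 2 powr \<gamma> * ?k powr (- \<gamma>)" using \<tau> by (simp add: powr_divide powr_minus field_simps)
    also have "\<dots> \<le> 2 powr 1 * ?k powr (- \<gamma>)" using \<gamma> by (intro mult_right_mono powr_mono) auto
    finally have hk: "?h powr (- \<gamma>) \<le> 2 * ?k powr (- \<gamma>)" by simp
    have "N \<gamma> (T ?h d) \<le> Cconv \<gamma> t0 * ?h powr (- \<gamma>) * norm d" by (rule T_smooth'[OF \<gamma> h j])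
    also have "\<dots> \<le> Cconv \<gamma> t0 * (2 * ?k powr (- \<gamma>)) * (P * \<tau>)"
      using C hk d(3) by (intro mult_mono) auto
    also have "\<dots> = (2 * Cconv \<gamma> t0) * (\<tau> * ?k powr (- \<gamma>) * P)" by (simp add: mult_ac)
    also have "\<dots> \<le> (2 * Cconv \<gamma> t0 + 1) * (\<tau> * ?k powr (- \<gamma>) * P)"
      using \<tau> P by (intro mult_right_mono) auto
    finally show ?thesis using T_smooth(1)[OF \<gamma> h j] by blast
  qed
  then show "T (real j * \<tau>) d \<in> DA \<gamma>"
    "N \<gamma> (T (real j * \<tau>) d) \<le> (2 * Cconv \<gamma> t0 + 1) * (\<tau> * (real (Suc j) * \<tau>) powr (- \<gamma>) * P)" by blast+
qed

end

lemma small_step_size: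
  fixes M q :: real
  assumes "0 < q"
  shows "\<exists>\<tau>0>0. \<forall>\<tau>. 0 < \<tau> \<longrightarrow> \<tau> < \<tau>0 \<longrightarrow> \<tau> \<le> 1 \<and> \<tau> \<le> q \<and> M * (\<tau> * (\<bar>ln \<tau>\<bar> + 1)) \<le> q"
proof -
  have "((\<lambda>\<tau>::real. \<tau> * (1 - ln \<tau>)) \<longlongrightarrow> 0) (at_right 0)" by real_asymp
  then have "((\<lambda>\<tau>. M * (\<tau> * (1 - ln \<tau>))) \<longlongrightarrow> M * 0) (at_right 0)" by (intro tendsto_mult_left)
  from order_tendstoD(2)[OF this, of q] have "eventually (\<lambda>\<tau>. M * (\<tau> * (1 - ln \<tau>)) < q) (at_right 0)" using assms by simp
  then obtain r where r: "0 < r" "\<And>\<tau>. 0 < \<tau> \<Longrightarrow> \<tau> < r \<Longrightarrow> M * (\<tau> * (1 - ln \<tau>)) < q"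
    unfolding eventually_at_right_field by blast
  have "M * (\<tau> * (\<bar>ln \<tau>\<bar> + 1)) \<le> q" if "0 < \<tau>" "\<tau> < r" "\<tau> < 1" for \<tau>
    using r(2)[OF that(1,2)] that by simp
  then show ?thesis using assms r(1) by (intro exI[of _ "min r (min q 1)"]) auto
qed

text \<open>Strong induction with the weighted bound 2 K exp (\<mu> t_k), K being C4 Cm \<tau>^(2 -
  \<gamma>) (|ln \<tau>| + 1). For k < n the bound keeps the errors small enough for
  \<open>step_error\<close>; in the sum of propagated defects the choice of \<mu> halves it, and the
  half gained covers the remaining K.\<close>

lemma (in runge_kutta) convergence:
  "\<exists>C. \<exists>\<tau>0>0. \<forall>\<tau>. 0 < \<tau> \<and> \<tau> < \<tau>0 \<longrightarrow> (\<forall>n. real n * \<tau> \<le> Tm \<longrightarrow>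
     eerk D A s c b a fX (\<iota> u0) \<tau> n - \<iota> (u (real n * \<tau>)) \<in> DA \<gamma> \<and>
     N \<gamma> (eerk D A s c b a fX (\<iota> u0) \<tau> n - \<iota> (u (real n * \<tau>))) \<le> C * \<tau> powr (2 - \<gamma>) * (\<bar>ln \<tau>\<bar> + 1))"
proof -
  note \<gamma>' = \<gamma>_nonneg \<gamma>(2)
  obtain C1 q1 where S1: "0 \<le> C1" "0 < q1" "\<And>\<tau> t v. admissible \<tau> t v \<Longrightarrow> quant \<tau> t v \<le> q1 \<Longrightarrow>
    step \<tau> t v - \<iota> (u (t + \<tau>)) - T \<tau> (v - \<iota> (u t)) \<in> DA \<gamma> \<and>
    N \<gamma> (step \<tau> t v - \<iota> (u (t + \<tau>)) - T \<tau> (v - \<iota> (u t))) \<le> C1 * \<tau> powr (1 - \<gamma>) * local_error \<tau> t v"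
    using step_error[OF \<gamma>'] by blast
  obtain C2 q2 where S2: "0 \<le> C2" "0 < q2" "\<And>\<tau> t v. admissible \<tau> t v \<Longrightarrow> quant \<tau> t v \<le> q2 \<Longrightarrow>
    N 0 (step \<tau> t v - \<iota> (u (t + \<tau>)) - T \<tau> (v - \<iota> (u t))) \<le> C2 * \<tau> powr (1 - 0) * local_error \<tau> t v"
    using step_error[OF order_refl zero_less_one] by blast
  define C3 where "C3 = C1 + C2"
  \<comment> \<open>Half of the thresholds, since \<open>quant\<close> has two summands: the error
    and \<tau>^(2 - \<alpha>) \<le> \<tau> are each kept below q.\<close>
  define q where "q = min q1 q2 / 2"
  have q: "0 < q" using S1(2) S2(2) by (simp add: q_def)
  have C3: "0 \<le> C3" using S1(1) S2(1) by (simp add: C3_def)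
  \<comment> \<open>The first factor is that of \<open>T_step_smooth\<close>; \<open>C3\<close>
    bounds a defect in both norms.\<close>
  define C4 where "C4 = (2 * Cconv \<gamma> Tm + 1) * C3"
  have C4: "0 \<le> C4" using Cconv_pos[OF \<gamma>', of Tm] C3 by (simp add: C4_def)
  define P where "P = Tm powr ((1 - \<gamma>) / 2) / ((1 - \<gamma>) / 2)"
  have P: "0 \<le> P" using \<gamma>' by (simp add: P_def)
  obtain \<mu> where \<mu>: "0 < \<mu>" "(C4 * P) * \<mu> powr (- ((1 - \<gamma>) / 2)) \<le> 1 / 2"
    using large_weight[of "(1 - \<gamma>) / 2" "C4 * P"] \<gamma>' C4 P by auto
  define Cm where "Cm = \<bar>ln Tm\<bar> + 1 + Tm powr (1 - \<gamma>) / (1 - \<gamma>)"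
  have Cm: "0 \<le> Cm" using \<gamma>' by (simp add: Cm_def)
  \<comment> \<open>The inductive bound at time Tm, without its power of \<tau> and
    logarithm.\<close>
  define C where "C = 2 * (C4 * Cm) * exp (\<mu> * Tm)"
  have C: "0 \<le> C" using C4 Cm by (simp add: C_def)
  obtain \<tau>0 where \<tau>0: "0 < \<tau>0" "\<And>\<tau>. 0 < \<tau> \<Longrightarrow> \<tau> < \<tau>0 \<Longrightarrow> \<tau> \<le> 1 \<and> \<tau> \<le> q \<and> C * (\<tau> * (\<bar>ln \<tau>\<bar> + 1)) \<le> q"
    using small_step_size[OF q] by blast
  have main: "real n * \<tau> \<le> Tm \<longrightarrow> eerk D A s c b a fX (\<iota> u0) \<tau> n - \<iota> (u (real n * \<tau>)) \<in> DA \<gamma> \<and>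
     N \<gamma> (eerk D A s c b a fX (\<iota> u0) \<tau> n - \<iota> (u (real n * \<tau>)))
       \<le> 2 * (C4 * (Cm * (\<tau> powr (2 - \<gamma>) * (\<bar>ln \<tau>\<bar> + 1)))) * exp (\<mu> * (real n * \<tau>))"
    (is "_ \<longrightarrow> ?E n \<in> DA \<gamma> \<and> _") if \<tau>: "0 < \<tau>" "\<tau> < \<tau>0" for \<tau> n
  proof (induction n rule: less_induct)
    case (less n)
    define E where "E k = eerk D A s c b a fX (\<iota> u0) \<tau> k - \<iota> (u (real k * \<tau>))" for k
    define X where "X = \<tau> powr (2 - \<gamma>) * (\<bar>ln \<tau>\<bar> + 1)"
    define K where "K = C4 * (Cm * X)"
    have X: "0 \<le> X" unfolding X_def by (intro mult_nonneg_nonneg) auto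
    have K: "0 \<le> K" unfolding K_def using C4 Cm X by (intro mult_nonneg_nonneg) auto
    have \<tau>1: "\<tau> \<le> 1" "\<tau> \<le> q" "C * (\<tau> * (\<bar>ln \<tau>\<bar> + 1)) \<le> q" using \<tau>0(2)[OF \<tau>] by auto
    have p1: "\<tau> powr (2 - \<delta>) \<le> \<tau>" if "\<delta> < 1" for \<delta>
      using powr_mono'[of 1 "2 - \<delta>" \<tau>] that \<tau> \<tau>1 by simp
    have CX: "C * X \<le> q"
    proof -
      have "C * X \<le> C * (\<tau> * (\<bar>ln \<tau>\<bar> + 1))"
        unfolding X_def using C by (intro mult_left_mono mult_right_mono p1 \<gamma>') auto
      then show ?thesis using \<tau>1(3) by linarith
    qed
    show ?case
    proof
      assume n: "real n * \<tau> \<le> Tm"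
      have t: "0 \<le> real k * \<tau>" "real k * \<tau> + \<tau> \<le> Tm" "real k * \<tau> \<le> Tm" if "k < n" for k
      proof -
        show "0 \<le> real k * \<tau>" using \<tau> by simp
        have "real (Suc k) * \<tau> \<le> real n * \<tau>" using that \<tau> by (intro mult_right_mono) auto
        then show "real k * \<tau> + \<tau> \<le> Tm" using n by (simp add: algebra_simps)
        then show "real k * \<tau> \<le> Tm" using \<tau> by linarith
      qed
      have IH: "E k \<in> DA \<gamma>" "N \<gamma> (E k) \<le> 2 * K * exp (\<mu> * (real k * \<tau>))" if "k < n" for k
        using less.IH[OF that] t(3)[OF that] unfolding E_def K_def X_def by blast+
      let ?v = "\<lambda>k. eerk D A s c b a fX (\<iota> u0) \<tau> k"
      define d where "d k = E (Suc k) - T \<tau> (E k)" for k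
      define e where "e k = N \<gamma> (E k) + (\<tau>\<^sup>2 / (\<tau> + real k * \<tau>) + \<tau> powr (2 - \<alpha>) * (\<bar>ln \<tau>\<bar> + 1))" for k
      have e0: "0 \<le> e k" if "k < n" for k
        unfolding e_def using N_nonneg[OF IH(1)[OF that]] \<tau> t(1)[OF that]
        by (intro add_nonneg_nonneg mult_nonneg_nonneg divide_nonneg_nonneg) auto
      have d: "d k \<in> DA \<gamma>" "N \<gamma> (d k) \<le> C3 * e k * \<tau> powr (1 - \<gamma>)" "norm (d k) \<le> C3 * e k * \<tau>" if k: "k < n" for k
      proof -
        have st: "d k = step \<tau> (real k * \<tau>) (?v k) - \<iota> (u (real k * \<tau> + \<tau>)) - T \<tau> (?v k - \<iota> (u (real k * \<tau>)))"
          by (simp add: d_def E_def distrib_right add.commute)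
        have ad: "admissible \<tau> (real k * \<tau>) (?v k)"
          using \<tau> \<tau>1 t[OF k] IH(1)[OF k] by (simp add: admissible_def E_def)
        have "N \<gamma> (E k) \<le> 2 * K * exp (\<mu> * Tm)"
          using K \<mu>(1) t(3)[OF k] by (intro order_trans[OF IH(2)[OF k]] mult_left_mono) auto
        also have "\<dots> = C * X" by (simp add: K_def C_def)
        finally have "N \<gamma> (E k) \<le> q" using CX by linarith
        then have "quant \<tau> (real k * \<tau>) (?v k) \<le> q + q"
          unfolding quant_def E_def using p1[OF \<alpha>(2)] \<tau>1(2) by linarith
        then have qu: "quant \<tau> (real k * \<tau>) (?v k) \<le> q1" "quant \<tau> (real k * \<tau>) (?v k) \<le> q2" by (auto simp: q_def)
        have le: "local_error \<tau> (real k * \<tau>) (?v k) = e k" by (simp add: local_error_def e_def E_def)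
        note s1 = S1(3)[OF ad qu(1), folded st, unfolded le] and s2 = S2(3)[OF ad qu(2), folded st, unfolded le]
        show "d k \<in> DA \<gamma>" using s1 by blast
        have "N \<gamma> (d k) \<le> C1 * (e k * \<tau> powr (1 - \<gamma>))" using conjunct2[OF s1] by (simp add: mult_ac)
        also have "\<dots> \<le> C3 * (e k * \<tau> powr (1 - \<gamma>))"
          using e0[OF k] S2(1) by (intro mult_right_mono) (auto simp: C3_def)
        finally show "N \<gamma> (d k) \<le> C3 * e k * \<tau> powr (1 - \<gamma>)" by simp
        have "norm (d k) \<le> C2 * (e k * \<tau>)" using s2 \<tau> by (simp add: mult_ac)
        also have "\<dots> \<le> C3 * (e k * \<tau>)"
          using e0[OF k] S1(1) \<tau> by (intro mult_right_mono) (auto simp: C3_def)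
        finally show "norm (d k) \<le> C3 * e k * \<tau>" by simp
      qed
      have En: "E n = (\<Sum>k<n. T (real (n - Suc k) * \<tau>) (d k))"
        by (rule discrete_variation_of_constants) (use \<tau> u_0 in \<open>auto simp: d_def E_def\<close>)
      let ?w = "\<lambda>k. \<tau> * (real (n - k) * \<tau>) powr (- \<gamma>)"
      have Td: "T (real (n - Suc k) * \<tau>) (d k) \<in> DA \<gamma>" "N \<gamma> (T (real (n - Suc k) * \<tau>) (d k)) \<le> C4 * (?w k * e k)" if k: "k < n" for k
      proof -
        have j: "real (n - Suc k) * \<tau> \<le> Tm"
          using \<tau> by (intro order_trans[OF mult_right_mono n]) auto
        have P0: "0 \<le> C3 * e k" using C3 e0[OF k] by simp
        note ts = T_step_smooth[OF \<gamma>' \<tau>(1) j P0 d[OF k]]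
        show "T (real (n - Suc k) * \<tau>) (d k) \<in> DA \<gamma>" by (rule ts(1))
        have "Suc (n - Suc k) = n - k" using k by simp
        with ts(2) show "N \<gamma> (T (real (n - Suc k) * \<tau>) (d k)) \<le> C4 * (?w k * e k)" by (simp only: C4_def mult_ac)
      qed
      have DAn: "E n \<in> DA \<gamma>" unfolding En by (rule DA_N_sum(1)) (use Td(1) in auto)
      have "N \<gamma> (E n) \<le> (\<Sum>k<n. N \<gamma> (T (real (n - Suc k) * \<tau>) (d k)))"
        unfolding En by (rule DA_N_sum(2)) (use Td(1) in auto)
      also have "\<dots> \<le> (\<Sum>k<n. C4 * (?w k * e k))" by (rule sum_mono) (use Td(2) in auto)
      also have "\<dots> \<le> (\<Sum>k<n. C4 * (2 * K * (?w k * exp (\<mu> * (real k * \<tau>))) +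
          ?w k * (\<tau>\<^sup>2 / (\<tau> + real k * \<tau>) + \<tau> powr (2 - \<alpha>) * (\<bar>ln \<tau>\<bar> + 1))))"
      proof (rule sum_mono, rule mult_left_mono[OF _ C4])
        fix k assume k: "k \<in> {..<n}"
        have "?w k * N \<gamma> (E k) \<le> ?w k * (2 * K * exp (\<mu> * (real k * \<tau>)))"
          using IH(2)[of k] k \<tau> by (intro mult_left_mono) auto
        also have "\<dots> = 2 * K * (?w k * exp (\<mu> * (real k * \<tau>)))" by (simp only: mult_ac)
        finally show "?w k * e k \<le> 2 * K * (?w k * exp (\<mu> * (real k * \<tau>))) +
            ?w k * (\<tau>\<^sup>2 / (\<tau> + real k * \<tau>) + \<tau> powr (2 - \<alpha>) * (\<bar>ln \<tau>\<bar> + 1))"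
          unfolding e_def distrib_left[of "?w k" "N \<gamma> (E k)"] by (rule add_right_mono)
      qed
      also have "\<dots> = 2 * K * (C4 * (\<Sum>k<n. ?w k * exp (\<mu> * (real k * \<tau>)))) +
          C4 * (\<Sum>k<n. ?w k * (\<tau>\<^sup>2 / (\<tau> + real k * \<tau>) + \<tau> powr (2 - \<alpha>) * (\<bar>ln \<tau>\<bar> + 1)))"
        unfolding sum_distrib_left[symmetric] sum.distrib distrib_left[of C4] by (simp only: mult_ac)
      also have "\<dots> \<le> 2 * K * (exp (\<mu> * (real n * \<tau>)) * (1 / 2)) + K"
      proof (rule add_mono)
        have "C4 * (\<Sum>k<n. ?w k * exp (\<mu> * (real k * \<tau>))) \<le> C4 * (exp (\<mu> * (real n * \<tau>)) * (P * \<mu> powr (- ((1 - \<gamma>) / 2))))"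
          unfolding P_def by (rule mult_left_mono[OF weighted_power_sum_le[OF \<gamma>' \<tau>(1) \<mu>(1) n] C4])
        also have "\<dots> = exp (\<mu> * (real n * \<tau>)) * ((C4 * P) * \<mu> powr (- ((1 - \<gamma>) / 2)))" by (simp only: mult_ac)
        also have "\<dots> \<le> exp (\<mu> * (real n * \<tau>)) * (1 / 2)" by (rule mult_left_mono[OF \<mu>(2)]) simp
        finally show "2 * K * (C4 * (\<Sum>k<n. ?w k * exp (\<mu> * (real k * \<tau>)))) \<le> 2 * K * (exp (\<mu> * (real n * \<tau>)) * (1 / 2))"
          using K by (intro mult_left_mono) auto
        show "C4 * (\<Sum>k<n. ?w k * (\<tau>\<^sup>2 / (\<tau> + real k * \<tau>) + \<tau> powr (2 - \<alpha>) * (\<bar>ln \<tau>\<bar> + 1))) \<le> K"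
          unfolding K_def X_def Cm_def by (rule mult_left_mono[OF defect_sum_le[OF \<gamma>' \<gamma>(1) \<tau>(1) \<tau>1(1) n] C4])
      qed
      also have "\<dots> \<le> 2 * K * exp (\<mu> * (real n * \<tau>))"
      proof -
        have "1 \<le> exp (\<mu> * (real n * \<tau>))" using \<mu>(1) \<tau>(1) by simp
        from mult_left_mono[OF this K] show ?thesis by simp
      qed
      finally show "?E n \<in> DA \<gamma> \<and> N \<gamma> (?E n) \<le> 2 * (C4 * (Cm * (\<tau> powr (2 - \<gamma>) * (\<bar>ln \<tau>\<bar> + 1)))) * exp (\<mu> * (real n * \<tau>))"
        using DAn unfolding E_def K_def X_def by blast
    qed
  qed
  show ?thesis
  proof (rule exI[of _ C], rule exI[of _ \<tau>0], intro conjI allI impI \<tau>0(1))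
    fix \<tau> n assume \<tau>: "0 < \<tau> \<and> \<tau> < \<tau>0" and n: "real n * \<tau> \<le> Tm"
    let ?E = "eerk D A s c b a fX (\<iota> u0) \<tau> n - \<iota> (u (real n * \<tau>))"
    let ?X = "\<tau> powr (2 - \<gamma>) * (\<bar>ln \<tau>\<bar> + 1)"
    have m: "?E \<in> DA \<gamma>" "N \<gamma> ?E \<le> 2 * (C4 * (Cm * ?X)) * exp (\<mu> * (real n * \<tau>))"
      using main[of \<tau> n] \<tau> n by blast+
    show "?E \<in> DA \<gamma>" by (rule m(1))
    have X: "0 \<le> ?X" by (intro mult_nonneg_nonneg) auto
    have "exp (\<mu> * (real n * \<tau>)) \<le> exp (\<mu> * Tm)" using \<mu>(1) n by simp
    then have "2 * (C4 * (Cm * ?X)) * exp (\<mu> * (real n * \<tau>)) \<le> 2 * (C4 * (Cm * ?X)) * exp (\<mu> * Tm)"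
      using C4 Cm X by (intro mult_left_mono mult_nonneg_nonneg) auto
    with m(2) show "N \<gamma> ?E \<le> C * \<tau> powr (2 - \<gamma>) * (\<bar>ln \<tau>\<bar> + 1)" by (simp add: C_def mult_ac)
  qed
qed

theorem theorem4p2:
  fixes D :: "'x::complex_banach set" and A :: "'x \<Rightarrow> 'x"
    and \<iota> :: "'y::complex_banach \<Rightarrow> 'x"
    and f :: "real \<Rightarrow> 'y \<Rightarrow> 'x"
    and u0 :: 'y and u :: "real \<Rightarrow> 'y"
    and \<alpha> \<gamma> T :: real
    and s :: nat and c :: "nat \<Rightarrow> real"
    and b :: "nat \<Rightarrow> phi_comb" and a :: "nat \<Rightarrow> nat \<Rightarrow> phi_comb"
  assumes "sectorial D A"
    and "0 \<le> \<alpha>" and "\<alpha> < 1"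
    and "intermediate_space D A \<alpha> \<iota>"
    and "sectorial (part_dom D A \<iota>) (part_op A \<iota>)"
    and "0 < T"
    and "lipschitz_on_balls T f"
    and "frechet_lipschitz_derivative T f"
    and "\<iota> u0 \<in> D"
    and "A (\<iota> u0) + f 0 u0 \<in> range \<iota>"
    and "mild_solution D A \<iota> f T u0 u"
    and "eerk_method s c b a"
    and "\<And>z. (\<Sum>i\<in>{1..s}. comb_fun (b i) z) = phi 1 z"
    and "\<And>z. (\<Sum>i\<in>{1..s}. comb_fun (b i) z * of_real (c i)) = phi 2 z"
    and "\<And>i z. i \<in> {2..s} \<Longrightarrow>
           (\<Sum>j\<in>{1..<i}. comb_fun (a i j) z) = of_real (c i) * phi 1 (of_real (c i) * z)"
    and "\<alpha> \<le> \<gamma>" and "\<gamma> < 1"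
  shows "\<exists>C. \<exists>\<tau>0>0. \<forall>\<tau>. 0 < \<tau> \<and> \<tau> < \<tau>0 \<longrightarrow>
           (\<forall>n. real n * \<tau> \<le> T \<longrightarrow>
              (let e = eerk D A s c b a (\<lambda>t x. f t (inv \<iota> x)) (\<iota> u0) \<tau> n - \<iota> (u (real n * \<tau>))
               in e \<in> DA_space D A \<gamma> 1 \<and>
                  DA_norm D A \<gamma> 1 e \<le> C * \<tau> powr (2 - \<gamma>) * (\<bar>ln \<tau>\<bar> + 1)))"
proof -
  interpret runge_kutta D A \<alpha> \<iota> f u0 u T s c b a \<gamma>
    by unfold_locales (fact assms)+
  show ?thesis unfolding Let_def by (rule convergence)
qed

end
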